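(* The non-real spectrum $\sigma(A)\setminus\mathbb R$ of the operator $A$ is bounded. Moreover, there exists a finite number of points $\lambda_1,\ldots,\lambda_n\in\mathbb R$ with $\lambda_{j-1}<\lambda_j$ for $j=2,\ldots,n$, such that the following holds: (i) The interval $(-\infty,\lambda_1)$ is of negative type with respect to $A$. (ii) Each interval $(\lambda_{j-1},\lambda_j)$, $j=2,\ldots,n$, is of definite type with respect to $A$. (iii) The interval $(\lambda_n,\infty)$ is of positive type with respect to $A$.
   Context: Setting. Let $a>0$ and let $w,p,q:\mathbb R\to\mathbb R$ be measurable and $a$-periodic, with $w,q,p^{-1}$ integrable over $(0,a)$, $w\neq0$ a.e. and $p>0$ a.e. Put $\mathfrak a(f):=\frac1w\big(-(pf')'+qf\big)$. $L^2_{|w|}(\mathbb R)$ is the Hilbert space of (classes of) measurable $f:\mathbb R\to\mathbb C$ with $|f|^2|w|$ integrable, with scalar product $(f,g)=\int_{\mathbb R}f\overline g\,|w|\,dx$. $J$ is multiplication by $\operatorname{sgn}(w(\cdot))$ and $[f,g]:=(Jf,g)=\int_{\mathbb R}f\overline g\,w\,dx$. The maximal operator $A$ is $Af:=\mathfrak a(f)$ with $\operatorname{dom}A=\{f\in L^2_{|w|}(\mathbb R): f,pf'\in AC_{\rm loc}(\mathbb R),\ \mathfrak a(f)\in L^2_{|w|}(\mathbb R)\}$. It is $J$-self-adjoint, i.e. $JA$ is self-adjoint. Sign types. For a Hilbert space with bounded operator $J=J^{-1}=J^*$, inner product $[f,g]=(Jf,g)$, and a $J$-self-adjoint operator $B$,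 the approximate point spectrum $\sigma_{ap}(B)$ is the set of $\lambda\in\mathbb C$ for which there is a sequence $(f_n)\subset\operatorname{dom}B$ with $\|f_n\|=1$ and $(B-\lambda)f_n\to0$. A point $\lambda\in\sigma_{ap}(B)$ belongs to $\sigma_+(B)$ (respectively $\sigma_-(B)$) if every such sequence satisfies $\liminf_n[f_n,f_n]>0$ (respectively $\limsup_n[f_n,f_n]<0$). A set $\Delta\subset\mathbb R$ is of positive (negative) type with respect to $B$ if $\Delta\cap\sigma(B)\subset\sigma_+(B)$ (respectively $\Delta\cap\sigma(B)\subset\sigma_-(B)$), and of definite type if it is of positive or of negative type. *)

theory Defs
  imports "HOL-Analysis.Analysis"
begin

subsection \<open>Absolute continuity\<close>

text \<open>A finite family of non-overlapping compact intervals is rendered as a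
  \<^const>\<open>division_of\<close> of its union.\<close>

definition abs_continuous_on :: "real set \<Rightarrow> (real \<Rightarrow> complex) \<Rightarrow> bool" where
  "abs_continuous_on S f \<longleftrightarrow>
     (\<forall>\<epsilon>>0. \<exists>\<delta>>0. \<forall>\<D> T. \<D> division_of T \<and> T \<subseteq> S \<and> (\<Sum>k\<in>\<D>. Sup k - Inf k) < \<delta> \<longrightarrow>
        (\<Sum>k\<in>\<D>. cmod (f (Sup k) - f (Inf k))) < \<epsilon>)"

definition AC_loc :: "(real \<Rightarrow> complex) set" where
  "AC_loc = {f. \<forall>c d. abs_continuous_on {c..d} f}"

subsection \<open>The Krein space\<close>

text \<open>Elements of the \<open>L\<^sup>2\<close> space are represented by functions, and equality in the space is
  equality almost everywhere. Since the weights of interest vanish only on a null set,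
  \<open>|w| dx\<close> and Lebesgue measure have the same null sets.\<close>

definition L2 :: "(real \<Rightarrow> real) \<Rightarrow> (real \<Rightarrow> complex) set" where
  "L2 w = {f \<in> borel_measurable lebesgue. integrable lebesgue (\<lambda>x. (cmod (f x))\<^sup>2 * \<bar>w x\<bar>)}"

definition ae_eq :: "(real \<Rightarrow> complex) \<Rightarrow> (real \<Rightarrow> complex) \<Rightarrow> bool" where
  "ae_eq f g \<longleftrightarrow> (AE x in lebesgue. f x = g x)"

definition L2_inner :: "(real \<Rightarrow> real) \<Rightarrow> (real \<Rightarrow> complex) \<Rightarrow> (real \<Rightarrow> complex) \<Rightarrow> complex" where
  "L2_inner w f g = (LINT x|lebesgue. f x * cnj (g x) * of_real \<bar>w x\<bar>)"

definition L2_norm :: "(real \<Rightarrow> real) \<Rightarrow> (real \<Rightarrow> complex) \<Rightarrow> real" where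
  "L2_norm w f = sqrt (Re (L2_inner w f f))"

definition J_op :: "(real \<Rightarrow> real) \<Rightarrow> (real \<Rightarrow> complex) \<Rightarrow> (real \<Rightarrow> complex)" where
  "J_op w f = (\<lambda>x. of_real (sgn (w x)) * f x)"

definition krein_inner :: "(real \<Rightarrow> real) \<Rightarrow> (real \<Rightarrow> complex) \<Rightarrow> (real \<Rightarrow> complex) \<Rightarrow> complex" where
  "krein_inner w f g = L2_inner w (J_op w f) g"

subsection \<open>Operators, spectrum and sign types\<close>

text \<open>An operator \<open>B\<close> in the space is given by its graph, a set of pairs of representatives that
  is closed under changing either component on a null set.\<close>

type_synonym operator = "((real \<Rightarrow> complex) \<times> (real \<Rightarrow> complex)) set"

definition op_shift :: "operator \<Rightarrow> complex \<Rightarrow> operator" where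
  "op_shift B z = {(f, \<lambda>x. g x - z * f x) | f g. (f, g) \<in> B}"

text \<open>\<open>z\<close> is in the resolvent set if \<open>B - z\<close> maps the domain of \<open>B\<close> bijectively (modulo null
  functions) onto the space, with bounded inverse.\<close>

definition resolvent_set :: "(real \<Rightarrow> real) \<Rightarrow> operator \<Rightarrow> complex set" where
  "resolvent_set w B =
     {z. (\<forall>h\<in>L2 w. \<exists>f. (f, h) \<in> op_shift B z \<and> (\<forall>f'. (f', h) \<in> op_shift B z \<longrightarrow> ae_eq f' f)) \<and>
         (\<exists>C. \<forall>(f, h)\<in>op_shift B z. L2_norm w f \<le> C * L2_norm w h)}"

definition spectrum :: "(real \<Rightarrow> real) \<Rightarrow> operator \<Rightarrow> complex set" where
  "spectrum w B = - resolvent_set w B"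

definition approx_eigenseq :: "(real \<Rightarrow> real) \<Rightarrow> operator \<Rightarrow> complex \<Rightarrow> (nat \<Rightarrow> real \<Rightarrow> complex) \<Rightarrow> bool"
  where "approx_eigenseq w B z f \<longleftrightarrow>
    (\<forall>n. L2_norm w (f n) = 1) \<and>
    (\<exists>h. (\<forall>n. (f n, h n) \<in> op_shift B z) \<and> (\<lambda>n. L2_norm w (h n)) \<longlonglongrightarrow> 0)"

definition approx_point_spectrum :: "(real \<Rightarrow> real) \<Rightarrow> operator \<Rightarrow> complex set" where
  "approx_point_spectrum w B = {z. \<exists>f. approx_eigenseq w B z f}"

text \<open>\<open>[f, f]\<close> is real, so taking its real part loses nothing; the lower and upper limits are
  taken in the extended reals.\<close>

definition spectrum_pos :: "(real \<Rightarrow> real) \<Rightarrow> operator \<Rightarrow> complex set" where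
  "spectrum_pos w B = {z \<in> approx_point_spectrum w B. \<forall>f. approx_eigenseq w B z f \<longrightarrow>
     liminf (\<lambda>n. ereal (Re (krein_inner w (f n) (f n)))) > 0}"

definition spectrum_neg :: "(real \<Rightarrow> real) \<Rightarrow> operator \<Rightarrow> complex set" where
  "spectrum_neg w B = {z \<in> approx_point_spectrum w B. \<forall>f. approx_eigenseq w B z f \<longrightarrow>
     limsup (\<lambda>n. ereal (Re (krein_inner w (f n) (f n)))) < 0}"

definition positive_type :: "(real \<Rightarrow> real) \<Rightarrow> operator \<Rightarrow> real set \<Rightarrow> bool" where
  "positive_type w B \<Delta> \<longleftrightarrow> complex_of_real ` \<Delta> \<inter> spectrum w B \<subseteq> spectrum_pos w B"

definition negative_type :: "(real \<Rightarrow> real) \<Rightarrow> operator \<Rightarrow> real set \<Rightarrow> bool" where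
  "negative_type w B \<Delta> \<longleftrightarrow> complex_of_real ` \<Delta> \<inter> spectrum w B \<subseteq> spectrum_neg w B"

definition definite_type :: "(real \<Rightarrow> real) \<Rightarrow> operator \<Rightarrow> real set \<Rightarrow> bool" where
  "definite_type w B \<Delta> \<longleftrightarrow> positive_type w B \<Delta> \<or> negative_type w B \<Delta>"

subsection \<open>The maximal Sturm--Liouville operator\<close>

text \<open>\<open>f\<^sub>0\<close> is the absolutely continuous representative of \<open>f\<close>, and \<open>u\<close> that of \<open>p f\<^sub>0'\<close>, which
  is only defined almost everywhere. Absolutely continuous functions are differentiable almost
  everywhere, so the values of \<^const>\<open>vector_derivative\<close> at the remaining points do not
  matter.\<close>

definition maximal_op :: "(real \<Rightarrow> real) \<Rightarrow> (real \<Rightarrow> real) \<Rightarrow> (real \<Rightarrow> real) \<Rightarrow> operator" where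
  "maximal_op w p q =
     {(f, g). f \<in> L2 w \<and> g \<in> L2 w \<and>
        (\<exists>f\<^sub>0\<in>AC_loc. \<exists>u\<in>AC_loc. ae_eq f f\<^sub>0 \<and>
           ae_eq u (\<lambda>x. of_real (p x) * vector_derivative f\<^sub>0 (at x)) \<and>
           ae_eq g (\<lambda>x. 1 / of_real (w x) *
                       (- vector_derivative u (at x) + of_real (q x) * f\<^sub>0 x)))}"

end

theory Submission imports Defs "HOL-Complex_Analysis.Conformal_Mappings" begin

text \<open>Let \<open>M(z)\<close> be the monodromy matrix of \<open>\<aa>(f) = z f\<close> and \<open>D = tr M\<close> the discriminant, an
  entire function that is real on \<open>\<real>\<close>. Since \<open>det M = 1\<close>, either \<open>M(z)\<close> is hyperbolic and the
  recursion \<open>Y\<^sub>k\<^sub>+\<^sub>1 = M Y\<^sub>k + e\<^sub>k\<close> for the data \<open>Y\<^sub>k = (f, p f')(k a)\<close> is solvable in \<open>\<ell>\<^sup>2\<close>, so that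
  \<open>z\<close> is in the resolvent set, or \<open>M(z)\<close> has an eigenvalue of modulus one.

  If \<open>|z|\<close> is large, then \<open>\<integral> p |f'|\<^sup>2 + q |f|\<^sup>2\<close> over a period dominates \<open>3 \<integral> |f|\<^sup>2 |w|\<close> up to the
  defect \<open>h = (\<aa> - z) f\<close>, because \<open>w\<close> has nearly constant sign near its Lebesgue points. Testing
  \<open>(\<aa> - z) f = h\<close> with \<open>f\<close> then gives \<open>z [f, f] \<ge> 3 \<parallel>f\<parallel>\<^sup>2 - O(\<parallel>h\<parallel> (\<parallel>f\<parallel> + \<parallel>h\<parallel>))\<close>: large real points have
  the sign type of \<open>z\<close>, and a bounded Floquet solution forces \<open>z\<close> to be real.

  If \<open>|D(z)| < 2\<close> for a real \<open>z\<close>, then \<open>M\<close> leaves a definite quadratic form invariant. Telescoping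
  over the periods, \<open>[f, f]\<close> becomes a multiple of \<open>\<Sum> |Y\<^sub>k|\<^sup>2\<close> up to \<open>O(\<parallel>h\<parallel>)\<close>, and the factor has the
  sign of \<open>- m\<^sub>1\<^sub>2 D'\<close>. Hence the sign type can only change at real zeros of \<open>D\<^sup>2 - 4\<close> and \<open>D'\<close>, of which
  a bounded interval contains finitely many. If \<open>D\<close> is constant there is no spectrum at all.\<close>

subsection \<open>Absolutely continuous functions\<close>

text \<open>The coefficients are merely integrable, so every identity has to be an integral
  identity, whereas \<open>maximal_op\<close> speaks of epsilon-delta absolute continuity and of
  derivatives almost everywhere. The passage between the two is Lebesgue's fundamental theorem,
  which is therefore established at the outset. Sign types quantify over all approximate
  eigensequences, so exact eigenfunctions are not enough: each estimate carries a defect h and is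
  quantitative in its norm. They are also defined inside the approximate point spectrum, so every
  real point with a multiplier of modulus one needs explicit approximate eigenfunctions; these exist
  in the domain because a forcing on one period can steer the data to any prescribed end values.
  Since w changes sign, \<open>[f, f]\<close> controls no norm and resolvent bounds cannot be read
  off from it. They come from the recursion for the data, estimated on finite windows of periods
  with explicit boundary terms, so that one estimate serves both square summable and merely bounded
  data.\<close>

lemma set_integral_small:
  fixes k :: "real \<Rightarrow> real"
  assumes k: "integrable lebesgue k" and pos: "\<And>x. k x \<ge> 0" and e: "\<epsilon> > 0"
  obtains \<delta> where "\<delta> > 0"
    "\<And>A. A \<in> sets lebesgue \<Longrightarrow> emeasure lebesgue A < ennreal \<delta> \<Longrightarrow> (LINT x:A|lebesgue. k x) < \<epsilon>"
proof -
  have "(\<lambda>m. LINT x|lebesgue. k x * indicator {x. k x > real m} x) \<longlonglongrightarrow> (LINT (x::real)|lebesgue. 0)"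
  proof (rule integral_dominated_convergence[where w=k])
    show "AE x in lebesgue. (\<lambda>i. k x * indicator {x. real i < k x} x) \<longlonglongrightarrow> 0"
    proof (rule AE_I2)
      fix x
      obtain m0 :: nat where "k x \<le> real m0" using real_arch_simple by blast
      then have "\<forall>i\<ge>m0. k x * indicator {x. real i < k x} x = 0" by (auto simp: indicator_def)
      then show "(\<lambda>i. k x * indicator {x. real i < k x} x) \<longlonglongrightarrow> 0"
        by (intro tendsto_eventually) (auto simp: eventually_sequentially)
    qed
    show "(\<lambda>x. k x * indicator {x. real i < k x} x) \<in> borel_measurable lebesgue" for i
      using k by measurable
  qed (use k pos in \<open>auto simp: indicator_def\<close>)
  then have "\<forall>\<^sub>F m in sequentially. (LINT x|lebesgue. k x * indicator {x. k x > real m} x) < \<epsilon>/2"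
    using e by (intro order_tendstoD) auto
  then obtain m where m: "(LINT x|lebesgue. k x * indicator {x. k x > real m} x) < \<epsilon>/2"
    by (auto simp: eventually_sequentially)
  \<comment> \<open>Dominated convergence has made the part of k above height m small; the part
    below contributes at most m times the measure of A, hence at most \<epsilon>/2.\<close>
  define \<delta> where "\<delta> = \<epsilon> / (2 * (real m + 1))"
  show ?thesis
  proof (rule that)
    show "\<delta> > 0" using e by (simp add: \<delta>_def add_nonneg_pos)
    fix A :: "real set" assume A: "A \<in> sets lebesgue" "emeasure lebesgue A < ennreal \<delta>"
    have fin: "emeasure lebesgue A < \<infinity>" using A(2) by (simp add: order_less_imp_le less_trans ennreal_less_top)
    have iA: "integrable lebesgue (indicator A :: real \<Rightarrow> real)"
      using A fin by simp
    have i1: "integrable lebesgue (\<lambda>x. k x * indicator {x. k x > real m} x)"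
    proof (rule Bochner_Integration.integrable_bound[OF k])
      show "(\<lambda>x. k x * indicator {x. real m < k x} x) \<in> borel_measurable lebesgue"
        using k by measurable
    qed (use pos in \<open>auto simp: indicator_def\<close>)
    have "(LINT x:A|lebesgue. k x) \<le> (LINT x|lebesgue. k x * indicator {x. k x > real m} x + real m * indicator A x)"
      unfolding set_lebesgue_integral_def
    proof (rule integral_mono)
      show "integrable lebesgue (\<lambda>x. indicat_real A x *\<^sub>R k x)"
        using integrable_mult_indicator[OF A(1) k] by simp
      show "integrable lebesgue (\<lambda>x. k x * indicator {x. k x > real m} x + real m * indicator A x)"
        using i1 iA by simp
    qed (use pos in \<open>auto simp: indicator_def\<close>)
    also have "\<dots> = (LINT x|lebesgue. k x * indicator {x. k x > real m} x) + real m * measure lebesgue A"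
      using i1 iA by simp
    also have "real m * measure lebesgue A \<le> real m * \<delta>"
    proof (rule mult_left_mono)
      show "measure lebesgue A \<le> \<delta>"
        using A(2) \<open>\<delta>>0\<close> fin by (metis emeasure_eq_ennreal_measure ennreal_less_iff infinity_ennreal_def less_imp_le measure_nonneg order_less_irrefl)
    qed simp
    also have "real m * \<delta> \<le> \<epsilon>/2"
      using e by (simp add: \<delta>_def field_simps)
    finally show "(LINT x:A|lebesgue. k x) < \<epsilon>" using m by linarith
  qed
qed

text \<open>The working form of absolute continuity. The derivative is carried along as an explicit
  Lebesgue integrable function, so differential equations can be stated and solved without pointwise
  derivatives.\<close>

definition prim_on :: "real \<Rightarrow> real \<Rightarrow> (real \<Rightarrow> 'a::euclidean_space) \<Rightarrow> (real \<Rightarrow> 'a) \<Rightarrow> bool" where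
  "prim_on c d g F \<longleftrightarrow> g absolutely_integrable_on {c..d} \<and>
     (\<forall>x\<in>{c..d}. \<forall>y\<in>{c..d}. x \<le> y \<longrightarrow> (g has_integral (F y - F x)) {x..y})"

text \<open>Each increment of F is at most the integral of |g| over the interval. Summed over a
  division this is the integral over a set whose measure is at most the total length, and it is
  small by absolute continuity of the integral.\<close>

lemma prim_on_AC:
  fixes g :: "real \<Rightarrow> complex"
  assumes "prim_on c d g F"
  shows "abs_continuous_on {c..d} F"
  unfolding abs_continuous_on_def
proof (intro allI impI)
  fix \<epsilon> :: real assume e: "\<epsilon> > 0"
  define k where "k = (\<lambda>x. indicator {c..d} x * norm (g x))"
  have gi: "g absolutely_integrable_on {c..d}" using assms by (simp add: prim_on_def)
  have kint: "integrable lebesgue k"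
    using gi absolutely_integrable_norm[OF gi] unfolding k_def set_integrable_def by (simp add: o_def)
  obtain \<delta> where \<delta>: "\<delta> > 0" "\<And>A. A \<in> sets lebesgue \<Longrightarrow> emeasure lebesgue A < ennreal \<delta> \<Longrightarrow> (LINT x:A|lebesgue. k x) < \<epsilon>"
    using set_integral_small[OF kint _ e] k_def by (metis indicator_pos_le mult_nonneg_nonneg norm_ge_zero)
  show "\<exists>\<delta>>0. \<forall>\<D> T. \<D> division_of T \<and> T \<subseteq> {c..d} \<and> (\<Sum>k\<in>\<D>. Sup k - Inf k) < \<delta> \<longrightarrow>
        (\<Sum>k\<in>\<D>. cmod (F (Sup k) - F (Inf k))) < \<epsilon>"
  proof (intro exI[of _ \<delta>] conjI allI impI \<delta>(1))
    fix \<D> T assume H: "\<D> division_of T \<and> T \<subseteq> {c..d} \<and> (\<Sum>k\<in>\<D>. Sup k - Inf k) < \<delta>"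
    then have div: "\<D> division_of T" by simp
    have kk: "\<exists>x y. k = {x..y} \<and> x \<le> y \<and> c \<le> x \<and> y \<le> d" if kD: "k \<in> \<D>" for k
    proof -
      obtain x y where k: "k = cbox x y" using division_ofD(4)[OF div kD] by blast
      have xy: "x \<le> y" using division_ofD(3)[OF div kD] k by simp
      have "k \<subseteq> {c..d}" using division_ofD(2)[OF div kD] H by blast
      then have "x \<in> {c..d}" "y \<in> {c..d}" using k xy by auto
      then show ?thesis using k xy by auto
    qed
    have dm: "k \<in> sets lebesgue" if kD: "k \<in> \<D>" for k
    proof -
      obtain x y where "k = {x..y}" using kk[OF kD] by blast
      then show ?thesis by simp
    qed
    have Tm: "T \<in> sets lebesgue"
      unfolding division_ofD(6)[OF div, symmetric] using division_ofD(1)[OF div] dm by blast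
    have gT: "(\<lambda>x. norm (g x)) absolutely_integrable_on T"
      using absolutely_integrable_norm[OF gi] H Tm
      by (intro set_integrable_subset[of lebesgue "{c..d}" _ T]) (auto simp: o_def)
    have mT: "emeasure lebesgue T \<le> ennreal (\<Sum>k\<in>\<D>. Sup k - Inf k)"
    proof -
      have "T = (\<Union>\<D>)" using division_ofD(6)[OF div] by simp
      then have "emeasure lebesgue T \<le> (\<Sum>k\<in>\<D>. emeasure lebesgue k)"
        using emeasure_subadditive_finite[of \<D> "\<lambda>k. k" lebesgue] division_ofD(1)[OF div] dm
        by (simp add: subset_iff)
      also have "\<dots> = (\<Sum>k\<in>\<D>. ennreal (Sup k - Inf k))"
      proof (rule sum.cong[OF refl])
        fix k assume "k \<in> \<D>"
        then obtain x y where "k = {x..y}" "x \<le> y" using kk by blast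
        then show "emeasure lebesgue k = ennreal (Sup k - Inf k)" by simp
      qed
      also have "\<dots> = ennreal (\<Sum>k\<in>\<D>. Sup k - Inf k)"
      proof (rule sum_ennreal)
        fix k assume "k \<in> \<D>"
        then obtain x y where "k = {x..y}" "x \<le> y" using kk by blast
        then show "0 \<le> Sup k - Inf k" by simp
      qed
      finally show ?thesis .
    qed
    have "(\<Sum>k\<in>\<D>. cmod (F (Sup k) - F (Inf k))) \<le> (\<Sum>k\<in>\<D>. integral k (\<lambda>x. norm (g x)))"
    proof (rule sum_mono)
      fix k assume "k \<in> \<D>"
      then obtain x y where k: "k = {x..y}" "x \<le> y" "c \<le> x" "y \<le> d" using kk by blast
      have 1: "(g has_integral (F y - F x)) {x..y}" using assms k by (auto simp: prim_on_def)
      have 2: "g absolutely_integrable_on {x..y}"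
        using gi k by (intro set_integrable_subset[of lebesgue "{c..d}" _ "{x..y}"]) auto
      show "cmod (F (Sup k) - F (Inf k)) \<le> integral k (\<lambda>x. norm (g x))"
      proof -
        have "F y - F x = integral {x..y} g" using 1 by (simp add: integral_unique)
        moreover have "norm (integral {x..y} g) \<le> integral {x..y} (\<lambda>x. norm (g x))"
          using 2 by (intro integral_norm_bound_integral) (auto simp: absolutely_integrable_on_def)
        ultimately show ?thesis using k by simp
      qed
    qed
    also have "\<dots> = integral T (\<lambda>x. norm (g x))"
      using integral_combine_division_topdown[of "\<lambda>x. norm (g x)" T \<D>] div gT
      by (simp add: absolutely_integrable_on_def)
    also have "\<dots> = (LINT x:T|lebesgue. norm (g x))"
      using set_lebesgue_integral_eq_integral(2)[OF gT] by simp
    also have "\<dots> = (LINT x:T|lebesgue. k x)"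
      using H by (intro set_lebesgue_integral_cong) (auto simp: k_def indicator_def Tm)
    also have "\<dots> < \<epsilon>"
    proof (rule \<delta>(2)[OF Tm])
      have "ennreal (\<Sum>k\<in>\<D>. Sup k - Inf k) < ennreal \<delta>" using H \<delta>(1) by (intro ennreal_lessI) auto
      with mT show "emeasure lebesgue T < ennreal \<delta>" by (rule le_less_trans)
    qed
    finally show "(\<Sum>k\<in>\<D>. cmod (F (Sup k) - F (Inf k))) < \<epsilon>" .
  qed
qed

lemma prim_on_continuous:
  assumes "prim_on c d g F" shows "continuous_on {c..d} F"
proof (cases "c \<le> d")
  case True
  have i: "g integrable_on {c..d}" using assms by (simp add: prim_on_def absolutely_integrable_on_def)
  have "continuous_on {c..d} (\<lambda>x. F c + integral {c..x} g)"
    by (intro continuous_intros indefinite_integral_continuous_1 i)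
  moreover have "F c + integral {c..x} g = F x" if "x \<in> {c..d}" for x
  proof -
    have "(g has_integral (F x - F c)) {c..x}" using assms that True unfolding prim_on_def by auto
    then show ?thesis by (simp add: integral_unique)
  qed
  ultimately show ?thesis by (metis (no_types, lifting) continuous_on_cong)
qed auto

text \<open>Points where the upper derivate exceeds \<open>s\<close> although the integrand is below \<open>r\<close> are
  Vitali-covered by intervals on which \<open>(g - r)\<^sup>+\<close> has mean at least \<open>s - r\<close>, while
  \<open>(g - r)\<^sup>+\<close> vanishes on the set itself.\<close>

lemma upper_derivate_negligible:
  fixes g F :: "real \<Rightarrow> real"
  assumes P: "prim_on c d g F" and rs: "r < s"
  shows "negligible {x\<in>{c<..<d}. g x < r \<and> (\<forall>\<delta>>0. \<exists>y. y \<noteq> x \<and> \<bar>y - x\<bar> < \<delta> \<and> (F y - F x) / (y - x) > s)}"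
    (is "negligible ?E")
proof (rule negligible_outer_le[THEN iffD2], intro allI impI)
  fix e :: real assume e: "e > 0"
  have gi: "g absolutely_integrable_on {c..d}" using P by (simp add: prim_on_def)
  have gio: "set_integrable lebesgue {c<..<d} g"
    using gi by (rule set_integrable_subset) auto
  define k where "k = (\<lambda>x. max 0 (indicator {c<..<d} x * (g x - r)))"
  have "integrable lebesgue (\<lambda>x. indicator {c<..<d} x * (g x - r))"
  proof -
    have "set_integrable lebesgue {c<..<d} (\<lambda>x. r)"
      by (rule absolutely_integrable_on_const) simp
    from set_integral_diff(1)[OF gio this] show ?thesis by (simp add: set_integrable_def)
  qed
  then have kint: "integrable lebesgue k" unfolding k_def by (intro Bochner_Integration.integrable_max) auto
  have kpos: "k x \<ge> 0" for x by (simp add: k_def)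
  have "0 < e * (s - r)" using e rs by simp
  from set_integral_small[OF kint kpos this] obtain \<delta> where \<delta>: "\<delta> > 0"
    "\<And>A. A \<in> sets lebesgue \<Longrightarrow> emeasure lebesgue A < ennreal \<delta> \<Longrightarrow> (LINT x:A|lebesgue. k x) < e * (s - r)"
    by blast
  define E' where "E' = {x\<in>{c<..<d}. g x < r}"
  have E'm: "E' \<in> sets lebesgue"
  proof -
    have m: "(\<lambda>x. indicator {c<..<d} x * g x) \<in> borel_measurable lebesgue"
      using gio by (auto simp: set_integrable_def)
    have "E' = {c<..<d} \<inter> {x \<in> space lebesgue. indicator {c<..<d} x * g x < r}" by (auto simp: E'_def indicator_def)
    also have "\<dots> \<in> sets lebesgue"
      by (intro sets.Int borel_measurable_less m borel_measurable_const) simp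
    finally show ?thesis .
  qed
  \<comment> \<open>\<open>k\<close> vanishes on \<open>E'\<close>, so an open superset exceeding
    \<open>E'\<close> by a set of small measure carries almost nothing of its integral.\<close>
  obtain U where U: "open U" "E' \<subseteq> U" "U - E' \<in> lmeasurable" "emeasure lebesgue (U - E') < ennreal \<delta>"
    using sets_lebesgue_outer_open[OF E'm \<delta>(1)] by metis
  define V where "V = U \<inter> {c<..<d}"
  have Vo: "open V" using U by (auto simp: V_def)
  have Vm: "V \<in> sets lebesgue" using Vo by (intro borel_open sets_completionI_sets) (simp add: borel_open)
  have kV: "(LINT x:V|lebesgue. k x) < e * (s - r)"
  proof -
    have "(LINT x:V|lebesgue. k x) = (LINT x:(V - E')|lebesgue. k x)"
      unfolding set_lebesgue_integral_def
      by (rule Bochner_Integration.integral_cong) (auto simp: indicator_def k_def E'_def)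
    also have "\<dots> < e * (s - r)"
    proof (rule \<delta>(2))
      show "V - E' \<in> sets lebesgue" using Vm E'm by auto
      have "emeasure lebesgue (V - E') \<le> emeasure lebesgue (U - E')"
        using U(3) by (intro emeasure_mono) (auto simp: V_def)
      then show "emeasure lebesgue (V - E') < ennreal \<delta>" using U(4) by simp
    qed
    finally show ?thesis .
  qed
  define K where "K = {(x::real,\<rho>::real). \<rho> > 0 \<and> cball x \<rho> \<subseteq> V \<and> F (x+\<rho>) - F (x-\<rho>) > s * (2*\<rho>)}"
  have cov: "\<exists>i. i \<in> K \<and> x \<in> cball (fst i) (snd i) \<and> snd i < \<eta>" if x: "x \<in> ?E" and \<eta>: "\<eta> > 0" for x \<eta>
  proof -
    have "x \<in> V" using x U(2) by (auto simp: V_def E'_def)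
    then obtain \<epsilon>' where \<epsilon>': "\<epsilon>' > 0" "ball x \<epsilon>' \<subseteq> V" using Vo open_contains_ball by blast
    have "min \<eta> \<epsilon>' > 0" using \<epsilon>' \<eta> by simp
    with x obtain y where y: "y \<noteq> x" "\<bar>y - x\<bar> < min \<eta> \<epsilon>'" "(F y - F x) / (y - x) > s" by blast
    \<comment> \<open>The covering theorem works with balls, so the interval between x and y is
      encoded by midpoint and half-length; x is then an end point of the ball and still belongs to
      it.\<close>
    define m \<rho> where "m = (x+y)/2" and "\<rho> = \<bar>y - x\<bar>/2"
    have "cball m \<rho> \<subseteq> ball x \<epsilon>'"
      using y(2) by (auto simp: m_def \<rho>_def cball_def ball_def dist_real_def abs_if field_simps split: if_splits)
    then have 1: "cball m \<rho> \<subseteq> V" using \<epsilon>' by blast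
    have 2: "F (m+\<rho>) - F (m-\<rho>) > s * (2*\<rho>)"
    proof (cases "y > x")
      case True
      then have eq: "m + \<rho> = y" "m - \<rho> = x" "2*\<rho> = y - x" by (auto simp: m_def \<rho>_def field_simps)
      show ?thesis unfolding eq using y(3) True by (simp add: pos_less_divide_eq)
    next
      case False
      then have xy: "y < x" using y(1) by simp
      then have eq: "m + \<rho> = x" "m - \<rho> = y" "2*\<rho> = x - y" by (auto simp: m_def \<rho>_def field_simps)
      have "(F y - F x) / (y - x) = (F x - F y) / (x - y)" by (metis minus_diff_eq minus_divide_divide)
      then show ?thesis unfolding eq using y(3) xy by (simp add: pos_less_divide_eq)
    qed
    have "(m,\<rho>) \<in> K" using 1 2 y(1) by (auto simp: K_def \<rho>_def)
    moreover have "x \<in> cball m \<rho>" "\<rho> < \<eta>" using y \<eta> by (auto simp: m_def \<rho>_def dist_real_def field_simps abs_if)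
    ultimately show ?thesis by (intro exI[of _ "(m,\<rho>)"]) auto
  qed
  obtain C where C: "countable C" "C \<subseteq> K"
     "pairwise (\<lambda>i j. disjnt (cball (fst i) (snd i)) (cball (fst j) (snd j))) C"
     "negligible (?E - (\<Union>i \<in> C. cball (fst i) (snd i)))"
  proof (rule Vitali_covering_theorem_cballs[where r=snd and a=fst and K=K and S="?E"])
    show "0 < snd i" if "i \<in> K" for i using that by (auto simp: K_def)
  qed (use cov in blast)+
  define I where "I = (\<lambda>i::real\<times>real. cball (fst i) (snd i))"
  define T where "T = (\<Union>i\<in>C. I i)"
  have Im: "I i \<in> sets lebesgue" for i by (simp add: I_def)
  have Tm: "T \<in> sets lebesgue" unfolding T_def using C(1) Im by blast
  have disj: "disjoint_family_on I C"
    using C(3) by (auto simp: disjoint_family_on_def pairwise_def disjnt_def I_def)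
  have "I i \<subseteq> V" if "i \<in> C" for i
    using subsetD[OF C(2) that] by (cases i) (simp add: I_def K_def)
  then have TV: "T \<subseteq> V" by (auto simp: T_def)
  define \<nu> where "\<nu> = density lebesgue (\<lambda>x. ennreal (k x))"
  have km: "(\<lambda>x. ennreal (k x)) \<in> borel_measurable lebesgue" using kint by measurable
  have \<nu>A: "emeasure \<nu> A = ennreal (LINT x:A|lebesgue. k x)" if "A \<in> sets lebesgue" for A
  proof -
    have "emeasure \<nu> A = (\<integral>\<^sup>+x. ennreal (k x * indicator A x) \<partial>lebesgue)"
      unfolding \<nu>_def by (subst emeasure_density[OF km that]) (auto intro!: nn_integral_cong simp: indicator_def)
    also have "\<dots> = ennreal (LINT x|lebesgue. k x * indicator A x)"
      using integrable_mult_indicator[OF that kint] kpos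
      by (intro nn_integral_eq_integral) (auto simp: mult.commute)
    finally show ?thesis by (simp add: set_lebesgue_integral_def mult.commute)
  qed
  have single: "ennreal (s - r) * emeasure lebesgue (I i) \<le> emeasure \<nu> (I i)" if iC: "i \<in> C" for i
  proof -
    obtain x \<rho> where i: "i = (x,\<rho>)" by (cases i)
    have K: "\<rho> > 0" "cball x \<rho> \<subseteq> V" "F (x+\<rho>) - F (x-\<rho>) > s * (2*\<rho>)" using iC C(2) i by (auto simp: K_def)
    have Ii: "I i = {x-\<rho>..x+\<rho>}" by (auto simp: I_def i cball_def dist_real_def)
    have sub: "{x-\<rho>..x+\<rho>} \<subseteq> {c<..<d}" using K(2) Ii by (auto simp: I_def i V_def)
    have "x-\<rho> \<in> {x-\<rho>..x+\<rho>}" "x+\<rho> \<in> {x-\<rho>..x+\<rho>}" using K(1) by auto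
    then have "x-\<rho> \<in> {c<..<d}" "x+\<rho> \<in> {c<..<d}" using sub by blast+
    then have "x-\<rho> \<in> {c..d}" "x+\<rho> \<in> {c..d}" by auto
    then have hi: "(g has_integral (F (x+\<rho>) - F (x-\<rho>))) {x-\<rho>..x+\<rho>}" using P K(1) by (auto simp: prim_on_def)
    have "((\<lambda>y. r) has_integral (r * (2*\<rho>))) {x-\<rho>..x+\<rho>}"
      using has_integral_const_real[of r "x-\<rho>" "x+\<rho>"] K(1) by (simp add: mult.commute)
    from has_integral_diff[OF hi this] have h1: "((\<lambda>y. g y - r) has_integral (F (x+\<rho>) - F (x-\<rho>) - r * (2*\<rho>))) {x-\<rho>..x+\<rho>}" .
    have ki: "k absolutely_integrable_on {x-\<rho>..x+\<rho>}"
      using integrable_mult_indicator[OF _ kint, of "{x-\<rho>..x+\<rho>}"] by (simp add: set_integrable_def)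
    then have h2: "(k has_integral (LINT x:I i|lebesgue. k x)) {x-\<rho>..x+\<rho>}"
      unfolding Ii using set_lebesgue_integral_eq_integral[OF ki] by (simp add: has_integral_integrable_integral)
    have "F (x+\<rho>) - F (x-\<rho>) - r * (2*\<rho>) \<le> (LINT x:I i|lebesgue. k x)"
      using h1 h2 sub by (rule_tac has_integral_le[OF h1 h2]) (auto simp: k_def subset_iff)
    then have "(s - r) * (2*\<rho>) \<le> (LINT x:I i|lebesgue. k x)" using K(3) by (simp add: algebra_simps)
    then have "ennreal ((s - r) * (2*\<rho>)) \<le> emeasure \<nu> (I i)" using \<nu>A[OF Im] by (simp add: ennreal_leI)
    moreover have "emeasure lebesgue (I i) = ennreal (2*\<rho>)" unfolding Ii using K(1) by simp
    ultimately show ?thesis using rs K(1) by (simp add: ennreal_mult)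
  qed
  \<comment> \<open>Disjointness adds up the bounds on single intervals: (s - r) |T| is at most the
    integral of k over V, hence below e (s - r). Cancelling s - r leaves |T| < e.\<close>
  have "ennreal (s - r) * emeasure lebesgue T = (\<integral>\<^sup>+i. ennreal (s - r) * emeasure lebesgue (I i) \<partial>count_space C)"
    unfolding T_def using emeasure_UN_countable[OF Im C(1) disj] by (simp add: nn_integral_cmult)
  also have "\<dots> \<le> (\<integral>\<^sup>+i. emeasure \<nu> (I i) \<partial>count_space C)"
    by (rule nn_integral_mono) (use single in auto)
  also have "\<dots> = emeasure \<nu> T"
    unfolding T_def using C(1) disj by (subst emeasure_UN_countable) (auto simp: \<nu>_def Im)
  also have "\<dots> \<le> emeasure \<nu> V" using TV Vm by (intro emeasure_mono) (auto simp: \<nu>_def)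
  also have "\<dots> < ennreal (e * (s - r))" unfolding \<nu>A[OF Vm] using kV e rs by (intro ennreal_lessI) auto
  also have "\<dots> = ennreal (s - r) * ennreal e" using e rs by (simp add: ennreal_mult mult.commute)
  finally have lt: "ennreal (s - r) * emeasure lebesgue T < ennreal (s - r) * ennreal e" .
  then have Te: "emeasure lebesgue T < ennreal e"
    by (meson linorder_not_le mult_left_mono zero_le)
  have Tfin: "T \<in> lmeasurable" using Te Tm by (intro fmeasurableI) (auto intro: less_trans)
  define N where "N = ?E - T"
  have Nn: "N \<in> lmeasurable" "measure lebesgue N = 0"
    using C(4) by (auto simp: N_def T_def I_def negligible_imp_measurable negligible_imp_measure0)
  show "\<exists>T'. ?E \<subseteq> T' \<and> T' \<in> lmeasurable \<and> measure lebesgue T' \<le> e"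
  proof (intro exI[of _ "T \<union> N"] conjI)
    show "?E \<subseteq> T \<union> N" by (auto simp: N_def)
    show "T \<union> N \<in> lmeasurable" using Tfin Nn by auto
    have "measure lebesgue (T \<union> N) \<le> measure lebesgue T + measure lebesgue N"
      using Tfin Nn by (intro measure_Un_le) auto
    also have "\<dots> \<le> e" using Te Nn Tfin e
      by (simp add: emeasure_eq_measure2 ennreal_less_iff)
    finally show "measure lebesgue (T \<union> N) \<le> e" .
  qed
qed

text \<open>Off a countable union of null sets, indexed by pairs of rationals r < s, no difference
  quotient of F stays above g in the limit. The same for -F and -g bounds the quotients from below,
  and both together give the derivative.\<close>

lemma prim_on_deriv_real:
  fixes g F :: "real \<Rightarrow> real"
  assumes P: "prim_on c d g F"
  shows "AE x in lebesgue. x \<in> {c<..<d} \<longrightarrow> (F has_real_derivative g x) (at x)"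
proof -
  have P': "prim_on c d (\<lambda>x. - g x) (\<lambda>x. - F x)"
  proof -
    have "(\<lambda>x. - g x) absolutely_integrable_on {c..d}"
      using P set_integrable_scaleR_right[of "-1::real" lebesgue "{c..d}" g] by (auto simp: prim_on_def set_integrable_def)
    moreover have "((\<lambda>x. - g x) has_integral (- F y - - F x)) {x..y}" if "x\<in>{c..d}" "y\<in>{c..d}" "x \<le> y" for x y
      using has_integral_neg[of g "F y - F x" "{x..y}"] P that by (auto simp: prim_on_def)
    ultimately show ?thesis by (auto simp: prim_on_def)
  qed
  define E where "E = (\<lambda>g F r s. {x\<in>{c<..<d}. (g x::real) < r \<and> (\<forall>\<delta>>0. \<exists>y::real. y \<noteq> x \<and> \<bar>y - x\<bar> < \<delta> \<and> ((F y::real) - F x) / (y - x) > s)})"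
  define Z where "Z = (\<Union>(r,s)\<in>{(r,s). r \<in> \<rat> \<and> s \<in> \<rat> \<and> r < s}. E g F r s \<union> E (\<lambda>x. - g x) (\<lambda>x. - F x) r s)"
  have "countable {(r,s). (r::real) \<in> \<rat> \<and> (s::real) \<in> \<rat> \<and> r < s}"
    by (rule countable_subset[of _ "\<rat> \<times> \<rat>"]) (auto simp: countable_rat)
  then have "negligible Z"
    unfolding Z_def
    using upper_derivate_negligible[OF P] upper_derivate_negligible[OF P']
    by (intro negligible_countable_Union[of "(\<lambda>(r,s). E g F r s \<union> E (\<lambda>x. - g x) (\<lambda>x. - F x) r s) ` _"])
      (auto simp: E_def intro!: negligible_Un)
  then have "AE x in lebesgue. x \<notin> Z"
    by (intro AE_I'[of Z]) (auto simp: negligible_iff_null_sets)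
  then show ?thesis
  proof (rule AE_mp, intro AE_I2 impI)
    fix x assume xZ: "x \<notin> Z" and x: "x \<in> {c<..<d}"
    have key: "\<exists>\<delta>>0. \<forall>y. y \<noteq> x \<longrightarrow> \<bar>y - x\<bar> < \<delta> \<longrightarrow> (F' y - F' x) / (y - x) < g' x + e"
      if e: "e > 0" and nin: "\<And>r s. r \<in> \<rat> \<Longrightarrow> s \<in> \<rat> \<Longrightarrow> r < s \<Longrightarrow> x \<notin> E g' F' r s" for e g' F'
    proof -
      obtain s where s: "s \<in> \<rat>" "g' x < s" "s < g' x + e" using Rats_dense_in_real[of "g' x" "g' x + e"] e by auto
      obtain r where r: "r \<in> \<rat>" "g' x < r" "r < s" using Rats_dense_in_real[of "g' x" s] s by auto
      from nin[OF r(1) s(1) r(3)] x r obtain \<delta> where "\<delta> > 0"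
        "\<And>y. y \<noteq> x \<Longrightarrow> \<bar>y - x\<bar> < \<delta> \<Longrightarrow> (F' y - F' x) / (y - x) \<le> s" unfolding E_def
        by (auto simp: not_less) (metis not_le)
      then show ?thesis using s(3) by (intro exI[of _ \<delta>]) force
    qed
    have "\<exists>\<delta>>0. \<forall>y. y \<noteq> x \<and> norm (y - x) < \<delta> \<longrightarrow> norm ((F y - F x) / (y - x) - g x) < e" if e: "e > 0" for e
    proof -
      obtain \<delta>1 where d1: "\<delta>1 > 0" "\<And>y. y \<noteq> x \<Longrightarrow> \<bar>y - x\<bar> < \<delta>1 \<Longrightarrow> (F y - F x) / (y - x) < g x + e"
        using key[of e g F] e xZ unfolding Z_def by blast
      obtain \<delta>2 where d2: "\<delta>2 > 0" "\<And>y. y \<noteq> x \<Longrightarrow> \<bar>y - x\<bar> < \<delta>2 \<Longrightarrow> (- F y - - F x) / (y - x) < - g x + e"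
        using key[of e "\<lambda>x. - g x" "\<lambda>x. - F x"] e xZ unfolding Z_def by blast
      have "\<bar>(F y - F x) / (y - x) - g x\<bar> < e" if y: "y \<noteq> x" "\<bar>y - x\<bar> < min \<delta>1 \<delta>2" for y
      proof -
        have "(- F y - - F x) / (y - x) = - ((F y - F x) / (y - x))" by (metis minus_diff_minus minus_divide_left)
        then show ?thesis using d1(2)[of y] d2(2)[of y] y by (simp add: abs_less_iff)
      qed
      then show ?thesis using d1 d2 by (intro exI[of _ "min \<delta>1 \<delta>2"]) auto
    qed
    then show "(F has_real_derivative g x) (at x)"
      unfolding has_field_derivative_iff LIM_eq by simp
  qed
qed

section \<open>Total variation of absolutely continuous functions\<close>

definition real_ac :: "real \<Rightarrow> real \<Rightarrow> (real \<Rightarrow> real) \<Rightarrow> bool" where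
  "real_ac c d F \<longleftrightarrow> (\<forall>\<epsilon>>0. \<exists>\<delta>>0. \<forall>\<D> T. \<D> division_of T \<and> T \<subseteq> {c..d} \<and> (\<Sum>k\<in>\<D>. Sup k - Inf k) < \<delta> \<longrightarrow>
        (\<Sum>k\<in>\<D>. \<bar>F (Sup k) - F (Inf k)\<bar>) < \<epsilon>)"

text \<open>Weak monotonicity lets a chain be cut at a point by \<open>min\<close> and
  \<open>max\<close> without changing its length; the degenerate intervals contribute nothing to
  \<open>vsum\<close>.\<close>

definition chain :: "(nat \<Rightarrow> real) \<Rightarrow> nat \<Rightarrow> real \<Rightarrow> real \<Rightarrow> bool" where
  "chain t n x y \<longleftrightarrow> (\<forall>i<n. t i \<le> t (Suc i)) \<and> t 0 = x \<and> t n = y"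

definition vsum :: "(real \<Rightarrow> real) \<Rightarrow> (nat \<Rightarrow> real) \<Rightarrow> nat \<Rightarrow> real" where
  "vsum F t n = (\<Sum>i<n. \<bar>F (t (Suc i)) - F (t i)\<bar>)"

text \<open>Total variation. A supremum of reals says something only for bounded sets, so
  \<open>vsum_bounded\<close> has to precede every use of it.\<close>

definition var :: "(real \<Rightarrow> real) \<Rightarrow> real \<Rightarrow> real \<Rightarrow> real" where
  "var F x y = Sup {vsum F t n |t n. chain t n x y}"

lemma chain_le: "chain t n x y \<Longrightarrow> i \<le> j \<Longrightarrow> j \<le> n \<Longrightarrow> t i \<le> t j"
proof (induction j)
  case (Suc j) then show ?case
    by (cases "i = Suc j") (auto simp: chain_def intro: order_trans)
qed auto

lemma chain_bounds:
  assumes "chain t n x y" "i \<le> n" shows "x \<le> t i" "t i \<le> y"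
  using chain_le[OF assms(1), of 0 i] chain_le[OF assms(1), of i n] assms by (auto simp: chain_def)

text \<open>A division is a set of intervals, so the pieces must be distinct: only those with
  nonempty interior are kept, and disjoint interiors then make the indexing injective. Dropping
  degenerate pieces is harmless for every g that vanishes on single points.\<close>

lemma refine_division:
  fixes p :: "real set set"
  assumes p: "p division_of S" and t: "\<And>k. k \<in> p \<Longrightarrow> chain (t k) (n k) (Inf k) (Sup k)"
  obtains \<D> T where "\<D> division_of T" "T \<subseteq> S"
    "\<And>g::real set \<Rightarrow> real. (\<And>z. g {z..z} = 0) \<Longrightarrow> (\<Sum>k\<in>\<D>. g k) = (\<Sum>k\<in>p. \<Sum>i<n k. g {t k i..t k (Suc i)})"
proof -
  define I where "I = Sigma p (\<lambda>k. {i\<in>{..<n k}. t k i < t k (Suc i)})"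
  define \<phi> where "\<phi> = (\<lambda>(k,i). {t k i..t k (Suc i)})"
  have pf: "finite p" using p by (rule division_ofD(1))
  have pk: "k = {Inf k..Sup k}" "Inf k \<le> Sup k" if kp: "k \<in> p" for k
  proof -
    obtain x y where "k = cbox x y" "k \<noteq> {}" using division_ofD(3,4)[OF p kp] by blast
    then show "k = {Inf k..Sup k}" "Inf k \<le> Sup k" by auto
  qed
  have sub: "\<phi> j \<subseteq> fst j" if j: "j \<in> I" for j
  proof -
    obtain k i where ki: "j = (k,i)" by (cases j)
    then have *: "k \<in> p" "i < n k" using j by (auto simp: I_def)
    have "Inf k \<le> t k i" "t k (Suc i) \<le> Sup k"
      using chain_bounds[OF t[OF *(1)], of i] chain_bounds[OF t[OF *(1)], of "Suc i"] * by auto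
    then have "{t k i..t k (Suc i)} \<subseteq> {Inf k..Sup k}" by auto
    then show ?thesis using pk(1)[OF *(1)] ki by (auto simp: \<phi>_def)
  qed
  have If: "finite I" using pf by (auto simp: I_def)
  have int: "interior (\<phi> j) \<inter> interior (\<phi> j') = {}" if j: "j \<in> I" "j' \<in> I" "j \<noteq> j'" for j j'
  proof (cases "fst j = fst j'")
    case True
    obtain k i i' where ki: "j = (k,i)" "j' = (k,i')" using True by (metis prod.collapse)
    then have *: "k \<in> p" "i < n k" "i' < n k" "i \<noteq> i'" using j by (auto simp: I_def)
    have "t k (Suc i) \<le> t k i' \<or> t k (Suc i') \<le> t k i"
      using chain_le[OF t[OF *(1)], of "Suc i" i'] chain_le[OF t[OF *(1)], of "Suc i'" i] * by linarith
    then show ?thesis by (auto simp: ki \<phi>_def)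
  next
    case False
    have "interior (fst j) \<inter> interior (fst j') = {}"
      using division_ofD(5)[OF p, of "fst j" "fst j'"] j False by (auto simp: I_def)
    moreover have "interior (\<phi> j) \<subseteq> interior (fst j)" "interior (\<phi> j') \<subseteq> interior (fst j')"
      by (rule interior_mono[OF sub[OF j(1)]], rule interior_mono[OF sub[OF j(2)]])
    ultimately show ?thesis by blast
  qed
  have ne: "interior (\<phi> j) \<noteq> {}" if "j \<in> I" for j using that by (auto simp: I_def \<phi>_def)
  have inj: "inj_on \<phi> I" using int ne by (metis inf.idem inj_onI)
  show ?thesis
  proof (rule that[of "\<phi> ` I" "\<Union>(\<phi> ` I)"])
    show "\<phi> ` I division_of \<Union>(\<phi> ` I)"
    proof (rule division_ofI)
      show "\<exists>a b. K = cbox a b" if "K \<in> \<phi> ` I" for K using that by (auto simp: \<phi>_def)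
      show "K \<noteq> {}" if "K \<in> \<phi> ` I" for K using that ne by fastforce
      show "interior K1 \<inter> interior K2 = {}" if K: "K1 \<in> \<phi> ` I" "K2 \<in> \<phi> ` I" "K1 \<noteq> K2" for K1 K2
      proof -
        obtain j1 j2 where "K1 = \<phi> j1" "K2 = \<phi> j2" "j1 \<in> I" "j2 \<in> I" using K by blast
        then show ?thesis using int[of j1 j2] K(3) by blast
      qed
    qed (use If in auto)
    show "\<Union>(\<phi> ` I) \<subseteq> S"
      using sub division_ofD(2)[OF p] by (fastforce simp: I_def)
    fix g :: "real set \<Rightarrow> real" assume g: "\<And>z. g {z..z} = 0"
    have "(\<Sum>k\<in>\<phi> ` I. g k) = (\<Sum>j\<in>I. g (\<phi> j))" using sum.reindex[OF inj] by (simp add: o_def)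
    also have "\<dots> = (\<Sum>k\<in>p. \<Sum>i\<in>{i\<in>{..<n k}. t k i < t k (Suc i)}. g {t k i..t k (Suc i)})"
      unfolding I_def \<phi>_def using pf by (subst sum.Sigma) (auto simp: case_prod_unfold)
    also have "\<dots> = (\<Sum>k\<in>p. \<Sum>i<n k. g {t k i..t k (Suc i)})"
    proof (rule sum.cong[OF refl], rule sum.mono_neutral_left)
      fix k assume "k \<in> p"
      show "\<forall>i\<in>{..<n k} - {i \<in> {..<n k}. t k i < t k (Suc i)}. g {t k i..t k (Suc i)} = 0"
      proof
        fix i assume i: "i \<in> {..<n k} - {i \<in> {..<n k}. t k i < t k (Suc i)}"
        then have "t k i = t k (Suc i)" using t[OF \<open>k \<in> p\<close>] by (auto simp: chain_def not_less order_antisym)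
        then show "g {t k i..t k (Suc i)} = 0" using g by simp
      qed
    qed auto
    finally show "(\<Sum>k\<in>\<phi> ` I. g k) = (\<Sum>k\<in>p. \<Sum>i<n k. g {t k i..t k (Suc i)})" .
  qed
qed

text \<open>Refining a division leaves its total length unchanged, so the same \<delta> controls all
  chains inside its members at once. This uniformity gives both finite variation and the absolute
  continuity of the variation.\<close>

lemma real_ac_refine:
  assumes F: "real_ac c d F" and e: "\<epsilon> > 0"
  shows "\<exists>\<delta>>0. \<forall>p S t n. p division_of S \<and> S \<subseteq> {c..d} \<and> (\<Sum>k\<in>p. Sup k - Inf k) < \<delta> \<and>
       (\<forall>k\<in>p. chain (t k) (n k) (Inf k) (Sup k)) \<longrightarrow> (\<Sum>k\<in>p. vsum F (t k) (n k)) < \<epsilon>"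
proof -
  obtain \<delta> where \<delta>: "\<delta> > 0" "\<And>\<D> T. \<D> division_of T \<Longrightarrow> T \<subseteq> {c..d} \<Longrightarrow> (\<Sum>k\<in>\<D>. Sup k - Inf k) < \<delta> \<Longrightarrow>
        (\<Sum>k\<in>\<D>. \<bar>F (Sup k) - F (Inf k)\<bar>) < \<epsilon>"
    using F e unfolding real_ac_def by meson
  show ?thesis
  proof (intro exI[of _ \<delta>] conjI allI impI \<delta>(1))
    fix p S t n assume HH: "p division_of S \<and> S \<subseteq> {c..d} \<and> (\<Sum>k\<in>p. Sup k - Inf k) < \<delta> \<and>
       (\<forall>k\<in>p. chain (t k) (n k) (Inf k) (Sup k))"
    then have H: "p division_of S" "S \<subseteq> {c..d}" "(\<Sum>k\<in>p. Sup k - Inf k) < \<delta>" by auto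
    have ch: "chain (t k) (n k) (Inf k) (Sup k)" if "k \<in> p" for k using HH that by blast
    obtain \<D> T where R: "\<D> division_of T" "T \<subseteq> S"
      "\<And>g::real set \<Rightarrow> real. (\<And>z. g {z..z} = 0) \<Longrightarrow> (\<Sum>k\<in>\<D>. g k) = (\<Sum>k\<in>p. \<Sum>i<n k. g {t k i..t k (Suc i)})"
      using refine_division[OF H(1) ch] by blast
    have le: "t k i \<le> t k (Suc i)" if "k \<in> p" "i < n k" for k i using ch[OF that(1)] that by (auto simp: chain_def)
    have "(\<Sum>k\<in>\<D>. Sup k - Inf k) = (\<Sum>k\<in>p. \<Sum>i<n k. Sup {t k i..t k (Suc i)} - Inf {t k i..t k (Suc i)})"
      by (rule R(3)) auto
    also have "\<dots> = (\<Sum>k\<in>p. \<Sum>i<n k. t k (Suc i) - t k i)"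
      using le by (intro sum.cong refl) auto
    also have "\<dots> = (\<Sum>k\<in>p. Sup k - Inf k)"
      using ch by (intro sum.cong refl) (auto simp: sum_lessThan_telescope chain_def)
    finally have "(\<Sum>k\<in>\<D>. Sup k - Inf k) < \<delta>" using H(3) by simp
    then have "(\<Sum>k\<in>\<D>. \<bar>F (Sup k) - F (Inf k)\<bar>) < \<epsilon>" using \<delta>(2)[OF R(1)] R(2) H(2) by blast
    also have "(\<Sum>k\<in>\<D>. \<bar>F (Sup k) - F (Inf k)\<bar>) = (\<Sum>k\<in>p. \<Sum>i<n k. \<bar>F (Sup {t k i..t k (Suc i)}) - F (Inf {t k i..t k (Suc i)})\<bar>)"
      by (rule R(3)) auto
    also have "\<dots> = (\<Sum>k\<in>p. vsum F (t k) (n k))"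
      unfolding vsum_def using le by (intro sum.cong refl) auto
    finally show "(\<Sum>k\<in>p. vsum F (t k) (n k)) < \<epsilon>" .
  qed
qed

lemma vsum_split:
  assumes "chain t n x z" "x \<le> y" "y \<le> z"
  obtains t1 t2 where "chain t1 n x y" "chain t2 n y z" "vsum F t n \<le> vsum F t1 n + vsum F t2 n"
proof
  show "chain (\<lambda>i. min (t i) y) n x y" "chain (\<lambda>i. max (t i) y) n y z"
    using assms by (auto simp: chain_def min_def max_def)
  show "vsum F t n \<le> vsum F (\<lambda>i. min (t i) y) n + vsum F (\<lambda>i. max (t i) y) n"
    unfolding vsum_def sum.distrib[symmetric] by (rule sum_mono) (auto simp: min_def max_def)
qed

lemma vsum_concat:
  assumes "chain t1 n x y" "chain t2 m y z"
  obtains t where "chain t (n + m) x z" "vsum F t (n + m) = vsum F t1 n + vsum F t2 m"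
proof
  define t where "t = (\<lambda>i. if i \<le> n then t1 i else t2 (i - n))"
  have tn: "t (n + i) = t2 i" for i using assms by (auto simp: t_def chain_def)
  show "chain t (n + m) x z"
    unfolding chain_def
  proof (intro conjI allI impI)
    fix i assume i: "i < n + m"
    show "t i \<le> t (Suc i)"
    proof (cases "i < n")
      case True then show ?thesis using assms by (auto simp: t_def chain_def)
    next
      case False
      then obtain j where j: "i = n + j" using le_Suc_ex not_less by blast
      then show ?thesis using tn[of j] tn[of "Suc j"] i assms by (auto simp: chain_def)
    qed
  qed (use assms tn[of m] in \<open>auto simp: t_def chain_def\<close>)
  have ts: "t (Suc (n + i)) = t2 (Suc i)" for i using tn[of "Suc i"] by simp
  have "vsum F t (n + m) = (\<Sum>i<n. \<bar>F (t (Suc i)) - F (t i)\<bar>) + (\<Sum>i<m. \<bar>F (t (Suc (n+i))) - F (t (n+i))\<bar>)"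
    unfolding vsum_def by (induction m) simp_all
  also have "\<dots> = vsum F t1 n + vsum F t2 m"
    unfolding vsum_def tn ts by (simp add: t_def)
  finally show "vsum F t (n + m) = vsum F t1 n + vsum F t2 m" .
qed

lemma chain_1: "x \<le> y \<Longrightarrow> chain (\<lambda>i. if i = 0 then x else y) 1 x y"
  by (auto simp: chain_def)

text \<open>Over an interval shorter than \<delta> the variation is at most 1, and a long chain is
  cut into steps of length \<delta>/2. Half of \<delta> is taken because short intervals are
  required to be strictly shorter than \<delta>.\<close>

lemma vsum_bounded:
  assumes F: "real_ac c d F"
  shows "\<exists>B. \<forall>x y t n. c \<le> x \<longrightarrow> y \<le> d \<longrightarrow> chain t n x y \<longrightarrow> vsum F t n \<le> B"
proof -
  obtain \<delta> where \<delta>: "\<delta> > 0"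
    "\<forall>p S t n. p division_of S \<and> S \<subseteq> {c..d} \<and> (\<Sum>k\<in>p. Sup k - Inf k) < \<delta> \<and>
       (\<forall>k\<in>p. chain (t k) (n k) (Inf k) (Sup k)) \<longrightarrow> (\<Sum>k\<in>p. vsum F (t k) (n k)) < 1"
    using real_ac_refine[OF F zero_less_one] by blast
  have short: "vsum F t n \<le> 1" if "c \<le> x" "y \<le> d" "chain t n x y" "y - x < \<delta>" for x y t n
  proof -
    have xy: "x \<le> y" using chain_bounds[OF that(3), of 0] that(3) by (auto simp: chain_def)
    have d: "{{x..y}} division_of {x..y}" using division_of_self[of x y] xy by simp
    have "(\<Sum>k\<in>{{x..y}}. vsum F ((\<lambda>_. t) k) ((\<lambda>_. n) k)) < 1"
      by (rule \<delta>(2)[rule_format, of _ "{x..y}"]) (use that xy d in auto)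
    then show ?thesis by simp
  qed
  have "vsum F t n \<le> real j + 1" if "c \<le> x" "y \<le> d" "chain t n x y" "y - x \<le> real j * (\<delta>/2)" for j x y t n
    using that
  proof (induction j arbitrary: x t)
    case 0 then show ?case using short[of x y t n] \<delta>(1) by auto
  next
    case (Suc j)
    have xy: "x \<le> y" using chain_bounds[OF Suc.prems(3), of 0] Suc.prems(3) by (auto simp: chain_def)
    define z where "z = min y (x + \<delta>/2)"
    have z: "x \<le> z" "z \<le> y" "z - x < \<delta>" "y - z \<le> real j * (\<delta>/2)"
      using xy \<delta>(1) Suc.prems(4) by (auto simp: z_def min_def field_simps)
    obtain t1 t2 where tt: "chain t1 n x z" "chain t2 n z y" "vsum F t n \<le> vsum F t1 n + vsum F t2 n"
      by (rule vsum_split[OF Suc.prems(3) z(1,2)])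
    have "vsum F t1 n \<le> 1" using short[OF _ _ tt(1)] z Suc.prems by auto
    moreover have "vsum F t2 n \<le> real j + 1" using Suc.IH[OF _ _ tt(2)] z Suc.prems by auto
    ultimately show ?case using tt(3) by simp
  qed note st = this
  obtain j :: nat where j: "d - c \<le> real j * (\<delta>/2)"
    using ex_less_of_nat_mult[of "\<delta>/2" "d - c"] \<delta>(1) by (auto intro: less_imp_le)
  show ?thesis
    by (rule exI[of _ "real j + 1"]) (use st j in force)
qed

context
  fixes c d F assumes F: "real_ac c d F"
begin

lemma vsum_le_var: "c \<le> x \<Longrightarrow> y \<le> d \<Longrightarrow> chain t n x y \<Longrightarrow> vsum F t n \<le> var F x y"
  unfolding var_def using vsum_bounded[OF F] by (intro cSup_upper) (auto simp: bdd_above_def, blast)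

lemma var_leI: "x \<le> y \<Longrightarrow> (\<And>t n. chain t n x y \<Longrightarrow> vsum F t n \<le> B) \<Longrightarrow> var F x y \<le> B"
  unfolding var_def using chain_1[of x y] by (intro cSup_least) auto

lemma var_approx:
  assumes "c \<le> x" "x \<le> y" "y \<le> d" "e > 0"
  obtains t n where "chain t n x y" "var F x y < vsum F t n + e"
  using var_leI[OF assms(2), of "var F x y - e"] assms(4)
  by (metis diff_add_cancel diff_less_eq less_add_same_cancel1 not_le)

lemma var_add:
  assumes "c \<le> x" "x \<le> y" "y \<le> z" "z \<le> d"
  shows "var F x z = var F x y + var F y z"
proof (rule antisym)
  show "var F x z \<le> var F x y + var F y z"
  proof (rule var_leI)
    fix t n assume "chain t n x z"
    then obtain t1 t2 where tt: "chain t1 n x y" "chain t2 n y z" "vsum F t n \<le> vsum F t1 n + vsum F t2 n"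
      by (rule vsum_split[OF _ assms(2,3)])
    show "vsum F t n \<le> var F x y + var F y z"
      using tt vsum_le_var[OF _ _ tt(1)] vsum_le_var[OF _ _ tt(2)] assms by linarith
  qed (use assms in auto)
  show "var F x y + var F y z \<le> var F x z"
  proof (rule field_le_epsilon)
    fix e :: real assume e: "e > 0"
    obtain t1 n1 where 1: "chain t1 n1 x y" "var F x y < vsum F t1 n1 + e/2"
      by (rule var_approx[of x y "e/2"]) (use assms e in auto)
    obtain t2 n2 where 2: "chain t2 n2 y z" "var F y z < vsum F t2 n2 + e/2"
      by (rule var_approx[of y z "e/2"]) (use assms e in auto)
    obtain t where t: "chain t (n1 + n2) x z" "vsum F t (n1 + n2) = vsum F t1 n1 + vsum F t2 n2"
      by (rule vsum_concat[OF 1(1) 2(1)])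
    show "var F x y + var F y z \<le> var F x z + e"
      using vsum_le_var[OF _ _ t(1)] t 1 2 assms by linarith
  qed
qed

lemma abs_diff_le_var:
  assumes "c \<le> x" "x \<le> y" "y \<le> d" shows "\<bar>F y - F x\<bar> \<le> var F x y"
  using vsum_le_var[OF _ _ chain_1[OF assms(2)]] assms by (simp add: vsum_def)

text \<open>Choose in every member of a division a chain that attains its variation up to \<eta>.
  These chains fall under \<open>real_ac_refine\<close>, and \<eta> is divided by the number of
  members so that the errors add up to at most \<epsilon>/2.\<close>

lemma var_real_ac: "real_ac c d (var F c)"
  unfolding real_ac_def
proof (intro allI impI)
  fix \<epsilon> :: real assume e: "\<epsilon> > 0"
  obtain \<delta> where \<delta>: "\<delta> > 0"
    "\<forall>p S t n. p division_of S \<and> S \<subseteq> {c..d} \<and> (\<Sum>k\<in>p. Sup k - Inf k) < \<delta> \<and>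
       (\<forall>k\<in>p. chain (t k) (n k) (Inf k) (Sup k)) \<longrightarrow> (\<Sum>k\<in>p. vsum F (t k) (n k)) < \<epsilon>/2"
    using real_ac_refine[OF F half_gt_zero[OF e]] by blast
  show "\<exists>\<delta>>0. \<forall>\<D> T. \<D> division_of T \<and> T \<subseteq> {c..d} \<and> (\<Sum>k\<in>\<D>. Sup k - Inf k) < \<delta> \<longrightarrow>
        (\<Sum>k\<in>\<D>. \<bar>var F c (Sup k) - var F c (Inf k)\<bar>) < \<epsilon>"
  proof (intro exI[of _ \<delta>] conjI allI impI \<delta>(1))
    fix \<D> T assume H: "\<D> division_of T \<and> T \<subseteq> {c..d} \<and> (\<Sum>k\<in>\<D>. Sup k - Inf k) < \<delta>"
    then have div: "\<D> division_of T" by simp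
    have fin: "finite \<D>" using div by (rule division_ofD(1))
    define \<eta> where "\<eta> = \<epsilon> / (2 * (real (card \<D>) + 1))"
    have \<eta>: "\<eta> > 0" using e by (simp add: \<eta>_def add_nonneg_pos)
    have kk: "c \<le> Inf k \<and> Inf k \<le> Sup k \<and> Sup k \<le> d" if kD: "k \<in> \<D>" for k
    proof -
      obtain x y where k: "k = cbox x y" "k \<noteq> {}" using division_ofD(3,4)[OF div kD] by blast
      have "k \<subseteq> {c..d}" using division_ofD(2)[OF div kD] H by blast
      then show ?thesis using k by auto
    qed
    have "\<forall>k\<in>\<D>. \<exists>tn. chain (fst tn) (snd tn) (Inf k) (Sup k) \<and> var F (Inf k) (Sup k) < vsum F (fst tn) (snd tn) + \<eta>"
    proof
      fix k assume k: "k \<in> \<D>"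
      show "\<exists>tn. chain (fst tn) (snd tn) (Inf k) (Sup k) \<and> var F (Inf k) (Sup k) < vsum F (fst tn) (snd tn) + \<eta>"
        by (rule var_approx[of "Inf k" "Sup k" \<eta>]) (use kk[OF k] \<eta> in auto)
    qed
    then obtain tn where tn: "\<And>k. k \<in> \<D> \<Longrightarrow> chain (fst (tn k)) (snd (tn k)) (Inf k) (Sup k)"
      "\<And>k. k \<in> \<D> \<Longrightarrow> var F (Inf k) (Sup k) < vsum F (fst (tn k)) (snd (tn k)) + \<eta>"
      by (metis (no_types, lifting) bchoice)
    have "(\<Sum>k\<in>\<D>. \<bar>var F c (Sup k) - var F c (Inf k)\<bar>) \<le> (\<Sum>k\<in>\<D>. vsum F (fst (tn k)) (snd (tn k)) + \<eta>)"
    proof (rule sum_mono)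
      fix k assume k: "k \<in> \<D>"
      have "var F c (Sup k) - var F c (Inf k) = var F (Inf k) (Sup k)"
        using var_add[of c "Inf k" "Sup k"] kk[OF k] by simp
      moreover have "0 \<le> var F (Inf k) (Sup k)" using abs_diff_le_var[of "Inf k" "Sup k"] kk[OF k] by linarith
      ultimately show "\<bar>var F c (Sup k) - var F c (Inf k)\<bar> \<le> vsum F (fst (tn k)) (snd (tn k)) + \<eta>"
        using tn(2)[OF k] by simp
    qed
    also have "\<dots> = (\<Sum>k\<in>\<D>. vsum F (fst (tn k)) (snd (tn k))) + real (card \<D>) * \<eta>" by (simp add: sum.distrib)
    also have "\<dots> < \<epsilon>/2 + \<epsilon>/2"
    proof (rule add_less_le_mono)
      show "(\<Sum>k\<in>\<D>. vsum F (fst (tn k)) (snd (tn k))) < \<epsilon>/2"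
        by (rule \<delta>(2)[rule_format, of _ T]) (use H tn in auto)
      show "real (card \<D>) * \<eta> \<le> \<epsilon>/2" using e by (simp add: \<eta>_def field_simps)
    qed
    finally show "(\<Sum>k\<in>\<D>. \<bar>var F c (Sup k) - var F c (Inf k)\<bar>) < \<epsilon>" by simp
  qed
qed

end

section \<open>Monotone absolutely continuous functions and Radon-Nikodym densities\<close>

lemma real_ac_continuous:
  assumes "real_ac c d F" shows "continuous_on {c..d} F"
proof (rule continuous_onI)
  fix x e :: real assume x: "x \<in> {c..d}" and e: "e > 0"
  obtain \<delta> where \<delta>: "\<delta> > 0" "\<And>\<D> T. \<D> division_of T \<Longrightarrow> T \<subseteq> {c..d} \<Longrightarrow> (\<Sum>k\<in>\<D>. Sup k - Inf k) < \<delta> \<Longrightarrow>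
        (\<Sum>k\<in>\<D>. \<bar>F (Sup k) - F (Inf k)\<bar>) < e"
    using assms e unfolding real_ac_def by meson
  have key: "\<bar>F v - F u\<bar> < e" if "u \<in> {c..d}" "v \<in> {c..d}" "u \<le> v" "v - u < \<delta>" for u v
  proof -
    have "{{u..v}} division_of {u..v}" using division_of_self[of u v] that by simp
    from \<delta>(2)[OF this] show ?thesis using that by auto
  qed
  show "\<exists>d'>0. \<forall>x'\<in>{c..d}. dist x' x < d' \<longrightarrow> dist (F x') (F x) \<le> e"
  proof (intro exI[of _ \<delta>] conjI ballI impI \<delta>(1))
    fix x' assume x': "x' \<in> {c..d}" "dist x' x < \<delta>"
    show "dist (F x') (F x) \<le> e"
      using key[of x x'] key[of x' x] x x' by (cases "x \<le> x'") (auto simp: dist_real_def abs_minus_commute)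
  qed
qed

text \<open>A Lebesgue null set lies in an open set of small length. Inside (c, d) this open set is
  an increasing union of finite unions of intervals, on each of which absolute continuity of G
  bounds the Stieltjes measure by e. Outside, G is constant and both half-lines are null.\<close>

lemma interval_measure_absolutely_continuous:
  assumes mono: "\<And>x y. x \<le> y \<Longrightarrow> G x \<le> G y" and cont: "continuous_on UNIV G"
    and F: "real_ac c d G" and left: "\<And>x. x \<le> c \<Longrightarrow> G x = G c" and right: "\<And>x. d \<le> x \<Longrightarrow> G x = G d"
  shows "absolutely_continuous lborel (interval_measure G)"
  unfolding absolutely_continuous_def
proof
  let ?\<mu> = "interval_measure G"
  have rc: "continuous (at_right x) G" for x
    using cont by (meson UNIV_I continuous_on_eq_continuous_within continuous_within_subset subset_UNIV)
  have Ioc: "emeasure ?\<mu> {x<..y} = ennreal (G y - G x)" if "x \<le> y" for x y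
    by (rule emeasure_interval_measure_Ioc[OF that mono rc])
  have Icc: "emeasure ?\<mu> {x..y} = ennreal (G y - G x)" if "x \<le> y" for x y
    by (rule emeasure_interval_measure_Icc[OF that mono cont])
  fix N :: "real set" assume N: "N \<in> null_sets lborel"
  have L: "{..c} \<in> null_sets ?\<mu>"
  proof -
    have "{c - real n<..c} \<in> null_sets ?\<mu>" for n
      using Ioc[of "c - real n" c] left[of "c - real n"] by (intro null_setsI) auto
    then have "(\<Union>n. {c - real n<..c}) \<in> null_sets ?\<mu>" by (intro null_sets_UN) auto
    also have "(\<Union>n. {c - real n<..c}) = {..c}"
    proof (safe; simp)
      fix x assume "x \<le> c"
      show "\<exists>n. c - real n < x" using reals_Archimedean2[of "c - x"] by (auto simp: algebra_simps)
    qed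
    finally show ?thesis .
  qed
  have R: "{d..} \<in> null_sets ?\<mu>"
  proof -
    have "{d..d + real n} \<in> null_sets ?\<mu>" for n
      using Icc[of d "d + real n"] right[of "d + real n"] by (intro null_setsI) auto
    then have "(\<Union>n. {d..d + real n}) \<in> null_sets ?\<mu>" by (intro null_sets_UN) auto
    also have "(\<Union>n. {d..d + real n}) = {d..}"
    proof (safe; simp)
      fix x assume "d \<le> x"
      show "\<exists>n. x \<le> d + real n" using real_arch_simple[of "x - d"] by (auto simp: algebra_simps)
    qed
    finally show ?thesis .
  qed
  have Nb: "N \<in> sets borel" using N by auto
  have "emeasure ?\<mu> (N \<inter> {c<..<d}) \<le> ennreal e" if e: "e > 0" for e
  proof -
    obtain \<delta> where \<delta>: "\<delta> > 0" "\<And>\<D> T. \<D> division_of T \<Longrightarrow> T \<subseteq> {c..d} \<Longrightarrow> (\<Sum>k\<in>\<D>. Sup k - Inf k) < \<delta> \<Longrightarrow>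
        (\<Sum>k\<in>\<D>. \<bar>G (Sup k) - G (Inf k)\<bar>) < e"
      using F e unfolding real_ac_def by meson
    obtain U where U: "open U" "N \<subseteq> U" "emeasure lborel (U - N) < \<delta>"
      by (rule outer_regular_lborel[OF Nb \<delta>(1)])
    have Um: "emeasure lborel U < \<delta>"
    proof -
      have "emeasure lborel (U - N) = emeasure lborel U"
        using N U(1) by (intro emeasure_Diff_null_set) auto
      then show ?thesis using U(3) by simp
    qed
    define V where "V = U \<inter> {c<..<d}"
    have Vo: "open V" using U by (auto simp: V_def)
    obtain \<C> where C: "countable \<C>" "\<C> \<subseteq> Pow V" "\<And>X. X \<in> \<C> \<Longrightarrow> \<exists>a b. X = cbox a b" "\<Union>\<C> = V"
      using open_countable_Union_open_cbox[OF Vo] by metis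
    \<comment> \<open>Adding the empty box makes the family nonempty, so it can be enumerated even
      when V is empty.\<close>
    define \<C>' where "\<C>' = insert {} \<C>"
    have C': "countable \<C>'" "\<C>' \<noteq> {}" "\<And>X. X \<in> \<C>' \<Longrightarrow> X \<subseteq> V" "\<Union>\<C>' = V"
      using C by (auto simp: \<C>'_def)
    have box: "\<exists>a b. X = cbox a b" if X: "X \<in> \<C>'" for X
    proof (cases "X = {}")
      case True then show ?thesis by (intro exI[of _ "1"] exI[of _ "0"]) simp
    qed (use X C(3) in \<open>auto simp: \<C>'_def\<close>)
    define X where "X = from_nat_into \<C>'"
    have X: "X i \<in> \<C>'" for i unfolding X_def using C'(2) by (rule from_nat_into)
    have ranX: "range X = \<C>'" unfolding X_def using C' by (simp add: range_from_nat_into)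
    \<comment> \<open>Absolute continuity only speaks of finite divisions, so the bound is shown for
      these finite unions and passes to V by continuity from below.\<close>
    define f where "f = (\<lambda>n::nat. \<Union>(X ` {..n}))"
    have fm: "emeasure ?\<mu> (f n) \<le> ennreal e" for n
    proof -
      obtain p where p: "p division_of f n"
        unfolding f_def by (rule elementary_unions_intervals[of "X ` {..n}"]) (use box X in auto)
      have fV: "f n \<subseteq> V" using C'(3) X by (auto simp: f_def)
      have fin: "finite p" using p by (rule division_ofD(1))
      have pk: "k = {Inf k..Sup k}" "Inf k \<le> Sup k" if kp: "k \<in> p" for k
      proof -
        obtain x y where "k = cbox x y" "k \<noteq> {}" using division_ofD(3,4)[OF p kp] by blast
        then show "k = {Inf k..Sup k}" "Inf k \<le> Sup k" by auto
      qed
      have "(\<Sum>k\<in>p. Sup k - Inf k) = (\<Sum>k\<in>p. measure lebesgue k)"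
      proof (rule sum.cong[OF refl])
        fix k assume k: "k \<in> p"
        have "measure lebesgue {Inf k..Sup k} = Sup k - Inf k" using pk(2)[OF k] by simp
        then show "Sup k - Inf k = measure lebesgue k" using pk(1)[OF k] by simp
      qed
      also have "\<dots> = measure lebesgue (f n)" by (rule content_division[OF p])
      also have "\<dots> \<le> measure lebesgue U"
      proof (rule measure_mono_fmeasurable)
        show "f n \<subseteq> U" using fV by (auto simp: V_def)
        show "f n \<in> sets lebesgue" using lmeasurable_division[OF p] by auto
        show "U \<in> lmeasurable" using Um U(1)
          by (intro fmeasurableI) (auto intro: less_trans simp: borel_open)
      qed
      also have "\<dots> < \<delta>"
      proof -
        have "ennreal (measure lebesgue U) = emeasure lborel U"
          using less_trans[OF Um ennreal_less_top] U(1) by (subst emeasure_eq_ennreal_measure[symmetric]) (auto simp: borel_open)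
        then have "ennreal (measure lebesgue U) < ennreal \<delta>" using Um by simp
        then show ?thesis by (simp add: ennreal_less_iff)
      qed
      finally have len: "(\<Sum>k\<in>p. Sup k - Inf k) < \<delta>" .
      have "f n \<subseteq> {c..d}" using fV by (auto simp: V_def)
      from \<delta>(2)[OF p this len] have s: "(\<Sum>k\<in>p. \<bar>G (Sup k) - G (Inf k)\<bar>) < e" .
      have pm: "k \<in> sets ?\<mu>" if "k \<in> p" for k using pk(1)[OF that] by (metis atLeastAtMost_borel sets_interval_measure)
      have "f n = \<Union>p" using division_ofD(6)[OF p] by simp
      then have "emeasure ?\<mu> (f n) \<le> (\<Sum>k\<in>p. emeasure ?\<mu> k)"
        using emeasure_subadditive_finite[of p "\<lambda>k. k" ?\<mu>] fin pm by (simp add: subset_iff)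
      also have "\<dots> = (\<Sum>k\<in>p. ennreal \<bar>G (Sup k) - G (Inf k)\<bar>)"
      proof (rule sum.cong[OF refl])
        fix k assume k: "k \<in> p"
        have "emeasure ?\<mu> {Inf k..Sup k} = ennreal \<bar>G (Sup k) - G (Inf k)\<bar>"
          using Icc[OF pk(2)[OF k]] mono[OF pk(2)[OF k]] by simp
        then show "emeasure ?\<mu> k = ennreal \<bar>G (Sup k) - G (Inf k)\<bar>" using pk(1)[OF k] by simp
      qed
      also have "\<dots> = ennreal (\<Sum>k\<in>p. \<bar>G (Sup k) - G (Inf k)\<bar>)" by (rule sum_ennreal) simp
      also have "\<dots> \<le> ennreal e" using s by (intro ennreal_leI) simp
      finally show ?thesis .
    qed
    have Xb: "X i \<in> sets ?\<mu>" for i using box[OF X[of i]] by auto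
    have "(\<Union>n. f n) = V" using ranX C'(4) by (auto simp: f_def)
    moreover have "(SUP n. emeasure ?\<mu> (f n)) = emeasure ?\<mu> (\<Union>n. f n)"
          proof (rule SUP_emeasure_incseq)
      show "incseq f" unfolding f_def by (intro monoI Sup_subset_mono image_mono) auto
    qed (use Xb in \<open>auto simp: f_def\<close>)
    ultimately have "emeasure ?\<mu> V \<le> ennreal e" using fm by (metis SUP_least)
    moreover have "emeasure ?\<mu> (N \<inter> {c<..<d}) \<le> emeasure ?\<mu> V"
      using U(2) Vo by (intro emeasure_mono) (auto simp: V_def borel_open)
    ultimately show ?thesis by (rule order_trans[rotated])
  qed
  then have "emeasure ?\<mu> (N \<inter> {c<..<d}) \<le> 0"
    using ennreal_le_epsilon[of 0 "emeasure ?\<mu> (N \<inter> {c<..<d})"] by simp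
  then have "N \<inter> {c<..<d} \<in> null_sets ?\<mu>" using Nb by (intro null_setsI) auto
  then have "(N \<inter> {c<..<d}) \<union> {..c} \<union> {d..} \<in> null_sets ?\<mu>" using L R by (intro null_sets.Un) auto
  then show "N \<in> null_sets ?\<mu>"
    by (rule null_sets_subset) (use Nb in auto)
qed

text \<open>Continued constantly beyond the interval, F becomes the distribution function of a
  measure that is absolutely continuous with respect to Lebesgue measure; the Radon-Nikodym density
  serves as integrand.\<close>

lemma mono_ac_prim_on:
  assumes mono: "\<And>x y. x \<in> {c..d} \<Longrightarrow> y \<in> {c..d} \<Longrightarrow> x \<le> y \<Longrightarrow> F x \<le> F y" and F: "real_ac c d F" and cd: "c \<le> d"
  shows "\<exists>g. prim_on c d g F"
proof -
  define G where "G = (\<lambda>x. F (max c (min d x)))"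
  have Gmono: "G x \<le> G y" if "x \<le> y" for x y
    unfolding G_def using that cd by (intro mono) auto
  have Gc: "continuous_on UNIV G"
    unfolding G_def using cd
    by (intro continuous_on_compose2[OF real_ac_continuous[OF F]] continuous_intros) auto
  have GF: "G x = F x" if "x \<in> {c..d}" for x using that by (auto simp: G_def max_def min_def)
  have Gac: "real_ac c d G"
    unfolding real_ac_def
  proof (intro allI impI)
    fix \<epsilon> :: real assume e: "\<epsilon> > 0"
    obtain \<delta> where \<delta>: "\<delta> > 0" "\<And>\<D> T. \<D> division_of T \<Longrightarrow> T \<subseteq> {c..d} \<Longrightarrow> (\<Sum>k\<in>\<D>. Sup k - Inf k) < \<delta> \<Longrightarrow>
        (\<Sum>k\<in>\<D>. \<bar>F (Sup k) - F (Inf k)\<bar>) < \<epsilon>"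
      using F e unfolding real_ac_def by meson
    show "\<exists>\<delta>>0. \<forall>\<D> T. \<D> division_of T \<and> T \<subseteq> {c..d} \<and> (\<Sum>k\<in>\<D>. Sup k - Inf k) < \<delta> \<longrightarrow>
        (\<Sum>k\<in>\<D>. \<bar>G (Sup k) - G (Inf k)\<bar>) < \<epsilon>"
    proof (intro exI[of _ \<delta>] conjI allI impI \<delta>(1))
      fix \<D> T assume H: "\<D> division_of T \<and> T \<subseteq> {c..d} \<and> (\<Sum>k\<in>\<D>. Sup k - Inf k) < \<delta>"
      then have div: "\<D> division_of T" by simp
      have "(\<Sum>k\<in>\<D>. \<bar>G (Sup k) - G (Inf k)\<bar>) = (\<Sum>k\<in>\<D>. \<bar>F (Sup k) - F (Inf k)\<bar>)"
      proof (rule sum.cong[OF refl])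
        fix k assume kD: "k \<in> \<D>"
        obtain x y where k: "k = cbox x y" "k \<noteq> {}" using division_ofD(3,4)[OF div kD] by blast
        have "k \<subseteq> {c..d}" using division_ofD(2)[OF div kD] H by blast
        then show "\<bar>G (Sup k) - G (Inf k)\<bar> = \<bar>F (Sup k) - F (Inf k)\<bar>" using k by (simp add: GF)
      qed
      then show "(\<Sum>k\<in>\<D>. \<bar>G (Sup k) - G (Inf k)\<bar>) < \<epsilon>" using \<delta>(2)[OF div] H by simp
    qed
  qed
  let ?\<mu> = "interval_measure G"
  have "absolutely_continuous lborel ?\<mu>"
    by (rule interval_measure_absolutely_continuous[OF Gmono Gc Gac]) (use cd in \<open>auto simp: G_def\<close>)
  from sigma_finite_measure.Radon_Nikodym[OF sigma_finite_lborel this] obtain h where h: "h \<in> borel_measurable lborel" "density lborel h = ?\<mu>"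
    by auto
  have Icc: "(\<integral>\<^sup>+z. h z * indicator {x..y} z \<partial>lborel) = ennreal (G y - G x)" if "x \<le> y" for x y
    using emeasure_interval_measure_Icc[OF that Gmono Gc] h(1)
    by (simp add: h(2)[symmetric] emeasure_density)
  \<comment> \<open>The interval has finite mass, so the density is finite almost everywhere on it
    and \<open>enn2real\<close> loses nothing there.\<close>
  have fin: "AE z in lborel. h z * indicator {c..d} z \<noteq> \<infinity>"
    using h(1) Icc[OF cd] by (intro nn_integral_noteq_infinite) auto
  define g where "g = (\<lambda>z. enn2real (h z))"
  have gb: "g \<in> borel_measurable borel" using h(1) unfolding g_def by measurable
  have int: "has_bochner_integral lborel (\<lambda>z. indicator {x..y} z *\<^sub>R g z) (F y - F x)"
    if xy: "x \<in> {c..d}" "y \<in> {c..d}" "x \<le> y" for x y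
  proof (rule has_bochner_integral_nn_integral)
    show "(\<lambda>z. indicat_real {x..y} z *\<^sub>R g z) \<in> borel_measurable lborel" using gb by measurable
    show "AE z in lborel. 0 \<le> indicat_real {x..y} z *\<^sub>R g z" by (simp add: g_def)
    show "0 \<le> F y - F x" using mono[OF xy] by simp
    have "(\<integral>\<^sup>+ z. ennreal (indicat_real {x..y} z *\<^sub>R g z) \<partial>lborel) = (\<integral>\<^sup>+z. h z * indicator {x..y} z \<partial>lborel)"
    proof (rule nn_integral_cong_AE, rule AE_mp[OF fin], rule AE_I2, rule impI)
      fix z assume f: "h z * indicator {c..d} z \<noteq> \<infinity>"
      show "ennreal (indicat_real {x..y} z *\<^sub>R g z) = h z * indicator {x..y} z"
      proof (cases "z \<in> {x..y}")
        case True
        then have "h z \<noteq> \<infinity>" using f xy by (auto simp: indicator_def)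
        then show ?thesis using True by (simp add: g_def less_top)
      qed simp
    qed
    also have "\<dots> = ennreal (F y - F x)" using Icc[OF xy(3)] GF[OF xy(1)] GF[OF xy(2)] by simp
    finally show "(\<integral>\<^sup>+ z. ennreal (indicat_real {x..y} z *\<^sub>R g z) \<partial>lborel) = ennreal (F y - F x)" .
  qed
  have sil: "set_integrable lborel {x..y} g" "(LINT z:{x..y}|lborel. g z) = F y - F x"
    if "x \<in> {c..d}" "y \<in> {c..d}" "x \<le> y" for x y
    using int[OF that] unfolding set_integrable_def set_lebesgue_integral_def
    by (auto dest: has_bochner_integral_integral_eq simp: has_bochner_integral_iff)
  have "prim_on c d g F"
    unfolding prim_on_def
  proof (intro conjI ballI impI)
    show "g absolutely_integrable_on {c..d}"
      using sil(1)[of c d] cd gb unfolding set_integrable_def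
      by (subst integrable_completion) auto
    fix x y assume xy: "x \<in> {c..d}" "y \<in> {c..d}" "x \<le> y"
    show "(g has_integral F y - F x) {x..y}"
      using set_borel_integral_eq_integral[OF sil(1)[OF xy]] sil(2)[OF xy] by (simp add: has_integral_iff)
  qed
  then show ?thesis by (intro exI[of _ g])
qed

section \<open>Calculus of indefinite integrals\<close>

lemma prim_on_linear:
  fixes g F :: "real \<Rightarrow> 'a::euclidean_space" and L :: "'a \<Rightarrow> 'b::euclidean_space"
  assumes "prim_on c d g F" "bounded_linear L"
  shows "prim_on c d (\<lambda>x. L (g x)) (\<lambda>x. L (F x))"
  unfolding prim_on_def
proof (intro conjI ballI impI)
  show "(\<lambda>x. L (g x)) absolutely_integrable_on {c..d}"
    using absolutely_integrable_linear[OF _ assms(2), where f=g] assms(1) by (simp add: prim_on_def o_def)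
  fix x y assume "x \<in> {c..d}" "y \<in> {c..d}" "x \<le> y"
  then have "(g has_integral (F y - F x)) {x..y}" using assms(1) by (auto simp: prim_on_def)
  from has_integral_linear[OF this assms(2)]
  show "((\<lambda>x. L (g x)) has_integral L (F y) - L (F x)) {x..y}"
    using assms(2) by (simp add: o_def linear_diff bounded_linear.linear)
qed

lemma prim_on_add:
  assumes "prim_on c d g F" "prim_on c d k H"
  shows "prim_on c d (\<lambda>x. g x + k x) (\<lambda>x. F x + H x)"
  unfolding prim_on_def
proof (intro conjI ballI impI)
  show "(\<lambda>x. g x + k x) absolutely_integrable_on {c..d}"
    using assms by (intro set_integral_add) (auto simp: prim_on_def)
  fix x y assume "x \<in> {c..d}" "y \<in> {c..d}" "x \<le> y"
  then have "(g has_integral (F y - F x)) {x..y}" "(k has_integral (H y - H x)) {x..y}" using assms by (auto simp: prim_on_def)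
  from has_integral_add[OF this] show "((\<lambda>x. g x + k x) has_integral (F y + H y - (F x + H x))) {x..y}"
    by (simp add: algebra_simps)
qed

lemma prim_on_diff:
  assumes "prim_on c d g F" "prim_on c d k H"
  shows "prim_on c d (\<lambda>x. g x - k x) (\<lambda>x. F x - H x)"
  using prim_on_add[OF assms(1) prim_on_linear[OF assms(2), of uminus]]
  by (simp add: bounded_linear_minus[OF bounded_linear_ident])

lemma prim_on_cmult:
  fixes g :: "real \<Rightarrow> complex"
  assumes "prim_on c d g F" shows "prim_on c d (\<lambda>x. a * g x) (\<lambda>x. a * F x)"
  using prim_on_linear[OF assms bounded_linear_mult_right[of a]] .

lemma prim_on_subset:
  assumes "prim_on c d g F" "c \<le> c'" "d' \<le> d" shows "prim_on c' d' g F"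
  unfolding prim_on_def
proof (intro conjI ballI impI)
  have "g absolutely_integrable_on {c..d}" using assms(1) by (simp add: prim_on_def)
  then show "g absolutely_integrable_on {c'..d'}"
    by (rule set_integrable_subset) (use assms(2,3) in auto)
  fix x y assume "x \<in> {c'..d'}" "y \<in> {c'..d'}" "x \<le> y"
  moreover from this have "x \<in> {c..d}" "y \<in> {c..d}" using assms(2,3) by auto
  ultimately show "(g has_integral F y - F x) {x..y}" using assms(1) unfolding prim_on_def by blast
qed

lemma prim_on_indefinite:
  fixes g :: "real \<Rightarrow> 'a::euclidean_space"
  assumes "g absolutely_integrable_on {c..d}"
  shows "prim_on c d g (\<lambda>x. a + integral {c..x} g)"
  unfolding prim_on_def
proof (intro conjI ballI impI assms)
  fix x y assume xy: "x \<in> {c..d}" "y \<in> {c..d}" "x \<le> y"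
  have gi: "g integrable_on {c..d}" using assms by (simp add: absolutely_integrable_on_def)
  have i: "g integrable_on {c..y}" "g integrable_on {x..y}"
    using xy by (auto intro: integrable_on_subinterval[OF gi])
  have "integral {c..x} g + integral {x..y} g = integral {c..y} g"
    using xy i by (intro Henstock_Kurzweil_Integration.integral_combine) auto
  then show "(g has_integral a + integral {c..y} g - (a + integral {c..x} g)) {x..y}"
    using i(2) by (simp add: has_integral_iff algebra_simps)
qed

text \<open>Jordan decomposition: with V the variation from c, both V + F and V are increasing and
  absolutely continuous, and F is their difference.\<close>

lemma real_ac_prim_on:
  assumes F: "real_ac c d F" and cd: "c \<le> d"
  shows "\<exists>g. prim_on c d g F"
proof -
  define V where "V = var F c"
  have Vdiff: "\<bar>F y - F x\<bar> \<le> V y - V x" if "x \<in> {c..d}" "y \<in> {c..d}" "x \<le> y" for x y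
    using var_add[OF F, of c x y] abs_diff_le_var[OF F, of x y] that by (simp add: V_def)
  have Vac: "real_ac c d V" unfolding V_def by (rule var_real_ac[OF F])
  have "real_ac c d (\<lambda>x. V x + F x)"
    unfolding real_ac_def
  proof (intro allI impI)
    fix \<epsilon> :: real assume e: "\<epsilon> > 0"
    then have e2: "\<epsilon>/2 > 0" by simp
    obtain \<delta>1 where d1: "\<delta>1 > 0" "\<And>\<D> T. \<D> division_of T \<Longrightarrow> T \<subseteq> {c..d} \<Longrightarrow> (\<Sum>k\<in>\<D>. Sup k - Inf k) < \<delta>1 \<Longrightarrow>
        (\<Sum>k\<in>\<D>. \<bar>V (Sup k) - V (Inf k)\<bar>) < \<epsilon>/2"
      using Vac e2 unfolding real_ac_def by meson
    obtain \<delta>2 where d2: "\<delta>2 > 0" "\<And>\<D> T. \<D> division_of T \<Longrightarrow> T \<subseteq> {c..d} \<Longrightarrow> (\<Sum>k\<in>\<D>. Sup k - Inf k) < \<delta>2 \<Longrightarrow>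
        (\<Sum>k\<in>\<D>. \<bar>F (Sup k) - F (Inf k)\<bar>) < \<epsilon>/2"
      using F e2 unfolding real_ac_def by meson
    show "\<exists>\<delta>>0. \<forall>\<D> T. \<D> division_of T \<and> T \<subseteq> {c..d} \<and> (\<Sum>k\<in>\<D>. Sup k - Inf k) < \<delta> \<longrightarrow>
        (\<Sum>k\<in>\<D>. \<bar>V (Sup k) + F (Sup k) - (V (Inf k) + F (Inf k))\<bar>) < \<epsilon>"
    proof (intro exI[of _ "min \<delta>1 \<delta>2"] conjI allI impI)
      fix \<D> T assume H: "\<D> division_of T \<and> T \<subseteq> {c..d} \<and> (\<Sum>k\<in>\<D>. Sup k - Inf k) < min \<delta>1 \<delta>2"
      have "(\<Sum>k\<in>\<D>. \<bar>V (Sup k) + F (Sup k) - (V (Inf k) + F (Inf k))\<bar>) \<le>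
        (\<Sum>k\<in>\<D>. \<bar>V (Sup k) - V (Inf k)\<bar>) + (\<Sum>k\<in>\<D>. \<bar>F (Sup k) - F (Inf k)\<bar>)"
        unfolding sum.distrib[symmetric] by (intro sum_mono) linarith
      also have "\<dots> < \<epsilon>/2 + \<epsilon>/2" using H by (intro add_strict_mono d1(2)[of _ T] d2(2)[of _ T]) auto
      finally show "(\<Sum>k\<in>\<D>. \<bar>V (Sup k) + F (Sup k) - (V (Inf k) + F (Inf k))\<bar>) < \<epsilon>" by simp
    qed (use d1 d2 in auto)
  qed
  moreover have "V x + F x \<le> V y + F y" if "x \<in> {c..d}" "y \<in> {c..d}" "x \<le> y" for x y
    using Vdiff[OF that] by linarith
  ultimately obtain g1 where "prim_on c d g1 (\<lambda>x. V x + F x)"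
    using mono_ac_prim_on[of c d "\<lambda>x. V x + F x"] cd by blast
  moreover obtain g2 where "prim_on c d g2 V"
  proof -
    have "V x \<le> V y" if "x \<in> {c..d}" "y \<in> {c..d}" "x \<le> y" for x y using Vdiff[OF that] by linarith
    then show ?thesis using mono_ac_prim_on[of c d V] Vac cd that by blast
  qed
  ultimately have "prim_on c d (\<lambda>x. g1 x - g2 x) (\<lambda>x. V x + F x - V x)" by (rule prim_on_diff)
  then have "prim_on c d (\<lambda>x. g1 x - g2 x) F" by simp
  then show ?thesis by (rule exI[of _ "\<lambda>x. g1 x - g2 x"])
qed

lemma AC_real_ac:
  assumes F: "abs_continuous_on {c..d} F" and L: "\<And>u v. \<bar>L u - L v\<bar> \<le> cmod (u - v)"
  shows "real_ac c d (\<lambda>x. L (F x))"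
  unfolding real_ac_def
proof (intro allI impI)
  fix \<epsilon> :: real assume e: "\<epsilon> > 0"
  obtain \<delta> where d: "\<delta> > 0" "\<And>\<D> T. \<D> division_of T \<Longrightarrow> T \<subseteq> {c..d} \<Longrightarrow> (\<Sum>k\<in>\<D>. Sup k - Inf k) < \<delta> \<Longrightarrow>
      (\<Sum>k\<in>\<D>. cmod (F (Sup k) - F (Inf k))) < \<epsilon>"
    using F e unfolding abs_continuous_on_def by meson
  show "\<exists>\<delta>>0. \<forall>\<D> T. \<D> division_of T \<and> T \<subseteq> {c..d} \<and> (\<Sum>k\<in>\<D>. Sup k - Inf k) < \<delta> \<longrightarrow>
      (\<Sum>k\<in>\<D>. \<bar>L (F (Sup k)) - L (F (Inf k))\<bar>) < \<epsilon>"
  proof (intro exI[of _ \<delta>] conjI allI impI d(1))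
    fix \<D> T assume H: "\<D> division_of T \<and> T \<subseteq> {c..d} \<and> (\<Sum>k\<in>\<D>. Sup k - Inf k) < \<delta>"
    have "(\<Sum>k\<in>\<D>. \<bar>L (F (Sup k)) - L (F (Inf k))\<bar>) \<le> (\<Sum>k\<in>\<D>. cmod (F (Sup k) - F (Inf k)))"
      by (intro sum_mono L)
    also have "\<dots> < \<epsilon>" using H by (intro d(2)) auto
    finally show "(\<Sum>k\<in>\<D>. \<bar>L (F (Sup k)) - L (F (Inf k))\<bar>) < \<epsilon>" .
  qed
qed

text \<open>Lebesgue's fundamental theorem, obtained for real and imaginary part separately. It is
  the entrance from \<open>AC_loc\<close> to integral equations.\<close>

theorem AC_prim_on:
  assumes F: "abs_continuous_on {c..d} F"
  shows "\<exists>g. prim_on c d g F"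
proof (cases "c \<le> d")
  case True
  have "real_ac c d (\<lambda>x. Re (F x))"
    by (rule AC_real_ac[OF F]) (metis abs_Re_le_cmod minus_complex.sel(1))
  moreover have "real_ac c d (\<lambda>x. Im (F x))"
    by (rule AC_real_ac[OF F]) (metis abs_Im_le_cmod minus_complex.sel(2))
  ultimately obtain g1 g2 where g: "prim_on c d g1 (\<lambda>x. Re (F x))" "prim_on c d g2 (\<lambda>x. Im (F x))"
    using real_ac_prim_on True by blast
  have "prim_on c d (\<lambda>x. of_real (g1 x) + \<i> * of_real (g2 x)) (\<lambda>x. of_real (Re (F x)) + \<i> * of_real (Im (F x)))"
    by (intro prim_on_add prim_on_cmult prim_on_linear[OF g(1)] prim_on_linear[OF g(2)] bounded_linear_of_real)
  then have "prim_on c d (\<lambda>x. of_real (g1 x) + \<i> * of_real (g2 x)) F"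
    by (simp add: complex_eq[symmetric])
  then show ?thesis by blast
qed (auto simp: prim_on_def)

theorem prim_on_deriv:
  fixes g F :: "real \<Rightarrow> complex"
  assumes P: "prim_on c d g F"
  shows "AE x in lebesgue. x \<in> {c<..<d} \<longrightarrow> (F has_vector_derivative g x) (at x)"
proof -
  have "AE x in lebesgue. x \<in> {c<..<d} \<longrightarrow> ((\<lambda>x. Re (F x)) has_real_derivative Re (g x)) (at x)"
       "AE x in lebesgue. x \<in> {c<..<d} \<longrightarrow> ((\<lambda>x. Im (F x)) has_real_derivative Im (g x)) (at x)"
    by (intro prim_on_deriv_real prim_on_linear[OF P] bounded_linear_Re bounded_linear_Im)+
  then show ?thesis
  proof (eventually_elim, intro impI)
    fix x assume H: "x \<in> {c<..<d} \<longrightarrow> ((\<lambda>x. Re (F x)) has_real_derivative Re (g x)) (at x)"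
       "x \<in> {c<..<d} \<longrightarrow> ((\<lambda>x. Im (F x)) has_real_derivative Im (g x)) (at x)" "x \<in> {c<..<d}"
    then have "((\<lambda>x. of_real (Re (F x)) + \<i> * of_real (Im (F x))) has_vector_derivative
        (of_real (Re (g x)) + \<i> * of_real (Im (g x)))) (at x)"
      by (intro has_vector_derivative_add has_vector_derivative_mult_right has_vector_derivative_of_real)
        (auto simp: has_real_derivative_iff_has_vector_derivative)
    then show "(F has_vector_derivative g x) (at x)" by (simp add: complex_eq[symmetric])
  qed
qed

lemma prim_on_spike:
  assumes P: "prim_on c d g F" and ae: "AE x in lebesgue. x \<in> {c<..<d} \<longrightarrow> k x = g x"
  shows "prim_on c d k F"
proof -
  obtain N where N: "N \<in> null_sets lebesgue" "{x. \<not> (x \<in> {c<..<d} \<longrightarrow> k x = g x)} \<subseteq> N"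
    using ae by (auto simp: eventually_ae_filter)
  define N' where "N' = N \<union> {c,d}"
  have N': "negligible N'" unfolding N'_def using N(1) by (intro negligible_Un) (auto simp: negligible_iff_null_sets)
  have eq: "k x = g x" if "x \<in> {c..d} - N'" for x using that N(2) by (auto simp: N'_def subset_iff less_le)
  show ?thesis unfolding prim_on_def
  proof (intro conjI ballI impI)
    show "k absolutely_integrable_on {c..d}"
      by (rule absolutely_integrable_spike[OF _ N' eq]) (use P in \<open>auto simp: prim_on_def\<close>)
    fix x y assume "x \<in> {c..d}" "y \<in> {c..d}" "x \<le> y"
    then show "(k has_integral F y - F x) {x..y}"
      using P eq by (intro has_integral_spike[OF N', of "{x..y}" k g]) (auto simp: prim_on_def)
  qed
qed

text \<open>Some integrand exists by \<open>AC_prim_on\<close>, and differentiating shows that it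
  agrees with g almost everywhere. In this way the pointwise product and chain rules become rules
  for \<open>prim_on\<close>.\<close>

lemma AC_deriv_prim_on:
  assumes F: "abs_continuous_on {c..d} F"
    and ae: "AE x in lebesgue. x \<in> {c<..<d} \<longrightarrow> (F has_vector_derivative g x) (at x)"
  shows "prim_on c d g F"
proof -
  obtain k where k: "prim_on c d k F" using AC_prim_on[OF F] by blast
  show ?thesis
  proof (rule prim_on_spike[OF k])
    show "AE x in lebesgue. x \<in> {c<..<d} \<longrightarrow> g x = k x"
      using ae prim_on_deriv[OF k] by eventually_elim (auto intro: vector_derivative_unique_at)
  qed
qed

lemma prim_on_bounded:
  fixes F :: "real \<Rightarrow> 'a::euclidean_space"
  assumes "prim_on c d g F"
  obtains B where "B > 0" "\<And>x. x \<in> {c..d} \<Longrightarrow> norm (F x) \<le> B"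
proof -
  have "bounded (F ` {c..d})"
    by (intro compact_imp_bounded compact_continuous_image prim_on_continuous[OF assms]) auto
  then obtain B where "B > 0" "\<forall>y\<in>F ` {c..d}. norm y \<le> B" unfolding bounded_pos by blast
  then show ?thesis by (intro that[of B]) auto
qed

lemma AC_mult:
  assumes P: "prim_on c d g F" "prim_on c d k H"
  shows "abs_continuous_on {c..d} (\<lambda>x. F x * H x :: complex)"
  unfolding abs_continuous_on_def
proof (intro allI impI)
  fix \<epsilon> :: real assume e: "\<epsilon> > 0"
  obtain B1 where B1: "B1 > 0" "\<And>x. x \<in> {c..d} \<Longrightarrow> norm (F x) \<le> B1" using prim_on_bounded[OF P(1)] by blast
  obtain B2 where B2: "B2 > 0" "\<And>x. x \<in> {c..d} \<Longrightarrow> norm (H x) \<le> B2" using prim_on_bounded[OF P(2)] by blast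
  define \<eta> where "\<eta> = \<epsilon> / (2 * (B1 + B2))"
  have \<eta>: "\<eta> > 0" using e B1 B2 by (simp add: \<eta>_def)
  obtain \<delta>1 where d1: "\<delta>1 > 0" "\<And>\<D> T. \<D> division_of T \<Longrightarrow> T \<subseteq> {c..d} \<Longrightarrow> (\<Sum>k\<in>\<D>. Sup k - Inf k) < \<delta>1 \<Longrightarrow>
      (\<Sum>k\<in>\<D>. cmod (F (Sup k) - F (Inf k))) < \<eta>"
    using prim_on_AC[OF P(1)] \<eta> unfolding abs_continuous_on_def by meson
  obtain \<delta>2 where d2: "\<delta>2 > 0" "\<And>\<D> T. \<D> division_of T \<Longrightarrow> T \<subseteq> {c..d} \<Longrightarrow> (\<Sum>k\<in>\<D>. Sup k - Inf k) < \<delta>2 \<Longrightarrow>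
      (\<Sum>k\<in>\<D>. cmod (H (Sup k) - H (Inf k))) < \<eta>"
    using prim_on_AC[OF P(2)] \<eta> unfolding abs_continuous_on_def by meson
  show "\<exists>\<delta>>0. \<forall>\<D> T. \<D> division_of T \<and> T \<subseteq> {c..d} \<and> (\<Sum>k\<in>\<D>. Sup k - Inf k) < \<delta> \<longrightarrow>
      (\<Sum>k\<in>\<D>. cmod (F (Sup k) * H (Sup k) - F (Inf k) * H (Inf k))) < \<epsilon>"
  proof (intro exI[of _ "min \<delta>1 \<delta>2"] conjI allI impI)
    fix \<D> T assume HH: "\<D> division_of T \<and> T \<subseteq> {c..d} \<and> (\<Sum>k\<in>\<D>. Sup k - Inf k) < min \<delta>1 \<delta>2"
    then have div: "\<D> division_of T" by simp
    have "(\<Sum>k\<in>\<D>. cmod (F (Sup k) * H (Sup k) - F (Inf k) * H (Inf k)))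
      \<le> (\<Sum>k\<in>\<D>. B2 * cmod (F (Sup k) - F (Inf k)) + B1 * cmod (H (Sup k) - H (Inf k)))"
    proof (rule sum_mono)
      fix k assume kD: "k \<in> \<D>"
      obtain x y where k: "k = cbox x y" "k \<noteq> {}" using division_ofD(3,4)[OF div kD] by blast
      have "k \<subseteq> {c..d}" using division_ofD(2)[OF div kD] HH by blast
      then have io: "Inf k \<in> {c..d}" "Sup k \<in> {c..d}" using k by auto
      have "F (Sup k) * H (Sup k) - F (Inf k) * H (Inf k) =
        (F (Sup k) - F (Inf k)) * H (Sup k) + F (Inf k) * (H (Sup k) - H (Inf k))" by (simp add: algebra_simps)
      also have "cmod \<dots> \<le> cmod (F (Sup k) - F (Inf k)) * cmod (H (Sup k)) + cmod (F (Inf k)) * cmod (H (Sup k) - H (Inf k))"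
        by (rule order_trans[OF norm_triangle_ineq]) (simp add: norm_mult)
      also have "\<dots> \<le> cmod (F (Sup k) - F (Inf k)) * B2 + B1 * cmod (H (Sup k) - H (Inf k))"
        using B1(2)[OF io(1)] B2(2)[OF io(2)] by (intro add_mono mult_left_mono mult_right_mono) auto
      finally show "cmod (F (Sup k) * H (Sup k) - F (Inf k) * H (Inf k)) \<le> B2 * cmod (F (Sup k) - F (Inf k)) + B1 * cmod (H (Sup k) - H (Inf k))"
        by (simp add: mult.commute)
    qed
    also have "\<dots> = B2 * (\<Sum>k\<in>\<D>. cmod (F (Sup k) - F (Inf k))) + B1 * (\<Sum>k\<in>\<D>. cmod (H (Sup k) - H (Inf k)))"
      by (simp add: sum.distrib sum_distrib_left)
    also have "\<dots> \<le> B2 * \<eta> + B1 * \<eta>"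
    proof (intro add_mono mult_left_mono)
      show "(\<Sum>k\<in>\<D>. cmod (F (Sup k) - F (Inf k))) \<le> \<eta>" using HH by (intro less_imp_le[OF d1(2)[OF div]]) auto
      show "(\<Sum>k\<in>\<D>. cmod (H (Sup k) - H (Inf k))) \<le> \<eta>" using HH by (intro less_imp_le[OF d2(2)[OF div]]) auto
    qed (use B1 B2 in auto)
    also have "\<dots> = (B1 + B2) * \<eta>" by (simp add: algebra_simps)
    also have "\<dots> = \<epsilon>/2"
    proof -
      have "B1 + B2 \<noteq> 0" using B1(1) B2(1) by simp
      then have "(B1 + B2) * (\<epsilon> / (2 * (B1 + B2))) = \<epsilon>/2" by (metis nonzero_mult_divide_mult_cancel_left times_divide_eq_right mult.commute)
      then show ?thesis by (simp add: \<eta>_def)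
    qed
    also have "\<dots> < \<epsilon>" using e by simp
    finally show "(\<Sum>k\<in>\<D>. cmod (F (Sup k) * H (Sup k) - F (Inf k) * H (Inf k))) < \<epsilon>" .
  qed (use d1 d2 in auto)
qed

text \<open>Integration by parts for integrands that are merely integrable; the Lagrange and energy
  identities below are instances of it.\<close>

theorem prim_on_mult:
  fixes g F k H :: "real \<Rightarrow> complex"
  assumes P: "prim_on c d g F" "prim_on c d k H"
  shows "prim_on c d (\<lambda>x. F x * k x + g x * H x) (\<lambda>x. F x * H x)"
proof (rule AC_deriv_prim_on[OF AC_mult[OF P]])
  show "AE x in lebesgue. x \<in> {c<..<d} \<longrightarrow> ((\<lambda>x. F x * H x) has_vector_derivative F x * k x + g x * H x) (at x)"
    using prim_on_deriv[OF P(1)] prim_on_deriv[OF P(2)]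
    by eventually_elim (auto intro: has_vector_derivative_mult)
qed

text \<open>The exponential is Lipschitz on a disc containing the range of F, so absolute continuity
  survives the composition. It supplies the integrating factors and the weights used for linear
  systems.\<close>

lemma prim_on_exp:
  fixes g F :: "real \<Rightarrow> complex"
  assumes P: "prim_on c d g F"
  shows "prim_on c d (\<lambda>x. g x * exp (F x)) (\<lambda>x. exp (F x))"
proof (rule AC_deriv_prim_on)
  obtain B where B: "B > 0" "\<And>x. x \<in> {c..d} \<Longrightarrow> norm (F x) \<le> B" using prim_on_bounded[OF P] by blast
  have lip: "cmod (exp u - exp v) \<le> exp B * cmod (u - v)" if "cmod u \<le> B" "cmod v \<le> B" for u v
  proof (rule field_differentiable_bound[of "cball 0 B" exp exp])
    show "norm (exp z) \<le> exp B" if "z \<in> cball 0 B" for z :: complex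
      using norm_exp[of z] that by (auto intro: order_trans)
  qed (use that in \<open>auto intro: DERIV_exp has_field_derivative_at_within\<close>)
  show "abs_continuous_on {c..d} (\<lambda>x. exp (F x))"
    unfolding abs_continuous_on_def
  proof (intro allI impI)
    fix \<epsilon> :: real assume e: "\<epsilon> > 0"
    then have "\<epsilon> / exp B > 0" by simp
    then obtain \<delta> where d: "\<delta> > 0" "\<And>\<D> T. \<D> division_of T \<Longrightarrow> T \<subseteq> {c..d} \<Longrightarrow> (\<Sum>k\<in>\<D>. Sup k - Inf k) < \<delta> \<Longrightarrow>
        (\<Sum>k\<in>\<D>. cmod (F (Sup k) - F (Inf k))) < \<epsilon> / exp B"
      using prim_on_AC[OF P] unfolding abs_continuous_on_def by meson
    show "\<exists>\<delta>>0. \<forall>\<D> T. \<D> division_of T \<and> T \<subseteq> {c..d} \<and> (\<Sum>k\<in>\<D>. Sup k - Inf k) < \<delta> \<longrightarrow>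
        (\<Sum>k\<in>\<D>. cmod (exp (F (Sup k)) - exp (F (Inf k)))) < \<epsilon>"
    proof (intro exI[of _ \<delta>] conjI allI impI d(1))
      fix \<D> T assume HH: "\<D> division_of T \<and> T \<subseteq> {c..d} \<and> (\<Sum>k\<in>\<D>. Sup k - Inf k) < \<delta>"
      then have div: "\<D> division_of T" by simp
      have "(\<Sum>k\<in>\<D>. cmod (exp (F (Sup k)) - exp (F (Inf k)))) \<le> (\<Sum>k\<in>\<D>. exp B * cmod (F (Sup k) - F (Inf k)))"
      proof (rule sum_mono)
        fix k assume kD: "k \<in> \<D>"
        obtain x y where k: "k = cbox x y" "k \<noteq> {}" using division_ofD(3,4)[OF div kD] by blast
        have "k \<subseteq> {c..d}" using division_ofD(2)[OF div kD] HH by blast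
        then have io: "Inf k \<in> {c..d}" "Sup k \<in> {c..d}" using k by auto
        show "cmod (exp (F (Sup k)) - exp (F (Inf k))) \<le> exp B * cmod (F (Sup k) - F (Inf k))"
          by (rule lip) (use B io in auto)
      qed
      also have "\<dots> = exp B * (\<Sum>k\<in>\<D>. cmod (F (Sup k) - F (Inf k)))" by (simp add: sum_distrib_left)
      also have "\<dots> < exp B * (\<epsilon> / exp B)" using HH by (intro mult_strict_left_mono d(2)[OF div]) auto
      finally show "(\<Sum>k\<in>\<D>. cmod (exp (F (Sup k)) - exp (F (Inf k)))) < \<epsilon>" by simp
    qed
  qed
  show "AE x in lebesgue. x \<in> {c<..<d} \<longrightarrow> ((\<lambda>x. exp (F x)) has_vector_derivative g x * exp (F x)) (at x)"
    using prim_on_deriv[OF P]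
  proof (eventually_elim, intro impI)
    fix x assume "x \<in> {c<..<d} \<longrightarrow> (F has_vector_derivative g x) (at x)" "x \<in> {c<..<d}"
    then have "(exp \<circ> F has_vector_derivative g x * exp (F x)) (at x)"
      by (intro field_vector_diff_chain_at DERIV_exp) auto
    then show "((\<lambda>x. exp (F x)) has_vector_derivative g x * exp (F x)) (at x)" by (simp add: o_def)
  qed
qed

lemma prim_on_absint: "prim_on c d g F \<Longrightarrow> g absolutely_integrable_on {c..d}"
  by (simp add: prim_on_def)

lemma prim_on_integral:
  "prim_on c d g F \<Longrightarrow> c \<le> x \<Longrightarrow> x \<le> y \<Longrightarrow> y \<le> d \<Longrightarrow> (g has_integral (F y - F x)) {x..y}"
  unfolding prim_on_def by (meson atLeastAtMost_iff order_trans)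

subsection \<open>Linear differential systems with integrable coefficients\<close>

lemma absint_mult:
  fixes k y :: "real \<Rightarrow> complex"
  assumes "k absolutely_integrable_on {c..d}" "continuous_on {c..d} y"
  shows "(\<lambda>x. k x * y x) absolutely_integrable_on {c..d}"
proof -
  have "(\<lambda>x. y x * k x) absolutely_integrable_on {c..d}"
  proof (rule absolutely_integrable_bounded_measurable_product[of "(*)", OF _ _ _ _ assms(1)])
    show "bilinear ((*) :: complex \<Rightarrow> complex \<Rightarrow> complex)"
      using bilinear_conv_bounded_bilinear bounded_bilinear_mult by blast
    show "y \<in> borel_measurable (lebesgue_on {c..d})"
      by (rule continuous_imp_measurable_on_sets_lebesgue[OF assms(2)]) simp
    show "bounded (y ` {c..d})"
      by (intro compact_imp_bounded compact_continuous_image assms) auto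
  qed simp
  then show ?thesis by (simp add: mult.commute)
qed

lemma absint_mult_real:
  fixes k y :: "real \<Rightarrow> real"
  assumes "k absolutely_integrable_on {c..d}" "continuous_on {c..d} y"
  shows "(\<lambda>x. k x * y x) absolutely_integrable_on {c..d}"
proof -
  have "(\<lambda>x. y x * k x) absolutely_integrable_on {c..d}"
  proof (rule absolutely_integrable_bounded_measurable_product_real[OF _ _ _ assms(1)])
    show "y \<in> borel_measurable (lebesgue_on {c..d})"
      by (rule continuous_imp_measurable_on_sets_lebesgue[OF assms(2)]) simp
    show "bounded (y ` {c..d})"
      by (intro compact_imp_bounded compact_continuous_image assms) auto
  qed simp
  then show ?thesis by (simp add: mult.commute)
qed

lemma absint_cnorm:
  "(k :: real \<Rightarrow> complex) absolutely_integrable_on S \<Longrightarrow> (\<lambda>x. cmod (k x)) absolutely_integrable_on S"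
  using absolutely_integrable_norm[where f=k] by (simp add: o_def)

lemma absint_subinterval:
  fixes k :: "real \<Rightarrow> 'a::euclidean_space"
  assumes "k absolutely_integrable_on {c..d}" "c \<le> x" "y \<le> d"
  shows "k absolutely_integrable_on {x..y}"
  using assms(1) by (rule set_integrable_subset) (use assms(2,3) in auto)

lemma prim_on_real_mult:
  fixes g F k H :: "real \<Rightarrow> real"
  assumes "prim_on c d g F" "prim_on c d k H"
  shows "prim_on c d (\<lambda>x. F x * k x + g x * H x) (\<lambda>x. F x * H x)"
proof -
  note L = bounded_linear_of_real[where 'a=complex]
  from prim_on_linear[OF prim_on_mult[OF prim_on_linear[OF assms(1) L] prim_on_linear[OF assms(2) L]] bounded_linear_Re]
  show ?thesis by simp
qed

lemma prim_on_real_exp: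
  fixes g F :: "real \<Rightarrow> real"
  assumes "prim_on c d g F"
  shows "prim_on c d (\<lambda>x. g x * exp (F x)) (\<lambda>x. exp (F x))"
proof -
  note L = bounded_linear_of_real[where 'a=complex]
  from prim_on_linear[OF prim_on_exp[OF prim_on_linear[OF assms L]] bounded_linear_Re]
  show ?thesis by (simp add: exp_of_real)
qed

text \<open>Let z be the right-hand side of the hypothesis and K the primitive of k. Then z *
  exp(-K) has the integrand k (y - z) exp(-K), which is nonpositive, so it never exceeds its initial
  value C.\<close>

lemma gronwall:
  fixes k y :: "real \<Rightarrow> real"
  assumes k: "k absolutely_integrable_on {c..d}" "\<And>x. k x \<ge> 0" and y: "continuous_on {c..d} y"
    and le: "\<And>x. x \<in> {c..d} \<Longrightarrow> y x \<le> C + integral {c..x} (\<lambda>t. k t * y t)" and x: "x \<in> {c..d}"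
  shows "y x \<le> C * exp (integral {c..x} k)"
proof -
  define z where "z = (\<lambda>x. C + integral {c..x} (\<lambda>t. k t * y t))"
  define K where "K = (\<lambda>x. 0 + integral {c..x} k)"
  have Pz: "prim_on c d (\<lambda>t. k t * y t) z"
    unfolding z_def by (rule prim_on_indefinite[OF absint_mult_real[OF k(1) y]])
  have PK: "prim_on c d k K" unfolding K_def by (rule prim_on_indefinite[OF k(1)])
  have PE: "prim_on c d (\<lambda>x. - k x * exp (- K x)) (\<lambda>x. exp (- K x))"
    using prim_on_real_exp[OF prim_on_linear[OF PK, of uminus]] by (simp add: bounded_linear_minus[OF bounded_linear_ident])
  from prim_on_real_mult[OF Pz PE]
  have P: "prim_on c d (\<lambda>x. z x * (- k x * exp (- K x)) + k x * y x * exp (- K x)) (\<lambda>x. z x * exp (- K x))" .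
  have "((\<lambda>x. z x * (- k x * exp (- K x)) + k x * y x * exp (- K x)) has_integral
      (z x * exp (- K x) - z c * exp (- K c))) {c..x}"
    using prim_on_integral[OF P] x by auto
  moreover have "z t * (- k t * exp (- K t)) + k t * y t * exp (- K t) \<le> 0" if "t \<in> {c..x}" for t
  proof -
    have "y t \<le> z t" using le[of t] that x by (auto simp: z_def)
    then have "k t * exp (- K t) * (y t - z t) \<le> 0" using k(2)[of t] by (simp add: mult_nonneg_nonpos)
    then show ?thesis by (simp add: algebra_simps)
  qed
  ultimately have "z x * exp (- K x) - z c * exp (- K c) \<le> 0"
    by (rule has_integral_le[OF _ has_integral_0])
  moreover have "z c * exp (- K c) = C" by (simp add: z_def K_def)
  ultimately have "z x * exp (- K x) \<le> C" by simp
  then have "z x \<le> C * exp (K x)" by (simp add: exp_minus field_simps)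
  then show ?thesis using le[OF x] by (simp add: z_def K_def)
qed

lemma absint_intro:
  fixes k :: "'n::euclidean_space \<Rightarrow> 'm::euclidean_space"
  shows "k absolutely_integrable_on S \<Longrightarrow> k integrable_on S"
  by (rule set_lebesgue_integral_eq_integral(1))

lemma norm_integral_le:
  fixes k :: "real \<Rightarrow> complex"
  assumes "k absolutely_integrable_on {c..d}"
  shows "cmod (integral {c..d} k) \<le> integral {c..d} (\<lambda>x. cmod (k x))"
  using assms absint_cnorm[OF assms]
  by (intro integral_norm_bound_integral) (auto simp: absolutely_integrable_on_def)

lemma prim_on_bound:
  fixes g F :: "real \<Rightarrow> complex"
  assumes P: "prim_on c d g F" and x: "x \<in> {c..d}"
  shows "cmod (F x) \<le> cmod (F c) + integral {c..x} (\<lambda>t. cmod (g t))"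
proof -
  have i: "(g has_integral F x - F c) {c..x}" using prim_on_integral[OF P] x by auto
  have a: "g absolutely_integrable_on {c..x}"
    using x by (intro absint_subinterval[OF prim_on_absint[OF P]]) auto
  have "cmod (F x - F c) \<le> integral {c..x} (\<lambda>t. cmod (g t))"
    using norm_integral_le[OF a] i by (simp add: integral_unique)
  then show ?thesis using norm_triangle_ineq2[of "F x" "F c"] by linarith
qed

lemma integral_mono_interval:
  fixes k :: "real \<Rightarrow> real"
  assumes "k absolutely_integrable_on {c..d}" "\<And>x. k x \<ge> 0" "c \<le> x" "x \<le> y" "y \<le> d"
  shows "integral {c..x} k \<le> integral {c..y} k"
  by (intro integral_subset_le absint_intro absint_subinterval[OF assms(1)]) (use assms(2-5) in auto)

text \<open>Both equations are treated at once: |f| + |u| satisfies Gronwall's inequality with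
  kernel |R| + |P|, while the forcing enters only the constant.\<close>

lemma lin_bound:
  fixes R P B f u :: "real \<Rightarrow> complex"
  assumes R: "R absolutely_integrable_on {c..d}" and P: "P absolutely_integrable_on {c..d}"
    and B: "B absolutely_integrable_on {c..d}"
    and f: "prim_on c d (\<lambda>x. R x * u x) f" and u: "prim_on c d (\<lambda>x. P x * f x - B x) u"
    and x: "x \<in> {c..d}"
  shows "cmod (f x) + cmod (u x) \<le> (cmod (f c) + cmod (u c) + integral {c..d} (\<lambda>x. cmod (B x)))
      * exp (integral {c..d} (\<lambda>x. cmod (R x) + cmod (P x)))"
proof -
  define k where "k = (\<lambda>x. cmod (R x) + cmod (P x))"
  define y where "y = (\<lambda>x. cmod (f x) + cmod (u x))"
  define C where "C = cmod (f c) + cmod (u c) + integral {c..d} (\<lambda>x. cmod (B x))"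
  have cf: "continuous_on {c..d} f" "continuous_on {c..d} u" by (rule prim_on_continuous[OF f], rule prim_on_continuous[OF u])
  have k: "k absolutely_integrable_on {c..d}" "\<And>x. k x \<ge> 0"
    unfolding k_def by (intro set_integral_add absint_cnorm R P) auto
  have y: "continuous_on {c..d} y" unfolding y_def by (intro continuous_intros cf)
  have ky: "(\<lambda>t. k t * y t) absolutely_integrable_on {c..d}" by (rule absint_mult_real[OF k(1) y])
  have le: "y x \<le> C + integral {c..x} (\<lambda>t. k t * y t)" if x: "x \<in> {c..d}" for x
  proof -
    have Ru: "(\<lambda>t. cmod (R t * u t)) absolutely_integrable_on {c..x}"
      using x by (intro absint_subinterval[OF absint_cnorm[OF prim_on_absint[OF f]]]) auto
    have Pf: "(\<lambda>t. cmod (P t * f t)) absolutely_integrable_on {c..x}"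
      using x by (intro absint_subinterval[OF absint_cnorm[OF absint_mult[OF P cf(1)]]]) auto
    have Bx: "(\<lambda>t. cmod (B t)) absolutely_integrable_on {c..x}"
      using x by (intro absint_subinterval[OF absint_cnorm[OF B]]) auto
    have PB: "(\<lambda>t. cmod (P t * f t - B t)) absolutely_integrable_on {c..x}"
      using x by (intro absint_subinterval[OF absint_cnorm[OF prim_on_absint[OF u]]]) auto
    have kx: "(\<lambda>t. k t * y t) absolutely_integrable_on {c..x}"
      using x by (intro absint_subinterval[OF ky]) auto
    have "y x \<le> cmod (f c) + cmod (u c) + (integral {c..x} (\<lambda>t. cmod (R t * u t)) + integral {c..x} (\<lambda>t. cmod (P t * f t - B t)))"
      using prim_on_bound[OF f x] prim_on_bound[OF u x] by (simp add: y_def)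
    also have "integral {c..x} (\<lambda>t. cmod (R t * u t)) + integral {c..x} (\<lambda>t. cmod (P t * f t - B t))
      = integral {c..x} (\<lambda>t. cmod (R t * u t) + cmod (P t * f t - B t))"
      using Ru PB by (simp add: Henstock_Kurzweil_Integration.integral_add absint_intro)
    also have "\<dots> \<le> integral {c..x} (\<lambda>t. k t * y t + cmod (B t))"
    proof (rule integral_le)
      fix t
      have "cmod (P t * f t - B t) \<le> cmod (P t) * cmod (f t) + cmod (B t)"
        using norm_triangle_ineq4[of "P t * f t" "B t"] by (simp add: norm_mult)
      moreover have "cmod (R t) * cmod (u t) + cmod (P t) * cmod (f t) \<le> k t * y t"
        by (simp add: k_def y_def algebra_simps)
      ultimately show "cmod (R t * u t) + cmod (P t * f t - B t) \<le> k t * y t + cmod (B t)" by (simp add: norm_mult)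
    qed (use Ru PB kx Bx in \<open>auto intro!: absint_intro set_integral_add\<close>)
    also have "\<dots> = integral {c..x} (\<lambda>t. k t * y t) + integral {c..x} (\<lambda>t. cmod (B t))"
      using kx Bx by (simp add: Henstock_Kurzweil_Integration.integral_add absint_intro)
    also have "integral {c..x} (\<lambda>t. cmod (B t)) \<le> integral {c..d} (\<lambda>t. cmod (B t))"
      using x by (intro integral_mono_interval[OF absint_cnorm[OF B]]) auto
    finally show ?thesis by (simp add: C_def)
  qed
  have C0: "C \<ge> 0" unfolding C_def using absint_cnorm[OF B]
    by (intro add_nonneg_nonneg Henstock_Kurzweil_Integration.integral_nonneg) (auto intro: absint_intro)
  have "y x \<le> C * exp (integral {c..x} k)" by (rule gronwall[OF k y le x])
  also have "\<dots> \<le> C * exp (integral {c..d} k)"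
    using C0 x by (intro mult_left_mono) (auto intro!: integral_mono_interval[OF k])
  finally show ?thesis by (simp add: y_def C_def k_def)
qed

text \<open>Picard iteration. Measured against a suitable exponential weight the iteration contracts
  by 1/2 on the whole interval, so no subdivision into short intervals is necessary.\<close>

lemma lin_exists:
  fixes R P B :: "real \<Rightarrow> complex"
  assumes R: "R absolutely_integrable_on {c..d}" and P: "P absolutely_integrable_on {c..d}"
    and B: "B absolutely_integrable_on {c..d}" and cd: "c \<le> d"
  obtains f u where "prim_on c d (\<lambda>x. R x * u x) f" "prim_on c d (\<lambda>x. P x * f x - B x) u" "f c = \<alpha>" "u c = \<beta>"
proof -
  define k where "k = (\<lambda>x. cmod (R x) + cmod (P x))"
  have k: "k absolutely_integrable_on {c..d}" "\<And>x. k x \<ge> 0"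
    unfolding k_def by (intro set_integral_add absint_cnorm R P) auto
  define K where "K = (\<lambda>x. 0 + integral {c..x} k)"
  have PK: "prim_on c d k K" unfolding K_def by (rule prim_on_indefinite[OF k(1)])
  \<comment> \<open>The factor 2 in the exponent is the contraction: k * E integrates to (E x - E c)
    / 2, so a bound by a multiple of E returns with half the constant.\<close>
  define E where "E = (\<lambda>x. exp (2 * K x))"
  have PE: "prim_on c d (\<lambda>x. 2 * k x * E x) E"
    unfolding E_def using prim_on_real_exp[OF prim_on_linear[OF PK bounded_linear_mult_right[of 2]]] .
  define T where "T = (\<lambda>(f,u). ((\<lambda>x. \<alpha> + integral {c..x} (\<lambda>x. R x * u x)), (\<lambda>x. \<beta> + integral {c..x} (\<lambda>x. P x * f x - B x))))"
  define Y where "Y = (\<lambda>n. (T ^^ n) ((\<lambda>x. \<alpha>), (\<lambda>x. \<beta>)))"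
  define F U where "F = (\<lambda>n. fst (Y n))" and "U = (\<lambda>n. snd (Y n))"
  have FS: "F (Suc n) = (\<lambda>x. \<alpha> + integral {c..x} (\<lambda>x. R x * U n x))"
    and US: "U (Suc n) = (\<lambda>x. \<beta> + integral {c..x} (\<lambda>x. P x * F n x - B x))" for n
    by (simp_all add: F_def U_def Y_def T_def case_prod_unfold)
  have F0: "F 0 = (\<lambda>x. \<alpha>)" "U 0 = (\<lambda>x. \<beta>)" by (simp_all add: F_def U_def Y_def)
  have Ru: "(\<lambda>x. R x * u x) absolutely_integrable_on {c..d}" if "continuous_on {c..d} u" for u
    by (rule absint_mult[OF R that])
  have Pf: "(\<lambda>x. P x * f x - B x) absolutely_integrable_on {c..d}" if "continuous_on {c..d} f" for f
    by (intro set_integral_diff absint_mult[OF P that] B)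
  have cont: "continuous_on {c..d} (F n) \<and> continuous_on {c..d} (U n)" for n
  proof (induction n)
    case (Suc n)
    then show ?case unfolding FS US
      using prim_on_continuous[OF prim_on_indefinite[OF Ru]] prim_on_continuous[OF prim_on_indefinite[OF Pf]] by blast
  qed (simp add: F0)
  have PF: "prim_on c d (\<lambda>x. R x * U n x) (F (Suc n))" for n
    unfolding FS by (rule prim_on_indefinite[OF Ru]) (use cont in blast)
  have PU: "prim_on c d (\<lambda>x. P x * F n x - B x) (U (Suc n))" for n
    unfolding US by (rule prim_on_indefinite[OF Pf]) (use cont in blast)
  have start: "F n c = \<alpha>" "U n c = \<beta>" for n by (cases n; simp add: F0 FS US)+
  define D where "D = (\<lambda>n x. cmod (F (Suc n) x - F n x) + cmod (U (Suc n) x - U n x))"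
  have Dc: "continuous_on {c..d} (D n)" for n unfolding D_def using cont by (intro continuous_intros) auto
  have "bounded (D 0 ` {c..d})" by (intro compact_imp_bounded compact_continuous_image Dc) auto
  then obtain C where C: "C > 0" "\<forall>y\<in>D 0 ` {c..d}. norm y \<le> C" unfolding bounded_pos by blast
  have K0: "K x \<ge> 0" if "x \<in> {c..d}" for x
    unfolding K_def using k that
    by (auto intro!: Henstock_Kurzweil_Integration.integral_nonneg absint_intro[OF absint_subinterval[OF k(1)]])
  have Dle: "D n x \<le> C * (1/2)^n * E x" if "x \<in> {c..d}" for n x
    using that
  proof (induction n arbitrary: x)
    case 0
    have "norm (D 0 x) \<le> C" using C(2) 0 by blast
    then have "D 0 x \<le> C" by simp
    also have "\<dots> \<le> C * E x" using K0[OF 0] C(1) by (simp add: E_def)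
    finally show ?case by simp
  next
    case (Suc n)
    have 1: "prim_on c d (\<lambda>x. R x * (U (Suc n) x - U n x)) (\<lambda>x. F (Suc (Suc n)) x - F (Suc n) x)"
      using prim_on_diff[OF PF[of "Suc n"] PF[of n]] by (simp add: algebra_simps)
    have 2: "prim_on c d (\<lambda>x. P x * (F (Suc n) x - F n x)) (\<lambda>x. U (Suc (Suc n)) x - U (Suc n) x)"
      using prim_on_diff[OF PU[of "Suc n"] PU[of n]] by (simp add: algebra_simps)
    have i1: "(\<lambda>t. cmod (R t * (U (Suc n) t - U n t))) integrable_on {c..x}"
      using Suc.prems by (intro absint_intro absint_subinterval[OF absint_cnorm[OF prim_on_absint[OF 1]]]) auto
    have i2: "(\<lambda>t. cmod (P t * (F (Suc n) t - F n t))) integrable_on {c..x}"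
      using Suc.prems by (intro absint_intro absint_subinterval[OF absint_cnorm[OF prim_on_absint[OF 2]]]) auto
    have hE: "((\<lambda>x. 2 * k x * E x) has_integral E x - E c) {c..x}" using prim_on_integral[OF PE] Suc.prems by auto
    from has_integral_mult_right[OF hE, of "C * (1/2)^n * (1/2)"]
    have hE': "((\<lambda>x. k x * (C * (1/2)^n * E x)) has_integral C * (1/2)^n * (1/2) * (E x - E c)) {c..x}"
      by (simp add: algebra_simps)
    have "D (Suc n) x \<le> integral {c..x} (\<lambda>t. cmod (R t * (U (Suc n) t - U n t))) + integral {c..x} (\<lambda>t. cmod (P t * (F (Suc n) t - F n t)))"
      using prim_on_bound[OF 1 Suc.prems] prim_on_bound[OF 2 Suc.prems] by (simp add: D_def start)
    also have "\<dots> = integral {c..x} (\<lambda>t. cmod (R t * (U (Suc n) t - U n t)) + cmod (P t * (F (Suc n) t - F n t)))"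
      using i1 i2 by (simp add: Henstock_Kurzweil_Integration.integral_add)
    also have "\<dots> \<le> C * (1/2)^n * (1/2) * (E x - E c)"
    proof (rule has_integral_le[OF integrable_integral hE'])
      show "(\<lambda>t. cmod (R t * (U (Suc n) t - U n t)) + cmod (P t * (F (Suc n) t - F n t))) integrable_on {c..x}"
        using i1 i2 by (rule integrable_add)
      fix t assume t: "t \<in> {c..x}"
      have "cmod (R t * (U (Suc n) t - U n t)) + cmod (P t * (F (Suc n) t - F n t)) \<le> k t * D n t"
        unfolding k_def D_def norm_mult by (simp add: distrib_left distrib_right)
      also have "\<dots> \<le> k t * (C * (1/2)^n * E t)" using Suc.IH[of t] t Suc.prems k(2) by (intro mult_left_mono) auto
      finally show "cmod (R t * (U (Suc n) t - U n t)) + cmod (P t * (F (Suc n) t - F n t)) \<le> k t * (C * (1/2)^n * E t)" .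
    qed
    also have "\<dots> \<le> C * (1/2)^n * (1/2) * E x" using C(1) by (intro mult_left_mono) (auto simp: E_def)
    finally show ?case by simp
  qed
  define M where "M = C * E d"
  have DM: "D n x \<le> M * (1/2)^n" if x: "x \<in> {c..d}" for n x
  proof -
    have "E x \<le> E d" unfolding E_def K_def using x by (auto intro!: integral_mono_interval[OF k])
    then have "C * (1/2)^n * E x \<le> C * (1/2)^n * E d" using C(1) by (intro mult_left_mono) auto
    then show ?thesis using Dle[OF x, of n] by (simp add: M_def mult_ac)
  qed
  have sumM: "summable (\<lambda>n. M * (1/2)^n)" by (intro summable_mult summable_geometric) simp
  have UL: "\<exists>l. uniform_limit {c..d} Z l sequentially"
    if Z: "\<And>n x. x \<in> {c..d} \<Longrightarrow> cmod (Z (Suc n) x - Z n x) \<le> D n x" for Z :: "nat \<Rightarrow> real \<Rightarrow> complex"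
  proof -
    have "uniform_limit {c..d} (\<lambda>n x. \<Sum>i<n. Z (Suc i) x - Z i x) (\<lambda>x. suminf (\<lambda>i. Z (Suc i) x - Z i x)) sequentially"
      by (rule Weierstrass_m_test[OF _ sumM]) (meson Z DM order_trans)
    then have "uniform_limit {c..d} (\<lambda>n x. Z 0 x + (\<Sum>i<n. Z (Suc i) x - Z i x)) (\<lambda>x. Z 0 x + suminf (\<lambda>i. Z (Suc i) x - Z i x)) sequentially"
      by (intro uniform_limit_add uniform_limit_const)
    moreover have "(\<lambda>n x. Z 0 x + (\<Sum>i<n. Z (Suc i) x - Z i x)) = Z"
    proof (intro ext)
      show "Z 0 x + (\<Sum>i<n. Z (Suc i) x - Z i x) = Z n x" for n x
        using sum_lessThan_telescope[of "\<lambda>i. Z i x" n] by simp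
    qed
    ultimately show ?thesis by auto
  qed
  obtain f where f: "uniform_limit {c..d} F f sequentially" using UL[of F] by (auto simp: D_def)
  obtain u where u: "uniform_limit {c..d} U u sequentially" using UL[of U] by (auto simp: D_def)
  have cf: "continuous_on {c..d} f" by (rule uniform_limit_theorem[OF _ f]) (use cont in auto)
  have cu: "continuous_on {c..d} u" by (rule uniform_limit_theorem[OF _ u]) (use cont in auto)
  \<comment> \<open>The coefficient is only integrable, but the iterates converge uniformly: the
    integrals differ by at most its L1 norm times the uniform distance.\<close>
  have lim: "(\<lambda>n. integral {c..x} (\<lambda>t. m t * Z n t)) \<longlonglongrightarrow> integral {c..x} (\<lambda>t. m t * z t)"
    if m: "m absolutely_integrable_on {c..d}" and Z: "uniform_limit {c..d} Z z sequentially" "\<And>n. continuous_on {c..d} (Z n)" "continuous_on {c..d} z"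
      and x: "x \<in> {c..d}" for m z x and Z :: "nat \<Rightarrow> real \<Rightarrow> complex"
  proof (rule LIMSEQ_I)
    fix e :: real assume e: "e > 0"
    define I where "I = integral {c..x} (\<lambda>t. cmod (m t))"
    have mi: "(\<lambda>t. cmod (m t)) integrable_on {c..x}" using x by (intro absint_intro absint_subinterval[OF absint_cnorm[OF m]]) auto
    have I: "I \<ge> 0" unfolding I_def by (rule Henstock_Kurzweil_Integration.integral_nonneg[OF mi]) simp
    have "e / (2 * (I + 1)) > 0" using e I by simp
    from uniform_limitD[OF Z(1) this] obtain N where N: "\<And>n t. n \<ge> N \<Longrightarrow> t \<in> {c..d} \<Longrightarrow> dist (Z n t) (z t) < e / (2 * (I + 1))"
      unfolding eventually_sequentially by blast
    show "\<exists>no. \<forall>n\<ge>no. norm (integral {c..x} (\<lambda>t. m t * Z n t) - integral {c..x} (\<lambda>t. m t * z t)) < e"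
    proof (intro exI[of _ N] allI impI)
      fix n assume n: "n \<ge> N"
      have 1: "(\<lambda>t. m t * Z n t) absolutely_integrable_on {c..x}" using x by (intro absint_subinterval[OF absint_mult[OF m Z(2)]]) auto
      have 2: "(\<lambda>t. m t * z t) absolutely_integrable_on {c..x}" using x by (intro absint_subinterval[OF absint_mult[OF m Z(3)]]) auto
      have "norm (integral {c..x} (\<lambda>t. m t * Z n t) - integral {c..x} (\<lambda>t. m t * z t)) = norm (integral {c..x} (\<lambda>t. m t * Z n t - m t * z t))"
        using 1 2 by (simp add: Henstock_Kurzweil_Integration.integral_diff absint_intro)
      also have "\<dots> \<le> integral {c..x} (\<lambda>t. e / (2 * (I + 1)) * cmod (m t))"
      proof (rule integral_norm_bound_integral)
        fix t assume t: "t \<in> {c..x}"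
        have "norm (m t * Z n t - m t * z t) = cmod (m t) * dist (Z n t) (z t)"
          by (simp add: dist_norm norm_mult[symmetric] right_diff_distrib)
        also have "\<dots> \<le> cmod (m t) * (e / (2 * (I + 1)))" using N[OF n, of t] t x by (intro mult_left_mono) auto
        finally show "norm (m t * Z n t - m t * z t) \<le> e / (2 * (I + 1)) * cmod (m t)" by (simp add: mult.commute)
      next
        show "(\<lambda>t. m t * Z n t - m t * z t) integrable_on {c..x}"
          by (intro integrable_diff absint_intro 1 2)
        show "(\<lambda>t. e / (2 * (I + 1)) * cmod (m t)) integrable_on {c..x}"
          by (intro integrable_on_mult_right mi)
      qed
      also have "\<dots> = e / (2 * (I + 1)) * I" by (simp add: I_def)
      also have "\<dots> < e"
      proof -
        have "e * I < e * (2 * (I + 1))" using e I by (intro mult_strict_left_mono) auto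
        then show ?thesis using I by (simp add: field_simps)
      qed
      finally show "norm (integral {c..x} (\<lambda>t. m t * Z n t) - integral {c..x} (\<lambda>t. m t * z t)) < e" .
    qed
  qed
  have pt: "(\<lambda>n. F n x) \<longlonglongrightarrow> f x" "(\<lambda>n. U n x) \<longlonglongrightarrow> u x" if "x \<in> {c..d}" for x
    using tendsto_uniform_limitI[OF f that] tendsto_uniform_limitI[OF u that] by auto
  have fe: "f x = \<alpha> + integral {c..x} (\<lambda>x. R x * u x)" if x: "x \<in> {c..d}" for x
  proof (rule LIMSEQ_unique)
    show "(\<lambda>n. F (Suc n) x) \<longlonglongrightarrow> f x" using pt(1)[OF x] by (rule LIMSEQ_Suc)
    show "(\<lambda>n. F (Suc n) x) \<longlonglongrightarrow> \<alpha> + integral {c..x} (\<lambda>x. R x * u x)"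
      unfolding FS using cont by (intro tendsto_add tendsto_const lim[OF R u _ cu x]) auto
  qed
  have ue: "u x = \<beta> + integral {c..x} (\<lambda>x. P x * f x - B x)" if x: "x \<in> {c..d}" for x
  proof (rule LIMSEQ_unique)
    show "(\<lambda>n. U (Suc n) x) \<longlonglongrightarrow> u x" using pt(2)[OF x] by (rule LIMSEQ_Suc)
    have Bi: "B integrable_on {c..x}" using B x by (intro absint_intro absint_subinterval[OF B]) auto
    have eq: "integral {c..x} (\<lambda>x. P x * g x - B x) = integral {c..x} (\<lambda>x. P x * g x) - integral {c..x} B"
      if "continuous_on {c..d} g" for g
      using x by (intro Henstock_Kurzweil_Integration.integral_diff Bi absint_intro absint_subinterval[OF absint_mult[OF P that]]) auto
    have eqF: "integral {c..x} (\<lambda>x. P x * F n x - B x) = integral {c..x} (\<lambda>x. P x * F n x) - integral {c..x} B" for n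
      by (rule eq) (use cont in blast)
    show "(\<lambda>n. U (Suc n) x) \<longlonglongrightarrow> \<beta> + integral {c..x} (\<lambda>x. P x * f x - B x)"
      unfolding US eq[OF cf] eqF using cont by (intro tendsto_add tendsto_diff tendsto_const lim[OF P f _ cf x]) auto
  qed
  have cong: "prim_on c d g G" if "prim_on c d g H" "\<And>x. x \<in> {c..d} \<Longrightarrow> G x = H x" for g G and H :: "real \<Rightarrow> complex"
    using that by (simp add: prim_on_def)
  show ?thesis
  proof (rule that)
    show "prim_on c d (\<lambda>x. R x * u x) f" by (rule cong[OF prim_on_indefinite[OF Ru[OF cu]] fe])
    show "prim_on c d (\<lambda>x. P x * f x - B x) u" by (rule cong[OF prim_on_indefinite[OF Pf[OF cf]] ue])
    show "f c = \<alpha>" "u c = \<beta>" using fe[of c] ue[of c] cd by auto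
  qed
qed

text \<open>At t = X / A the hypothesis becomes X^2 \<le> A N. This reduces the Cauchy-Schwarz
  inequality to the nonnegativity of one integrated square.\<close>

lemma sq_le_if_AMGM:
  fixes X A N :: real
  assumes "A \<ge> 0" "N \<ge> 0" and H: "\<And>t. t > 0 \<Longrightarrow> 2 * X \<le> t * A + N / t"
  shows "X \<le> sqrt (A * N)"
proof (cases "X > 0")
  case X: True
  have A: "A > 0"
  proof (rule ccontr)
    assume "\<not> A > 0"
    then have A0: "A = 0" using assms(1) by simp
    \<comment> \<open>For A = 0 a large t refutes X > 0: at this t the hypothesis reads 2 X \<le> N
      / t, while N / t \<le> X.\<close>
    have t: "(N + 1) / X > 0" using X assms(2) by (simp add: add_nonneg_pos)
    have "N / ((N + 1) / X) \<le> X" using X assms(2) by (simp add: field_simps)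
    then show False using H[OF t] A0 X by simp
  qed
  have t: "X / A > 0" using X A by simp
  have "2 * X \<le> X + N * A / X" using H[OF t] X A by (simp add: field_simps)
  then have "X * X \<le> A * N" using X by (simp add: field_simps)
  then show ?thesis by (simp add: real_le_rsqrt power2_eq_square)
qed (use assms in \<open>auto intro: order_trans[OF _ real_sqrt_ge_zero]\<close>)

lemma integral_CS:
  fixes m f g :: "real \<Rightarrow> real"
  assumes i: "(\<lambda>x. m x * (f x)\<^sup>2) integrable_on S" "(\<lambda>x. m x * (g x)\<^sup>2) integrable_on S"
    "(\<lambda>x. m x * (f x * g x)) integrable_on S" and m: "\<And>x. m x \<ge> 0"
  shows "integral S (\<lambda>x. m x * (f x * g x)) \<le> sqrt (integral S (\<lambda>x. m x * (f x)\<^sup>2) * integral S (\<lambda>x. m x * (g x)\<^sup>2))"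
proof (rule sq_le_if_AMGM)
  show "0 \<le> integral S (\<lambda>x. m x * (f x)\<^sup>2)" "0 \<le> integral S (\<lambda>x. m x * (g x)\<^sup>2)"
    using i m by (auto intro!: Henstock_Kurzweil_Integration.integral_nonneg)
  fix t :: real assume t: "t > 0"
  have i1: "(\<lambda>x. t * (m x * (f x)\<^sup>2)) integrable_on S" by (intro integrable_on_mult_right i)
  have i2: "(\<lambda>x. (m x * (g x)\<^sup>2) * (1/t)) integrable_on S" by (intro integrable_on_mult_left i)
  have "2 * integral S (\<lambda>x. m x * (f x * g x)) = integral S (\<lambda>x. 2 * (m x * (f x * g x)))" by simp
  also have "\<dots> \<le> integral S (\<lambda>x. t * (m x * (f x)\<^sup>2) + (m x * (g x)\<^sup>2) * (1/t))"
  proof (rule integral_le)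
    fix x
    have "0 \<le> m x * (t * f x - g x)\<^sup>2 * (1/t)" using m[of x] t by simp
    also have "\<dots> = t * (m x * (f x)\<^sup>2) + (m x * (g x)\<^sup>2) * (1/t) - 2 * (m x * (f x * g x))"
      using t by (simp add: field_simps power2_eq_square)
    finally show "2 * (m x * (f x * g x)) \<le> t * (m x * (f x)\<^sup>2) + (m x * (g x)\<^sup>2) * (1/t)" by simp
  next
    show "(\<lambda>x. 2 * (m x * (f x * g x))) integrable_on S" by (intro integrable_on_mult_right i)
  qed (rule integrable_add[OF i1 i2])
  also have "\<dots> = t * integral S (\<lambda>x. m x * (f x)\<^sup>2) + integral S (\<lambda>x. m x * (g x)\<^sup>2) / t"
    unfolding Henstock_Kurzweil_Integration.integral_add[OF i1 i2] by simp
  finally show "2 * integral S (\<lambda>x. m x * (f x * g x)) \<le> t * integral S (\<lambda>x. m x * (f x)\<^sup>2) + integral S (\<lambda>x. m x * (g x)\<^sup>2) / t" .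
qed

lemma prim_on_cong:
  assumes "prim_on c d g F" "\<And>x. x \<in> {c..d} \<Longrightarrow> G x = F x" "\<And>x. x \<in> {c..d} \<Longrightarrow> k x = g x"
  shows "prim_on c d k G"
  unfolding prim_on_def
proof (intro conjI ballI impI)
  show "k absolutely_integrable_on {c..d}"
    using prim_on_absint[OF assms(1)] by (rule set_integrable_cong[THEN iffD1, rotated 3]) (use assms(3) in auto)
  fix x y assume xy: "x \<in> {c..d}" "y \<in> {c..d}" "x \<le> y"
  then have "(g has_integral (F y - F x)) {x..y}" using prim_on_integral[OF assms(1)] by auto
  then show "(k has_integral G y - G x) {x..y}"
    using assms(2)[OF xy(1)] assms(2)[OF xy(2)] assms(3) xy by (subst has_integral_cong[of _ k g]) auto
qed

subsection \<open>The monodromy matrix\<close>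

locale SL =
  fixes a :: real and w p q :: "real \<Rightarrow> real"
  assumes a_pos: "a > 0"
    and w_meas: "w \<in> borel_measurable lebesgue"
    and p_meas: "p \<in> borel_measurable lebesgue"
    and q_meas: "q \<in> borel_measurable lebesgue"
    and w_per: "\<And>x. w (x + a) = w x"
    and p_per: "\<And>x. p (x + a) = p x"
    and q_per: "\<And>x. q (x + a) = q x"
    and w_int: "set_integrable lebesgue {0<..<a} w"
    and q_int: "set_integrable lebesgue {0<..<a} q"
    and p_int: "set_integrable lebesgue {0<..<a} (\<lambda>x. 1 / p x)"
    and w_nz: "AE x in lebesgue. w x \<noteq> 0"
    and p_pos: "AE x in lebesgue. p x > 0"
begin

definition R :: "real \<Rightarrow> complex" where "R x = of_real (1 / p x)"
definition W :: "real \<Rightarrow> complex" where "W x = of_real (w x)"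
definition Q :: "real \<Rightarrow> complex" where "Q x = of_real (q x)"
definition P :: "complex \<Rightarrow> real \<Rightarrow> complex" where "P z x = Q x - z * W x"

lemma closed_interval_int:
  fixes k :: "real \<Rightarrow> real"
  assumes "set_integrable lebesgue {0<..<a} k" shows "k absolutely_integrable_on {0..a}"
proof (rule absolutely_integrable_spike_set[OF assms])
  show "negligible {x \<in> {0<..<a} - {0..a}. k x \<noteq> 0}" by (rule negligible_subset[of "{}"]) auto
  show "negligible {x \<in> {0..a} - {0<..<a}. k x \<noteq> 0}" by (rule negligible_subset[of "{0,a}"]) auto
qed

lemma w_absint: "w absolutely_integrable_on {0..a}"
  and q_absint: "q absolutely_integrable_on {0..a}"
  and r_absint: "(\<lambda>x. 1 / p x) absolutely_integrable_on {0..a}"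
  by (intro closed_interval_int w_int q_int p_int)+

lemma complex_absint:
  fixes k :: "real \<Rightarrow> real"
  shows "k absolutely_integrable_on S \<Longrightarrow> (\<lambda>x. complex_of_real (k x)) absolutely_integrable_on S"
  using absolutely_integrable_linear[OF _ bounded_linear_of_real, where f=k] by (simp add: o_def)

lemma W_absint: "W absolutely_integrable_on {0..a}"
  and Q_absint: "Q absolutely_integrable_on {0..a}"
  and R_absint: "R absolutely_integrable_on {0..a}"
  unfolding W_def[abs_def] Q_def[abs_def] R_def[abs_def]
  by (intro complex_absint w_absint q_absint r_absint)+

lemma cW_absint: "(\<lambda>x. z * W x) absolutely_integrable_on {0..a}"
  by (rule set_integrable_mult_right) (use W_absint in auto)

lemma P_absint: "P z absolutely_integrable_on {0..a}"
  unfolding P_def[abs_def] by (intro set_integral_diff Q_absint cW_absint)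

text \<open>On one period, \<open>(\<aa> - z) f = h\<close> is the first-order system \<open>f' = u / p\<close>,
  \<open>u' = (q - z w) f - w h\<close> for \<open>f\<close> and the quasi-derivative \<open>u = p f'\<close>.\<close>

definition psol :: "complex \<Rightarrow> (real \<Rightarrow> complex) \<Rightarrow> (real \<Rightarrow> complex) \<Rightarrow> (real \<Rightarrow> complex) \<Rightarrow> bool" where
  "psol z h f u \<longleftrightarrow> prim_on 0 a (\<lambda>x. R x * u x) f \<and> prim_on 0 a (\<lambda>x. P z x * f x - W x * h x) u"

definition nsq :: "(real \<Rightarrow> complex) \<Rightarrow> real" where
  "nsq h = integral {0..a} (\<lambda>x. \<bar>w x\<bar> * (cmod (h x))\<^sup>2)"

definition l2p :: "(real \<Rightarrow> complex) \<Rightarrow> bool" where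
  "l2p h \<longleftrightarrow> (\<lambda>x. \<bar>w x\<bar> * (cmod (h x))\<^sup>2) absolutely_integrable_on {0..a} \<and>
     (\<lambda>x. W x * h x) absolutely_integrable_on {0..a}"

definition w1 :: real where "w1 = integral {0..a} (\<lambda>x. \<bar>w x\<bar>)"

lemma absw_absint: "(\<lambda>x. \<bar>w x\<bar>) absolutely_integrable_on {0..a}"
  using absolutely_integrable_norm[OF w_absint] by (simp add: o_def)

lemma w1_nonneg: "w1 \<ge> 0"
  unfolding w1_def by (intro Henstock_Kurzweil_Integration.integral_nonneg absint_intro absw_absint) simp

lemma nsq_nonneg: "nsq h \<ge> 0"
proof (cases "(\<lambda>x. \<bar>w x\<bar> * (cmod (h x))\<^sup>2) integrable_on {0..a}")
  case True then show ?thesis unfolding nsq_def by (rule Henstock_Kurzweil_Integration.integral_nonneg) simp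
qed (simp add: nsq_def not_integrable_integral)

lemma l2p_W_norm: "l2p h \<Longrightarrow> integral {0..a} (\<lambda>x. cmod (W x * h x)) \<le> sqrt (w1 * nsq h)"
proof -
  assume h: "l2p h"
  have "integral {0..a} (\<lambda>x. \<bar>w x\<bar> * (1 * cmod (h x))) \<le> sqrt (integral {0..a} (\<lambda>x. \<bar>w x\<bar> * 1\<^sup>2) * integral {0..a} (\<lambda>x. \<bar>w x\<bar> * (cmod (h x))\<^sup>2))"
  proof (rule integral_CS)
    show "(\<lambda>x. \<bar>w x\<bar> * (1 * cmod (h x))) integrable_on {0..a}"
      using absint_cnorm[where k="\<lambda>x. W x * h x"] h by (auto simp: l2p_def W_def norm_mult intro: absint_intro)
  qed (use absw_absint h in \<open>auto simp: l2p_def intro: absint_intro\<close>)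
  then show ?thesis by (simp add: nsq_def w1_def W_def norm_mult)
qed

lemma l2p_continuous:
  assumes "continuous_on {0..a} h" shows "l2p h"
  unfolding l2p_def
  by (intro conjI absint_mult absint_mult_real W_absint absw_absint continuous_intros assms)

lemma l2p_bound:
  fixes B :: real
  assumes "continuous_on {0..a} h" "\<And>x. x \<in> {0..a} \<Longrightarrow> cmod (h x) \<le> B"
  shows "nsq h \<le> w1 * B\<^sup>2"
proof -
  have "nsq h \<le> integral {0..a} (\<lambda>x. \<bar>w x\<bar> * B\<^sup>2)"
    unfolding nsq_def
  proof (rule integral_le)
    show "(\<lambda>x. \<bar>w x\<bar> * (cmod (h x))\<^sup>2) integrable_on {0..a}" using l2p_continuous[OF assms(1)] by (auto simp: l2p_def intro: absint_intro)
    show "(\<lambda>x. \<bar>w x\<bar> * B\<^sup>2) integrable_on {0..a}" by (intro integrable_on_mult_left absint_intro absw_absint)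
    fix x assume "x \<in> {0..a}"
    then have "(cmod (h x))\<^sup>2 \<le> B\<^sup>2" using assms(2) by (intro power_mono) auto
    then show "\<bar>w x\<bar> * (cmod (h x))\<^sup>2 \<le> \<bar>w x\<bar> * B\<^sup>2" by (intro mult_left_mono) auto
  qed
  then show ?thesis by (simp add: w1_def)
qed

text \<open>Gronwall factor of one period. Because the coefficients are periodic, the same factor
  serves every period of the line.\<close>

definition G :: "complex \<Rightarrow> real" where
  "G z = exp (integral {0..a} (\<lambda>x. cmod (R x) + cmod (P z x)))"

lemma G_pos: "G z > 0" by (simp add: G_def)

lemma psol_Wh: "psol z h f u \<Longrightarrow> (\<lambda>x. W x * h x) absolutely_integrable_on {0..a}"
proof -
  assume s: "psol z h f u"
  then have f: "prim_on 0 a (\<lambda>x. R x * u x) f" and u: "prim_on 0 a (\<lambda>x. P z x * f x - W x * h x) u" by (auto simp: psol_def)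
  have "(\<lambda>x. P z x * f x - (P z x * f x - W x * h x)) absolutely_integrable_on {0..a}"
    by (intro set_integral_diff absint_mult P_absint prim_on_continuous[OF f] prim_on_absint[OF u])
  then show ?thesis by simp
qed

lemma psol_cont: "psol z h f u \<Longrightarrow> continuous_on {0..a} f" "psol z h f u \<Longrightarrow> continuous_on {0..a} u"
  by (auto simp: psol_def intro: prim_on_continuous)

lemma psol_bound:
  assumes s: "psol z h f u" and h: "l2p h" and x: "x \<in> {0..a}"
  shows "cmod (f x) + cmod (u x) \<le> (cmod (f 0) + cmod (u 0) + sqrt (w1 * nsq h)) * G z"
proof -
  have "cmod (f x) + cmod (u x) \<le> (cmod (f 0) + cmod (u 0) + integral {0..a} (\<lambda>x. cmod (W x * h x))) * G z"
    unfolding G_def using s by (intro lin_bound R_absint P_absint psol_Wh[OF s] x) (auto simp: psol_def)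
  also have "\<dots> \<le> (cmod (f 0) + cmod (u 0) + sqrt (w1 * nsq h)) * G z"
    using l2p_W_norm[OF h] G_pos[of z] by (intro mult_right_mono) auto
  finally show ?thesis .
qed

lemma psol_exists:
  assumes "(\<lambda>x. W x * h x) absolutely_integrable_on {0..a}"
  shows "\<exists>f u. psol z h f u \<and> f 0 = \<alpha> \<and> u 0 = \<beta>"
  using lin_exists[OF R_absint P_absint assms] a_pos unfolding psol_def by (metis less_imp_le)

lemma psol_lin:
  assumes "psol z h f u" "psol z k g v"
  shows "psol z (\<lambda>x. \<alpha> * h x + \<beta> * k x) (\<lambda>x. \<alpha> * f x + \<beta> * g x) (\<lambda>x. \<alpha> * u x + \<beta> * v x)"
  unfolding psol_def
proof
  have f: "prim_on 0 a (\<lambda>x. R x * u x) f" "prim_on 0 a (\<lambda>x. R x * v x) g"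
   and u: "prim_on 0 a (\<lambda>x. P z x * f x - W x * h x) u" "prim_on 0 a (\<lambda>x. P z x * g x - W x * k x) v" using assms by (auto simp: psol_def)
  show "prim_on 0 a (\<lambda>x. R x * (\<alpha> * u x + \<beta> * v x)) (\<lambda>x. \<alpha> * f x + \<beta> * g x)"
    using prim_on_add[OF prim_on_cmult[OF f(1), of \<alpha>] prim_on_cmult[OF f(2), of \<beta>]] by (simp add: algebra_simps)
  show "prim_on 0 a (\<lambda>x. P z x * (\<alpha> * f x + \<beta> * g x) - W x * (\<alpha> * h x + \<beta> * k x)) (\<lambda>x. \<alpha> * u x + \<beta> * v x)"
    using prim_on_add[OF prim_on_cmult[OF u(1), of \<alpha>] prim_on_cmult[OF u(2), of \<beta>]] by (simp add: algebra_simps)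
qed

lemma basis_exists:
  "\<exists>b. psol z (\<lambda>x. 0) (fst (fst b)) (snd (fst b)) \<and> fst (fst b) 0 = 1 \<and> snd (fst b) 0 = 0 \<and>
     psol z (\<lambda>x. 0) (fst (snd b)) (snd (snd b)) \<and> fst (snd b) 0 = 0 \<and> snd (snd b) 0 = 1"
proof -
  have i: "(\<lambda>x. W x * 0) absolutely_integrable_on {0..a}" by simp
  obtain c cu where 1: "psol z (\<lambda>x. 0) c cu" "c 0 = 1" "cu 0 = 0" using psol_exists[OF i] by blast
  obtain s su where 2: "psol z (\<lambda>x. 0) s su" "s 0 = 0" "su 0 = 1" using psol_exists[OF i] by blast
  show ?thesis by (rule exI[of _ "((c,cu),(s,su))"]) (simp add: 1 2)
qed

text \<open>The fundamental system with identity data at 0. By \<open>psol_homogeneous\<close> the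
  choice is immaterial on the period; values outside it are arbitrary and never enter.\<close>

definition basis where
  "basis z = (SOME b. psol z (\<lambda>x. 0) (fst (fst b)) (snd (fst b)) \<and> fst (fst b) 0 = 1 \<and> snd (fst b) 0 = 0 \<and>
     psol z (\<lambda>x. 0) (fst (snd b)) (snd (snd b)) \<and> fst (snd b) 0 = 0 \<and> snd (snd b) 0 = 1)"

definition C where "C z = fst (fst (basis z))"
definition C' where "C' z = snd (fst (basis z))"
definition S where "S z = fst (snd (basis z))"
definition S' where "S' z = snd (snd (basis z))"

lemma C_psol: "psol z (\<lambda>x. 0) (C z) (C' z)" and C_0: "C z 0 = 1" "C' z 0 = 0"
  and S_psol: "psol z (\<lambda>x. 0) (S z) (S' z)" and S_0: "S z 0 = 0" "S' z 0 = 1"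
  using someI_ex[OF basis_exists[of z]] by (auto simp: basis_def C_def C'_def S_def S'_def)

lemma C_cont: "continuous_on {0..a} (C z)" "continuous_on {0..a} (C' z)"
  and S_cont: "continuous_on {0..a} (S z)" "continuous_on {0..a} (S' z)"
  using psol_cont C_psol S_psol by blast+

lemma l2p_zero: "l2p (\<lambda>x. 0)" by (intro l2p_continuous continuous_intros)

lemma nsq_zero: "nsq (\<lambda>x. 0) = 0" by (simp add: nsq_def)

text \<open>Variation of constants as an estimate: subtracting the homogeneous solution with the
  same data at 0 leaves a solution with zero data, for which \<open>psol_bound\<close> sees only the
  forcing.\<close>

lemma psol_decompose:
  assumes s: "psol z h f u" and h: "l2p h" and x: "x \<in> {0..a}"
  shows "cmod (f x - (f 0 * C z x + u 0 * S z x)) + cmod (u x - (f 0 * C' z x + u 0 * S' z x)) \<le> sqrt (w1 * nsq h) * G z"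
proof -
  have "psol z (\<lambda>x. 1 * h x + (-1) * (f 0 * 0 + u 0 * 0)) (\<lambda>x. 1 * f x + (-1) * (f 0 * C z x + u 0 * S z x))
     (\<lambda>x. 1 * u x + (-1) * (f 0 * C' z x + u 0 * S' z x))"
    by (intro psol_lin s C_psol S_psol)
  then have "psol z h (\<lambda>x. f x - (f 0 * C z x + u 0 * S z x)) (\<lambda>x. u x - (f 0 * C' z x + u 0 * S' z x))"
    by (simp add: algebra_simps)
  from psol_bound[OF this h x] show ?thesis by (simp add: C_0 S_0)
qed

lemma psol_homogeneous:
  assumes "psol z (\<lambda>x. 0) f u" "x \<in> {0..a}"
  shows "f x = f 0 * C z x + u 0 * S z x" "u x = f 0 * C' z x + u 0 * S' z x"
proof -
  have le: "cmod (f x - (f 0 * C z x + u 0 * S z x)) + cmod (u x - (f 0 * C' z x + u 0 * S' z x)) \<le> 0"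
    using psol_decompose[OF assms(1) l2p_zero assms(2)] by (simp add: nsq_zero)
  have "cmod (f x - (f 0 * C z x + u 0 * S z x)) = 0"
    using le norm_ge_zero[of "f x - (f 0 * C z x + u 0 * S z x)"] norm_ge_zero[of "u x - (f 0 * C' z x + u 0 * S' z x)"] by linarith
  then show "f x = f 0 * C z x + u 0 * S z x" by simp
  have "cmod (u x - (f 0 * C' z x + u 0 * S' z x)) = 0"
    using le norm_ge_zero[of "f x - (f 0 * C z x + u 0 * S z x)"] norm_ge_zero[of "u x - (f 0 * C' z x + u 0 * S' z x)"] by linarith
  then show "u x = f 0 * C' z x + u 0 * S' z x" by simp
qed

definition m11 where "m11 z = C z a"
definition m12 where "m12 z = S z a"
definition m21 where "m21 z = C' z a"
definition m22 where "m22 z = S' z a"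
definition D where "D z = m11 z + m22 z"

text \<open>In the derivative of u g - f v the terms with 1/p and q cancel. The pairing is bilinear,
  without conjugation, so it compares two complex parameters directly.\<close>

lemma lagrange:
  assumes f: "psol z h f u" and g: "psol y k g v"
  shows "((\<lambda>x. (y - z) * (W x * f x * g x) - W x * h x * g x + W x * k x * f x) has_integral
     (u a * g a - f a * v a - (u 0 * g 0 - f 0 * v 0))) {0..a}"
proof -
  have F: "prim_on 0 a (\<lambda>x. R x * u x) f" "prim_on 0 a (\<lambda>x. R x * v x) g"
   and U: "prim_on 0 a (\<lambda>x. P z x * f x - W x * h x) u" "prim_on 0 a (\<lambda>x. P y x * g x - W x * k x) v" using assms by (auto simp: psol_def)
  have "prim_on 0 a (\<lambda>x. (u x * (R x * v x) + (P z x * f x - W x * h x) * g x) - (f x * (P y x * g x - W x * k x) + R x * u x * v x))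
     (\<lambda>x. u x * g x - f x * v x)"
    by (intro prim_on_diff prim_on_mult F U)
  then have "prim_on 0 a (\<lambda>x. (y - z) * (W x * f x * g x) - W x * h x * g x + W x * k x * f x) (\<lambda>x. u x * g x - f x * v x)"
    by (rule prim_on_cong) (auto simp: P_def algebra_simps)
  from prim_on_integral[OF this, of 0 a] show ?thesis using a_pos by simp
qed

definition I :: "(real \<Rightarrow> complex) \<Rightarrow> (real \<Rightarrow> complex) \<Rightarrow> complex" where
  "I f g = integral {0..a} (\<lambda>x. W x * f x * g x)"

lemma lagrange_hom:
  assumes f: "psol z (\<lambda>x. 0) f u" and g: "psol y (\<lambda>x. 0) g v"
  shows "u a * g a - f a * v a = (u 0 * g 0 - f 0 * v 0) + (y - z) * I f g"
proof -
  have "((\<lambda>x. (y - z) * (W x * f x * g x)) has_integral (u a * g a - f a * v a - (u 0 * g 0 - f 0 * v 0))) {0..a}"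
    using lagrange[OF assms] by simp
  then have "integral {0..a} (\<lambda>x. (y - z) * (W x * f x * g x)) = u a * g a - f a * v a - (u 0 * g 0 - f 0 * v 0)"
    by (rule integral_unique)
  then show ?thesis by (simp add: I_def)
qed

lemma det_M: "m11 z * m22 z - m12 z * m21 z = 1"
  using lagrange_hom[OF C_psol[of z] S_psol[of z]] by (simp add: m11_def m12_def m21_def m22_def C_0 S_0 algebra_simps)

text \<open>Minus the difference quotient of the discriminant between z and y, see
  \<open>D_diff\<close>; on the diagonal it is minus the derivative.\<close>

definition FF :: "complex \<Rightarrow> complex \<Rightarrow> complex" where
  "FF z y = m12 y * I (C z) (C y) - m11 y * I (C z) (S y) + m22 y * I (S z) (C y) - m21 y * I (S z) (S y)"

text \<open>The Lagrange identity for the four pairs of basis solutions expresses the products of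
  the entries of M(z) and M(y) by integrals. Since det M(y) = 1, suitable combinations of them with
  the entries of M(y) isolate \<open>m11 z\<close> and \<open>m22 z\<close>, and the factor y - z
  comes out exactly.\<close>

lemma D_diff: "D z - D y = (y - z) * FF z y"
proof -
  let ?d = "y - z"
  have 1: "m21 z * m11 y - m11 z * m21 y = ?d * I (C z) (C y)"
    using lagrange_hom[OF C_psol[of z] C_psol[of y]] by (simp add: m11_def m12_def m21_def m22_def C_0 S_0)
  have 2: "m21 z * m12 y - m11 z * m22 y = -1 + ?d * I (C z) (S y)"
    using lagrange_hom[OF C_psol[of z] S_psol[of y]] by (simp add: m11_def m12_def m21_def m22_def C_0 S_0)
  have 3: "m22 z * m11 y - m12 z * m21 y = 1 + ?d * I (S z) (C y)"
    using lagrange_hom[OF S_psol[of z] C_psol[of y]] by (simp add: m11_def m12_def m21_def m22_def C_0 S_0)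
  have 4: "m22 z * m12 y - m12 z * m22 y = ?d * I (S z) (S y)"
    using lagrange_hom[OF S_psol[of z] S_psol[of y]] by (simp add: m11_def m12_def m21_def m22_def C_0 S_0)
  have "m11 z * (m11 y * m22 y - m12 y * m21 y) = m12 y * (m21 z * m11 y - m11 z * m21 y) - m11 y * (m21 z * m12 y - m11 z * m22 y)"
    by (simp add: algebra_simps)
  then have a: "m11 z = m12 y * (?d * I (C z) (C y)) - m11 y * (-1 + ?d * I (C z) (S y))" unfolding det_M 1 2 by simp
  have "m22 z * (m11 y * m22 y - m12 y * m21 y) = m22 y * (m22 z * m11 y - m12 z * m21 y) - m21 y * (m22 z * m12 y - m12 z * m22 y)"
    by (simp add: algebra_simps)
  then have b: "m22 z = m22 y * (1 + ?d * I (S z) (C y)) - m21 y * (?d * I (S z) (S y))" unfolding det_M 3 4 by simp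
  show ?thesis unfolding D_def FF_def by (subst a, subst b) (simp add: algebra_simps)
qed

end

lemma ae_zero_continuous:
  fixes f :: "real \<Rightarrow> complex"
  assumes f: "continuous_on {c..d} f" and cd: "c < d"
    and ae: "AE x in lebesgue. x \<in> {c<..<d} \<longrightarrow> f x = 0" and x: "x \<in> {c..d}"
  shows "f x = 0"
proof -
  obtain N where N: "N \<in> null_sets lebesgue" "{x. \<not> (x \<in> {c<..<d} \<longrightarrow> f x = 0)} \<subseteq> N"
    using ae by (auto simp: eventually_ae_filter)
  define N' where "N' = N \<union> {c,d}"
  have N': "negligible N'" unfolding N'_def using N(1) by (intro negligible_Un) (auto simp: negligible_iff_null_sets)
  have eq: "cmod (f x) = 0" if "x \<in> {c..d} - N'" for x using that N(2) by (auto simp: N'_def subset_iff less_le)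
  have "((\<lambda>x. cmod (f x)) has_integral 0) {c..d}"
    by (rule has_integral_spike[OF N' eq has_integral_0])
  then have "integral {c..d} (\<lambda>x. cmod (f x)) = 0" by (rule integral_unique)
  moreover have "continuous_on {c..d} (\<lambda>x. cmod (f x))" by (intro continuous_intros f)
  ultimately show ?thesis using integral_eq_0_iff[of c d "\<lambda>x. cmod (f x)"] cd x by simp
qed

lemma integral_zero_ae:
  fixes f :: "real \<Rightarrow> real"
  assumes f: "f absolutely_integrable_on {c..d}" "\<And>x. f x \<ge> 0" and z: "integral {c..d} f \<le> 0"
  shows "AE x in lebesgue. x \<in> {c<..<d} \<longrightarrow> f x = 0"
proof -
  have eq: "(LINT x|lebesgue. indicator {c..d} x *\<^sub>R f x) = integral {c..d} f"
    using set_lebesgue_integral_eq_integral(2)[OF f(1)] by (simp add: set_lebesgue_integral_def)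
  have nn: "AE x in lebesgue. 0 \<le> indicat_real {c..d} x *\<^sub>R f x" by (rule AE_I2) (simp add: f(2))
  have int: "integrable lebesgue (\<lambda>x. indicat_real {c..d} x *\<^sub>R f x)" using f(1) by (simp add: set_integrable_def)
  have "(LINT x|lebesgue. indicat_real {c..d} x *\<^sub>R f x) = 0"
    using z eq integral_nonneg_AE[OF nn] by linarith
  from integral_nonneg_eq_0_iff_AE[OF int nn, THEN iffD1, OF this]
  show ?thesis by eventually_elim (simp add: indicator_def split: if_splits)
qed

lemma cmod_add_sq_le: "(cmod (x + y))\<^sup>2 \<le> 2 * (cmod x)\<^sup>2 + 2 * (cmod y)\<^sup>2"
proof -
  have "(cmod (x + y))\<^sup>2 \<le> (cmod x + cmod y)\<^sup>2" by (intro power_mono norm_triangle_ineq) auto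
  also have "\<dots> \<le> 2 * (cmod x)\<^sup>2 + 2 * (cmod y)\<^sup>2"
    using sum_squares_bound[of "cmod x" "cmod y"] by (simp add: power2_eq_square algebra_simps)
  finally show ?thesis .
qed

section \<open>Dependence on the spectral parameter: the discriminant is entire\<close>

context SL begin

lemma I_integrable:
  assumes "continuous_on {0..a} f" "continuous_on {0..a} g"
  shows "(\<lambda>x. W x * f x * g x) absolutely_integrable_on {0..a}"
  by (intro absint_mult W_absint assms)

lemma I_diff_bound:
  fixes B1 B2 :: real
  assumes c: "continuous_on {0..a} f" "continuous_on {0..a} f'" "continuous_on {0..a} g"
    and b: "\<And>x. x \<in> {0..a} \<Longrightarrow> cmod (f x - f' x) \<le> B1" "\<And>x. x \<in> {0..a} \<Longrightarrow> cmod (g x) \<le> B2" and B1: "B1 \<ge> 0"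
  shows "cmod (I f g - I f' g) \<le> w1 * B1 * B2"
proof -
  have "I f g - I f' g = integral {0..a} (\<lambda>x. W x * f x * g x - W x * f' x * g x)"
    unfolding I_def using I_integrable[OF c(1,3)] I_integrable[OF c(2,3)]
    by (simp add: Henstock_Kurzweil_Integration.integral_diff absint_intro)
  also have "cmod \<dots> \<le> integral {0..a} (\<lambda>x. \<bar>w x\<bar> * (B1 * B2))"
  proof (rule integral_norm_bound_integral)
    show "(\<lambda>x. W x * f x * g x - W x * f' x * g x) integrable_on {0..a}"
      by (intro integrable_diff absint_intro I_integrable c)
    show "(\<lambda>x. \<bar>w x\<bar> * (B1 * B2)) integrable_on {0..a}" by (intro integrable_on_mult_left absint_intro absw_absint)
    fix x assume x: "x \<in> {0..a}"
    have "cmod (W x * f x * g x - W x * f' x * g x) = \<bar>w x\<bar> * (cmod (f x - f' x) * cmod (g x))"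
    proof -
      have "W x * f x * g x - W x * f' x * g x = W x * ((f x - f' x) * g x)" by (simp add: algebra_simps)
      then show ?thesis by (simp only: norm_mult W_def norm_of_real)
    qed
    also have "\<dots> \<le> \<bar>w x\<bar> * (B1 * B2)" using b[OF x] B1 by (intro mult_left_mono mult_mono) auto
    finally show "cmod (W x * f x * g x - W x * f' x * g x) \<le> \<bar>w x\<bar> * (B1 * B2)" .
  qed
  also have "\<dots> = w1 * B1 * B2" by (simp add: w1_def)
  finally show ?thesis .
qed

lemma continuous_bound:
  fixes f :: "real \<Rightarrow> complex"
  assumes "continuous_on {c..d} f"
  obtains B where "B > 0" "\<forall>x\<in>{c..d}. cmod (f x) \<le> B"
proof -
  have "bounded (f ` {c..d})" by (intro compact_imp_bounded compact_continuous_image assms) auto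
  then obtain B where "B > 0" "\<forall>y\<in>f ` {c..d}. norm y \<le> B" unfolding bounded_pos by blast
  then show ?thesis by (intro that[of B]) auto
qed

lemma psol_diff_param:
  assumes f: "psol z (\<lambda>x. 0) f u" and g: "psol y (\<lambda>x. 0) g v"
  shows "psol z (\<lambda>x. (z - y) * g x) (\<lambda>x. f x - g x) (\<lambda>x. u x - v x)"
  unfolding psol_def
proof
  have F: "prim_on 0 a (\<lambda>x. R x * u x) f" "prim_on 0 a (\<lambda>x. R x * v x) g"
   and U: "prim_on 0 a (\<lambda>x. P z x * f x - W x * 0) u" "prim_on 0 a (\<lambda>x. P y x * g x - W x * 0) v" using assms by (auto simp: psol_def)
  show "prim_on 0 a (\<lambda>x. R x * (u x - v x)) (\<lambda>x. f x - g x)"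
    using prim_on_diff[OF F] by (rule prim_on_cong) (auto simp: algebra_simps)
  show "prim_on 0 a (\<lambda>x. P z x * (f x - g x) - W x * ((z - y) * g x)) (\<lambda>x. u x - v x)"
    using prim_on_diff[OF U] by (rule prim_on_cong) (auto simp: P_def algebra_simps)
qed

lemma G_bound: "\<exists>K>0. \<forall>z. cmod (z - y) \<le> 1 \<longrightarrow> G z \<le> K"
proof (intro exI conjI allI impI)
  let ?k = "\<lambda>x. cmod (R x) + (cmod (Q x) + (cmod y + 1) * cmod (W x))"
  show "exp (integral {0..a} ?k) > 0" by simp
  fix z assume z: "cmod (z - y) \<le> 1"
  have zn: "cmod z \<le> cmod y + 1" using z norm_triangle_ineq2[of z y] by linarith
  show "G z \<le> exp (integral {0..a} ?k)"
    unfolding G_def exp_le_cancel_iff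
  proof (rule integral_le)
    show "(\<lambda>x. cmod (R x) + cmod (P z x)) integrable_on {0..a}"
      by (intro integrable_add absint_intro absint_cnorm R_absint P_absint)
    show "?k integrable_on {0..a}"
      by (intro integrable_add integrable_on_mult_right absint_intro absint_cnorm R_absint Q_absint W_absint)
    fix x
    have "cmod (P z x) \<le> cmod (Q x) + cmod z * cmod (W x)"
      unfolding P_def using norm_triangle_ineq4[of "Q x" "z * W x"] by (simp add: norm_mult)
    also have "cmod z * cmod (W x) \<le> (cmod y + 1) * cmod (W x)" using zn by (intro mult_right_mono) auto
    finally show "cmod (R x) + cmod (P z x) \<le> ?k x" by simp
  qed
qed

text \<open>Two solutions with equal data at parameters z and y differ by a solution for z with zero
  data and forcing (z - y) times the second one. Gronwall makes the difference linear in |z -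
  y|.\<close>

lemma param_lip:
  assumes f: "\<And>z. psol z (\<lambda>x. 0) (f z) (u z)" and init: "\<And>z. f z 0 = \<alpha>" "\<And>z. u z 0 = \<beta>"
  shows "\<exists>K\<ge>0. \<forall>z. cmod (z - y) \<le> 1 \<longrightarrow> (\<forall>x\<in>{0..a}. cmod (f z x - f y x) \<le> K * cmod (z - y))"
proof -
  obtain K where K: "K > 0" "\<And>z. cmod (z - y) \<le> 1 \<Longrightarrow> G z \<le> K" using G_bound[of y] by blast
  obtain B where B: "B > 0" "\<forall>x\<in>{0..a}. cmod (f y x) \<le> B" by (rule continuous_bound[OF psol_cont(1)[OF f[of y]]])
  show ?thesis
  proof (intro exI[of _ "w1 * B * K"] conjI allI impI ballI)
    show "0 \<le> w1 * B * K" using w1_nonneg B(1) K(1) by simp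
    fix z x assume z: "cmod (z - y) \<le> 1" and x: "x \<in> {0..a}"
    let ?h = "\<lambda>x. (z - y) * f y x"
    have hc: "continuous_on {0..a} ?h" by (intro continuous_intros psol_cont(1)[OF f])
    have s: "psol z ?h (\<lambda>x. f z x - f y x) (\<lambda>x. u z x - u y x)" by (rule psol_diff_param[OF f f])
    have n: "nsq ?h \<le> w1 * (cmod (z - y) * B)\<^sup>2"
      by (rule l2p_bound[OF hc]) (use B in \<open>auto simp: norm_mult intro!: mult_left_mono\<close>)
    have "sqrt (w1 * nsq ?h) \<le> sqrt ((w1 * (cmod (z - y) * B))\<^sup>2)"
      using n w1_nonneg by (intro real_sqrt_le_mono) (auto simp: power2_eq_square mult_ac dest: mult_left_mono[of _ _ w1])
    also have "\<dots> = w1 * (cmod (z - y) * B)" using w1_nonneg B(1) by simp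
    finally have sq: "sqrt (w1 * nsq ?h) \<le> w1 * (cmod (z - y) * B)" .
    have "cmod (f z x - f y x) + cmod (u z x - u y x) \<le> sqrt (w1 * nsq ?h) * G z"
      using psol_bound[OF s l2p_continuous[OF hc] x] by (simp add: init)
    also have "\<dots> \<le> w1 * (cmod (z - y) * B) * K"
      using sq K(2)[OF z] G_pos[of z] w1_nonneg B(1) by (intro mult_mono) auto
    finally have le: "cmod (f z x - f y x) + cmod (u z x - u y x) \<le> w1 * (cmod (z - y) * B) * K" .
    have "cmod (f z x - f y x) \<le> w1 * (cmod (z - y) * B) * K"
      using le norm_ge_zero[of "u z x - u y x"] by linarith
    then show "cmod (f z x - f y x) \<le> w1 * B * K * cmod (z - y)" by (simp add: mult_ac)
  qed
qed

lemma I_tendsto: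
  assumes f: "\<And>z. psol z (\<lambda>x. 0) (f z) (u z)" and init: "\<And>z. f z 0 = \<alpha>" "\<And>z. u z 0 = \<beta>"
    and g: "continuous_on {0..a} g"
  shows "((\<lambda>z. I (f z) g) \<longlongrightarrow> I (f y) g) (at y)"
proof -
  obtain K where K: "K \<ge> 0" "\<And>z x. cmod (z - y) \<le> 1 \<Longrightarrow> x \<in> {0..a} \<Longrightarrow> cmod (f z x - f y x) \<le> K * cmod (z - y)"
    using param_lip[where f=f and u=u, OF f init, of y] by blast
  obtain B where B: "B > 0" "\<forall>x\<in>{0..a}. cmod (g x) \<le> B" by (rule continuous_bound[OF g])
  have "((\<lambda>z. I (f z) g - I (f y) g) \<longlongrightarrow> 0) (at y)"
  proof (rule Lim_null_comparison)
    show "((\<lambda>z. w1 * (K * cmod (z - y)) * B) \<longlongrightarrow> 0) (at y)" by (rule tendsto_eq_intros refl | simp)+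
    have "eventually (\<lambda>z. dist z y < 1) (at y)" unfolding eventually_at by (intro exI[of _ 1]) auto
    then show "\<forall>\<^sub>F z in at y. norm (I (f z) g - I (f y) g) \<le> w1 * (K * cmod (z - y)) * B"
    proof eventually_elim
      fix z assume "dist z y < 1"
      then have z: "cmod (z - y) \<le> 1" by (simp add: dist_norm)
      show "norm (I (f z) g - I (f y) g) \<le> w1 * (K * cmod (z - y)) * B"
        by (rule I_diff_bound[OF psol_cont(1)[OF f] psol_cont(1)[OF f] g K(2)[OF z]]) (use B K in auto)
    qed
  qed
  then show ?thesis by (simp add: LIM_zero_iff)
qed

text \<open>The difference formula \<open>D_diff\<close> is exact, so only continuity of the
  integrals in z is needed for the limit; no power series of the solutions in z is involved.\<close>

lemma D_deriv: "(D has_field_derivative - FF y y) (at y)"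
proof -
  have "((\<lambda>z. FF z y) \<longlongrightarrow> FF y y) (at y)"
    unfolding FF_def
    by (intro tendsto_intros I_tendsto[OF C_psol C_0] I_tendsto[OF S_psol S_0] C_cont S_cont)
  then have "((\<lambda>z. - FF z y) \<longlongrightarrow> - FF y y) (at y)" by (rule tendsto_minus)
  moreover have "\<forall>\<^sub>F z in at y. - FF z y = (D z - D y) / (z - y)"
    unfolding eventually_at
  proof (intro exI[of _ 1] conjI ballI impI)
    fix z assume "z \<noteq> y \<and> dist z y < 1"
    then have "z - y \<noteq> 0" by simp
    moreover have "D z - D y = (z - y) * (- FF z y)" using D_diff[of z y] by (simp add: algebra_simps)
    ultimately show "- FF z y = (D z - D y) / (z - y)" by simp
  qed auto
  ultimately have "((\<lambda>z. (D z - D y) / (z - y)) \<longlongrightarrow> - FF y y) (at y)" by (rule Lim_transform_eventually)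
  then show ?thesis by (simp add: has_field_derivative_iff)
qed

lemma D_holomorphic: "D holomorphic_on UNIV"
  by (auto simp: holomorphic_on_def field_differentiable_def intro!: D_deriv)

lemma deriv_D: "deriv D y = - FF y y" by (rule DERIV_imp_deriv[OF D_deriv])

lemma psol_cnj:
  assumes "psol z h f u"
  shows "psol (cnj z) (\<lambda>x. cnj (h x)) (\<lambda>x. cnj (f x)) (\<lambda>x. cnj (u x))"
  unfolding psol_def
proof
  have F: "prim_on 0 a (\<lambda>x. R x * u x) f" and U: "prim_on 0 a (\<lambda>x. P z x * f x - W x * h x) u" using assms by (auto simp: psol_def)
  show "prim_on 0 a (\<lambda>x. R x * cnj (u x)) (\<lambda>x. cnj (f x))"
    using prim_on_linear[OF F bounded_linear_cnj] by (rule prim_on_cong) (auto simp: R_def)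
  show "prim_on 0 a (\<lambda>x. P (cnj z) x * cnj (f x) - W x * cnj (h x)) (\<lambda>x. cnj (u x))"
    using prim_on_linear[OF U bounded_linear_cnj] by (rule prim_on_cong) (auto simp: P_def Q_def W_def)
qed

lemma basis_real:
  assumes z: "z \<in> \<real>" and x: "x \<in> {0..a}"
  shows "cnj (C z x) = C z x" "cnj (C' z x) = C' z x" "cnj (S z x) = S z x" "cnj (S' z x) = S' z x"
proof -
  have cz: "cnj z = z" using z by (simp add: Reals_cnj_iff)
  have 1: "psol z (\<lambda>x. 0) (\<lambda>x. cnj (C z x)) (\<lambda>x. cnj (C' z x))" "psol z (\<lambda>x. 0) (\<lambda>x. cnj (S z x)) (\<lambda>x. cnj (S' z x))"
    using psol_cnj[OF C_psol[of z]] psol_cnj[OF S_psol[of z]] cz by auto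
  show "cnj (C z x) = C z x" "cnj (C' z x) = C' z x" "cnj (S z x) = S z x" "cnj (S' z x) = S' z x"
    using psol_homogeneous[OF 1(1) x] psol_homogeneous[OF 1(2) x] by (simp_all add: C_0 S_0)
qed

lemma M_real:
  assumes "z \<in> \<real>" shows "m11 z \<in> \<real>" "m12 z \<in> \<real>" "m21 z \<in> \<real>" "m22 z \<in> \<real>"
  using basis_real[OF assms, of a] a_pos by (simp_all add: m11_def m12_def m21_def m22_def Reals_cnj_iff)

lemma nsq_bound:
  assumes s: "psol z h f u" and h: "l2p h"
  shows "nsq f \<le> 3 * w1 * (G z)\<^sup>2 * ((cmod (f 0))\<^sup>2 + (cmod (u 0))\<^sup>2 + w1 * nsq h)"
proof -
  let ?B = "(cmod (f 0) + cmod (u 0) + sqrt (w1 * nsq h)) * G z"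
  have n0: "w1 * nsq h \<ge> 0" using w1_nonneg nsq_nonneg by simp
  have "nsq f \<le> w1 * ?B\<^sup>2"
  proof (rule l2p_bound[OF psol_cont(1)[OF s]])
    fix x assume "x \<in> {0..a}"
    from psol_bound[OF s h this] show "cmod (f x) \<le> ?B" using norm_ge_zero[of "u x"] by linarith
  qed
  also have "w1 * ?B\<^sup>2 \<le> w1 * (3 * ((cmod (f 0))\<^sup>2 + (cmod (u 0))\<^sup>2 + w1 * nsq h) * (G z)\<^sup>2)"
  proof (intro mult_left_mono w1_nonneg)
    have "(x + y + t)\<^sup>2 \<le> 3 * (x\<^sup>2 + y\<^sup>2 + t\<^sup>2)" for x y t :: real
      using sum_squares_bound[of x y] sum_squares_bound[of y t] sum_squares_bound[of x t]
      by (simp add: power2_eq_square algebra_simps)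
    from this[of "cmod (f 0)" "cmod (u 0)" "sqrt (w1 * nsq h)"]
    show "?B\<^sup>2 \<le> 3 * ((cmod (f 0))\<^sup>2 + (cmod (u 0))\<^sup>2 + w1 * nsq h) * (G z)\<^sup>2"
      using n0 by (simp add: power_mult_distrib mult_right_mono)
  qed
  finally show ?thesis by (simp add: algebra_simps)
qed

lemma period_step:
  assumes s: "psol z h f u" and h: "l2p h"
  shows "cmod (f a - (m11 z * f 0 + m12 z * u 0)) \<le> sqrt (w1 * nsq h) * G z"
    "cmod (u a - (m21 z * f 0 + m22 z * u 0)) \<le> sqrt (w1 * nsq h) * G z"
proof -
  have e: "f 0 * C z a + u 0 * S z a = m11 z * f 0 + m12 z * u 0" "f 0 * C' z a + u 0 * S' z a = m21 z * f 0 + m22 z * u 0"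
    by (simp_all add: m11_def m12_def m21_def m22_def mult.commute)
  have le: "cmod (f a - (m11 z * f 0 + m12 z * u 0)) + cmod (u a - (m21 z * f 0 + m22 z * u 0)) \<le> sqrt (w1 * nsq h) * G z"
    using psol_decompose[OF s h, of a] a_pos unfolding e by auto
  show "cmod (f a - (m11 z * f 0 + m12 z * u 0)) \<le> sqrt (w1 * nsq h) * G z"
    using le norm_ge_zero[of "u a - (m21 z * f 0 + m22 z * u 0)"] by linarith
  show "cmod (u a - (m21 z * f 0 + m22 z * u 0)) \<le> sqrt (w1 * nsq h) * G z"
    using le norm_ge_zero[of "f a - (m11 z * f 0 + m12 z * u 0)"] by linarith
qed

section \<open>The Gram matrix of the fundamental system over one period\<close>

lemma R_nz: "AE x in lebesgue. R x \<noteq> 0"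
  using p_pos by eventually_elim (auto simp: R_def)

text \<open>If the weighted norm vanished, f would be zero because w is nonzero almost everywhere
  and f is continuous. The first equation then forces u = 0, because 1/p is nonzero almost
  everywhere, and the initial data would vanish.\<close>

lemma nsq_pos:
  assumes s: "psol z (\<lambda>x. 0) f u" and nz: "f 0 \<noteq> 0 \<or> u 0 \<noteq> 0"
  shows "nsq f > 0"
proof (rule ccontr)
  assume "\<not> nsq f > 0"
  then have "nsq f \<le> 0" by simp
  have F: "prim_on 0 a (\<lambda>x. R x * u x) f" using s by (simp add: psol_def)
  have "AE x in lebesgue. x \<in> {0<..<a} \<longrightarrow> \<bar>w x\<bar> * (cmod (f x))\<^sup>2 = 0"
    by (rule integral_zero_ae) (use \<open>nsq f \<le> 0\<close> l2p_continuous[OF psol_cont(1)[OF s]] in \<open>auto simp: nsq_def l2p_def\<close>)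
  then have "AE x in lebesgue. x \<in> {0<..<a} \<longrightarrow> f x = 0" using w_nz by eventually_elim auto
  then have f0: "f x = 0" if "x \<in> {0..a}" for x
    using ae_zero_continuous[OF psol_cont(1)[OF s] a_pos _ that] by blast
  have "prim_on 0 a (\<lambda>x. R x * u x) (\<lambda>x. 0)" by (rule prim_on_cong[OF F]) (auto simp: f0)
  from prim_on_deriv[OF this] R_nz have "AE x in lebesgue. x \<in> {0<..<a} \<longrightarrow> u x = 0"
  proof eventually_elim
    case (elim x)
    show ?case
    proof
      assume "x \<in> {0<..<a}"
      then have "((\<lambda>x. 0) has_vector_derivative R x * u x) (at x)" using elim by blast
      then have "R x * u x = 0" using vector_derivative_unique_at has_vector_derivative_const by blast
      then show "u x = 0" using elim by simp
    qed
  qed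
  then have "u 0 = 0" using ae_zero_continuous[OF psol_cont(2)[OF s] a_pos, of 0] a_pos by auto
  then show False using nz f0[of 0] a_pos by auto
qed

text \<open>The off-diagonal entry of the Gram matrix of \<open>C z\<close> and \<open>S z\<close>
  with respect to |w| dx on one period; the diagonal entries are \<open>nsq (C z)\<close> and
  \<open>nsq (S z)\<close>.\<close>

definition gramB :: "complex \<Rightarrow> complex" where
  "gramB z = integral {0..a} (\<lambda>x. of_real \<bar>w x\<bar> * (C z x * cnj (S z x)))"

lemma absW_absint: "(\<lambda>x. complex_of_real \<bar>w x\<bar>) absolutely_integrable_on {0..a}"
  by (intro complex_absint absw_absint)

lemma nsq_comb:
  "nsq (\<lambda>x. \<alpha> * C z x + \<beta> * S z x) = (cmod \<alpha>)\<^sup>2 * nsq (C z) + (cmod \<beta>)\<^sup>2 * nsq (S z) + 2 * Re (\<alpha> * cnj \<beta> * gramB z)"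
proof -
  have 1: "(\<lambda>x. \<bar>w x\<bar> * (cmod (C z x))\<^sup>2) integrable_on {0..a}" "(\<lambda>x. \<bar>w x\<bar> * (cmod (S z x))\<^sup>2) integrable_on {0..a}"
    using l2p_continuous C_cont S_cont by (auto simp: l2p_def intro: absint_intro)
  have 2: "(\<lambda>x. of_real \<bar>w x\<bar> * (C z x * cnj (S z x))) integrable_on {0..a}"
    by (intro absint_intro absint_mult absW_absint continuous_intros C_cont S_cont)
  have h: "((\<lambda>x. Re (\<alpha> * cnj \<beta> * (of_real \<bar>w x\<bar> * (C z x * cnj (S z x))))) has_integral Re (\<alpha> * cnj \<beta> * gramB z)) {0..a}"
    unfolding gramB_def by (intro has_integral_Re has_integral_mult_right integrable_integral 2)
  have "((\<lambda>x. (cmod \<alpha>)\<^sup>2 * (\<bar>w x\<bar> * (cmod (C z x))\<^sup>2) + (cmod \<beta>)\<^sup>2 * (\<bar>w x\<bar> * (cmod (S z x))\<^sup>2)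
      + 2 * Re (\<alpha> * cnj \<beta> * (of_real \<bar>w x\<bar> * (C z x * cnj (S z x))))) has_integral
    ((cmod \<alpha>)\<^sup>2 * nsq (C z) + (cmod \<beta>)\<^sup>2 * nsq (S z) + 2 * Re (\<alpha> * cnj \<beta> * gramB z))) {0..a}"
    unfolding nsq_def by (intro has_integral_add has_integral_mult_right integrable_integral 1 h)
  moreover have "(cmod \<alpha>)\<^sup>2 * (\<bar>w x\<bar> * (cmod (C z x))\<^sup>2) + (cmod \<beta>)\<^sup>2 * (\<bar>w x\<bar> * (cmod (S z x))\<^sup>2)
      + 2 * Re (\<alpha> * cnj \<beta> * (of_real \<bar>w x\<bar> * (C z x * cnj (S z x)))) = \<bar>w x\<bar> * (cmod (\<alpha> * C z x + \<beta> * S z x))\<^sup>2" for x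
    unfolding cmod_power2 by (simp add: power2_eq_square algebra_simps)
  ultimately show ?thesis unfolding nsq_def by (simp add: integral_unique)
qed

lemma comb_psol: "psol z (\<lambda>x. 0) (\<lambda>x. \<alpha> * C z x + \<beta> * S z x) (\<lambda>x. \<alpha> * C' z x + \<beta> * S' z x)"
  using psol_lin[OF C_psol[of z] S_psol[of z], of \<alpha> \<beta>] by simp

text \<open>The combination with coefficients \<open>- cnj (gramB z)\<close> and
  \<open>nsq (C z)\<close> has squared norm equal to \<open>nsq (C z)\<close> times the determinant,
  and \<open>nsq_pos\<close> applies to it.\<close>

lemma gram_det_pos: "nsq (C z) * nsq (S z) - (cmod (gramB z))\<^sup>2 > 0"
proof -
  let ?A = "nsq (C z)" and ?E = "nsq (S z)" and ?B = "gramB z"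
  have A: "?A > 0" using nsq_pos[OF C_psol[of z]] by (simp add: C_0)
  have "0 < nsq (\<lambda>x. (- cnj ?B) * C z x + of_real ?A * S z x)"
    by (rule nsq_pos[OF comb_psol]) (use A in \<open>simp add: C_0 S_0\<close>)
  also have "\<dots> = ?A * (?A * ?E - (cmod ?B)\<^sup>2)"
    unfolding nsq_comb cmod_power2 using A by (simp add: power2_eq_square algebra_simps)
  finally show ?thesis using A zero_less_mult_pos by blast
qed

text \<open>Complete the square once in each variable and add. The constant is determinant over
  trace, a lower bound for the smaller eigenvalue of the Gram matrix.\<close>

lemma nsq_lower: "\<exists>\<kappa>>0. \<forall>\<alpha> \<beta>. nsq (\<lambda>x. \<alpha> * C z x + \<beta> * S z x) \<ge> \<kappa> * ((cmod \<alpha>)\<^sup>2 + (cmod \<beta>)\<^sup>2)"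
proof -
  let ?A = "nsq (C z)" and ?E = "nsq (S z)" and ?B = "gramB z"
  let ?d = "?A * ?E - (cmod ?B)\<^sup>2"
  have A: "?A > 0" using nsq_pos[OF C_psol[of z]] by (simp add: C_0)
  have E: "?E > 0" using nsq_pos[OF S_psol[of z]] by (simp add: S_0)
  have d: "?d > 0" by (rule gram_det_pos)
  have "?d * ((cmod \<alpha>)\<^sup>2 + (cmod \<beta>)\<^sup>2) \<le> (?A + ?E) * nsq (\<lambda>x. \<alpha> * C z x + \<beta> * S z x)" for \<alpha> \<beta>
  proof -
    have 1: "?A * nsq (\<lambda>x. \<alpha> * C z x + \<beta> * S z x) - ?d * (cmod \<beta>)\<^sup>2 = (cmod (of_real ?A * \<alpha> + cnj ?B * \<beta>))\<^sup>2"
      unfolding nsq_comb cmod_power2 by (simp add: power2_eq_square algebra_simps)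
    have 2: "?E * nsq (\<lambda>x. \<alpha> * C z x + \<beta> * S z x) - ?d * (cmod \<alpha>)\<^sup>2 = (cmod (of_real ?E * \<beta> + ?B * \<alpha>))\<^sup>2"
      unfolding nsq_comb cmod_power2 by (simp add: power2_eq_square algebra_simps)
    have "?d * (cmod \<beta>)\<^sup>2 \<le> ?A * nsq (\<lambda>x. \<alpha> * C z x + \<beta> * S z x)"
      using 1 zero_le_power2[of "cmod (of_real ?A * \<alpha> + cnj ?B * \<beta>)"] by linarith
    moreover have "?d * (cmod \<alpha>)\<^sup>2 \<le> ?E * nsq (\<lambda>x. \<alpha> * C z x + \<beta> * S z x)"
      using 2 zero_le_power2[of "cmod (of_real ?E * \<beta> + ?B * \<alpha>)"] by linarith
    ultimately show ?thesis unfolding distrib_left distrib_right by linarith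
  qed
  then show ?thesis using A E d
    by (intro exI[of _ "?d / (?A + ?E)"]) (simp add: pos_divide_le_eq mult.commute)
qed

text \<open>Converse direction to \<open>nsq_bound\<close>: the homogeneous solution with the data
  of f is bounded below by \<open>nsq_lower\<close> and differs from f only by the effect of h. Thus
  square integrability of f on the line passes to its data.\<close>

lemma initial_bound:
  "\<exists>K>0. \<forall>h f u. psol z h f u \<and> l2p h \<longrightarrow> (cmod (f 0))\<^sup>2 + (cmod (u 0))\<^sup>2 \<le> K * (nsq f + nsq h)"
proof -
  obtain \<kappa> where \<kappa>: "\<kappa> > 0" "\<And>\<alpha> \<beta>. nsq (\<lambda>x. \<alpha> * C z x + \<beta> * S z x) \<ge> \<kappa> * ((cmod \<alpha>)\<^sup>2 + (cmod \<beta>)\<^sup>2)"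
    using nsq_lower[of z] by blast
  define K where "K = (2 + 2 * w1 * w1 * (G z)\<^sup>2) / \<kappa>"
  have K: "K > 0" unfolding K_def using \<kappa>(1) w1_nonneg by (intro divide_pos_pos add_pos_nonneg) auto
  show ?thesis
  proof (intro exI[of _ K] conjI allI impI K)
    fix h f u assume "psol z h f u \<and> l2p h"
    then have s: "psol z h f u" and h: "l2p h" by auto
    let ?f = "\<lambda>x. f 0 * C z x + u 0 * S z x"
    have cf: "continuous_on {0..a} f" by (rule psol_cont[OF s])
    have cF: "continuous_on {0..a} ?f" by (intro continuous_intros C_cont S_cont)
    have cg: "continuous_on {0..a} (\<lambda>x. ?f x - f x)" by (intro continuous_on_diff cF cf)
    have ng: "nsq (\<lambda>x. ?f x - f x) \<le> w1 * (sqrt (w1 * nsq h) * G z)\<^sup>2"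
    proof (rule l2p_bound[OF cg])
      fix x assume "x \<in> {0..a}"
      from psol_decompose[OF s h this]
      show "cmod (?f x - f x) \<le> sqrt (w1 * nsq h) * G z"
        using norm_ge_zero[of "u x - (f 0 * C' z x + u 0 * S' z x)"] norm_minus_commute[of "?f x" "f x"] by linarith
    qed
    have i: "(\<lambda>x. \<bar>w x\<bar> * (cmod (k x))\<^sup>2) integrable_on {0..a}" if "continuous_on {0..a} k" for k
      using l2p_continuous[OF that] by (auto simp: l2p_def intro: absint_intro)
    have "nsq ?f \<le> 2 * nsq f + 2 * nsq (\<lambda>x. ?f x - f x)"
    proof -
      have "nsq ?f \<le> integral {0..a} (\<lambda>x. 2 * (\<bar>w x\<bar> * (cmod (f x))\<^sup>2) + 2 * (\<bar>w x\<bar> * (cmod (?f x - f x))\<^sup>2))"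
        unfolding nsq_def
      proof (rule integral_le)
        fix x
        have "(cmod (f x + (?f x - f x)))\<^sup>2 \<le> 2 * (cmod (f x))\<^sup>2 + 2 * (cmod (?f x - f x))\<^sup>2" by (rule cmod_add_sq_le)
        then have "\<bar>w x\<bar> * (cmod (?f x))\<^sup>2 \<le> \<bar>w x\<bar> * (2 * (cmod (f x))\<^sup>2 + 2 * (cmod (?f x - f x))\<^sup>2)"
          by (intro mult_left_mono) auto
        then show "\<bar>w x\<bar> * (cmod (?f x))\<^sup>2 \<le> 2 * (\<bar>w x\<bar> * (cmod (f x))\<^sup>2) + 2 * (\<bar>w x\<bar> * (cmod (?f x - f x))\<^sup>2)"
          by (simp add: algebra_simps)
      qed (intro integrable_add integrable_on_mult_right i cf cg cF)+
      also have "\<dots> = 2 * nsq f + 2 * nsq (\<lambda>x. ?f x - f x)"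
        unfolding nsq_def using i[OF cf] i[OF cg]
        by (subst Henstock_Kurzweil_Integration.integral_add) (auto intro!: integrable_on_mult_right)
      finally show ?thesis .
    qed
    also have "\<dots> \<le> 2 * nsq f + 2 * w1 * w1 * (G z)\<^sup>2 * nsq h"
      using ng w1_nonneg nsq_nonneg[of h] by (simp add: power_mult_distrib mult_ac)
    also have "\<dots> \<le> (2 + 2 * w1 * w1 * (G z)\<^sup>2) * (nsq f + nsq h)"
      using w1_nonneg nsq_nonneg[of h] nsq_nonneg[of f] by (simp add: algebra_simps)
    finally have "\<kappa> * ((cmod (f 0))\<^sup>2 + (cmod (u 0))\<^sup>2) \<le> (2 + 2 * w1 * w1 * (G z)\<^sup>2) * (nsq f + nsq h)"
      using \<kappa>(2)[of "f 0" "u 0"] by linarith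
    then show "(cmod (f 0))\<^sup>2 + (cmod (u 0))\<^sup>2 \<le> K * (nsq f + nsq h)"
      unfolding K_def using \<kappa>(1) by (simp add: pos_le_divide_eq mult.commute)
  qed
qed

end

lemma young_real:
  fixes \<theta> x y :: real
  assumes "\<theta> > 0" shows "2 * y * x \<le> \<theta> / 2 * y\<^sup>2 + 2 / \<theta> * x\<^sup>2"
proof -
  have "0 \<le> (\<theta> * y - 2 * x)\<^sup>2" by simp
  then have "2 * y * x * (2 * \<theta>) \<le> \<theta> * y * (\<theta> * y) + 4 * (x * x)" by (simp add: power2_eq_square algebra_simps)
  then have "2 * y * x \<le> (\<theta> * y * (\<theta> * y) + 4 * (x * x)) / (2 * \<theta>)" using assms by (simp add: pos_le_divide_eq)
  also have "\<dots> = \<theta> / 2 * y\<^sup>2 + 2 / \<theta> * x\<^sup>2"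
    using assms by (simp add: add_divide_distrib power2_eq_square)
  finally show ?thesis .
qed

context SL begin

subsection \<open>The indefinite form on one period\<close>

definition kr :: "(real \<Rightarrow> complex) \<Rightarrow> real" where
  "kr f = integral {0..a} (\<lambda>x. w x * (cmod (f x))\<^sup>2)"
definition qf :: "(real \<Rightarrow> complex) \<Rightarrow> real" where
  "qf f = integral {0..a} (\<lambda>x. q x * (cmod (f x))\<^sup>2)"
definition En :: "(real \<Rightarrow> complex) \<Rightarrow> real" where
  "En u = integral {0..a} (\<lambda>x. \<bar>1 / p x\<bar> * (cmod (u x))\<^sup>2)"
definition b11 where "b11 z = Re (I (C z) (C z))"
definition b12 where "b12 z = Re (I (C z) (S z))"
definition b22 where "b22 z = Re (I (S z) (S z))"

lemma absr_absint: "(\<lambda>x. \<bar>1 / p x\<bar>) absolutely_integrable_on {0..a}"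
  using absolutely_integrable_norm[OF r_absint] by (simp add: o_def)

lemma absq_absint: "(\<lambda>x. \<bar>q x\<bar>) absolutely_integrable_on {0..a}"
  using absolutely_integrable_norm[OF q_absint] by (simp add: o_def)

lemma weight_sq_int:
  assumes "k absolutely_integrable_on {0..a}" "continuous_on {0..a} f"
  shows "(\<lambda>x. k x * (cmod (f x))\<^sup>2) absolutely_integrable_on {0..a}"
  by (intro absint_mult_real assms continuous_intros)

lemma En_nonneg: "continuous_on {0..a} u \<Longrightarrow> En u \<ge> 0"
  unfolding En_def
  by (intro Henstock_Kurzweil_Integration.integral_nonneg absint_intro weight_sq_int absr_absint) auto

lemma I_real:
  assumes z: "z \<in> \<real>" and f: "\<And>x. x \<in> {0..a} \<Longrightarrow> cnj (f x) = f x" and g: "\<And>x. x \<in> {0..a} \<Longrightarrow> cnj (g x) = g x"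
    and c: "continuous_on {0..a} f" "continuous_on {0..a} g"
  shows "I f g \<in> \<real>"
proof -
  have i: "((\<lambda>x. W x * f x * g x) has_integral I f g) {0..a}"
    unfolding I_def by (intro integrable_integral absint_intro I_integrable c)
  from has_integral_linear[OF this bounded_linear_cnj]
  have "((\<lambda>x. cnj (W x * f x * g x)) has_integral cnj (I f g)) {0..a}" by (simp add: o_def)
  then have "((\<lambda>x. W x * f x * g x) has_integral cnj (I f g)) {0..a}"
    by (rule has_integral_eq[rotated]) (simp add: W_def f g)
  then have "I f g = cnj (I f g)" using i has_integral_unique by blast
  then show ?thesis by (simp add: Reals_cnj_iff)
qed

lemma I_basis_real:
  assumes z: "z \<in> \<real>"
  shows "I (C z) (C z) = of_real (b11 z)" "I (C z) (S z) = of_real (b12 z)" "I (S z) (C z) = of_real (b12 z)"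
    "I (S z) (S z) = of_real (b22 z)"
proof -
  note R = I_real[OF z]
  show "I (C z) (C z) = of_real (b11 z)" "I (C z) (S z) = of_real (b12 z)" "I (S z) (S z) = of_real (b22 z)"
    unfolding b11_def b12_def b22_def
    using R[of "C z" "C z"] R[of "C z" "S z"] R[of "S z" "S z"] basis_real[OF z] C_cont S_cont by simp_all
  moreover have "I (S z) (C z) = I (C z) (S z)" unfolding I_def by (rule arg_cong[where f="integral {0..a}"]) (auto simp: mult_ac)
  ultimately show "I (S z) (C z) = of_real (b12 z)" by simp
qed

text \<open>Minus the derivative of the discriminant on the real axis (\<open>deriv_D_real\<close>),
  written with real entries so that it can be compared with real quadratic forms.\<close>

definition F0 :: "complex \<Rightarrow> real" where
  "F0 z = Re (m12 z) * b11 z + (Re (m22 z) - Re (m11 z)) * b12 z - Re (m21 z) * b22 z"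

lemma of_real_Re: "z \<in> \<real> \<Longrightarrow> of_real (Re z) = z"
  by (simp add: complex_is_Real_iff complex_eq_iff)

lemma deriv_D_real: "z \<in> \<real> \<Longrightarrow> deriv D z = - of_real (F0 z)"
  unfolding deriv_D FF_def I_basis_real F0_def
  by (simp add: of_real_Re M_real algebra_simps)

lemma kr_comb:
  assumes z: "z \<in> \<real>"
  shows "kr (\<lambda>x. \<alpha> * C z x + \<beta> * S z x) = (cmod \<alpha>)\<^sup>2 * b11 z + 2 * Re (\<alpha> * cnj \<beta>) * b12 z + (cmod \<beta>)\<^sup>2 * b22 z"
proof -
  have i: "((\<lambda>x. W x * f x * g x) has_integral I f g) {0..a}" if "continuous_on {0..a} f" "continuous_on {0..a} g" for f g
    unfolding I_def by (intro integrable_integral absint_intro I_integrable that)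
  have "((\<lambda>x. of_real ((cmod \<alpha>)\<^sup>2) * (W x * C z x * C z x) + of_real (2 * Re (\<alpha> * cnj \<beta>)) * (W x * C z x * S z x) + of_real ((cmod \<beta>)\<^sup>2) * (W x * S z x * S z x))
    has_integral (of_real ((cmod \<alpha>)\<^sup>2) * I (C z) (C z) + of_real (2 * Re (\<alpha> * cnj \<beta>)) * I (C z) (S z) + of_real ((cmod \<beta>)\<^sup>2) * I (S z) (S z))) {0..a}"
    by (intro has_integral_add has_integral_mult_right i C_cont S_cont)
  from has_integral_Re[OF this]
  have "((\<lambda>x. Re (of_real ((cmod \<alpha>)\<^sup>2) * (W x * C z x * C z x) + of_real (2 * Re (\<alpha> * cnj \<beta>)) * (W x * C z x * S z x) + of_real ((cmod \<beta>)\<^sup>2) * (W x * S z x * S z x)))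
     has_integral ((cmod \<alpha>)\<^sup>2 * b11 z + 2 * Re (\<alpha> * cnj \<beta>) * b12 z + (cmod \<beta>)\<^sup>2 * b22 z)) {0..a}"
    unfolding I_basis_real[OF z] by simp
  moreover have "Re (of_real ((cmod \<alpha>)\<^sup>2) * (W x * C z x * C z x) + of_real (2 * Re (\<alpha> * cnj \<beta>)) * (W x * C z x * S z x) + of_real ((cmod \<beta>)\<^sup>2) * (W x * S z x * S z x))
      = w x * (cmod (\<alpha> * C z x + \<beta> * S z x))\<^sup>2" if x: "x \<in> {0..a}" for x
  proof -
    have "C z x = of_real (Re (C z x))" "S z x = of_real (Re (S z x))"
      using basis_real[OF z x] by (simp_all add: of_real_Re Reals_cnj_iff)
    then obtain c s where cs: "C z x = complex_of_real c" "S z x = complex_of_real s" by blast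
    show ?thesis unfolding cs cmod_power2 W_def by (simp add: power2_eq_square algebra_simps)
  qed
  ultimately have "((\<lambda>x. w x * (cmod (\<alpha> * C z x + \<beta> * S z x))\<^sup>2) has_integral ((cmod \<alpha>)\<^sup>2 * b11 z + 2 * Re (\<alpha> * cnj \<beta>) * b12 z + (cmod \<beta>)\<^sup>2 * b22 z)) {0..a}"
    by (rule has_integral_eq[rotated]) 
  then show ?thesis unfolding kr_def by (rule integral_unique)
qed

text \<open>Replacing f by the homogeneous solution with the same data costs a product of the size
  of the data and the norm of h. Young's inequality splits it, and \<theta> stays free so that the
  share of the data can be absorbed later.\<close>

lemma kr_form:
  assumes z: "z \<in> \<real>"
  shows "\<exists>K>0. \<forall>h f u \<theta>. psol z h f u \<and> l2p h \<and> 0 < \<theta> \<and> \<theta> \<le> 1 \<longrightarrow>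
    \<bar>kr f - ((cmod (f 0))\<^sup>2 * b11 z + 2 * Re (f 0 * cnj (u 0)) * b12 z + (cmod (u 0))\<^sup>2 * b22 z)\<bar>
      \<le> \<theta> * ((cmod (f 0))\<^sup>2 + (cmod (u 0))\<^sup>2) + K / \<theta> * nsq h"
proof -
  define g where "g = G z"
  have g: "g > 0" unfolding g_def by (rule G_pos)
  define K where "K = 2 * (w1 * g\<^sup>2)\<^sup>2 * w1 + w1 * g\<^sup>2 * w1 + 1"
  have K: "K > 0" unfolding K_def using w1_nonneg g by (intro add_nonneg_pos) auto
  show ?thesis
  proof (intro exI[of _ K] conjI allI impI K)
    fix h f u and \<theta> :: real assume A: "psol z h f u \<and> l2p h \<and> 0 < \<theta> \<and> \<theta> \<le> 1"
    then have s: "psol z h f u" and h: "l2p h" and \<theta>: "0 < \<theta>" "\<theta> \<le> 1" by auto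
    let ?f = "\<lambda>x. f 0 * C z x + u 0 * S z x"
    define y t where "y = cmod (f 0) + cmod (u 0)" and "t = sqrt (w1 * nsq h)"
    have t0: "t \<ge> 0" and y0: "y \<ge> 0" unfolding t_def y_def using w1_nonneg nsq_nonneg[of h] by auto
    have t2: "t\<^sup>2 = w1 * nsq h" unfolding t_def using w1_nonneg nsq_nonneg[of h] by simp
    have cf: "continuous_on {0..a} f" by (rule psol_cont[OF s])
    have cF: "continuous_on {0..a} ?f" by (intro continuous_intros C_cont S_cont)
    have e1: "kr f - kr ?f = integral {0..a} (\<lambda>x. w x * (cmod (f x))\<^sup>2 - w x * (cmod (?f x))\<^sup>2)"
      unfolding kr_def by (intro Henstock_Kurzweil_Integration.integral_diff[symmetric] absint_intro weight_sq_int w_absint cf cF)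
    have e2: "norm (integral {0..a} (\<lambda>x. w x * (cmod (f x))\<^sup>2 - w x * (cmod (?f x))\<^sup>2)) \<le> integral {0..a} (\<lambda>x. \<bar>w x\<bar> * ((2 * y + t) * g * (t * g)))"
    proof (rule integral_norm_bound_integral)
      fix x assume x: "x \<in> {0..a}"
      have d: "cmod (f x - ?f x) \<le> t * g"
        using psol_decompose[OF s h x] norm_ge_zero[of "u x - (f 0 * C' z x + u 0 * S' z x)"] unfolding t_def g_def by linarith
      have b1: "cmod (f x) \<le> (y + t) * g"
        using psol_bound[OF s h x] norm_ge_zero[of "u x"] unfolding y_def t_def g_def by linarith
      have b2: "cmod (?f x) \<le> y * g"
      proof -
        have "cmod (?f x) + cmod (f 0 * C' z x + u 0 * S' z x) \<le> (cmod (f 0) + cmod (u 0)) * G z"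
          using psol_bound[OF comb_psol[of z "f 0" "u 0"] l2p_zero x] by (simp add: nsq_zero C_0 S_0)
        then show ?thesis using norm_ge_zero[of "f 0 * C' z x + u 0 * S' z x"] unfolding y_def g_def by linarith
      qed
      have "norm (w x * (cmod (f x))\<^sup>2 - w x * (cmod (?f x))\<^sup>2) = \<bar>w x\<bar> * (\<bar>cmod (f x) - cmod (?f x)\<bar> * (cmod (f x) + cmod (?f x)))"
      proof -
        have "w x * (cmod (f x))\<^sup>2 - w x * (cmod (?f x))\<^sup>2 = w x * ((cmod (f x) - cmod (?f x)) * (cmod (f x) + cmod (?f x)))"
          by (simp add: power2_eq_square algebra_simps)
        then show ?thesis by (simp only: real_norm_def abs_mult) simp
      qed
      also have "\<dots> \<le> \<bar>w x\<bar> * ((t * g) * ((2 * y + t) * g))"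
      proof (intro mult_left_mono mult_mono)
        show "\<bar>cmod (f x) - cmod (?f x)\<bar> \<le> t * g" using norm_triangle_ineq3[of "f x" "?f x"] d by linarith
        have "(2 * y + t) * g = (y + t) * g + y * g" by (simp add: algebra_simps)
        then show "cmod (f x) + cmod (?f x) \<le> (2 * y + t) * g" using b1 b2 by linarith
      qed (use t0 g in auto)
      finally show "norm (w x * (cmod (f x))\<^sup>2 - w x * (cmod (?f x))\<^sup>2) \<le> \<bar>w x\<bar> * ((2 * y + t) * g * (t * g))"
        by (simp add: mult_ac)
    next
      show "(\<lambda>x. \<bar>w x\<bar> * ((2 * y + t) * g * (t * g))) integrable_on {0..a}" by (intro integrable_on_mult_left absint_intro absw_absint)
    qed (intro integrable_diff absint_intro weight_sq_int w_absint cf cF)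
    have e3: "integral {0..a} (\<lambda>x. \<bar>w x\<bar> * ((2 * y + t) * g * (t * g))) = w1 * ((2 * y + t) * g * (t * g))"
      unfolding w1_def by (rule Henstock_Kurzweil_Integration.integral_mult_left)
    have "\<bar>kr f - kr ?f\<bar> \<le> w1 * ((2 * y + t) * g * (t * g))"
      using e2 unfolding e1[symmetric] e3 by simp
    also have "\<dots> = 2 * y * (w1 * g\<^sup>2 * t) + w1 * g\<^sup>2 * t\<^sup>2" by (simp add: power2_eq_square algebra_simps)
    also have "\<dots> \<le> (\<theta> / 2 * y\<^sup>2 + 2 / \<theta> * (w1 * g\<^sup>2 * t)\<^sup>2) + (w1 * g\<^sup>2 * t\<^sup>2) / \<theta>"
    proof (rule add_mono)
      show "2 * y * (w1 * g\<^sup>2 * t) \<le> \<theta> / 2 * y\<^sup>2 + 2 / \<theta> * (w1 * g\<^sup>2 * t)\<^sup>2" by (rule young_real[OF \<theta>(1)])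
      have "w1 * g\<^sup>2 * t\<^sup>2 * \<theta> \<le> w1 * g\<^sup>2 * t\<^sup>2 * 1" using \<theta> w1_nonneg by (intro mult_left_mono) auto
      then show "w1 * g\<^sup>2 * t\<^sup>2 \<le> (w1 * g\<^sup>2 * t\<^sup>2) / \<theta>" using \<theta> by (simp add: pos_le_divide_eq)
    qed
    also have "\<dots> = \<theta> / 2 * y\<^sup>2 + (2 * (w1 * g\<^sup>2)\<^sup>2 * w1 + w1 * g\<^sup>2 * w1) / \<theta> * nsq h"
    proof -
      have "2 / \<theta> * (X * (W' * n)) + Y * (W' * n) / \<theta> = (2 * X * W' + Y * W') / \<theta> * n" for X Y W' n :: real
        by (simp add: divide_inverse algebra_simps)
      note e = this[of "(w1 * g\<^sup>2)\<^sup>2" w1 "nsq h" "w1 * g\<^sup>2"]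
      show ?thesis
        unfolding power_mult_distrib[of "w1 * g\<^sup>2" t] t2 by (simp only: add.assoc e)
    qed
    also have "\<dots> \<le> \<theta> * ((cmod (f 0))\<^sup>2 + (cmod (u 0))\<^sup>2) + K / \<theta> * nsq h"
    proof (rule add_mono)
      have "y\<^sup>2 \<le> 2 * ((cmod (f 0))\<^sup>2 + (cmod (u 0))\<^sup>2)"
        unfolding y_def using sum_squares_bound[of "cmod (f 0)" "cmod (u 0)"] by (simp add: power2_eq_square algebra_simps)
      then have "\<theta> / 2 * y\<^sup>2 \<le> \<theta> / 2 * (2 * ((cmod (f 0))\<^sup>2 + (cmod (u 0))\<^sup>2))" using \<theta> by (intro mult_left_mono) auto
      then show "\<theta> / 2 * y\<^sup>2 \<le> \<theta> * ((cmod (f 0))\<^sup>2 + (cmod (u 0))\<^sup>2)" by (simp add: algebra_simps)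
      show "(2 * (w1 * g\<^sup>2)\<^sup>2 * w1 + w1 * g\<^sup>2 * w1) / \<theta> * nsq h \<le> K / \<theta> * nsq h"
        using \<theta> nsq_nonneg[of h] by (intro mult_right_mono divide_right_mono) (auto simp: K_def)
    qed
    finally show "\<bar>kr f - ((cmod (f 0))\<^sup>2 * b11 z + 2 * Re (f 0 * cnj (u 0)) * b12 z + (cmod (u 0))\<^sup>2 * b22 z)\<bar>
      \<le> \<theta> * ((cmod (f 0))\<^sup>2 + (cmod (u 0))\<^sup>2) + K / \<theta> * nsq h"
      by (simp only: kr_comb[OF z])
  qed
qed

text \<open>Green's identity, from the derivative of u * cnj f over one period. It is kept in
  complex form: its real part gives the sign estimate for real parameters, and the full identity
  determines z for Floquet solutions.\<close>

lemma energy: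
  assumes s: "psol z h f u"
  shows "of_real (En u + qf f) - z * of_real (kr f) - integral {0..a} (\<lambda>x. W x * h x * cnj (f x)) = u a * cnj (f a) - u 0 * cnj (f 0)"
    "(\<lambda>x. W x * h x * cnj (f x)) absolutely_integrable_on {0..a}"
proof -
  have F: "prim_on 0 a (\<lambda>x. R x * u x) f" and U: "prim_on 0 a (\<lambda>x. P z x * f x - W x * h x) u" using s by (auto simp: psol_def)
  have cf: "continuous_on {0..a} f" and cu: "continuous_on {0..a} u" by (rule psol_cont[OF s])+
  show Wh: "(\<lambda>x. W x * h x * cnj (f x)) absolutely_integrable_on {0..a}"
    by (intro absint_mult psol_Wh[OF s] continuous_intros cf)
  have "prim_on 0 a (\<lambda>x. u x * cnj (R x * u x) + (P z x * f x - W x * h x) * cnj (f x)) (\<lambda>x. u x * cnj (f x))"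
    by (intro prim_on_mult U prim_on_linear[OF F bounded_linear_cnj])
  from prim_on_integral[OF this, of 0 a]
  have 1: "((\<lambda>x. u x * cnj (R x * u x) + (P z x * f x - W x * h x) * cnj (f x)) has_integral (u a * cnj (f a) - u 0 * cnj (f 0))) {0..a}"
    using a_pos by simp
  have h: "((\<lambda>x. complex_of_real (k x * (cmod (g x))\<^sup>2)) has_integral of_real (integral {0..a} (\<lambda>x. k x * (cmod (g x))\<^sup>2))) {0..a}"
    if "k absolutely_integrable_on {0..a}" "continuous_on {0..a} g" for k g
    using has_integral_linear[OF integrable_integral[OF absint_intro[OF weight_sq_int[OF that]]] bounded_linear_of_real] by (simp add: o_def)
  \<comment> \<open>\<open>En\<close> is built with |1/p|, which makes it nonnegative outright;
    positivity of p almost everywhere identifies it with the integral in Green's identity.\<close>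
  have hE: "((\<lambda>x. complex_of_real (1 / p x * (cmod (u x))\<^sup>2)) has_integral of_real (En u)) {0..a}"
  proof -
    obtain N where N: "N \<in> null_sets lebesgue" "{x. \<not> p x > 0} \<subseteq> N"
      using p_pos by (auto simp: eventually_ae_filter)
    show ?thesis
    proof (rule has_integral_spike[OF _ _ h[OF absr_absint cu, folded En_def], of N])
      show "negligible N" using N by (simp add: negligible_iff_null_sets)
      fix x assume "x \<in> {0..a} - N"
      then have "p x > 0" using N(2) by auto
      then show "complex_of_real (1 / p x * (cmod (u x))\<^sup>2) = complex_of_real (\<bar>1 / p x\<bar> * (cmod (u x))\<^sup>2)" by simp
    qed
  qed
  have 2: "((\<lambda>x. complex_of_real (1 / p x * (cmod (u x))\<^sup>2) + of_real (q x * (cmod (f x))\<^sup>2) - z * of_real (w x * (cmod (f x))\<^sup>2) - W x * h x * cnj (f x))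
      has_integral (of_real (En u) + of_real (qf f) - z * of_real (kr f) - integral {0..a} (\<lambda>x. W x * h x * cnj (f x)))) {0..a}"
    unfolding kr_def qf_def
    by (intro has_integral_diff has_integral_add has_integral_mult_right hE h w_absint q_absint cf integrable_integral absint_intro Wh)
  have eq: "complex_of_real (1 / p x * (cmod (u x))\<^sup>2) + of_real (q x * (cmod (f x))\<^sup>2) - z * of_real (w x * (cmod (f x))\<^sup>2) - W x * h x * cnj (f x)
     = u x * cnj (R x * u x) + (P z x * f x - W x * h x) * cnj (f x)" for x
    unfolding of_real_mult complex_norm_square P_def Q_def W_def R_def by (simp add: algebra_simps)
  show "of_real (En u + qf f) - z * of_real (kr f) - integral {0..a} (\<lambda>x. W x * h x * cnj (f x)) = u a * cnj (f a) - u 0 * cnj (f 0)"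
    using has_integral_unique[OF 2[unfolded eq] 1] by simp
qed

text \<open>Exact controllability of the end values. Pairing with C and S by the Lagrange identity
  turns the two end conditions into a linear system with the Gram matrix. The factor sgn w in the
  forcing turns w into |w|, and real z makes C and S real, so that the bilinear pairing is the inner
  product.\<close>

lemma control:
  assumes z: "z \<in> \<real>"
  shows "\<exists>\<gamma> \<delta> f u. psol z (\<lambda>x. of_real (sgn (w x)) * (\<gamma> * C z x + \<delta> * S z x)) f u \<and> f 0 = 0 \<and> u 0 = 0 \<and> f a = \<alpha> \<and> u a = \<beta>"
proof -
  let ?A = "nsq (C z)" and ?E = "nsq (S z)"
  define B where "B = Re (gramB z)"
  have S_r: "cnj (S z x) = S z x" and C_r: "cnj (C z x) = C z x" if "x \<in> {0..a}" for x using basis_real[OF z that] by auto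
  have absW: "((\<lambda>x. of_real \<bar>w x\<bar> * (f x * g x)) has_integral integral {0..a} (\<lambda>x. of_real \<bar>w x\<bar> * (f x * g x))) {0..a}"
    if "continuous_on {0..a} f" "continuous_on {0..a} g" for f g :: "real \<Rightarrow> complex"
    by (intro integrable_integral absint_intro absint_mult absW_absint continuous_intros that)
  have sq: "((\<lambda>x. of_real \<bar>w x\<bar> * (g x * g x)) has_integral of_real (nsq g)) {0..a}"
    if c: "continuous_on {0..a} g" and r: "\<And>x. x \<in> {0..a} \<Longrightarrow> cnj (g x) = g x" for g
  proof -
    have "((\<lambda>x. complex_of_real (\<bar>w x\<bar> * (cmod (g x))\<^sup>2)) has_integral of_real (nsq g)) {0..a}"
      unfolding nsq_def
      using has_integral_linear[OF integrable_integral[OF absint_intro[OF weight_sq_int[OF absw_absint c]]] bounded_linear_of_real] by (simp add: o_def)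
    then show ?thesis
    proof (rule has_integral_eq[rotated])
      fix x assume "x \<in> {0..a}"
      then show "complex_of_real (\<bar>w x\<bar> * (cmod (g x))\<^sup>2) = of_real \<bar>w x\<bar> * (g x * g x)"
        unfolding of_real_mult complex_norm_square using r by simp
    qed
  qed
  have AC: "((\<lambda>x. of_real \<bar>w x\<bar> * (C z x * C z x)) has_integral of_real ?A) {0..a}"
    and ES: "((\<lambda>x. of_real \<bar>w x\<bar> * (S z x * S z x)) has_integral of_real ?E) {0..a}"
    by (rule sq; use C_cont S_cont C_r S_r in blast)+
  have BCS: "((\<lambda>x. of_real \<bar>w x\<bar> * (C z x * S z x)) has_integral gramB z) {0..a}"
  proof -
    have "((\<lambda>x. of_real \<bar>w x\<bar> * (C z x * cnj (S z x))) has_integral gramB z) {0..a}"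
      unfolding gramB_def by (intro absW C_cont continuous_on_cnj S_cont)
    then show ?thesis by (rule has_integral_eq[rotated]) (simp add: S_r)
  qed
  have Br: "gramB z = of_real B"
  proof -
    have "((\<lambda>x. cnj (of_real \<bar>w x\<bar> * (C z x * S z x))) has_integral cnj (gramB z)) {0..a}"
      using has_integral_linear[OF BCS bounded_linear_cnj] by (simp add: o_def)
    then have "((\<lambda>x. of_real \<bar>w x\<bar> * (C z x * S z x)) has_integral cnj (gramB z)) {0..a}"
      by (rule has_integral_eq[rotated]) (simp add: S_r C_r)
    then have "gramB z = cnj (gramB z)" using BCS has_integral_unique by blast
    then show ?thesis unfolding B_def by (metis Reals_cnj_iff of_real_Re)
  qed
  define d where "d = ?A * ?E - B\<^sup>2"
  have d: "d > 0" using gram_det_pos[of z] unfolding d_def Br by simp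
  \<comment> \<open>X and Z are the values that the Lagrange identity demands of the pairings of the
    forcing with C and S; \<gamma> and \<delta> then come from Cramer's rule.\<close>
  define X Z where "X = \<alpha> * m21 z - \<beta> * m11 z" and "Z = \<alpha> * m22 z - \<beta> * m12 z"
  define \<gamma> \<delta> where "\<gamma> = (of_real ?E * X - of_real B * Z) / of_real d" and "\<delta> = (of_real ?A * Z - of_real B * X) / of_real d"
  have dc: "complex_of_real d \<noteq> 0" using d by simp
  have dA: "complex_of_real d = of_real ?A * of_real ?E - of_real B * of_real B" unfolding d_def by (simp add: power2_eq_square)
  have solve: "\<gamma> * of_real ?A + \<delta> * of_real B = X" "\<gamma> * of_real B + \<delta> * of_real ?E = Z"
  proof -
    have g: "\<gamma> * of_real d = of_real ?E * X - of_real B * Z" "\<delta> * of_real d = of_real ?A * Z - of_real B * X"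
      using dc by (simp_all add: \<gamma>_def \<delta>_def)
    have "(\<gamma> * of_real ?A + \<delta> * of_real B) * of_real d = (\<gamma> * of_real d) * of_real ?A + (\<delta> * of_real d) * of_real B"
      by (simp add: algebra_simps)
    also have "\<dots> = X * of_real d" unfolding g by (simp add: dA algebra_simps)
    finally show "\<gamma> * of_real ?A + \<delta> * of_real B = X" using dc by simp
    have "(\<gamma> * of_real B + \<delta> * of_real ?E) * of_real d = (\<gamma> * of_real d) * of_real B + (\<delta> * of_real d) * of_real ?E"
      by (simp add: algebra_simps)
    also have "\<dots> = Z * of_real d" unfolding g by (simp add: dA algebra_simps)
    finally show "\<gamma> * of_real B + \<delta> * of_real ?E = Z" using dc by simp
  qed
  let ?h = "\<lambda>x. of_real (sgn (w x)) * (\<gamma> * C z x + \<delta> * S z x)"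
  have Wh: "W x * ?h x = of_real \<bar>w x\<bar> * (\<gamma> * C z x + \<delta> * S z x)" for x
  proof -
    have "w x * sgn (w x) = \<bar>w x\<bar>" by (simp add: sgn_if)
    then show ?thesis unfolding W_def by (metis mult.assoc of_real_mult)
  qed
  have "(\<lambda>x. W x * ?h x) absolutely_integrable_on {0..a}"
    unfolding Wh by (intro absint_mult absW_absint continuous_intros C_cont S_cont)
  then obtain f u where f: "psol z ?h f u" "f 0 = 0" "u 0 = 0" using psol_exists[of ?h] by blast
  have e1: "u a * m11 z - f a * m21 z = \<beta> * m11 z - \<alpha> * m21 z"
  proof -
    have 1: "((\<lambda>x. - (W x * ?h x * C z x)) has_integral (u a * m11 z - f a * m21 z)) {0..a}"
      using lagrange[OF f(1) C_psol[of z]] by (simp add: f C_0 m11_def m21_def)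
    have 2: "((\<lambda>x. - (\<gamma> * (of_real \<bar>w x\<bar> * (C z x * C z x)) + \<delta> * (of_real \<bar>w x\<bar> * (C z x * S z x)))) has_integral - (\<gamma> * of_real ?A + \<delta> * of_real B)) {0..a}"
      using BCS unfolding Br by (intro has_integral_neg has_integral_add has_integral_mult_right AC)
    have eq: "- (W x * ?h x * C z x) = - (\<gamma> * (of_real \<bar>w x\<bar> * (C z x * C z x)) + \<delta> * (of_real \<bar>w x\<bar> * (C z x * S z x)))" for x
      unfolding Wh by (simp add: algebra_simps)
    have "u a * m11 z - f a * m21 z = - (\<gamma> * of_real ?A + \<delta> * of_real B)"
      by (rule has_integral_unique[OF 1[unfolded eq] 2])
    then show ?thesis unfolding solve X_def by simp
  qed
  have e2: "u a * m12 z - f a * m22 z = \<beta> * m12 z - \<alpha> * m22 z"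
  proof -
    have 1: "((\<lambda>x. - (W x * ?h x * S z x)) has_integral (u a * m12 z - f a * m22 z)) {0..a}"
      using lagrange[OF f(1) S_psol[of z]] by (simp add: f S_0 m12_def m22_def)
    have 2: "((\<lambda>x. - (\<gamma> * (of_real \<bar>w x\<bar> * (C z x * S z x)) + \<delta> * (of_real \<bar>w x\<bar> * (S z x * S z x)))) has_integral - (\<gamma> * of_real B + \<delta> * of_real ?E)) {0..a}"
      using BCS unfolding Br by (intro has_integral_neg has_integral_add has_integral_mult_right ES)
    have eq: "- (W x * ?h x * S z x) = - (\<gamma> * (of_real \<bar>w x\<bar> * (C z x * S z x)) + \<delta> * (of_real \<bar>w x\<bar> * (S z x * S z x)))" for x
      unfolding Wh by (simp add: algebra_simps)
    have "u a * m12 z - f a * m22 z = - (\<gamma> * of_real B + \<delta> * of_real ?E)"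
      by (rule has_integral_unique[OF 1[unfolded eq] 2])
    then show ?thesis unfolding solve Z_def by simp
  qed
  have "(u a - \<beta>) * (m11 z * m22 z - m12 z * m21 z) = m22 z * (u a * m11 z - f a * m21 z - (\<beta> * m11 z - \<alpha> * m21 z)) - m21 z * (u a * m12 z - f a * m22 z - (\<beta> * m12 z - \<alpha> * m22 z))"
    by (simp add: algebra_simps)
  then have ub: "u a = \<beta>" unfolding det_M e1 e2 by simp
  have "(f a - \<alpha>) * (m11 z * m22 z - m12 z * m21 z) = m12 z * (u a * m11 z - f a * m21 z - (\<beta> * m11 z - \<alpha> * m21 z)) - m11 z * (u a * m12 z - f a * m22 z - (\<beta> * m12 z - \<alpha> * m22 z))"
    by (simp add: algebra_simps)
  then have "f a = \<alpha>" unfolding det_M e1 e2 by simp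
  then show ?thesis using f ub by blast
qed

end

subsection \<open>Large spectral parameters\<close>

lemma indefinite_small:
  fixes k :: "real \<Rightarrow> real"
  assumes k: "k absolutely_integrable_on {c..d}" "\<And>x. k x \<ge> 0" and e: "e > 0"
  obtains \<delta> where "\<delta> > 0" "\<And>x y. c \<le> x \<Longrightarrow> x \<le> y \<Longrightarrow> y \<le> d \<Longrightarrow> y - x \<le> \<delta> \<Longrightarrow> integral {x..y} k \<le> e"
proof -
  define K where "K = (\<lambda>x. 0 + integral {c..x} k)"
  have PK: "prim_on c d k K" unfolding K_def by (rule prim_on_indefinite[OF k(1)])
  have "uniformly_continuous_on {c..d} K"
    by (rule compact_uniformly_continuous[OF prim_on_continuous[OF PK]]) simp
  then obtain \<delta> where \<delta>: "\<delta> > 0" "\<And>x y. x \<in> {c..d} \<Longrightarrow> y \<in> {c..d} \<Longrightarrow> dist y x < \<delta> \<Longrightarrow> dist (K y) (K x) < e"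
    using e unfolding uniformly_continuous_on_def by meson
  show ?thesis
  proof (rule that[of "\<delta>/2"])
    fix x y assume xy: "c \<le> x" "x \<le> y" "y \<le> d" "y - x \<le> \<delta>/2"
    have "integral {x..y} k = K y - K x" by (rule integral_unique[OF prim_on_integral[OF PK xy(1-3)]])
    also have "\<dots> \<le> e" using \<delta>(2)[of x y] xy \<delta>(1) by (auto simp: dist_real_def abs_le_iff)
    finally show "integral {x..y} k \<le> e" .
  qed (use \<delta> in auto)
qed

lemma integral_pos_ae:
  fixes k :: "real \<Rightarrow> real"
  assumes k: "k absolutely_integrable_on {c..d}" "\<And>x. k x \<ge> 0" and cd: "c < d" and ae: "AE x in lebesgue. k x \<noteq> 0"
  shows "integral {c..d} k > 0"
proof (rule ccontr)
  assume "\<not> integral {c..d} k > 0"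
  then have "AE x in lebesgue. x \<in> {c<..<d} \<longrightarrow> k x = 0" by (intro integral_zero_ae k) simp
  with ae have "AE x in lebesgue. x \<notin> {c<..<d}" by eventually_elim auto
  then have "{c<..<d} \<in> null_sets lebesgue" using AE_iff_null_sets[of "{c<..<d}" lebesgue] by simp
  then have "emeasure lebesgue {c<..<d} = 0" by auto
  then show False using cd by simp
qed

context SL begin

lemma w_sub: "0 \<le> s \<Longrightarrow> t \<le> a \<Longrightarrow> w absolutely_integrable_on {s..t}"
  by (rule absint_subinterval[OF w_absint])
lemma absw_sub: "0 \<le> s \<Longrightarrow> t \<le> a \<Longrightarrow> (\<lambda>x. \<bar>w x\<bar>) absolutely_integrable_on {s..t}"
  by (rule absint_subinterval[OF absw_absint])
lemma absr_sub: "0 \<le> s \<Longrightarrow> t \<le> a \<Longrightarrow> (\<lambda>x. \<bar>1 / p x\<bar>) absolutely_integrable_on {s..t}"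
  by (rule absint_subinterval[OF absr_absint])

text \<open>A Lebesgue point of the weight yields a subinterval on which it hardly changes sign.\<close>

lemma good_interval:
  assumes cd: "0 \<le> c" "c < d" "d \<le> a"
  obtains s t where "c \<le> s" "s < t" "t \<le> d" "integral {s..t} (\<lambda>x. \<bar>w x\<bar>) > 0"
    "\<bar>integral {s..t} w\<bar> \<ge> 3/4 * integral {s..t} (\<lambda>x. \<bar>w x\<bar>)"
proof -
  define U V where "U = (\<lambda>x. 0 + integral {0..x} w)" and "V = (\<lambda>x. 0 + integral {0..x} (\<lambda>x. \<bar>w x\<bar>))"
  have PU: "prim_on 0 a w U" unfolding U_def by (rule prim_on_indefinite[OF w_absint])
  have PV: "prim_on 0 a (\<lambda>x. \<bar>w x\<bar>) V" unfolding V_def by (rule prim_on_indefinite[OF absw_absint])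
  have "AE x in lebesgue. x \<in> {0<..<a} \<longrightarrow> (U has_real_derivative w x) (at x) \<and> (V has_real_derivative \<bar>w x\<bar>) (at x) \<and> w x \<noteq> 0"
    using prim_on_deriv_real[OF PU] prim_on_deriv_real[OF PV] w_nz by eventually_elim auto
  then obtain N where N: "N \<in> null_sets lebesgue"
    "{x. \<not> (x \<in> {0<..<a} \<longrightarrow> (U has_real_derivative w x) (at x) \<and> (V has_real_derivative \<bar>w x\<bar>) (at x) \<and> w x \<noteq> 0)} \<subseteq> N"
    by (auto simp: eventually_ae_filter)
  have "\<not> {c<..<d} \<subseteq> N"
  proof
    assume "{c<..<d} \<subseteq> N"
    then have "{c<..<d} \<in> null_sets lebesgue" using N(1) by (rule null_sets_subset[rotated 2]) auto
    then have "emeasure lebesgue {c<..<d} = 0" by auto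
    then show False using cd by simp
  qed
  then obtain x where "x \<in> {c<..<d}" "x \<notin> N" by blast
  then have x: "c < x" "x < d" "x \<notin> N" by auto
  then have "x \<in> {0<..<a}" using cd by auto
  then have D: "(U has_real_derivative w x) (at x)" "(V has_real_derivative \<bar>w x\<bar>) (at x)" "w x \<noteq> 0" using N(2) x by blast+
  \<comment> \<open>With an error of 1/8 the difference quotients of the integrals of w and of |w|
    exceed 7/8 |w x| in modulus and stay below 9/8 |w x| respectively; their ratio 7/9 exceeds
    3/4.\<close>
  define e where "e = \<bar>w x\<bar> / 8"
  have e: "e > 0" using D(3) by (simp add: e_def)
  obtain \<delta>1 where d1: "\<delta>1 > 0" "\<And>y. y \<noteq> x \<Longrightarrow> norm (y - x) < \<delta>1 \<Longrightarrow> norm ((U y - U x) / (y - x) - w x) < e"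
    using D(1) e unfolding has_field_derivative_iff LIM_eq by meson
  obtain \<delta>2 where d2: "\<delta>2 > 0" "\<And>y. y \<noteq> x \<Longrightarrow> norm (y - x) < \<delta>2 \<Longrightarrow> norm ((V y - V x) / (y - x) - \<bar>w x\<bar>) < e"
    using D(2) e unfolding has_field_derivative_iff LIM_eq by meson
  define y where "y = min d (x + min \<delta>1 \<delta>2 / 2)"
  have y: "x < y" "y \<le> d" "y - x < \<delta>1" "y - x < \<delta>2" using d1 d2 x by (auto simp: y_def min_def)
  have Ui: "integral {x..y} w = U y - U x" using y x cd by (intro integral_unique[OF prim_on_integral[OF PU]]) auto
  have Vi: "integral {x..y} (\<lambda>x. \<bar>w x\<bar>) = V y - V x" using y x cd by (intro integral_unique[OF prim_on_integral[OF PV]]) auto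
  have q1: "\<bar>(U y - U x) / (y - x)\<bar> > 7/8 * \<bar>w x\<bar>" 
  proof -
    have "\<bar>(U y - U x) / (y - x) - w x\<bar> < \<bar>w x\<bar> / 8" using d1(2)[of y] y by (simp add: e_def)
    then show ?thesis by linarith
  qed
  have q2: "\<bar>(V y - V x) / (y - x) - \<bar>w x\<bar>\<bar> < \<bar>w x\<bar> / 8" using d2(2)[of y] y by (simp add: e_def)
  have "(V y - V x) / (y - x) < 9/8 * \<bar>w x\<bar>" "(V y - V x) / (y - x) > 0" using q2 D(3) by linarith+
  then have V: "V y - V x < 9/8 * \<bar>w x\<bar> * (y - x)" "V y - V x > 0"
    using y(1) by (auto simp: pos_divide_less_eq zero_less_divide_iff)
  have "7/8 * \<bar>w x\<bar> * (y - x) < \<bar>U y - U x\<bar>" using q1 y(1) by (simp add: abs_divide pos_less_divide_eq)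
  moreover have "\<bar>w x\<bar> * (y - x) > 0" using D(3) y(1) by simp
  moreover have "3/4 * v \<le> u" if "7/8 * A < u" "A > 0" "v < 9/8 * A" for u v A :: real using that by linarith
  ultimately have "3/4 * (V y - V x) \<le> \<bar>U y - U x\<bar>" using V(1) unfolding mult.assoc by blast
  then show ?thesis using V(2) y x by (intro that[of x y]) (auto simp: Ui Vi)
qed

text \<open>Cauchy-Schwarz for f' = u/p with respect to the measure dx/p: f oscillates little where
  1/p has small mass.\<close>

lemma osc_bound:
  assumes s: "psol z h f u" and xy: "0 \<le> x" "x \<le> y" "y \<le> a"
  shows "cmod (f y - f x) \<le> sqrt (integral {x..y} (\<lambda>t. \<bar>1 / p t\<bar>) * En u)"
proof -
  have F: "prim_on 0 a (\<lambda>x. R x * u x) f" using s by (simp add: psol_def)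
  have cu: "continuous_on {0..a} u" by (rule psol_cont[OF s])
  have i: "((\<lambda>x. R x * u x) has_integral f y - f x) {x..y}" by (rule prim_on_integral[OF F xy])
  have ai: "(\<lambda>x. R x * u x) absolutely_integrable_on {x..y}" by (rule absint_subinterval[OF prim_on_absint[OF F] xy(1,3)])
  have ru: "(\<lambda>t. \<bar>1 / p t\<bar> * (cmod (u t))\<^sup>2) absolutely_integrable_on {x..y}"
    by (rule absint_subinterval[OF weight_sq_int[OF absr_absint cu] xy(1,3)])
  have "cmod (f y - f x) \<le> integral {x..y} (\<lambda>t. cmod (R t * u t))"
    using norm_integral_le[OF ai] i by (simp add: integral_unique)
  also have "(\<lambda>t. cmod (R t * u t)) = (\<lambda>t. \<bar>1 / p t\<bar> * (1 * cmod (u t)))" by (auto simp: R_def norm_mult norm_divide)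
  also have "integral {x..y} (\<lambda>t. \<bar>1 / p t\<bar> * (1 * cmod (u t))) \<le>
     sqrt (integral {x..y} (\<lambda>t. \<bar>1 / p t\<bar> * 1\<^sup>2) * integral {x..y} (\<lambda>t. \<bar>1 / p t\<bar> * (cmod (u t))\<^sup>2))"
  proof (rule integral_CS)
    show "(\<lambda>t. \<bar>1 / p t\<bar> * (1 * cmod (u t))) integrable_on {x..y}"
      using absint_intro[OF absint_cnorm[OF ai]] by (simp add: R_def norm_mult norm_divide)
  qed (use absr_sub[OF xy(1,3)] ru in \<open>auto intro: absint_intro\<close>)
  also have "\<dots> \<le> sqrt (integral {x..y} (\<lambda>t. \<bar>1 / p t\<bar>) * En u)"
  proof (intro real_sqrt_le_mono)
    have "integral {x..y} (\<lambda>t. \<bar>1 / p t\<bar> * (cmod (u t))\<^sup>2) \<le> En u"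
      unfolding En_def
      by (intro integral_subset_le absint_intro ru weight_sq_int absr_absint cu) (use xy in auto)
    moreover have "integral {x..y} (\<lambda>t. \<bar>1 / p t\<bar>) \<ge> 0"
      by (intro Henstock_Kurzweil_Integration.integral_nonneg absint_intro absr_sub xy) auto
    ultimately show "integral {x..y} (\<lambda>t. \<bar>1 / p t\<bar> * 1\<^sup>2) * integral {x..y} (\<lambda>t. \<bar>1 / p t\<bar> * (cmod (u t))\<^sup>2)
       \<le> integral {x..y} (\<lambda>t. \<bar>1 / p t\<bar>) * En u" by (simp add: mult_left_mono)
  qed
  finally show ?thesis .
qed

text \<open>The energy controls u only in mean, so a pointwise bound is available merely at a
  minimum point of |u|. Integrating the second equation therefore requires movable end
  points.\<close>

lemma mean_point:
  assumes cu: "continuous_on {0..a} u" and st: "0 \<le> s" "s < t" "t \<le> a"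
  shows "integral {s..t} (\<lambda>x. \<bar>1 / p x\<bar>) > 0"
    "\<exists>x\<in>{s..t}. cmod (u x) \<le> sqrt (En u) / sqrt (integral {s..t} (\<lambda>x. \<bar>1 / p x\<bar>))"
proof -
  let ?\<kappa> = "integral {s..t} (\<lambda>x. \<bar>1 / p x\<bar>)"
  have rnz: "AE x in lebesgue. \<bar>1 / p x\<bar> \<noteq> 0" using p_pos by eventually_elim auto
  show \<kappa>: "?\<kappa> > 0" by (rule integral_pos_ae[OF absr_sub _ st(2) rnz]) (use st in auto)
  have "continuous_on {s..t} (\<lambda>x. cmod (u x))" using st by (intro continuous_intros continuous_on_subset[OF cu]) auto
  then obtain x where x: "x \<in> {s..t}" "\<And>y. y \<in> {s..t} \<Longrightarrow> cmod (u x) \<le> cmod (u y)"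
    using continuous_attains_inf[of "{s..t}" "\<lambda>x. cmod (u x)"] st by auto
  have ru: "(\<lambda>t. \<bar>1 / p t\<bar> * (cmod (u t))\<^sup>2) absolutely_integrable_on {s..t}"
    by (rule absint_subinterval[OF weight_sq_int[OF absr_absint cu]]) (use st in auto)
  have "integral {s..t} (\<lambda>y. \<bar>1 / p y\<bar> * (cmod (u x))\<^sup>2) \<le> integral {s..t} (\<lambda>y. \<bar>1 / p y\<bar> * (cmod (u y))\<^sup>2)"
  proof (rule integral_le)
    show "(\<lambda>y. \<bar>1 / p y\<bar> * (cmod (u x))\<^sup>2) integrable_on {s..t}"
      using st by (intro integrable_on_mult_left absint_intro absr_sub) auto
    show "(\<lambda>y. \<bar>1 / p y\<bar> * (cmod (u y))\<^sup>2) integrable_on {s..t}" by (rule absint_intro[OF ru])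
    fix y assume "y \<in> {s..t}"
    then have "(cmod (u x))\<^sup>2 \<le> (cmod (u y))\<^sup>2" using x(2) by (intro power_mono) auto
    then show "\<bar>1 / p y\<bar> * (cmod (u x))\<^sup>2 \<le> \<bar>1 / p y\<bar> * (cmod (u y))\<^sup>2" by (intro mult_left_mono) auto
  qed
  moreover have "integral {s..t} (\<lambda>y. \<bar>1 / p y\<bar> * (cmod (u x))\<^sup>2) = ?\<kappa> * (cmod (u x))\<^sup>2"
    by (rule Henstock_Kurzweil_Integration.integral_mult_left)
  moreover have "integral {s..t} (\<lambda>t. \<bar>1 / p t\<bar> * (cmod (u t))\<^sup>2) \<le> En u"
    unfolding En_def by (intro integral_subset_le absint_intro ru weight_sq_int absr_absint cu) (use st in auto)
  ultimately have "(cmod (u x))\<^sup>2 \<le> En u / ?\<kappa>" using \<kappa> by (simp add: pos_le_divide_eq mult.commute)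
  then have "cmod (u x) \<le> sqrt (En u) / sqrt ?\<kappa>" unfolding real_sqrt_divide[symmetric] by (rule real_le_rsqrt)
  then show "\<exists>x\<in>{s..t}. cmod (u x) \<le> sqrt (En u) / sqrt ?\<kappa>" using x(1) by blast
qed

text \<open>Integrating the second equation of the system over an interval on which the weight hardly
  changes sign, between points where the quasi-derivative does not exceed its mean.\<close>

lemma piece_bound:
  assumes cd: "0 \<le> c" "c < d" "d \<le> a"
  shows "\<exists>K>0. \<forall>z h f u Fm. psol z h f u \<and> l2p h \<and> z \<noteq> 0 \<and> (\<forall>x\<in>{0..a}. cmod (f x) \<le> Fm) \<longrightarrow>
     (\<forall>x\<in>{c..d}. cmod (f x) \<le> 3 * sqrt (integral {c..d} (\<lambda>t. \<bar>1 / p t\<bar>) * En u)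
        + K / cmod z * (Fm + sqrt (nsq h) + sqrt (En u)))"
proof -
  obtain s t where st: "c \<le> s" "s < t" "t \<le> d" "integral {s..t} (\<lambda>x. \<bar>w x\<bar>) > 0"
    "\<bar>integral {s..t} w\<bar> \<ge> 3/4 * integral {s..t} (\<lambda>x. \<bar>w x\<bar>)"
    by (rule good_interval[OF cd])
  define m where "m = integral {s..t} (\<lambda>x. \<bar>w x\<bar>)"
  have m: "m > 0" using st by (simp add: m_def)
  have m8: "m / 8 > 0" using m by simp
  obtain \<delta> where \<delta>: "\<delta> > 0" "\<And>x y. 0 \<le> x \<Longrightarrow> x \<le> y \<Longrightarrow> y \<le> a \<Longrightarrow> y - x \<le> \<delta> \<Longrightarrow> integral {x..y} (\<lambda>x. \<bar>w x\<bar>) \<le> m / 8"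
    using indefinite_small[OF absw_absint _ m8] by (metis abs_ge_zero)
  \<comment> \<open>Moving each end point by at most \<eta> loses at most m/8 of the mass of |w|, so
    the integral of w keeps modulus at least 3m/4 - 2m/8 = m/2. The bound (t - s)/3 keeps the two
    end zones apart.\<close>
  define \<eta> where "\<eta> = min \<delta> ((t - s) / 3)"
  have \<eta>: "\<eta> > 0" "\<eta> \<le> \<delta>" "s + \<eta> < t - \<eta>" using \<delta>(1) st by (auto simp: \<eta>_def min_def field_simps)
  have s0: "0 \<le> s" "t \<le> a" using st cd by auto
  define \<kappa>1 \<kappa>2 where "\<kappa>1 = integral {s..s+\<eta>} (\<lambda>x. \<bar>1 / p x\<bar>)" and "\<kappa>2 = integral {t-\<eta>..t} (\<lambda>x. \<bar>1 / p x\<bar>)"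
  have \<kappa>: "\<kappa>1 > 0" "\<kappa>2 > 0" unfolding \<kappa>1_def \<kappa>2_def
    using mean_point(1)[of "\<lambda>x. 0" s "s+\<eta>"] mean_point(1)[of "\<lambda>x. 0" "t-\<eta>" t] s0 st \<eta> by auto
  define q1 where "q1 = integral {0..a} (\<lambda>x. \<bar>q x\<bar>)"
  have q1: "q1 \<ge> 0" unfolding q1_def by (intro Henstock_Kurzweil_Integration.integral_nonneg absint_intro absq_absint) auto
  define L where "L = q1 + sqrt w1 + 1 / sqrt \<kappa>1 + 1 / sqrt \<kappa>2"
  define K where "K = 2 * L / m"
  have L: "L > 0" unfolding L_def using q1 w1_nonneg \<kappa> by (intro add_nonneg_pos add_nonneg_nonneg) auto
  have K: "K > 0" unfolding K_def using L m by simp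
  define \<rho> where "\<rho> = integral {c..d} (\<lambda>t. \<bar>1 / p t\<bar>)"
  show ?thesis
  proof (intro exI[of _ K] conjI allI impI ballI K)
    fix z h f u Fm x
    assume H: "psol z h f u \<and> l2p h \<and> z \<noteq> 0 \<and> (\<forall>x\<in>{0..a}. cmod (f x) \<le> Fm)" and x: "x \<in> {c..d}"
    then have sol: "psol z h f u" and h: "l2p h" and z: "z \<noteq> 0" and Fm: "\<And>x. x \<in> {0..a} \<Longrightarrow> cmod (f x) \<le> Fm" by auto
    have U: "prim_on 0 a (\<lambda>x. P z x * f x - W x * h x) u" using sol by (simp add: psol_def)
    have cf: "continuous_on {0..a} f" and cu: "continuous_on {0..a} u" by (rule psol_cont[OF sol])+
    have F0: "Fm \<ge> 0" using order_trans[OF norm_ge_zero Fm[of 0]] a_pos by simp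
    obtain s' where s': "s' \<in> {s..s+\<eta>}" "cmod (u s') \<le> sqrt (En u) / sqrt \<kappa>1"
      using mean_point(2)[OF cu, of s "s+\<eta>"] s0 \<eta> st unfolding \<kappa>1_def by auto
    obtain t' where t': "t' \<in> {t-\<eta>..t}" "cmod (u t') \<le> sqrt (En u) / sqrt \<kappa>2"
      using mean_point(2)[OF cu, of "t-\<eta>" t] s0 \<eta> st unfolding \<kappa>2_def by auto
    have st': "s \<le> s'" "s' < t'" "t' \<le> t" "0 \<le> s'" "t' \<le> a" using s' t' \<eta> s0 by auto
    define o' where "o' = sqrt (\<rho> * En u)"
    have En0: "En u \<ge> 0" by (rule En_nonneg[OF cu])
    have osc: "cmod (f y - f s) \<le> o'" if y: "y \<in> {c..d}" for y
    proof -
      have mono: "integral {x..y} (\<lambda>t. \<bar>1 / p t\<bar>) \<le> \<rho>" if "c \<le> x" "x \<le> y" "y \<le> d" for x y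
        unfolding \<rho>_def using that cd by (intro integral_subset_le absint_intro absr_sub) auto
      have sub: "sqrt (integral {x..y} (\<lambda>t. \<bar>1 / p t\<bar>) * En u) \<le> o'" if "c \<le> x" "x \<le> y" "y \<le> d" for x y
        unfolding o'_def using mono[OF that] En0 by (intro real_sqrt_le_mono mult_right_mono) auto
      show ?thesis
      proof (cases "s \<le> y")
        case True
        then show ?thesis using osc_bound[OF sol, of s y] sub[of s y] y st cd s0 by auto
      next
        case False
        then show ?thesis using osc_bound[OF sol, of y s] sub[of y s] y st cd s0 by (auto simp: norm_minus_commute)
      qed
    qed
    have w': "\<bar>integral {s'..t'} w\<bar> \<ge> m / 2"
    proof -
      have c1: "integral {s..s'} w + integral {s'..t} w = integral {s..t} w"
        by (rule Henstock_Kurzweil_Integration.integral_combine) (use st' s0 in \<open>auto intro!: absint_intro[OF w_sub]\<close>)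
      have c2: "integral {s'..t'} w + integral {t'..t} w = integral {s'..t} w"
        by (rule Henstock_Kurzweil_Integration.integral_combine) (use st' s0 in \<open>auto intro!: absint_intro[OF w_sub]\<close>)
      have n: "\<bar>integral {x..y} w\<bar> \<le> integral {x..y} (\<lambda>x. \<bar>w x\<bar>)" if "0 \<le> x" "y \<le> a" for x y
      proof -
        have "norm (integral {x..y} w) \<le> integral {x..y} (\<lambda>x. \<bar>w x\<bar>)"
          by (rule integral_norm_bound_integral) (use that in \<open>auto intro!: absint_intro[OF w_sub] absint_intro[OF absw_sub]\<close>)
        then show ?thesis by simp
      qed
      have "integral {s..s'} (\<lambda>x. \<bar>w x\<bar>) \<le> m / 8"
        by (rule \<delta>(2)) (use s' t' st' s0 \<eta> in auto)
      moreover have "integral {t'..t} (\<lambda>x. \<bar>w x\<bar>) \<le> m / 8"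
        by (rule \<delta>(2)) (use s' t' st' s0 \<eta> in auto)
      ultimately have "\<bar>integral {s..s'} w\<bar> \<le> m / 8" "\<bar>integral {t'..t} w\<bar> \<le> m / 8"
        using n[of s s'] n[of t' t] st' s0 by auto
      moreover have "\<bar>integral {s..t} w\<bar> \<ge> 3/4 * m" using st(5) by (simp add: m_def)
      ultimately show ?thesis using c1 c2 m by linarith
    qed
    have iWf: "(\<lambda>x. W x * f x) absolutely_integrable_on {0..a}" by (rule absint_mult[OF W_absint cf])
    have iQf: "(\<lambda>x. Q x * f x) absolutely_integrable_on {0..a}" by (rule absint_mult[OF Q_absint cf])
    have iWh: "(\<lambda>x. W x * h x) absolutely_integrable_on {0..a}" by (rule psol_Wh[OF sol])
    note sb = absint_subinterval[OF _ st'(4,5)]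
    have h1: "((\<lambda>x. Q x * f x - z * (W x * f x) - W x * h x) has_integral
        integral {s'..t'} (\<lambda>x. Q x * f x) - z * integral {s'..t'} (\<lambda>x. W x * f x) - integral {s'..t'} (\<lambda>x. W x * h x)) {s'..t'}"
      by (intro has_integral_diff has_integral_mult_right integrable_integral absint_intro sb iWf iQf iWh)
    have h2: "((\<lambda>x. Q x * f x - z * (W x * f x) - W x * h x) has_integral u t' - u s') {s'..t'}"
    proof -
      have e: "Q x * f x - z * (W x * f x) - W x * h x = P z x * f x - W x * h x" for x by (simp add: P_def algebra_simps)
      show ?thesis unfolding e by (rule prim_on_integral[OF U]) (use st' in auto)
    qed
    have "z * integral {s'..t'} (\<lambda>x. W x * f x) = integral {s'..t'} (\<lambda>x. Q x * f x) - integral {s'..t'} (\<lambda>x. W x * h x) - u t' + u s'"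
      using has_integral_unique[OF h1 h2] by (simp add: algebra_simps)
    then have zI: "cmod z * cmod (integral {s'..t'} (\<lambda>x. W x * f x)) \<le>
        cmod (integral {s'..t'} (\<lambda>x. Q x * f x)) + cmod (integral {s'..t'} (\<lambda>x. W x * h x)) + cmod (u t') + cmod (u s')"
      unfolding norm_mult[symmetric]
      using norm_triangle_ineq[of "integral {s'..t'} (\<lambda>x. Q x * f x) - integral {s'..t'} (\<lambda>x. W x * h x) - u t'" "u s'"]
        norm_triangle_ineq4[of "integral {s'..t'} (\<lambda>x. Q x * f x) - integral {s'..t'} (\<lambda>x. W x * h x)" "u t'"]
        norm_triangle_ineq4[of "integral {s'..t'} (\<lambda>x. Q x * f x)" "integral {s'..t'} (\<lambda>x. W x * h x)"] by simp
    have b1: "cmod (integral {s'..t'} (\<lambda>x. Q x * f x)) \<le> q1 * Fm"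
    proof -
      have "cmod (integral {s'..t'} (\<lambda>x. Q x * f x)) \<le> integral {s'..t'} (\<lambda>x. \<bar>q x\<bar> * Fm)"
      proof (rule integral_norm_bound_integral)
        show "(\<lambda>x. \<bar>q x\<bar> * Fm) integrable_on {s'..t'}"
          by (intro integrable_on_mult_left absint_intro sb absq_absint)
        fix x assume "x \<in> {s'..t'}"
        then have "cmod (f x) \<le> Fm" using st' by (intro Fm) auto
        then show "cmod (Q x * f x) \<le> \<bar>q x\<bar> * Fm" by (auto simp: Q_def norm_mult intro!: mult_left_mono)
      qed (intro absint_intro sb iQf)
      also have "\<dots> = integral {s'..t'} (\<lambda>x. \<bar>q x\<bar>) * Fm" by (rule Henstock_Kurzweil_Integration.integral_mult_left)
      also have "\<dots> \<le> q1 * Fm" unfolding q1_def using st' F0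
        by (intro mult_right_mono integral_subset_le absint_intro sb absq_absint) auto
      finally show ?thesis .
    qed
    have b2: "cmod (integral {s'..t'} (\<lambda>x. W x * h x)) \<le> sqrt w1 * sqrt (nsq h)"
    proof -
      have "cmod (integral {s'..t'} (\<lambda>x. W x * h x)) \<le> integral {s'..t'} (\<lambda>x. cmod (W x * h x))"
        by (rule norm_integral_le[OF sb[OF iWh]])
      also have "\<dots> \<le> integral {0..a} (\<lambda>x. cmod (W x * h x))"
        using st' by (intro integral_subset_le absint_intro absint_cnorm sb iWh) auto
      also have "\<dots> \<le> sqrt w1 * sqrt (nsq h)" using l2p_W_norm[OF h] by (simp add: real_sqrt_mult)
      finally show ?thesis .
    qed
    \<comment> \<open>On the interval f equals \<open>f s\<close> up to its oscillation, so the
      integral of w f inherits the lower bound on the integral of w. Since z times this integral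
      stays bounded by the data of the problem, \<open>f s\<close> is small up to
      oscillation.\<close>
    have lower: "m / 2 * cmod (f s) - o' * m \<le> cmod (integral {s'..t'} (\<lambda>x. W x * f x))"
    proof -
      have cW: "W absolutely_integrable_on {s'..t'}" by (rule sb[OF W_absint])
      have Wi: "integral {s'..t'} W = of_real (integral {s'..t'} w)"
      proof -
        have "(w has_integral integral {s'..t'} w) {s'..t'}" using st' by (intro integrable_integral absint_intro w_sub) auto
        from has_integral_linear[OF this bounded_linear_of_real[where 'a=complex]] show ?thesis
          unfolding W_def[abs_def] o_def by (rule integral_unique)
      qed
      have hd: "((\<lambda>x. W x * f x - f s * W x) has_integral (integral {s'..t'} (\<lambda>x. W x * f x) - f s * integral {s'..t'} W)) {s'..t'}"
        by (intro has_integral_diff has_integral_mult_right integrable_integral absint_intro sb[OF iWf] cW)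
      have "norm (integral {s'..t'} (\<lambda>x. W x * f x - f s * W x)) \<le> integral {s'..t'} (\<lambda>x. \<bar>w x\<bar> * o')"
      proof (rule integral_norm_bound_integral)
        show "(\<lambda>x. W x * f x - f s * W x) integrable_on {s'..t'}" using hd by (rule has_integral_integrable)
        show "(\<lambda>x. \<bar>w x\<bar> * o') integrable_on {s'..t'}" by (intro integrable_on_mult_left absint_intro sb absw_absint)
        fix x assume x: "x \<in> {s'..t'}"
        have "W x * f x - f s * W x = W x * (f x - f s)" by (simp add: algebra_simps)
        then have "norm (W x * f x - f s * W x) = \<bar>w x\<bar> * cmod (f x - f s)" by (simp add: norm_mult W_def)
        also have "\<dots> \<le> \<bar>w x\<bar> * o'" using x st st' by (intro mult_left_mono osc) auto
        finally show "norm (W x * f x - f s * W x) \<le> \<bar>w x\<bar> * o'" .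
      qed
      also have "integral {s'..t'} (\<lambda>x. \<bar>w x\<bar> * o') = integral {s'..t'} (\<lambda>x. \<bar>w x\<bar>) * o'"
        by (rule Henstock_Kurzweil_Integration.integral_mult_left)
      also have "\<dots> \<le> m * o'"
      proof (intro mult_right_mono)
        show "integral {s'..t'} (\<lambda>x. \<bar>w x\<bar>) \<le> m" unfolding m_def using st' s0
          by (intro integral_subset_le absint_intro absw_sub) auto
        show "o' \<ge> 0" using osc[of s] st by auto
      qed
      finally have 1: "cmod (integral {s'..t'} (\<lambda>x. W x * f x) - f s * integral {s'..t'} W) \<le> m * o'"
        unfolding integral_unique[OF hd] .
      have 2: "m / 2 * cmod (f s) \<le> cmod (f s * integral {s'..t'} W)"
        unfolding Wi norm_mult norm_of_real using w' by (subst mult.commute) (intro mult_left_mono; simp)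
      have "cmod (f s * integral {s'..t'} W) \<le> cmod (integral {s'..t'} (\<lambda>x. W x * f x)) + m * o'"
        using norm_triangle_ineq2[of "f s * integral {s'..t'} W" "integral {s'..t'} (\<lambda>x. W x * f x)"] 1
        by (simp add: norm_minus_commute)
      then show ?thesis using 2 by (simp add: mult.commute)
    qed
    define T where "T = Fm + sqrt (nsq h) + sqrt (En u)"
    have "cmod z * (m / 2 * cmod (f s) - o' * m) \<le> cmod z * cmod (integral {s'..t'} (\<lambda>x. W x * f x))"
      using lower by (intro mult_left_mono) auto
    also have "\<dots> \<le> q1 * Fm + sqrt w1 * sqrt (nsq h) + sqrt (En u) / sqrt \<kappa>2 + sqrt (En u) / sqrt \<kappa>1"
      using zI b1 b2 s'(2) t'(2) by linarith
    also have "\<dots> \<le> L * T"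
    proof -
      have pos: "0 \<le> sqrt w1" "0 \<le> 1 / sqrt \<kappa>1" "0 \<le> 1 / sqrt \<kappa>2" "0 \<le> sqrt (nsq h)" "0 \<le> sqrt (En u)"
        using w1_nonneg \<kappa> nsq_nonneg En0 by auto
      have T: "Fm \<le> T" "sqrt (nsq h) \<le> T" "sqrt (En u) \<le> T" unfolding T_def using F0 pos by auto
      have "q1 * Fm + sqrt w1 * sqrt (nsq h) + (1 / sqrt \<kappa>2) * sqrt (En u) + (1 / sqrt \<kappa>1) * sqrt (En u)
        \<le> q1 * T + sqrt w1 * T + (1 / sqrt \<kappa>2) * T + (1 / sqrt \<kappa>1) * T"
        by (intro add_mono mult_left_mono T pos q1)
      also have "\<dots> = L * T" unfolding L_def by (simp only: distrib_right) 
      finally show ?thesis by simp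
    qed
    finally have fin: "cmod z * (m / 2 * cmod (f s) - o' * m) \<le> L * T" .
    have zp: "cmod z > 0" using z by simp
    have "m / 2 * cmod (f s) - o' * m \<le> L * T / cmod z" using fin zp by (simp add: pos_le_divide_eq mult.commute)
    from mult_left_mono[OF this, of 2]
    have "m * cmod (f s) \<le> m * (2 * o') + 2 * (L * T / cmod z)" by (simp add: algebra_simps)
    also have "2 * (L * T / cmod z) = m * (K / cmod z * T)" using m by (simp add: K_def)
    finally have "m * cmod (f s) \<le> m * (2 * o' + K / cmod z * T)" by (simp only: distrib_left)
    then have fs: "cmod (f s) \<le> 2 * o' + K / cmod z * T" using m by simp
    have "cmod (f x) \<le> cmod (f s) + cmod (f x - f s)" by (metis norm_triangle_sub)
    then have "cmod (f x) \<le> 3 * o' + K / cmod z * T" using osc[OF x] fs by linarith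
    then show "cmod (f x) \<le> 3 * sqrt (integral {c..d} (\<lambda>t. \<bar>1 / p t\<bar>) * En u) + K / cmod z * (Fm + sqrt (nsq h) + sqrt (En u))"
      unfolding T_def o'_def \<rho>_def .
  qed
qed

text \<open>Cut the period into pieces on which 1/p has mass at most \<eta> and use
  \<open>piece_bound\<close> on the piece where |f| attains its maximum. The oscillation is small by
  the choice of pieces, everything else by division by |z|.\<close>

lemma large_sup:
  assumes \<epsilon>: "\<epsilon> > 0"
  shows "\<exists>\<Lambda>>0. \<forall>z h f u. cmod z \<ge> \<Lambda> \<and> psol z h f u \<and> l2p h \<longrightarrow> (\<forall>x\<in>{0..a}. (cmod (f x))\<^sup>2 \<le> \<epsilon> * (En u + nsq h))"
proof -
  \<comment> \<open>The maximum M turns out to be at most 8 sqrt \<eta> (sqrt (En u) + sqrt (nsq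
    h)); squaring gives 64 \<eta>, and the square of the sum costs another factor 2.\<close>
  define \<eta> where "\<eta> = \<epsilon> / 128"
  have \<eta>: "\<eta> > 0" using \<epsilon> by (simp add: \<eta>_def)
  obtain \<delta> where \<delta>: "\<delta> > 0" "\<And>x y. 0 \<le> x \<Longrightarrow> x \<le> y \<Longrightarrow> y \<le> a \<Longrightarrow> y - x \<le> \<delta> \<Longrightarrow> integral {x..y} (\<lambda>t. \<bar>1 / p t\<bar>) \<le> \<eta>"
    using indefinite_small[OF absr_absint _ \<eta>] by (metis abs_ge_zero)
  obtain n :: nat where n: "n > 0" "a / real n \<le> \<delta>"
  proof -
    obtain n :: nat where "a / \<delta> < real n" using reals_Archimedean2 by blast
    moreover have "a / \<delta> > 0" using a_pos \<delta> by simp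
    ultimately have rn: "real n > 0" by linarith
    then have "n > 0" by simp
    moreover have "a / real n \<le> \<delta>"
      using \<open>a / \<delta> < real n\<close> \<delta>(1) rn by (simp add: pos_divide_le_eq pos_divide_less_eq mult.commute)
    ultimately show ?thesis by (rule that)
  qed
  define x where "x = (\<lambda>j::nat. real j * (a / real n))"
  have xp: "0 \<le> x j" "x j < x (Suc j)" "x (Suc j) \<le> a" "x (Suc j) - x j \<le> \<delta>" if "j < n" for j
  proof -
    show "0 \<le> x j" "x j < x (Suc j)" using a_pos n by (auto simp: x_def field_simps)
    have "real (Suc j) \<le> real n" using that by simp
    then have "real (Suc j) * (a / real n) \<le> real n * (a / real n)" using a_pos by (intro mult_right_mono) auto
    then show "x (Suc j) \<le> a" using n by (simp add: x_def)
    show "x (Suc j) - x j \<le> \<delta>" using n by (simp add: x_def field_simps)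
  qed
  have "\<forall>j\<in>{..<n}. \<exists>K>0. \<forall>z h f u Fm. psol z h f u \<and> l2p h \<and> z \<noteq> 0 \<and> (\<forall>x\<in>{0..a}. cmod (f x) \<le> Fm) \<longrightarrow>
     (\<forall>y\<in>{x j..x (Suc j)}. cmod (f y) \<le> 3 * sqrt (integral {x j..x (Suc j)} (\<lambda>t. \<bar>1 / p t\<bar>) * En u)
        + K / cmod z * (Fm + sqrt (nsq h) + sqrt (En u)))"
    using piece_bound xp by blast
  then obtain K where K: "\<And>j. j < n \<Longrightarrow> K j > 0" "\<And>j z h f u Fm y. j < n \<Longrightarrow> psol z h f u \<Longrightarrow> l2p h \<Longrightarrow> z \<noteq> 0 \<Longrightarrow> (\<forall>x\<in>{0..a}. cmod (f x) \<le> Fm) \<Longrightarrow>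
     y\<in>{x j..x (Suc j)} \<Longrightarrow> cmod (f y) \<le> 3 * sqrt (integral {x j..x (Suc j)} (\<lambda>t. \<bar>1 / p t\<bar>) * En u)
        + K j / cmod z * (Fm + sqrt (nsq h) + sqrt (En u))"
    unfolding bchoice_iff by (metis lessThan_iff)
  define K' where "K' = (\<Sum>j<n. K j)"
  have Kle: "K j \<le> K'" if "j < n" for j unfolding K'_def
    using that K(1) by (intro member_le_sum) (auto intro: less_imp_le)
  have K'0: "K' > 0" using Kle[of 0] K(1)[of 0] n(1) by linarith
  \<comment> \<open>For |z| \<ge> \<Lambda> every K j / |z| is at most 1/2, which absorbs the
    maximum of |f|, and at most sqrt \<eta>, which handles the remaining terms.\<close>
  define \<Lambda> where "\<Lambda> = K' * (2 + 1 / sqrt \<eta>)"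
  have \<Lambda>: "\<Lambda> > 0" unfolding \<Lambda>_def using K'0 \<eta> by (intro mult_pos_pos add_pos_pos) auto
  show ?thesis
  proof (intro exI[of _ \<Lambda>] conjI allI impI \<Lambda>)
    fix z h f u assume H: "cmod z \<ge> \<Lambda> \<and> psol z h f u \<and> l2p h"
    then have s: "psol z h f u" and h: "l2p h" and z: "cmod z \<ge> \<Lambda>" by auto
    have z0: "z \<noteq> 0" "cmod z > 0" using z \<Lambda> by auto
    have cf: "continuous_on {0..a} f" and cu: "continuous_on {0..a} u" by (rule psol_cont[OF s])+
    have En0: "En u \<ge> 0" by (rule En_nonneg[OF cu])
    have "continuous_on {0..a} (\<lambda>x. cmod (f x))" by (intro continuous_intros cf)
    then obtain x0 where x0: "x0 \<in> {0..a}" "\<And>y. y \<in> {0..a} \<Longrightarrow> cmod (f y) \<le> cmod (f x0)"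
      using continuous_attains_sup[of "{0..a}" "\<lambda>x. cmod (f x)"] a_pos by auto
    define M where "M = cmod (f x0)"
    obtain j where j: "j < n" "x0 \<in> {x j..x (Suc j)}"
    proof -
      define k where "k = nat \<lfloor>x0 / (a / real n)\<rfloor>"
      have an: "a / real n > 0" using a_pos n by simp
      have k: "real k \<le> x0 / (a / real n)" "x0 / (a / real n) < real k + 1"
        unfolding k_def using x0(1) an by (auto simp: of_nat_nat)
      have "real k * (a / real n) \<le> x0" using k(1) pos_le_divide_eq[OF an] by blast
      moreover have "x0 < (real k + 1) * (a / real n)" using k(2) pos_divide_less_eq[OF an] by blast
      ultimately have kx: "x k \<le> x0" "x0 < x (Suc k)" by (simp_all only: x_def of_nat_Suc add.commute)
      show ?thesis
      proof (cases "k < n")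
        case True then show ?thesis using kx by (intro that[of k]) auto
      next
        case False
        then have "real n * (a / real n) \<le> real k * (a / real n)" using an by (intro mult_right_mono) auto
        then have "a \<le> x k" using n by (simp add: x_def)
        then have xa: "x0 = a" using kx x0 by auto
        have "Suc (n - 1) = n" using n by simp
        then have "x (Suc (n - 1)) = a" using n by (simp add: x_def)
        then show ?thesis using xp[of "n - 1"] n xa by (intro that[of "n - 1"]) auto
      qed
    qed
    have Kz: "K j / cmod z \<le> 1 / 2" "K j / cmod z \<le> sqrt \<eta>"
    proof -
      have "2 * K' \<le> \<Lambda>" "K' / sqrt \<eta> \<le> \<Lambda>" unfolding \<Lambda>_def using K'0 \<eta> by (auto simp: distrib_left)
      then have "2 * K j \<le> cmod z" "K j / sqrt \<eta> \<le> cmod z"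
        using Kle[OF j(1)] z \<eta> divide_right_mono[OF Kle[OF j(1)], of "sqrt \<eta>"] by auto
      then show "K j / cmod z \<le> 1 / 2" "K j / cmod z \<le> sqrt \<eta>" using z0 \<eta> by (auto simp: pos_divide_le_eq mult.commute)
    qed
    have sE: "sqrt (En u) \<ge> 0" "sqrt (nsq h) \<ge> 0" using En0 nsq_nonneg by auto
    have Kj0: "K j / cmod z \<ge> 0" using K(1)[OF j(1)] z0 by (simp add: less_imp_le)
    \<comment> \<open>The global bound Fm is taken to be the maximum itself and the point lies on
      this very piece, so M appears on both sides and the right-hand occurrence can be
      absorbed.\<close>
    have "M \<le> 3 * sqrt (integral {x j..x (Suc j)} (\<lambda>t. \<bar>1 / p t\<bar>) * En u) + K j / cmod z * (M + sqrt (nsq h) + sqrt (En u))"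
      unfolding M_def by (rule K(2)[OF j(1) s h z0(1) _ j(2)]) (use x0 in auto)
    also have "\<dots> \<le> 3 * (sqrt \<eta> * sqrt (En u)) + (1 / 2 * M + sqrt \<eta> * (sqrt (nsq h) + sqrt (En u)))"
    proof (intro add_mono mult_left_mono)
      have "integral {x j..x (Suc j)} (\<lambda>t. \<bar>1 / p t\<bar>) \<le> \<eta>" using xp[OF j(1)] by (intro \<delta>(2)) auto
      then show "sqrt (integral {x j..x (Suc j)} (\<lambda>t. \<bar>1 / p t\<bar>) * En u) \<le> sqrt \<eta> * sqrt (En u)"
        unfolding real_sqrt_mult[symmetric] using En0 by (intro real_sqrt_le_mono mult_right_mono) auto
      have "K j / cmod z * (M + sqrt (nsq h) + sqrt (En u)) = K j / cmod z * M + K j / cmod z * (sqrt (nsq h) + sqrt (En u))"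
        by (simp only: distrib_left add.assoc)
      also have "\<dots> \<le> 1 / 2 * M + sqrt \<eta> * (sqrt (nsq h) + sqrt (En u))"
        using sE by (intro add_mono mult_right_mono Kz) (auto simp: M_def)
      finally show "K j / cmod z * (M + sqrt (nsq h) + sqrt (En u)) \<le> 1 / 2 * M + sqrt \<eta> * (sqrt (nsq h) + sqrt (En u))" .
    qed auto
    finally have "M \<le> 8 * (sqrt \<eta> * sqrt (En u)) + 2 * (sqrt \<eta> * sqrt (nsq h))" by (simp add: distrib_left)
    moreover have "0 \<le> sqrt \<eta> * sqrt (nsq h)" using \<eta> sE by simp
    ultimately have "M \<le> 8 * (sqrt \<eta> * sqrt (En u)) + 8 * (sqrt \<eta> * sqrt (nsq h))" by linarith
    then have "M \<le> 8 * sqrt \<eta> * (sqrt (En u) + sqrt (nsq h))" by (simp add: algebra_simps)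
    then have "M\<^sup>2 \<le> (8 * sqrt \<eta> * (sqrt (En u) + sqrt (nsq h)))\<^sup>2" by (intro power_mono) (auto simp: M_def)
    also have "\<dots> = 64 * \<eta> * (sqrt (En u) + sqrt (nsq h))\<^sup>2" using \<eta> by (simp add: power_mult_distrib)
    also have "\<dots> \<le> 64 * \<eta> * (2 * (En u + nsq h))"
    proof (intro mult_left_mono)
      show "(sqrt (En u) + sqrt (nsq h))\<^sup>2 \<le> 2 * (En u + nsq h)"
        using sum_squares_bound[of "sqrt (En u)" "sqrt (nsq h)"] En0 nsq_nonneg[of h] by (simp add: power2_sum)
    qed (use \<eta> in auto)
    also have "\<dots> = \<epsilon> * (En u + nsq h)" by (simp add: \<eta>_def)
    finally have M2: "M\<^sup>2 \<le> \<epsilon> * (En u + nsq h)" .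
    show "\<forall>x\<in>{0..a}. (cmod (f x))\<^sup>2 \<le> \<epsilon> * (En u + nsq h)"
    proof
      fix y assume "y \<in> {0..a}"
      then have "(cmod (f y))\<^sup>2 \<le> M\<^sup>2" unfolding M_def using x0 by (intro power_mono) auto
      then show "(cmod (f y))\<^sup>2 \<le> \<epsilon> * (En u + nsq h)" using M2 by linarith
    qed
  qed
qed

end

subsection \<open>Solutions on the real line\<close>

lemma has_integral_shift:
  fixes g :: "real \<Rightarrow> 'z::real_normed_vector"
  shows "((\<lambda>x. g (x + s)) has_integral I) {c..d} \<longleftrightarrow> (g has_integral I) {c + s..d + s}"
  using has_integral_shift_Icc_real[of g s I c d] by (simp add: o_def add.commute)

lemma integrable_shift:
  fixes g :: "real \<Rightarrow> 'z::real_normed_vector"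
  shows "(\<lambda>x. g (x + s)) integrable_on {c..d} \<longleftrightarrow> g integrable_on {c + s..d + s}"
  unfolding integrable_on_def has_integral_shift ..

lemma absint_shift:
  fixes g :: "real \<Rightarrow> 'z::euclidean_space"
  shows "(\<lambda>x. g (x + s)) absolutely_integrable_on {c..d} \<longleftrightarrow> g absolutely_integrable_on {c + s..d + s}"
  unfolding absolutely_integrable_on_def integrable_shift[of g] integrable_shift[of "\<lambda>x. norm (g x)"] ..

lemma prim_on_shift:
  fixes g F :: "real \<Rightarrow> complex"
  assumes P: "prim_on c d g F"
  shows "prim_on (c - s) (d - s) (\<lambda>x. g (x + s)) (\<lambda>x. F (x + s))"
  unfolding prim_on_def
proof (intro conjI ballI impI)
  show "(\<lambda>x. g (x + s)) absolutely_integrable_on {c - s..d - s}"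
    using prim_on_absint[OF P] by (simp add: absint_shift)
  fix x y assume "x \<in> {c - s..d - s}" "y \<in> {c - s..d - s}" "x \<le> y"
  then show "((\<lambda>x. g (x + s)) has_integral F (y + s) - F (x + s)) {x..y}"
    unfolding has_integral_shift by (intro prim_on_integral[OF P]) auto
qed

lemma prim_on_concat:
  assumes P: "prim_on c d g F" "prim_on d e g F" and cde: "c \<le> d" "d \<le> e"
  shows "prim_on c e g F"
  unfolding prim_on_def
proof (intro conjI ballI impI)
  show "g absolutely_integrable_on {c..e}"
    using prim_on_absint[OF P(1)] prim_on_absint[OF P(2)] cde by (rule absolutely_integrable_on_combine)
  fix x y assume xy: "x \<in> {c..e}" "y \<in> {c..e}" "x \<le> y"
  consider "y \<le> d" | "d \<le> x" | "x \<le> d" "d \<le> y" by linarith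
  then show "(g has_integral F y - F x) {x..y}"
  proof cases
    case 3
    have "(g has_integral (F d - F x) + (F y - F d)) {x..y}"
      by (rule has_integral_combine[OF 3 prim_on_integral[OF P(1)] prim_on_integral[OF P(2)]]) (use 3 xy in auto)
    then show ?thesis by simp
  next
    case 1 then show ?thesis using xy by (intro prim_on_integral[OF P(1)]) auto
  next
    case 2 then show ?thesis using xy by (intro prim_on_integral[OF P(2)]) auto
  qed
qed

context SL begin

text \<open>Transports the k-th period to [0, a]. By periodicity of the coefficients the one-period
  estimates then hold with constants independent of k.\<close>

definition sh :: "int \<Rightarrow> (real \<Rightarrow> 'z) \<Rightarrow> real \<Rightarrow> 'z" where "sh k g x = g (x + of_int k * a)"

text \<open>A solution on the line given period by period. Adjacent periods match automatically,
  because both evaluate the same functions f and u at the common end point.\<close>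

definition sol :: "complex \<Rightarrow> (real \<Rightarrow> complex) \<Rightarrow> (real \<Rightarrow> complex) \<Rightarrow> (real \<Rightarrow> complex) \<Rightarrow> bool" where
  "sol z h f u \<longleftrightarrow> (\<forall>k. psol z (sh k h) (sh k f) (sh k u))"

lemma per_int:
  fixes \<phi> :: "real \<Rightarrow> 'z"
  assumes "\<And>x. \<phi> (x + a) = \<phi> x" shows "\<phi> (x + of_int k * a) = \<phi> x"
proof (induction k arbitrary: x rule: int_induct[where k=0])
  case (step1 i)
  have "\<phi> (x + of_int (i + 1) * a) = \<phi> ((x + of_int i * a) + a)" by (simp add: algebra_simps)
  also have "\<dots> = \<phi> x" unfolding assms by (rule step1)
  finally show ?case .
next
  case (step2 i)
  have "\<phi> (x + of_int (i - 1) * a) = \<phi> ((x + of_int (i - 1) * a) + a)" by (simp only: assms)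
  also have "(x + of_int (i - 1) * a) + a = x + of_int i * a" by (simp add: algebra_simps)
  also have "\<phi> \<dots> = \<phi> x" by (rule step2)
  finally show ?case .
qed simp

lemma w_sh: "w (x + of_int k * a) = w x" and R_sh: "R (x + of_int k * a) = R x"
  and W_sh: "W (x + of_int k * a) = W x" and Q_sh: "Q (x + of_int k * a) = Q x" and P_sh: "P z (x + of_int k * a) = P z x"
  by (rule per_int; simp add: w_per p_per q_per R_def W_def Q_def P_def)+

text \<open>The k-th period ends at (k + 1) a, so the symmetric interval of radius N a corresponds
  to the half-open window of indices from -N to N - 1.\<close>

lemma period_sum:
  fixes m :: "real \<Rightarrow> 'z::euclidean_space"
  assumes m: "\<And>k. (sh k m) absolutely_integrable_on {0..a}"
  shows "m absolutely_integrable_on {- (real N * a)..real N * a} \<and>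
    integral {- (real N * a)..real N * a} m = (\<Sum>k\<in>{- int N..<int N}. integral {0..a} (sh k m))"
proof (induction N)
  case 0
  have "sh 0 m = m" by (simp add: sh_def fun_eq_iff)
  then have "m absolutely_integrable_on {0..a}" using m[of 0] by simp
  then have "m absolutely_integrable_on {0}" by (rule set_integrable_subset) (use a_pos in auto)
  then show ?case by simp
next
  case (Suc N)
  have per: "m absolutely_integrable_on {of_int k * a..of_int (k + 1) * a}"
    "integral {of_int k * a..of_int (k + 1) * a} m = integral {0..a} (sh k m)" for k
  proof -
    have e: "{0 + of_int k * a..a + of_int k * a} = {of_int k * a..of_int (k + 1) * a}" by (simp add: algebra_simps)
    show "m absolutely_integrable_on {of_int k * a..of_int (k + 1) * a}"
      using m[of k] unfolding sh_def[abs_def] absint_shift e .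
    have "((\<lambda>x. m (x + of_int k * a)) has_integral integral {0..a} (sh k m)) {0..a}"
      using m[of k] unfolding sh_def[abs_def] by (intro integrable_integral absint_intro)
    then show "integral {of_int k * a..of_int (k + 1) * a} m = integral {0..a} (sh k m)"
      unfolding has_integral_shift e by (rule integral_unique)
  qed
  let ?L = "- (real (Suc N) * a)" and ?l = "- (real N * a)" and ?r = "real N * a" and ?R = "real (Suc N) * a"
  have p1: "m absolutely_integrable_on {?L..?l}" "integral {?L..?l} m = integral {0..a} (sh (- int (Suc N)) m)"
    using per[of "- int (Suc N)"] by (simp_all add: algebra_simps)
  have p2: "m absolutely_integrable_on {?r..?R}" "integral {?r..?R} m = integral {0..a} (sh (int N) m)"
    using per[of "int N"] by (simp_all add: algebra_simps)
  have ord: "?L \<le> ?l" "?l \<le> ?r" "?r \<le> ?R" using a_pos by (auto simp: algebra_simps)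
  have m1: "m absolutely_integrable_on {?L..?r}" using Suc p1 ord by (intro absolutely_integrable_on_combine[where f=m and a="?L" and c="?l" and b="?r"]) auto
  have m2: "m absolutely_integrable_on {?L..?R}" using m1 p2 ord by (intro absolutely_integrable_on_combine[where f=m and a="?L" and c="?r" and b="?R"]) auto
  have "integral {?L..?R} m = integral {?L..?r} m + integral {?r..?R} m"
    using ord m2 by (intro Henstock_Kurzweil_Integration.integral_combine[symmetric]) (auto intro: absint_intro)
  also have "integral {?L..?r} m = integral {?L..?l} m + integral {?l..?r} m"
    using ord m1 by (intro Henstock_Kurzweil_Integration.integral_combine[symmetric]) (auto intro: absint_intro)
  finally have s: "integral {?L..?R} m = integral {0..a} (sh (- int (Suc N)) m) + (\<Sum>k\<in>{- int N..<int N}. integral {0..a} (sh k m)) + integral {0..a} (sh (int N) m)"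
    using Suc p1 p2 by simp
  have "{- int (Suc N)..<int (Suc N)} = insert (- int (Suc N)) (insert (int N) {- int N..<int N})" by auto
  then have "(\<Sum>k\<in>{- int (Suc N)..<int (Suc N)}. integral {0..a} (sh k m)) =
     integral {0..a} (sh (- int (Suc N)) m) + (integral {0..a} (sh (int N) m) + (\<Sum>k\<in>{- int N..<int N}. integral {0..a} (sh k m)))"
    by simp
  then show ?case using m2 s by (simp add: algebra_simps)
qed

lemma integrable_period:
  fixes m :: "real \<Rightarrow> 'z::euclidean_space"
  assumes "integrable lebesgue m" shows "(sh k m) absolutely_integrable_on {0..a}"
proof -
  have m: "m absolutely_integrable_on {of_int k * a..of_int (k + 1) * a}"
    unfolding set_integrable_def by (rule integrable_mult_indicator[OF _ assms]) simp
  have e: "{0 + of_int k * a..a + of_int k * a} = {of_int k * a..of_int (k + 1) * a}" by (simp add: algebra_simps)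
  show ?thesis unfolding sh_def[abs_def] absint_shift e by (rule m)
qed

lemma eventually_in_interval: "\<forall>\<^sub>F N in sequentially. x \<in> {- (real N * a)..real N * a}"
proof -
  obtain N0 :: nat where "\<bar>x\<bar> / a \<le> real N0" using real_arch_simple by blast
  then have N0: "\<bar>x\<bar> \<le> real N0 * a" using a_pos by (simp add: pos_divide_le_eq)
  show ?thesis unfolding eventually_sequentially
  proof (intro exI[of _ N0] allI impI)
    fix N assume "N0 \<le> N"
    then have "real N0 * a \<le> real N * a" using a_pos by (intro mult_right_mono) auto
    then show "x \<in> {- (real N * a)..real N * a}" using N0 by auto
  qed
qed

lemma integrable_sum_limit:
  fixes m :: "real \<Rightarrow> real"
  assumes "integrable lebesgue m"
  shows "(\<lambda>N. \<Sum>k\<in>{- int N..<int N}. integral {0..a} (sh k m)) \<longlonglongrightarrow> (LINT x|lebesgue. m x)"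
proof -
  have "(\<lambda>N. LINT x|lebesgue. indicator {- (real N * a)..real N * a} x *\<^sub>R m x) \<longlonglongrightarrow> (LINT x|lebesgue. m x)"
  proof (rule integral_dominated_convergence[where w="\<lambda>x. norm (m x)"])
    show "AE x in lebesgue. (\<lambda>N. indicat_real {- (real N * a)..real N * a} x *\<^sub>R m x) \<longlonglongrightarrow> m x"
    proof (rule AE_I2, rule tendsto_eventually)
      show "\<forall>\<^sub>F N in sequentially. indicat_real {- (real N * a)..real N * a} x *\<^sub>R m x = m x" for x
        using eventually_in_interval[of x] by eventually_elim simp
    qed
    show "(\<lambda>x. indicat_real {- (real N * a)..real N * a} x *\<^sub>R m x) \<in> borel_measurable lebesgue" for N
      using integrable_mult_indicator[OF _ assms, of "{- (real N * a)..real N * a}"] by auto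
  qed (use assms in \<open>auto simp: indicator_def\<close>)
  moreover have "(LINT x|lebesgue. indicator {- (real N * a)..real N * a} x *\<^sub>R m x) = (\<Sum>k\<in>{- int N..<int N}. integral {0..a} (sh k m))" for N
    using period_sum[of m N] integrable_period[OF assms] set_lebesgue_integral_eq_integral(2)[of "{- (real N * a)..real N * a}" m]
    by (simp add: set_lebesgue_integral_def)
  ultimately show ?thesis by simp
qed

lemma integrable_from_sums:
  fixes m :: "real \<Rightarrow> real"
  assumes meas: "m \<in> borel_measurable lebesgue" and pos: "\<And>x. m x \<ge> 0"
    and per: "\<And>k. (sh k m) absolutely_integrable_on {0..a}"
    and B: "\<And>N. (\<Sum>k\<in>{- int N..<int N}. integral {0..a} (sh k m)) \<le> B"
  shows "integrable lebesgue m"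
proof -
  define f where "f = (\<lambda>N x. indicat_real {- (real N * a)..real N * a} x *\<^sub>R m x)"
  have fi: "integrable lebesgue (f N)" for N
    using period_sum[of m N] per by (simp add: f_def set_integrable_def)
  have ff: "(LINT x|lebesgue. f N x) = (\<Sum>k\<in>{- int N..<int N}. integral {0..a} (sh k m))" for N
    using period_sum[of m N] per set_lebesgue_integral_eq_integral(2)[of "{- (real N * a)..real N * a}" m]
    by (simp add: set_lebesgue_integral_def f_def)
  have mono: "f N x \<le> f (Suc N) x" for N x
  proof -
    have "real N * a \<le> real (Suc N) * a" using a_pos by (intro mult_right_mono) auto
    then show ?thesis using pos[of x] by (auto simp: f_def indicator_def)
  qed
  have inc: "incseq (\<lambda>N. LINT x|lebesgue. f N x)"
    by (intro incseq_SucI Bochner_Integration.integral_mono fi mono)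
  have "\<forall>i. (LINT x|lebesgue. f i x) \<le> B" using B ff by simp
  from incseq_convergent[OF inc this] obtain L where L: "(\<lambda>N. LINT x|lebesgue. f N x) \<longlonglongrightarrow> L" by blast
  show ?thesis
  proof (rule integrable_monotone_convergence[OF fi _ _ L meas])
    show "AE x in lebesgue. mono (\<lambda>n. f n x)" by (intro AE_I2 incseq_SucI mono)
    show "AE x in lebesgue. (\<lambda>N. f N x) \<longlonglongrightarrow> m x"
    proof (rule AE_I2, rule tendsto_eventually)
      show "\<forall>\<^sub>F N in sequentially. f N x = m x" for x
        using eventually_in_interval[of x] by eventually_elim (simp add: f_def)
    qed
  qed
qed

lemma L2_int: "h \<in> L2 w \<Longrightarrow> integrable lebesgue (\<lambda>x. \<bar>w x\<bar> * (cmod (h x))\<^sup>2)"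
  by (simp add: L2_def mult.commute)

lemma sh_weight: "sh k (\<lambda>x. \<bar>w x\<bar> * (cmod (h x))\<^sup>2) = (\<lambda>x. \<bar>w x\<bar> * (cmod (sh k h x))\<^sup>2)"
  "sh k (\<lambda>x. w x * (cmod (h x))\<^sup>2) = (\<lambda>x. w x * (cmod (sh k h x))\<^sup>2)"
  by (auto simp: sh_def w_sh)

text \<open>On one period w is integrable and |w h| \<le> |w| + |w| |h|^2, which gives the
  integrability of the forcing.\<close>

lemma L2_l2p:
  assumes h: "h \<in> L2 w" shows "l2p (sh k h)"
proof -
  have 1: "(\<lambda>x. \<bar>w x\<bar> * (cmod (sh k h x))\<^sup>2) absolutely_integrable_on {0..a}"
    using integrable_period[OF L2_int[OF h], of k] unfolding sh_weight .
  have hm: "h \<in> borel_measurable lebesgue" using h by (simp add: L2_def)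
  have Wm: "W \<in> borel_measurable lebesgue" unfolding W_def[abs_def] using w_meas by measurable
  define J where "J = {of_int k * a..of_int (k + 1) * a}"
  have "set_integrable lebesgue J (\<lambda>x. W x * h x)"
    unfolding set_integrable_def
  proof (rule Bochner_Integration.integrable_bound)
    have "set_integrable lebesgue J w"
    proof -
      have e: "{0 + of_int k * a..a + of_int k * a} = J" by (simp add: J_def algebra_simps)
      have "(\<lambda>x. w (x + of_int k * a)) absolutely_integrable_on {0..a}" unfolding w_sh by (rule w_absint)
      then show ?thesis unfolding absint_shift e .
    qed
    then have "integrable lebesgue (\<lambda>x. norm (indicat_real J x *\<^sub>R w x))" unfolding set_integrable_def by (rule integrable_norm)
    then show "integrable lebesgue (\<lambda>x. norm (indicat_real J x *\<^sub>R w x) + \<bar>w x\<bar> * (cmod (h x))\<^sup>2)"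
      using L2_int[OF h] by (rule Bochner_Integration.integrable_add)
    show "(\<lambda>x. indicat_real J x *\<^sub>R (W x * h x)) \<in> borel_measurable lebesgue"
      unfolding J_def using Wm hm by (intro borel_measurable_scaleR borel_measurable_times borel_measurable_indicator) auto
    show "AE x in lebesgue. norm (indicat_real J x *\<^sub>R (W x * h x)) \<le> norm (norm (indicat_real J x *\<^sub>R w x) + \<bar>w x\<bar> * (cmod (h x))\<^sup>2)"
    proof (rule AE_I2)
      fix x
      have "cmod (h x) \<le> 1 + (cmod (h x))\<^sup>2" 
      proof -
        have "2 * cmod (h x) \<le> 1 + (cmod (h x))\<^sup>2" using sum_squares_bound[of 1 "cmod (h x)"] by simp
        then show ?thesis using norm_ge_zero[of "h x"] by linarith
      qed
      then have "\<bar>w x\<bar> * cmod (h x) \<le> \<bar>w x\<bar> * (1 + (cmod (h x))\<^sup>2)" by (intro mult_left_mono) auto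
      then show "norm (indicat_real J x *\<^sub>R (W x * h x)) \<le> norm (norm (indicat_real J x *\<^sub>R w x) + \<bar>w x\<bar> * (cmod (h x))\<^sup>2)"
        by (auto simp: indicator_def W_def norm_mult distrib_left)
    qed
  qed
  then have "integrable lebesgue (\<lambda>x. indicat_real J x *\<^sub>R (W x * h x))" by (simp add: set_integrable_def)
  from integrable_period[OF this, of k]
  have "(\<lambda>x. W x * sh k h x) absolutely_integrable_on {0..a}"
  proof (rule set_integrable_cong[THEN iffD1, rotated 3])
    fix x assume "x \<in> {0..a}"
    show "sh k (\<lambda>x. indicat_real J x *\<^sub>R (W x * h x)) x = W x * sh k h x"
    proof -
      have "x + of_int k * a \<in> J" using \<open>x \<in> {0..a}\<close> by (auto simp: J_def algebra_simps)
      then show ?thesis by (simp add: sh_def W_sh)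
    qed
  qed auto
  with 1 show ?thesis by (simp add: l2p_def)
qed

lemma L2_norm_sq: "(L2_norm w f)\<^sup>2 = (LINT x|lebesgue. \<bar>w x\<bar> * (cmod (f x))\<^sup>2)"
proof -
  have "L2_inner w f f = (LINT x|lebesgue. complex_of_real (\<bar>w x\<bar> * (cmod (f x))\<^sup>2))"
    unfolding L2_inner_def
    by (rule Bochner_Integration.integral_cong[OF refl]) (simp only: of_real_mult complex_norm_square mult_ac)
  also have "\<dots> = of_real (LINT x|lebesgue. \<bar>w x\<bar> * (cmod (f x))\<^sup>2)" by (rule integral_complex_of_real)
  finally have "L2_inner w f f = of_real (LINT x|lebesgue. \<bar>w x\<bar> * (cmod (f x))\<^sup>2)" .
  moreover have "(LINT x|lebesgue. \<bar>w x\<bar> * (cmod (f x))\<^sup>2) \<ge> 0" by (rule integral_nonneg_AE) auto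
  ultimately show ?thesis by (simp add: L2_norm_def)
qed

lemma L2_norm_nonneg: "L2_norm w f \<ge> 0"
proof -
  have "L2_inner w f f = (LINT x|lebesgue. complex_of_real (\<bar>w x\<bar> * (cmod (f x))\<^sup>2))"
    unfolding L2_inner_def
    by (rule Bochner_Integration.integral_cong[OF refl]) (simp only: of_real_mult complex_norm_square mult_ac)
  also have "\<dots> = of_real (LINT x|lebesgue. \<bar>w x\<bar> * (cmod (f x))\<^sup>2)" by (rule integral_complex_of_real)
  moreover have "(LINT x|lebesgue. \<bar>w x\<bar> * (cmod (f x))\<^sup>2) \<ge> 0" by (rule integral_nonneg_AE) auto
  ultimately show ?thesis by (simp add: L2_norm_def)
qed

lemma norm_sum_limit: "h \<in> L2 w \<Longrightarrow> (\<lambda>N. \<Sum>k\<in>{- int N..<int N}. nsq (sh k h)) \<longlonglongrightarrow> (L2_norm w h)\<^sup>2"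
  using integrable_sum_limit[OF L2_int] unfolding L2_norm_sq nsq_def sh_weight by simp

lemma krein_real: "Re (krein_inner w f f) = (LINT x|lebesgue. w x * (cmod (f x))\<^sup>2)"
proof -
  have "krein_inner w f f = (LINT x|lebesgue. complex_of_real (w x * (cmod (f x))\<^sup>2))"
    unfolding krein_inner_def L2_inner_def J_op_def
  proof (rule Bochner_Integration.integral_cong[OF refl])
    fix x
    have "sgn (w x) * \<bar>w x\<bar> = w x" by (simp add: sgn_if)
    then have "complex_of_real (sgn (w x)) * of_real \<bar>w x\<bar> = of_real (w x)" by (metis of_real_mult)
    then show "of_real (sgn (w x)) * f x * cnj (f x) * complex_of_real \<bar>w x\<bar> = of_real (w x * (cmod (f x))\<^sup>2)"
    proof -
      assume E: "complex_of_real (sgn (w x)) * of_real \<bar>w x\<bar> = of_real (w x)"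
      have "of_real (sgn (w x)) * f x * cnj (f x) * complex_of_real \<bar>w x\<bar> = (of_real (sgn (w x)) * of_real \<bar>w x\<bar>) * (f x * cnj (f x))"
        by (simp only: mult_ac)
      then show ?thesis unfolding E by (simp only: of_real_mult complex_norm_square)
    qed
  qed
  also have "\<dots> = of_real (LINT x|lebesgue. w x * (cmod (f x))\<^sup>2)" by (rule integral_complex_of_real)
  finally show ?thesis by simp
qed

lemma krein_sum_limit:
  assumes f: "f \<in> L2 w"
  shows "(\<lambda>N. \<Sum>k\<in>{- int N..<int N}. kr (sh k f)) \<longlonglongrightarrow> Re (krein_inner w f f)"
proof -
  have fm: "f \<in> borel_measurable lebesgue" using f by (simp add: L2_def)
  have "integrable lebesgue (\<lambda>x. w x * (cmod (f x))\<^sup>2)"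
    by (rule Bochner_Integration.integrable_bound[OF L2_int[OF f]]) (use w_meas fm in \<open>auto simp: abs_mult\<close>)
  from integrable_sum_limit[OF this] show ?thesis unfolding krein_real kr_def sh_weight .
qed

lemma L2_from_sums:
  assumes "f \<in> borel_measurable lebesgue" "\<And>k. l2p (sh k f)"
    "\<And>N. (\<Sum>k\<in>{- int N..<int N}. nsq (sh k f)) \<le> B"
  shows "f \<in> L2 w"
proof -
  have "integrable lebesgue (\<lambda>x. \<bar>w x\<bar> * (cmod (f x))\<^sup>2)"
  proof (rule integrable_from_sums)
    show "(\<lambda>x. \<bar>w x\<bar> * (cmod (f x))\<^sup>2) \<in> borel_measurable lebesgue" using w_meas assms(1) by measurable
  qed (use assms in \<open>auto simp: sh_weight l2p_def nsq_def\<close>)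
  then show ?thesis using assms(1) by (simp add: L2_def mult.commute)
qed

lemma L2_lin:
  assumes "f \<in> L2 w" "g \<in> L2 w" shows "(\<lambda>x. \<alpha> * f x + \<beta> * g x) \<in> L2 w"
proof -
  have m: "f \<in> borel_measurable lebesgue" "g \<in> borel_measurable lebesgue" using assms by (auto simp: L2_def)
  have "integrable lebesgue (\<lambda>x. (cmod (\<alpha> * f x + \<beta> * g x))\<^sup>2 * \<bar>w x\<bar>)"
  proof (rule Bochner_Integration.integrable_bound)
    show "integrable lebesgue (\<lambda>x. 2 * (cmod \<alpha>)\<^sup>2 * ((cmod (f x))\<^sup>2 * \<bar>w x\<bar>) + 2 * (cmod \<beta>)\<^sup>2 * ((cmod (g x))\<^sup>2 * \<bar>w x\<bar>))"
      using assms by (intro Bochner_Integration.integrable_add integrable_mult_right) (auto simp: L2_def)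
    show "(\<lambda>x. (cmod (\<alpha> * f x + \<beta> * g x))\<^sup>2 * \<bar>w x\<bar>) \<in> borel_measurable lebesgue" using m w_meas by measurable
    show "AE x in lebesgue. norm ((cmod (\<alpha> * f x + \<beta> * g x))\<^sup>2 * \<bar>w x\<bar>) \<le> norm (2 * (cmod \<alpha>)\<^sup>2 * ((cmod (f x))\<^sup>2 * \<bar>w x\<bar>) + 2 * (cmod \<beta>)\<^sup>2 * ((cmod (g x))\<^sup>2 * \<bar>w x\<bar>))"
    proof (rule AE_I2)
      fix x
      have "(cmod (\<alpha> * f x + \<beta> * g x))\<^sup>2 * \<bar>w x\<bar> \<le> (2 * (cmod (\<alpha> * f x))\<^sup>2 + 2 * (cmod (\<beta> * g x))\<^sup>2) * \<bar>w x\<bar>"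
        by (intro mult_right_mono cmod_add_sq_le) auto
      then show "norm ((cmod (\<alpha> * f x + \<beta> * g x))\<^sup>2 * \<bar>w x\<bar>) \<le> norm (2 * (cmod \<alpha>)\<^sup>2 * ((cmod (f x))\<^sup>2 * \<bar>w x\<bar>) + 2 * (cmod \<beta>)\<^sup>2 * ((cmod (g x))\<^sup>2 * \<bar>w x\<bar>))"
        by (simp add: norm_mult power_mult_distrib algebra_simps)
    qed
  qed
  moreover have "(\<lambda>x. \<alpha> * f x + \<beta> * g x) \<in> borel_measurable lebesgue" using m by measurable
  ultimately show ?thesis by (simp add: L2_def)
qed

end

lemma sum_shift_Suc:
  fixes g :: "int \<Rightarrow> 'z::ab_group_add"
  shows "(\<Sum>k\<in>{- int (Suc N)..<int (Suc N)}. g k) = (\<Sum>k\<in>{- int N..<int N}. g k) + g (- int (Suc N)) + g (int N)"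
proof -
  have "{- int (Suc N)..<int (Suc N)} = insert (- int (Suc N)) (insert (int N) {- int N..<int N})" by auto
  then show ?thesis by (simp add: algebra_simps)
qed

lemma sum_telescope_int:
  fixes g :: "int \<Rightarrow> 'z::ab_group_add"
  shows "(\<Sum>k\<in>{- int N..<int N}. g (k + 1) - g k) = g (int N) - g (- int N)"
proof (induction N)
  case (Suc N)
  have e: "- int (Suc N) + 1 = - int N" "int N + 1 = int (Suc N)" by auto
  show ?case unfolding sum_shift_Suc Suc.IH e by (simp add: algebra_simps)
qed simp

section \<open>The maximal operator as a first-order system\<close>

context SL begin

text \<open>The pointwise almost-everywhere definition is converted into integral equations once and
  for all; dividing by p and multiplying by w is legitimate almost everywhere. The system holds for
  the absolutely continuous representative, whereas f is known only up to a null set.\<close>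

lemma maximal_op_D:
  assumes "(f, h) \<in> op_shift (maximal_op w p q) z"
  shows "f \<in> L2 w \<and> h \<in> L2 w \<and> (\<exists>f\<^sub>0 u. ae_eq f f\<^sub>0 \<and> sol z h f\<^sub>0 u)"
proof -
  obtain g where g: "(f, g) \<in> maximal_op w p q" "h = (\<lambda>x. g x - z * f x)" using assms by (auto simp: op_shift_def)
  then obtain f0 u where fu: "f \<in> L2 w" "g \<in> L2 w" "f0 \<in> AC_loc" "u \<in> AC_loc" "ae_eq f f0"
    "ae_eq u (\<lambda>x. of_real (p x) * vector_derivative f0 (at x))"
    "ae_eq g (\<lambda>x. 1 / of_real (w x) * (- vector_derivative u (at x) + of_real (q x) * f0 x))"
    unfolding maximal_op_def by blast
  have hL: "h \<in> L2 w" using L2_lin[OF fu(2,1), of 1 "- z"] by (simp add: g(2))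
  have "psol z (sh k h) (sh k f0) (sh k u)" for k
  proof -
    let ?c = "of_int k * a" and ?d = "of_int k * a + a"
    have AC: "abs_continuous_on {?c..?d} f0" "abs_continuous_on {?c..?d} u" using fu(3,4) by (auto simp: AC_loc_def)
    obtain g1 where g1: "prim_on ?c ?d g1 f0" using AC_prim_on[OF AC(1)] by blast
    obtain g2 where g2: "prim_on ?c ?d g2 u" using AC_prim_on[OF AC(2)] by blast
    have F: "prim_on ?c ?d (\<lambda>x. R x * u x) f0"
    proof (rule prim_on_spike[OF g1])
      show "AE x in lebesgue. x \<in> {?c<..<?d} \<longrightarrow> R x * u x = g1 x"
        using prim_on_deriv[OF g1] fu(6)[unfolded ae_eq_def] p_pos
      proof (eventually_elim, intro impI)
        fix x assume H: "x \<in> {?c<..<?d} \<longrightarrow> (f0 has_vector_derivative g1 x) (at x)" "u x = of_real (p x) * vector_derivative f0 (at x)" "p x > 0" "x \<in> {?c<..<?d}"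
        then have "vector_derivative f0 (at x) = g1 x" by (simp add: vector_derivative_at)
        then show "R x * u x = g1 x" using H by (simp add: R_def)
      qed
    qed
    have U: "prim_on ?c ?d (\<lambda>x. P z x * f0 x - W x * h x) u"
    proof (rule prim_on_spike[OF g2])
      show "AE x in lebesgue. x \<in> {?c<..<?d} \<longrightarrow> P z x * f0 x - W x * h x = g2 x"
        using prim_on_deriv[OF g2] fu(7)[unfolded ae_eq_def] fu(5)[unfolded ae_eq_def] w_nz
      proof (eventually_elim, intro impI)
        fix x assume H: "x \<in> {?c<..<?d} \<longrightarrow> (u has_vector_derivative g2 x) (at x)"
          "g x = 1 / of_real (w x) * (- vector_derivative u (at x) + of_real (q x) * f0 x)" "f x = f0 x" "w x \<noteq> 0" "x \<in> {?c<..<?d}"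
        then have "vector_derivative u (at x) = g2 x" by (simp add: vector_derivative_at)
        then have "W x * g x = - g2 x + Q x * f0 x" using H by (simp add: W_def Q_def)
        then show "P z x * f0 x - W x * h x = g2 x" unfolding g(2) P_def using H(3) by (simp add: algebra_simps)
      qed
    qed
    have F': "prim_on 0 a (\<lambda>x. R (x + ?c) * u (x + ?c)) (\<lambda>x. f0 (x + ?c))"
      using prim_on_shift[OF F, of ?c] by simp
    have U': "prim_on 0 a (\<lambda>x. P z (x + ?c) * f0 (x + ?c) - W (x + ?c) * h (x + ?c)) (\<lambda>x. u (x + ?c))"
      using prim_on_shift[OF U, of ?c] by simp
    show ?thesis unfolding psol_def sh_def[abs_def] using F' U' unfolding R_sh P_sh W_sh by blast
  qed
  then show ?thesis using fu hL unfolding sol_def by blast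
qed

lemma sol_prim:
  assumes s: "sol z h f u"
  shows "prim_on (- (real N * a)) (real N * a) (\<lambda>x. R x * u x) f"
    "prim_on (- (real N * a)) (real N * a) (\<lambda>x. P z x * f x - W x * h x) u"
proof -
  have glue: "prim_on (- (real N * a)) (real N * a) g F"
    if per: "\<And>k::int. prim_on (of_int k * a) (of_int (k + 1) * a) g F" for g F :: "real \<Rightarrow> complex"
  proof (induction N)
    case 0 then show ?case using prim_on_subset[OF per[of 0], of 0 0] a_pos by simp
  next
    case (Suc N)
    have 1: "prim_on (- (real (Suc N) * a)) (- (real N * a)) g F" using per[of "- int (Suc N)"] by (simp add: algebra_simps)
    have 2: "prim_on (real N * a) (real (Suc N) * a) g F" using per[of "int N"] by (simp add: algebra_simps)
    have e: "real (Suc N) * a = real N * a + a" by (simp add: algebra_simps)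
    have Na: "0 \<le> real N * a" using a_pos by simp
    show ?case
      by (rule prim_on_concat[OF prim_on_concat[OF 1 Suc.IH] 2]) (use a_pos e Na in linarith)+
  qed
  have F: "prim_on (of_int k * a) (of_int (k + 1) * a) (\<lambda>x. R x * u x) f" and
    U: "prim_on (of_int k * a) (of_int (k + 1) * a) (\<lambda>x. P z x * f x - W x * h x) u" for k
  proof -
    have e: "0 - - (of_int k * a) = of_int k * a" "a - - (of_int k * a) = of_int (k + 1) * a" by (auto simp: algebra_simps)
    have "psol z (sh k h) (sh k f) (sh k u)" using s by (simp add: sol_def)
    then have 1: "prim_on 0 a (\<lambda>x. R (x + of_int k * a) * u (x + of_int k * a)) (\<lambda>x. f (x + of_int k * a))"
      and 2: "prim_on 0 a (\<lambda>x. P z (x + of_int k * a) * f (x + of_int k * a) - W (x + of_int k * a) * h (x + of_int k * a)) (\<lambda>x. u (x + of_int k * a))"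
      unfolding psol_def sh_def[abs_def] R_sh P_sh W_sh by auto
    show "prim_on (of_int k * a) (of_int (k + 1) * a) (\<lambda>x. R x * u x) f"
      using prim_on_shift[OF 1, of "- (of_int k * a)"] unfolding e by simp
    show "prim_on (of_int k * a) (of_int (k + 1) * a) (\<lambda>x. P z x * f x - W x * h x) u"
      using prim_on_shift[OF 2, of "- (of_int k * a)"] unfolding e by simp
  qed
  show "prim_on (- (real N * a)) (real N * a) (\<lambda>x. R x * u x) f"
    "prim_on (- (real N * a)) (real N * a) (\<lambda>x. P z x * f x - W x * h x) u"
    by (rule glue[OF F], rule glue[OF U])
qed

lemma in_open_interval: "\<exists>N. x \<in> {- (real N * a)<..<real N * a}"
proof -
  obtain N :: nat where "\<bar>x\<bar> / a < real N" using reals_Archimedean2 by blast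
  then have "\<bar>x\<bar> < real N * a" using a_pos by (simp add: pos_divide_less_eq)
  then show ?thesis by (intro exI[of _ N]) auto
qed

lemma local_prim_AC_loc:
  fixes g F :: "real \<Rightarrow> complex"
  assumes "\<And>N. prim_on (- (real N * a)) (real N * a) g F"
  shows "F \<in> AC_loc"
  unfolding AC_loc_def
proof (intro CollectI allI)
  fix c d
  obtain N1 where N1: "c \<in> {- (real N1 * a)<..<real N1 * a}" using in_open_interval by blast
  obtain N2 where N2: "d \<in> {- (real N2 * a)<..<real N2 * a}" using in_open_interval by blast
  let ?N = "max N1 N2"
  have "real N1 * a \<le> real ?N * a" "real N2 * a \<le> real ?N * a" using a_pos by (intro mult_right_mono; simp)+
  then have "- (real ?N * a) \<le> c" "d \<le> real ?N * a" using N1 N2 by auto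
  then show "abs_continuous_on {c..d} F" by (intro prim_on_AC[OF prim_on_subset[OF assms[of ?N]]])
qed

lemma local_prim_AE_deriv:
  fixes g F :: "real \<Rightarrow> complex"
  assumes "\<And>N. prim_on (- (real N * a)) (real N * a) g F"
  shows "AE x in lebesgue. (F has_vector_derivative g x) (at x)"
proof -
  have "AE x in lebesgue. \<forall>N. x \<in> {- (real N * a)<..<real N * a} \<longrightarrow> (F has_vector_derivative g x) (at x)"
    unfolding AE_all_countable using prim_on_deriv[OF assms] by blast
  then show ?thesis
  proof eventually_elim
    case (elim x)
    then show ?case using in_open_interval[of x] by blast
  qed
qed

text \<open>The way back, used to place constructed solutions in the domain: primitives are locally
  absolutely continuous and differentiable almost everywhere, and w is nonzero almost
  everywhere.\<close>

lemma sol_maximal_op: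
  assumes s: "sol z h f u" and f: "f \<in> L2 w" and h: "h \<in> L2 w"
  shows "(f, h) \<in> op_shift (maximal_op w p q) z"
proof -
  have F: "AE x in lebesgue. (f has_vector_derivative R x * u x) (at x)" by (rule local_prim_AE_deriv[OF sol_prim(1)[OF s]])
  have U: "AE x in lebesgue. (u has_vector_derivative P z x * f x - W x * h x) (at x)" by (rule local_prim_AE_deriv[OF sol_prim(2)[OF s]])
  define g where "g = (\<lambda>x. z * f x + h x)"
  have gL: "g \<in> L2 w" using L2_lin[OF f h, of z 1] by (simp add: g_def)
  have "(f, g) \<in> maximal_op w p q"
    unfolding maximal_op_def
  proof (intro CollectI case_prodI conjI f gL bexI)
    show "ae_eq f f" by (simp add: ae_eq_def)
    show "ae_eq u (\<lambda>x. of_real (p x) * vector_derivative f (at x))"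
      unfolding ae_eq_def using F p_pos by eventually_elim (simp add: vector_derivative_at R_def)
    show "ae_eq g (\<lambda>x. 1 / of_real (w x) * (- vector_derivative u (at x) + of_real (q x) * f x))"
      unfolding ae_eq_def using U w_nz
    proof eventually_elim
      case (elim x)
      have "- (P z x * f x - W x * h x) + of_real (q x) * f x = of_real (w x) * g x"
        by (simp add: P_def Q_def W_def g_def algebra_simps)
      then show ?case using elim by (simp add: vector_derivative_at)
    qed
    show "f \<in> AC_loc" "u \<in> AC_loc" by (rule local_prim_AC_loc[OF sol_prim(1)[OF s]], rule local_prim_AC_loc[OF sol_prim(2)[OF s]])
  qed
  then have "(f, \<lambda>x. g x - z * f x) \<in> op_shift (maximal_op w p q) z" unfolding op_shift_def by blast
  then show ?thesis by (simp add: g_def)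
qed

lemma sol_measurable:
  assumes s: "sol z h f u" shows "f \<in> borel_measurable lebesgue"
proof -
  have "isCont f x" for x
  proof -
    obtain N where N: "x \<in> {- (real N * a)<..<real N * a}" using in_open_interval by blast
    have "continuous_on {- (real N * a)<..<real N * a} f"
      by (rule continuous_on_subset[OF prim_on_continuous[OF sol_prim(1)[OF s, of N]]]) auto
    then show ?thesis using N by (simp add: continuous_on_eq_continuous_at)
  qed
  then have "continuous_on UNIV f" by (simp add: continuous_at_imp_continuous_on)
  then have "f \<in> borel_measurable borel" by (rule borel_measurable_continuous_onI)
  then show ?thesis by (simp add: measurable_completion)
qed

lemma ae_eq_L2:
  assumes e: "ae_eq f g" and f: "f \<in> L2 w" and g: "g \<in> borel_measurable lebesgue"
  shows "g \<in> L2 w" "L2_norm w g = L2_norm w f" "Re (krein_inner w g g) = Re (krein_inner w f f)"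
proof -
  have fm: "f \<in> borel_measurable lebesgue" using f by (simp add: L2_def)
  have "integrable lebesgue (\<lambda>x. (cmod (g x))\<^sup>2 * \<bar>w x\<bar>) \<longleftrightarrow> integrable lebesgue (\<lambda>x. (cmod (f x))\<^sup>2 * \<bar>w x\<bar>)"
    by (rule integrable_cong_AE) (use fm g w_meas e in \<open>auto simp: ae_eq_def\<close>)
  then show "g \<in> L2 w" using f g by (simp add: L2_def)
  have "(L2_norm w g)\<^sup>2 = (L2_norm w f)\<^sup>2" unfolding L2_norm_sq
    by (rule integral_cong_AE) (use fm g w_meas e in \<open>auto simp: ae_eq_def\<close>)
  then show "L2_norm w g = L2_norm w f" using L2_norm_nonneg by simp
  show "Re (krein_inner w g g) = Re (krein_inner w f f)" unfolding krein_real
    by (rule integral_cong_AE) (use fm g w_meas e in \<open>auto simp: ae_eq_def\<close>)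
qed

text \<open>The pieces are selected by the floor of x / a. At the right end of a period the floor
  already belongs to the next one, and the matching conditions say exactly that the value is the
  same.\<close>

lemma glue_sol:
  fixes fk uk :: "int \<Rightarrow> real \<Rightarrow> complex"
  assumes s: "\<And>k. psol z (sh k h) (fk k) (uk k)" and m: "\<And>k. fk k a = fk (k + 1) 0" "\<And>k. uk k a = uk (k + 1) 0"
  shows "\<exists>f u. sol z h f u \<and> (\<forall>k. \<forall>x\<in>{0..a}. sh k f x = fk k x \<and> sh k u x = uk k x)"
proof -
  define gl where "gl = (\<lambda>\<phi>::int \<Rightarrow> real \<Rightarrow> complex. \<lambda>x. \<phi> \<lfloor>x / a\<rfloor> (x - of_int \<lfloor>x / a\<rfloor> * a))"
  have gl: "sh k (gl \<phi>) x = \<phi> k x" if m: "\<And>k. \<phi> k a = \<phi> (k + 1) 0" and x: "x \<in> {0..a}" for \<phi> k x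
  proof (cases "x = a")
    case True
    have "(a + of_int k * a) / a = of_int (k + 1)" using a_pos by (simp add: field_simps)
    then have "\<lfloor>(a + of_int k * a) / a\<rfloor> = k + 1" by simp
    then show ?thesis using True m[of k] by (simp add: sh_def gl_def algebra_simps)
  next
    case False
    have "(x + of_int k * a) / a = x / a + of_int k" using a_pos by (simp add: field_simps)
    moreover have "0 \<le> x / a" "x / a < 1" using x False a_pos by auto
    ultimately have "\<lfloor>(x + of_int k * a) / a\<rfloor> = k" by (simp add: floor_unique)
    then show ?thesis by (simp add: sh_def gl_def)
  qed
  have F: "sh k (gl fk) x = fk k x" and U: "sh k (gl uk) x = uk k x" if "x \<in> {0..a}" for k x
    using gl[of fk x k] gl[of uk x k] m that by auto
  have "psol z (sh k h) (sh k (gl fk)) (sh k (gl uk))" for k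
  proof -
    have p: "prim_on 0 a (\<lambda>x. R x * uk k x) (fk k)" "prim_on 0 a (\<lambda>x. P z x * fk k x - W x * sh k h x) (uk k)"
      using s[of k] by (auto simp: psol_def)
    have "prim_on 0 a (\<lambda>x. R x * sh k (gl uk) x) (sh k (gl fk))"
      by (rule prim_on_cong[OF p(1)]) (simp_all add: F U)
    moreover have "prim_on 0 a (\<lambda>x. P z x * sh k (gl fk) x - W x * sh k h x) (sh k (gl uk))"
      by (rule prim_on_cong[OF p(2)]) (simp_all add: F U)
    ultimately show ?thesis by (simp add: psol_def)
  qed
  then show ?thesis using F U by (intro exI[of _ "gl fk"] exI[of _ "gl uk"]) (auto simp: sol_def)
qed

lemma nsq_tail:
  assumes f: "f \<in> L2 w"
  shows "(\<lambda>N. nsq (sh (int N) f)) \<longlonglongrightarrow> 0" "(\<lambda>N. nsq (sh (- int N) f)) \<longlonglongrightarrow> 0"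
proof -
  let ?T = "\<lambda>N. \<Sum>k\<in>{- int N..<int N}. nsq (sh k f)"
  have "(\<lambda>N. ?T (Suc N) - ?T N) \<longlonglongrightarrow> (L2_norm w f)\<^sup>2 - (L2_norm w f)\<^sup>2"
    by (intro tendsto_diff LIMSEQ_Suc norm_sum_limit f)
  then have lim: "(\<lambda>N. nsq (sh (- int (Suc N)) f) + nsq (sh (int N) f)) \<longlonglongrightarrow> 0"
    unfolding sum_shift_Suc by (simp add: algebra_simps)
  show "(\<lambda>N. nsq (sh (int N) f)) \<longlonglongrightarrow> 0"
    by (rule Lim_null_comparison[OF _ lim]) (simp add: nsq_nonneg)
  have "(\<lambda>N. nsq (sh (- int (Suc N)) f)) \<longlonglongrightarrow> 0"
    by (rule Lim_null_comparison[OF _ lim]) (simp add: nsq_nonneg)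
  then show "(\<lambda>N. nsq (sh (- int N) f)) \<longlonglongrightarrow> 0" by (rule LIMSEQ_imp_Suc)
qed

definition Ysq :: "(real \<Rightarrow> complex) \<Rightarrow> (real \<Rightarrow> complex) \<Rightarrow> int \<Rightarrow> real" where
  "Ysq f u k = (cmod (f (of_int k * a)))\<^sup>2 + (cmod (u (of_int k * a)))\<^sup>2"

lemma Ysq_nonneg: "Ysq f u k \<ge> 0" by (simp add: Ysq_def)

lemma sh_0: "sh k f 0 = f (of_int k * a)" and sh_a: "sh k f a = f (of_int (k + 1) * a)"
  by (simp_all add: sh_def algebra_simps)

text \<open>The norms over single periods tend to zero because their sums converge, and
  \<open>initial_bound\<close> passes this to the data. Hence the boundary terms of all telescoping
  sums vanish in the limit.\<close>

lemma decay:
  assumes s: "sol z h f u" and f: "f \<in> L2 w" and h: "h \<in> L2 w"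
  shows "(\<lambda>N. Ysq f u (int N)) \<longlonglongrightarrow> 0" "(\<lambda>N. Ysq f u (- int N)) \<longlonglongrightarrow> 0"
proof -
  obtain K where K: "K > 0" "\<And>h f u. psol z h f u \<Longrightarrow> l2p h \<Longrightarrow> (cmod (f 0))\<^sup>2 + (cmod (u 0))\<^sup>2 \<le> K * (nsq f + nsq h)"
    using initial_bound[of z] by blast
  have b: "norm (Ysq f u k) \<le> K * (nsq (sh k f) + nsq (sh k h))" for k
    using K(2)[of "sh k h" "sh k f" "sh k u"] s L2_l2p[OF h] Ysq_nonneg[of f u k] by (simp add: sol_def Ysq_def sh_0)
  have "(\<lambda>N. K * (nsq (sh (int N) f) + nsq (sh (int N) h))) \<longlonglongrightarrow> K * (0 + 0)"
    by (intro tendsto_intros nsq_tail f h)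
  then have 1: "(\<lambda>N. K * (nsq (sh (int N) f) + nsq (sh (int N) h))) \<longlonglongrightarrow> 0" by simp
  show "(\<lambda>N. Ysq f u (int N)) \<longlonglongrightarrow> 0" by (rule Lim_null_comparison[OF always_eventually[OF allI[OF b]] 1])
  have "(\<lambda>N. K * (nsq (sh (- int N) f) + nsq (sh (- int N) h))) \<longlonglongrightarrow> K * (0 + 0)"
    by (intro tendsto_intros nsq_tail f h)
  then have 2: "(\<lambda>N. K * (nsq (sh (- int N) f) + nsq (sh (- int N) h))) \<longlonglongrightarrow> 0" by simp
  show "(\<lambda>N. Ysq f u (- int N)) \<longlonglongrightarrow> 0" by (rule Lim_null_comparison[OF always_eventually[OF allI[OF b]] 2])
qed

lemma partial_le_norm:
  assumes h: "h \<in> L2 w" shows "(\<Sum>k\<in>{- int N..<int N}. nsq (sh k h)) \<le> (L2_norm w h)\<^sup>2"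
proof (rule incseq_le[OF _ norm_sum_limit[OF h]])
  show "incseq (\<lambda>N. \<Sum>k\<in>{- int N..<int N}. nsq (sh k h))"
    by (rule incseq_SucI) (unfold sum_shift_Suc, simp add: nsq_nonneg)
qed

text \<open>For large |z| the energy exceeds the squared supremum of f by any prescribed factor, up
  to the defect, so neither the potential nor the weighted norm can compete with it.\<close>

lemma large_period:
  "\<exists>\<Lambda>>0. \<forall>z h f u. cmod z \<ge> \<Lambda> \<and> psol z h f u \<and> l2p h \<longrightarrow> En u + qf f \<ge> 3 * nsq f - nsq h"
proof -
  define q1 where "q1 = integral {0..a} (\<lambda>x. \<bar>q x\<bar>)"
  have q1: "q1 \<ge> 0" unfolding q1_def by (intro Henstock_Kurzweil_Integration.integral_nonneg absint_intro absq_absint) auto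
  \<comment> \<open>With B the resulting bound on |f|^2 this makes 4 (w1 + q1 + 1) B equal to the
    energy plus \<open>nsq h\<close>, while \<open>nsq f\<close> is at most w1 B and the potential
    takes away at most q1 B.\<close>
  define \<epsilon> where "\<epsilon> = 1 / (4 * (w1 + q1 + 1))"
  have \<epsilon>: "\<epsilon> > 0" using q1 w1_nonneg by (simp add: \<epsilon>_def)
  obtain \<Lambda> where \<Lambda>: "\<Lambda> > 0" "\<And>z h f u x. cmod z \<ge> \<Lambda> \<Longrightarrow> psol z h f u \<Longrightarrow> l2p h \<Longrightarrow> x \<in> {0..a} \<Longrightarrow> (cmod (f x))\<^sup>2 \<le> \<epsilon> * (En u + nsq h)"
    using large_sup[OF \<epsilon>] by blast
  show ?thesis
  proof (intro exI[of _ \<Lambda>] conjI allI impI \<Lambda>(1))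
    fix z h f u assume "cmod z \<ge> \<Lambda> \<and> psol z h f u \<and> l2p h"
    then have z: "cmod z \<ge> \<Lambda>" and s: "psol z h f u" and h: "l2p h" by auto
    have cf: "continuous_on {0..a} f" and cu: "continuous_on {0..a} u" by (rule psol_cont[OF s])+
    define B where "B = \<epsilon> * (En u + nsq h)"
    have B: "(cmod (f x))\<^sup>2 \<le> B" if "x \<in> {0..a}" for x unfolding B_def by (rule \<Lambda>(2)[OF z s h that])
    have En0: "En u + nsq h \<ge> 0" using En_nonneg[OF cu] nsq_nonneg[of h] by simp
    have B0: "B \<ge> 0" unfolding B_def using \<epsilon> En0 by simp
    have 1: "nsq f \<le> w1 * B"
    proof -
      have "nsq f \<le> integral {0..a} (\<lambda>x. \<bar>w x\<bar> * B)" unfolding nsq_def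
        by (rule integral_le) (use B in \<open>auto intro!: absint_intro[OF weight_sq_int[OF absw_absint cf]] integrable_on_mult_left absint_intro[OF absw_absint] mult_left_mono\<close>)
      also have "\<dots> = w1 * B" unfolding w1_def by (rule Henstock_Kurzweil_Integration.integral_mult_left)
      finally show ?thesis .
    qed
    have 2: "- qf f \<le> q1 * B"
    proof -
      have "norm (qf f) \<le> integral {0..a} (\<lambda>x. \<bar>q x\<bar> * B)" unfolding qf_def
        by (rule integral_norm_bound_integral) (use B in \<open>auto simp: abs_mult intro!: absint_intro[OF weight_sq_int[OF q_absint cf]] integrable_on_mult_left absint_intro[OF absq_absint] mult_left_mono\<close>)
      also have "\<dots> = q1 * B" unfolding q1_def by (rule Henstock_Kurzweil_Integration.integral_mult_left)
      finally show ?thesis by simp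
    qed
    have s0: "4 * (w1 + q1 + 1) > 0" using w1_nonneg q1 by simp
    have "4 * ((w1 + q1 + 1) * B) = (4 * (w1 + q1 + 1)) * \<epsilon> * (En u + nsq h)" by (simp add: B_def)
    also have "(4 * (w1 + q1 + 1)) * \<epsilon> = 1" unfolding \<epsilon>_def using s0 by simp
    finally have 3: "4 * (w1 * B) + 4 * (q1 * B) + 4 * B = En u + nsq h" by (simp add: algebra_simps)
    have 4: "0 \<le> w1 * B" "0 \<le> q1 * B" using w1_nonneg q1 B0 by auto
    show "En u + qf f \<ge> 3 * nsq f - nsq h" using 1 2 3 4 B0 by linarith
  qed
qed

text \<open>The threshold is fixed once, so that a single disc separates large from small parameters
  in the whole remaining argument.\<close>

definition Lam :: real where
  "Lam = (SOME \<Lambda>. \<Lambda> > 0 \<and> (\<forall>z h f u. cmod z \<ge> \<Lambda> \<and> psol z h f u \<and> l2p h \<longrightarrow> En u + qf f \<ge> 3 * nsq f - nsq h))"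

lemma Lam_pos: "Lam > 0" and large_Lam: "cmod z \<ge> Lam \<Longrightarrow> psol z h f u \<Longrightarrow> l2p h \<Longrightarrow> En u + qf f \<ge> 3 * nsq f - nsq h"
  using someI_ex[OF large_period, folded Lam_def] by blast+

lemma cross_bound:
  assumes s: "psol z h f u" and h: "l2p h"
  shows "cmod (integral {0..a} (\<lambda>x. W x * h x * cnj (f x))) \<le> sqrt (nsq h) * sqrt (nsq f)"
proof -
  have cf: "continuous_on {0..a} f" by (rule psol_cont[OF s])
  note i = energy(2)[OF s]
  have "cmod (integral {0..a} (\<lambda>x. W x * h x * cnj (f x))) \<le> integral {0..a} (\<lambda>x. cmod (W x * h x * cnj (f x)))"
    by (rule norm_integral_le[OF i])
  also have e: "(\<lambda>x. cmod (W x * h x * cnj (f x))) = (\<lambda>x. \<bar>w x\<bar> * (cmod (h x) * cmod (f x)))" by (auto simp: norm_mult W_def)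
  also have "integral {0..a} (\<lambda>x. \<bar>w x\<bar> * (cmod (h x) * cmod (f x))) \<le> sqrt (nsq h * nsq f)"
    unfolding nsq_def
  proof (rule integral_CS)
    show "(\<lambda>x. \<bar>w x\<bar> * (cmod (h x) * cmod (f x))) integrable_on {0..a}" using absint_intro[OF absint_cnorm[OF i]] unfolding e .
    show "(\<lambda>x. \<bar>w x\<bar> * (cmod (h x))\<^sup>2) integrable_on {0..a}" using h by (simp add: l2p_def absint_intro)
    show "(\<lambda>x. \<bar>w x\<bar> * (cmod (f x))\<^sup>2) integrable_on {0..a}" by (rule absint_intro[OF weight_sq_int[OF absw_absint cf]])
  qed auto
  finally show ?thesis by (simp add: real_sqrt_mult)
qed

text \<open>The real part of the energy identity is summed over symmetric windows. The boundary
  terms telescope and vanish by \<open>decay\<close>, the cross terms are bounded by Cauchy-Schwarz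
  for sums.\<close>

lemma large_real:
  assumes x: "\<bar>x\<bar> \<ge> Lam" and s: "sol (of_real x) h f u" and f: "f \<in> L2 w" and h: "h \<in> L2 w"
  shows "x * Re (krein_inner w f f) \<ge> 3 * (L2_norm w f)\<^sup>2 - (L2_norm w h)\<^sup>2 - L2_norm w h * L2_norm w f"
proof -
  let ?z = "complex_of_real x"
  have ps: "psol ?z (sh k h) (sh k f) (sh k u)" for k using s by (simp add: sol_def)
  define g where "g = (\<lambda>k::int. Re (u (of_int k * a) * cnj (f (of_int k * a))))"
  have gb: "\<bar>g k\<bar> \<le> Ysq f u k" for k
  proof -
    have "\<bar>g k\<bar> \<le> cmod (u (of_int k * a) * cnj (f (of_int k * a)))" unfolding g_def by (rule abs_Re_le_cmod)
    also have "\<dots> = cmod (u (of_int k * a)) * cmod (f (of_int k * a))" by (simp add: norm_mult)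
    also have "\<dots> \<le> Ysq f u k" unfolding Ysq_def
      using sum_squares_bound[of "cmod (u (of_int k * a))" "cmod (f (of_int k * a))"]
        mult_nonneg_nonneg[OF norm_ge_zero[of "u (of_int k * a)"] norm_ge_zero[of "f (of_int k * a)"]] by linarith
    finally show ?thesis .
  qed
  have per: "x * kr (sh k f) \<ge> 3 * nsq (sh k f) - nsq (sh k h) - sqrt (nsq (sh k h)) * sqrt (nsq (sh k f)) - (g (k + 1) - g k)" for k
  proof -
    have "Re (of_real (En (sh k u) + qf (sh k f)) - ?z * of_real (kr (sh k f)) - integral {0..a} (\<lambda>x. W x * sh k h x * cnj (sh k f x))) = g (k + 1) - g k"
      unfolding energy(1)[OF ps] by (simp add: g_def sh_0 sh_a)
    then have "En (sh k u) + qf (sh k f) - x * kr (sh k f) - Re (integral {0..a} (\<lambda>x. W x * sh k h x * cnj (sh k f x))) = g (k + 1) - g k" by simp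
    moreover have "\<bar>Re (integral {0..a} (\<lambda>x. W x * sh k h x * cnj (sh k f x)))\<bar> \<le> sqrt (nsq (sh k h)) * sqrt (nsq (sh k f))"
      using abs_Re_le_cmod cross_bound[OF ps L2_l2p[OF h]] by (rule order_trans)
    moreover have "En (sh k u) + qf (sh k f) \<ge> 3 * nsq (sh k f) - nsq (sh k h)"
      by (rule large_Lam[OF _ ps L2_l2p[OF h]]) (use x in simp)
    ultimately show ?thesis by linarith
  qed
  let ?S = "\<lambda>\<phi> N. \<Sum>k\<in>{- int N..<int N}. \<phi> k"
  have CS: "?S (\<lambda>k. sqrt (nsq (sh k h)) * sqrt (nsq (sh k f))) N \<le> L2_norm w h * L2_norm w f" for N
  proof -
    have "?S (\<lambda>k. \<bar>sqrt (nsq (sh k h))\<bar> * \<bar>sqrt (nsq (sh k f))\<bar>) N \<le> L2_set (\<lambda>k. sqrt (nsq (sh k h))) {- int N..<int N} * L2_set (\<lambda>k. sqrt (nsq (sh k f))) {- int N..<int N}"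
      by (rule L2_set_mult_ineq)
    also have "\<dots> = sqrt (?S (\<lambda>k. nsq (sh k h)) N) * sqrt (?S (\<lambda>k. nsq (sh k f)) N)" by (simp add: L2_set_def nsq_nonneg)
    also have "\<dots> \<le> sqrt ((L2_norm w h)\<^sup>2) * sqrt ((L2_norm w f)\<^sup>2)"
      by (intro mult_mono real_sqrt_le_mono partial_le_norm f h) (auto intro!: sum_nonneg nsq_nonneg)
    finally show ?thesis using L2_norm_nonneg by (simp add: nsq_nonneg)
  qed
  have fin: "3 * ?S (\<lambda>k. nsq (sh k f)) N - ?S (\<lambda>k. nsq (sh k h)) N - L2_norm w h * L2_norm w f - (g (int N) - g (- int N)) \<le> x * ?S (\<lambda>k. kr (sh k f)) N" for N
  proof -
    have tel: "?S (\<lambda>k. g (k + 1)) N - ?S g N = g (int N) - g (- int N)"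
      using sum_telescope_int[of g N] by (simp only: sum_subtractf)
    have "?S (\<lambda>k. 3 * nsq (sh k f) - nsq (sh k h) - sqrt (nsq (sh k h)) * sqrt (nsq (sh k f)) - (g (k + 1) - g k)) N \<le> ?S (\<lambda>k. x * kr (sh k f)) N"
      by (intro sum_mono per)
    then have "3 * ?S (\<lambda>k. nsq (sh k f)) N - ?S (\<lambda>k. nsq (sh k h)) N - ?S (\<lambda>k. sqrt (nsq (sh k h)) * sqrt (nsq (sh k f))) N - (g (int N) - g (- int N)) \<le> x * ?S (\<lambda>k. kr (sh k f)) N"
      unfolding sum_subtractf sum_distrib_left tel .
    then show ?thesis using CS[of N] by linarith
  qed
  have g0: "(\<lambda>N. g (int N)) \<longlonglongrightarrow> 0" "(\<lambda>N. g (- int N)) \<longlonglongrightarrow> 0"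
    by (rule Lim_null_comparison[OF _ decay(1)[OF s f h]]; simp add: gb)
       (rule Lim_null_comparison[OF _ decay(2)[OF s f h]]; simp add: gb)
  have L: "(\<lambda>N. 3 * ?S (\<lambda>k. nsq (sh k f)) N - ?S (\<lambda>k. nsq (sh k h)) N - L2_norm w h * L2_norm w f - (g (int N) - g (- int N)))
      \<longlonglongrightarrow> 3 * (L2_norm w f)\<^sup>2 - (L2_norm w h)\<^sup>2 - L2_norm w h * L2_norm w f - (0 - 0)"
    by (intro tendsto_diff tendsto_mult tendsto_const norm_sum_limit f h g0)
  have Rr: "(\<lambda>N. x * ?S (\<lambda>k. kr (sh k f)) N) \<longlonglongrightarrow> x * Re (krein_inner w f f)"
    by (intro tendsto_mult tendsto_const krein_sum_limit f)
  have "3 * (L2_norm w f)\<^sup>2 - (L2_norm w h)\<^sup>2 - L2_norm w h * L2_norm w f - (0 - 0) \<le> x * Re (krein_inner w f f)"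
    by (rule LIMSEQ_le[OF L Rr]) (use fin in blast)
  then show ?thesis by simp
qed

text \<open>A multiplier of modulus one makes the boundary terms at 0 and a equal. The energy
  identity then writes z times the real number \<open>kr f\<close> as a positive real number, so z
  is a quotient of reals.\<close>

lemma large_floquet:
  assumes z: "cmod z \<ge> Lam" and s: "psol z (\<lambda>x. 0) f u" and nz: "f 0 \<noteq> 0 \<or> u 0 \<noteq> 0"
    and fl: "f a = \<rho> * f 0" "u a = \<rho> * u 0" and \<rho>: "cmod \<rho> = 1"
  shows "z \<in> \<real>"
proof -
  have r1: "\<rho> * cnj \<rho> = 1" using complex_norm_square[of \<rho>] \<rho> by simp
  have "u a * cnj (f a) = (\<rho> * cnj \<rho>) * (u 0 * cnj (f 0))" unfolding fl by (simp add: mult_ac)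
  then have "u a * cnj (f a) = u 0 * cnj (f 0)" unfolding r1 by simp
  then have e: "complex_of_real (En u + qf f) = z * of_real (kr f)" using energy(1)[OF s] by simp
  have "En u + qf f > 0" using large_Lam[OF z s l2p_zero] nsq_pos[OF s nz] by (simp add: nsq_zero)
  have k: "kr f \<noteq> 0"
  proof
    assume "kr f = 0"
    then have "complex_of_real (En u + qf f) = 0" using e by simp
    then have "En u + qf f = 0" by (simp only: of_real_eq_0_iff)
    then show False using \<open>En u + qf f > 0\<close> by simp
  qed
  have "z = of_real ((En u + qf f) / kr f)" unfolding of_real_divide e using k by simp
  then show ?thesis by (metis Reals_of_real)
qed

end

subsection \<open>Resolvent points\<close>

text \<open>Convexity of the square with weights |\<rho>| and 1 - |\<rho>|, applied to |x| and |y| /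
  (1 - |\<rho>|).\<close>

lemma convex_sq:
  fixes x y \<rho> :: complex
  assumes r: "cmod \<rho> < 1"
  shows "(cmod (\<rho> * x + y))\<^sup>2 \<le> cmod \<rho> * (cmod x)\<^sup>2 + (cmod y)\<^sup>2 / (1 - cmod \<rho>)"
proof -
  let ?r = "cmod \<rho>"
  have "(cmod (\<rho> * x + y))\<^sup>2 \<le> (?r * cmod x + cmod y)\<^sup>2"
    by (intro power_mono order_trans[OF norm_triangle_ineq]) (auto simp: norm_mult)
  also have "\<dots> \<le> ?r * (cmod x)\<^sup>2 + (cmod y)\<^sup>2 / (1 - ?r)"
  proof -
    have "0 \<le> ?r * ((1 - ?r) * cmod x - cmod y)\<^sup>2" by simp
    then have "(?r * cmod x + cmod y)\<^sup>2 * (1 - ?r) \<le> ?r * (cmod x)\<^sup>2 * (1 - ?r) + (cmod y)\<^sup>2"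
      by (simp add: power2_eq_square algebra_simps)
    then have "(?r * cmod x + cmod y)\<^sup>2 \<le> (?r * (cmod x)\<^sup>2 * (1 - ?r) + (cmod y)\<^sup>2) / (1 - ?r)" using r by (simp add: pos_le_divide_eq)
    also have "\<dots> = ?r * (cmod x)\<^sup>2 + (cmod y)\<^sup>2 / (1 - ?r)" using r by (simp add: add_divide_distrib)
    finally show ?thesis .
  qed
  finally show ?thesis .
qed

text \<open>Summing the convexity bound shifts the index, and the shift costs only a boundary term
  at the left end. No summability of the sequence is presupposed, so the bound can later be used to
  prove it.\<close>

lemma contract_apriori:
  fixes \<alpha> e :: "int \<Rightarrow> complex"
  assumes r: "cmod \<rho> < 1" and rec: "\<And>k. \<alpha> (k + 1) = \<rho> * \<alpha> k + e k"
  shows "(1 - cmod \<rho>) * (\<Sum>k\<in>{- int N..<int N}. (cmod (\<alpha> k))\<^sup>2)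
    \<le> (cmod (\<alpha> (- int N)))\<^sup>2 + (\<Sum>k\<in>{- int N..<int N}. (cmod (e k))\<^sup>2) / (1 - cmod \<rho>)"
proof -
  let ?S = "\<lambda>g. \<Sum>k\<in>{- int N..<int N}. g k :: real"
  have 1: "?S (\<lambda>k. (cmod (\<alpha> (k + 1)))\<^sup>2) - ?S (\<lambda>k. (cmod (\<alpha> k))\<^sup>2) = (cmod (\<alpha> (int N)))\<^sup>2 - (cmod (\<alpha> (- int N)))\<^sup>2"
    using sum_telescope_int[of "\<lambda>k. (cmod (\<alpha> k))\<^sup>2" N] by (simp only: sum_subtractf)
  have "?S (\<lambda>k. (cmod (\<alpha> (k + 1)))\<^sup>2) \<le> ?S (\<lambda>k. cmod \<rho> * (cmod (\<alpha> k))\<^sup>2 + (cmod (e k))\<^sup>2 / (1 - cmod \<rho>))"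
    unfolding rec by (intro sum_mono convex_sq r)
  also have "\<dots> = cmod \<rho> * ?S (\<lambda>k. (cmod (\<alpha> k))\<^sup>2) + ?S (\<lambda>k. (cmod (e k))\<^sup>2) / (1 - cmod \<rho>)"
    by (simp only: sum.distrib sum_distrib_left sum_divide_distrib)
  finally show ?thesis using 1 zero_le_power2[of "cmod (\<alpha> (int N))"] unfolding left_diff_distrib by linarith
qed

text \<open>The version for the expanding component: run backwards it contracts, and the boundary
  term sits at the right end.\<close>

lemma contract_apriori_back:
  fixes \<alpha> e :: "int \<Rightarrow> complex"
  assumes r: "cmod \<rho> < 1" and rec: "\<And>k. \<alpha> k = \<rho> * \<alpha> (k + 1) + e k"
  shows "(1 - cmod \<rho>) * (\<Sum>k\<in>{- int N..<int N}. (cmod (\<alpha> k))\<^sup>2)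
    \<le> (cmod (\<alpha> (int N)))\<^sup>2 + (\<Sum>k\<in>{- int N..<int N}. (cmod (e k))\<^sup>2) / (1 - cmod \<rho>)"
proof -
  let ?S = "\<lambda>g. \<Sum>k\<in>{- int N..<int N}. g k :: real"
  have 1: "?S (\<lambda>k. (cmod (\<alpha> (k + 1)))\<^sup>2) - ?S (\<lambda>k. (cmod (\<alpha> k))\<^sup>2) = (cmod (\<alpha> (int N)))\<^sup>2 - (cmod (\<alpha> (- int N)))\<^sup>2"
    using sum_telescope_int[of "\<lambda>k. (cmod (\<alpha> k))\<^sup>2" N] by (simp only: sum_subtractf)
  have "?S (\<lambda>k. (cmod (\<alpha> k))\<^sup>2) \<le> ?S (\<lambda>k. cmod \<rho> * (cmod (\<alpha> (k + 1)))\<^sup>2 + (cmod (e k))\<^sup>2 / (1 - cmod \<rho>))"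
  proof (rule sum_mono)
    fix k show "(cmod (\<alpha> k))\<^sup>2 \<le> cmod \<rho> * (cmod (\<alpha> (k + 1)))\<^sup>2 + (cmod (e k))\<^sup>2 / (1 - cmod \<rho>)"
      by (subst rec) (rule convex_sq[OF r])
  qed
  also have "\<dots> = cmod \<rho> * ?S (\<lambda>k. (cmod (\<alpha> (k + 1)))\<^sup>2) + ?S (\<lambda>k. (cmod (e k))\<^sup>2) / (1 - cmod \<rho>)"
    by (simp only: sum.distrib sum_distrib_left sum_divide_distrib)
  also have "cmod \<rho> * ?S (\<lambda>k. (cmod (\<alpha> (k + 1)))\<^sup>2) \<le> cmod \<rho> * (?S (\<lambda>k. (cmod (\<alpha> k))\<^sup>2) + (cmod (\<alpha> (int N)))\<^sup>2)"
    using 1 zero_le_power2[of "cmod (\<alpha> (- int N))"] by (intro mult_left_mono) (linarith, simp)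
  also have "\<dots> \<le> cmod \<rho> * ?S (\<lambda>k. (cmod (\<alpha> k))\<^sup>2) + (cmod (\<alpha> (int N)))\<^sup>2"
    using mult_right_mono[of "cmod \<rho>" 1 "(cmod (\<alpha> (int N)))\<^sup>2"] r by (simp add: distrib_left)
  finally show ?thesis unfolding left_diff_distrib by simp
qed

lemma contract_exists:
  fixes e :: "int \<Rightarrow> complex"
  assumes r: "cmod \<rho> < 1" and B: "\<And>k. cmod (e k) \<le> B"
  shows "\<exists>\<alpha>. (\<forall>k. \<alpha> (k + 1) = \<rho> * \<alpha> k + e k) \<and> (\<forall>k. cmod (\<alpha> k) \<le> B / (1 - cmod \<rho>))"
proof -
  \<comment> \<open>The bounded solution is the series over the past. Its forcing index starts at k
    - 1 because \<open>e k\<close> first enters \<open>\<alpha> (k + 1)\<close>.\<close>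
  define t where "t = (\<lambda>k j. \<rho> ^ j * e (k - 1 - int j))"
  have tb: "norm (t k j) \<le> B * cmod \<rho> ^ j" for k j
    unfolding t_def norm_mult norm_power by (subst mult.commute) (intro mult_right_mono B zero_le_power norm_ge_zero)
  have gs: "(\<lambda>j. B * cmod \<rho> ^ j) sums (B * (1 / (1 - cmod \<rho>)))" using r by (intro sums_mult geometric_sums) simp
  have ts: "summable (t k)" for k by (rule summable_comparison_test'[OF sums_summable[OF gs]]) (rule tb)
  have tn: "summable (\<lambda>j. norm (t k j))" for k by (rule summable_comparison_test'[OF sums_summable[OF gs]]) (simp add: tb)
  define \<alpha> where "\<alpha> = (\<lambda>k. suminf (t k))"
  have "\<alpha> (k + 1) = \<rho> * \<alpha> k + e k" for k
  proof -
    have "suminf (t (k + 1)) = t (k + 1) 0 + (\<Sum>j. t (k + 1) (Suc j))"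
      using suminf_split_head[OF ts, of "k + 1"] by simp
    also have "(\<lambda>j. t (k + 1) (Suc j)) = (\<lambda>j. \<rho> * t k j)" by (intro ext) (simp add: t_def algebra_simps)
    also have "(\<Sum>j. \<rho> * t k j) = \<rho> * suminf (t k)" by (rule suminf_mult[OF ts])
    finally show ?thesis by (simp add: \<alpha>_def t_def)
  qed
  moreover have "cmod (\<alpha> k) \<le> B / (1 - cmod \<rho>)" for k
  proof -
    have "cmod (\<alpha> k) \<le> (\<Sum>j. norm (t k j))" unfolding \<alpha>_def by (rule summable_norm[OF tn])
    also have "\<dots> \<le> (\<Sum>j. B * cmod \<rho> ^ j)" by (intro suminf_le tb tn sums_summable[OF gs])
    also have "\<dots> = B / (1 - cmod \<rho>)" using sums_unique[OF gs] by simp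
    finally show ?thesis .
  qed
  ultimately show ?thesis by blast
qed

lemma contract_exists_back:
  fixes e :: "int \<Rightarrow> complex"
  assumes r: "cmod \<rho> < 1" and B: "\<And>k. cmod (e k) \<le> B"
  shows "\<exists>\<alpha>. (\<forall>k. \<alpha> k = \<rho> * \<alpha> (k + 1) + e k) \<and> (\<forall>k. cmod (\<alpha> k) \<le> B / (1 - cmod \<rho>))"
proof -
  \<comment> \<open>Under the reflection of indices the step between k and k + 1 becomes the step
    from -k - 1 to -k, hence the shifted forcing index.\<close>
  obtain \<alpha> where \<alpha>: "\<And>k. \<alpha> (k + 1) = \<rho> * \<alpha> k + e (- k - 1)" "\<And>k. cmod (\<alpha> k) \<le> B / (1 - cmod \<rho>)"
    using contract_exists[OF r, of "\<lambda>k. e (- k - 1)" B] B by blast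
  have "\<alpha> (- k) = \<rho> * \<alpha> (- (k + 1)) + e k" for k
  proof -
    have e: "- (k + 1) = - k - 1" by simp
    show ?thesis unfolding e using \<alpha>(1)[of "- k - 1"] by simp
  qed
  then show ?thesis using \<alpha>(2) by (intro exI[of _ "\<lambda>k. \<alpha> (- k)"]) blast
qed

section \<open>Hyperbolic two-by-two recursions\<close>

lemma lin_sq_le:
  fixes c1 c2 x y :: complex
  shows "(cmod (c1 * x + c2 * y))\<^sup>2 \<le> ((cmod c1)\<^sup>2 + (cmod c2)\<^sup>2) * ((cmod x)\<^sup>2 + (cmod y)\<^sup>2)"
proof -
  have "(cmod (c1 * x + c2 * y))\<^sup>2 \<le> (cmod c1 * cmod x + cmod c2 * cmod y)\<^sup>2"
    by (intro power_mono order_trans[OF norm_triangle_ineq]) (auto simp: norm_mult)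
  also have "\<dots> \<le> ((cmod c1)\<^sup>2 + (cmod c2)\<^sup>2) * ((cmod x)\<^sup>2 + (cmod y)\<^sup>2)"
    using zero_le_power2[of "cmod c1 * cmod y - cmod c2 * cmod x"] by (simp add: power2_eq_square algebra_simps)
  finally show ?thesis .
qed

text \<open>A hyperbolic matrix M of determinant one: \<rho> and \<sigma> = 1/\<rho> are its
  eigenvalues, and neither lies on the unit circle.\<close>

locale hyp2 =
  fixes m11 m12 m21 m22 \<rho> \<sigma> :: complex
  assumes det: "m11 * m22 - m12 * m21 = 1" and tr: "\<rho> + \<sigma> = m11 + m22" and inv: "\<rho> * \<sigma> = 1" and r: "cmod \<rho> < 1"
begin

lemma d_nz: "\<rho> - \<sigma> \<noteq> 0"
proof
  assume "\<rho> - \<sigma> = 0"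
  then have "\<rho> * \<rho> = 1" using inv by simp
  then have "cmod \<rho> * cmod \<rho> = 1" by (metis norm_mult norm_one)
  then show False using r by (metis abs_norm_cancel abs_square_eq_1 less_irrefl power2_eq_square)
qed

definition rec :: "(int \<Rightarrow> complex) \<Rightarrow> (int \<Rightarrow> complex) \<Rightarrow> (int \<Rightarrow> complex) \<Rightarrow> (int \<Rightarrow> complex) \<Rightarrow> bool" where
  "rec e1 e2 y1 y2 \<longleftrightarrow> (\<forall>k. y1 (k + 1) = m11 * y1 k + m12 * y2 k + e1 k \<and> y2 (k + 1) = m21 * y1 k + m22 * y2 k + e2 k)"

text \<open>By Cayley-Hamilton (M - \<sigma>)/(\<rho> - \<sigma>) and -(M - \<rho>)/(\<rho> -
  \<sigma>) are the spectral projections. Each component of the forcing is solved forwards with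
  \<rho> and backwards with \<sigma>; applying the projections to these scalar solutions and adding
  gives a bounded solution of the system.\<close>

lemma rec_exists:
  assumes B: "\<And>k. cmod (e1 k) \<le> B" "\<And>k. cmod (e2 k) \<le> B"
  shows "\<exists>y1 y2 B'. rec e1 e2 y1 y2 \<and> (\<forall>k. (cmod (y1 k))\<^sup>2 + (cmod (y2 k))\<^sup>2 \<le> B')"
proof -
  let ?r = "cmod \<rho>"
  obtain a1 where a1: "\<And>k. a1 (k + 1) = \<rho> * a1 k + e1 k" "\<And>k. cmod (a1 k) \<le> B / (1 - ?r)" using contract_exists[OF r, of e1 B, OF B(1)] by blast
  obtain a2 where a2: "\<And>k. a2 (k + 1) = \<rho> * a2 k + e2 k" "\<And>k. cmod (a2 k) \<le> B / (1 - ?r)" using contract_exists[OF r, of e2 B, OF B(2)] by blast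
  \<comment> \<open>The expanding recursion b (k + 1) = \<sigma> b k + e k, multiplied by \<rho> =
    1/\<sigma>, reads b k = \<rho> b (k + 1) - \<rho> e k and is thus a contraction
    backwards.\<close>
  have B': "cmod (- \<rho> * e1 k) \<le> ?r * B" "cmod (- \<rho> * e2 k) \<le> ?r * B" for k using B by (auto simp: norm_mult intro: mult_left_mono)
  obtain b1 where b1: "\<And>k. b1 k = \<rho> * b1 (k + 1) + (- \<rho> * e1 k)" "\<And>k. cmod (b1 k) \<le> ?r * B / (1 - ?r)" using contract_exists_back[OF r, of "\<lambda>k. - \<rho> * e1 k", OF B'(1)] by blast
  obtain b2 where b2: "\<And>k. b2 k = \<rho> * b2 (k + 1) + (- \<rho> * e2 k)" "\<And>k. cmod (b2 k) \<le> ?r * B / (1 - ?r)" using contract_exists_back[OF r, of "\<lambda>k. - \<rho> * e2 k", OF B'(2)] by blast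
  have bs1: "b1 (k + 1) = \<sigma> * b1 k + e1 k" for k using b1(1)[of k] inv by algebra
  have bs2: "b2 (k + 1) = \<sigma> * b2 k + e2 k" for k using b2(1)[of k] inv by algebra
  define d where "d = \<rho> - \<sigma>"
  have d: "d \<noteq> 0" using d_nz by (simp add: d_def)
  define x1 x2 where "x1 = (\<lambda>k. (m11 - \<sigma>) * a1 k + m12 * a2 k - (m11 - \<rho>) * b1 k - m12 * b2 k)"
    and "x2 = (\<lambda>k. m21 * a1 k + (m22 - \<sigma>) * a2 k - m21 * b1 k - (m22 - \<rho>) * b2 k)"
  have X1: "x1 (k + 1) = m11 * x1 k + m12 * x2 k + d * e1 k" for k
    unfolding x1_def x2_def d_def a1(1) a2(1) bs1 bs2 using det tr inv by algebra
  have X2: "x2 (k + 1) = m21 * x1 k + m22 * x2 k + d * e2 k" for k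
    unfolding x1_def x2_def d_def a1(1) a2(1) bs1 bs2 using det tr inv by algebra
  have "rec e1 e2 (\<lambda>k. x1 k / d) (\<lambda>k. x2 k / d)"
    unfolding rec_def X1 X2 using d by (simp add: add_divide_distrib)
  moreover have "(cmod (x1 k / d))\<^sup>2 + (cmod (x2 k / d))\<^sup>2 \<le>
     (((cmod (m11 - \<sigma>) + cmod m12 + cmod (m11 - \<rho>) + cmod m12) * (B / (1 - ?r) + ?r * B / (1 - ?r))) / cmod d)\<^sup>2
     + (((cmod m21 + cmod (m22 - \<sigma>) + cmod m21 + cmod (m22 - \<rho>)) * (B / (1 - ?r) + ?r * B / (1 - ?r))) / cmod d)\<^sup>2" for k
  proof -
    let ?C = "B / (1 - ?r) + ?r * B / (1 - ?r)"
    have B0: "B \<ge> 0" using order_trans[OF norm_ge_zero B(1)] .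
    have p: "B / (1 - ?r) \<ge> 0" "?r * B / (1 - ?r) \<ge> 0" using B0 r by auto
    have c: "cmod (a1 k) \<le> ?C" "cmod (a2 k) \<le> ?C" "cmod (b1 k) \<le> ?C" "cmod (b2 k) \<le> ?C"
      using a1(2)[of k] a2(2)[of k] b1(2)[of k] b2(2)[of k] p by linarith+
    have tri: "cmod (c1 * u1 + c2 * u2 - c3 * u3 - c4 * u4) \<le> (cmod c1 + cmod c2 + cmod c3 + cmod c4) * C"
      if "cmod u1 \<le> C" "cmod u2 \<le> C" "cmod u3 \<le> C" "cmod u4 \<le> C" for c1 c2 c3 c4 u1 u2 u3 u4 :: complex and C
    proof -
      have "cmod (c1 * u1 + c2 * u2 - c3 * u3 - c4 * u4) \<le> cmod (c1 * u1) + cmod (c2 * u2) + cmod (c3 * u3) + cmod (c4 * u4)"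
        using norm_triangle_ineq4[of "c1 * u1 + c2 * u2 - c3 * u3" "c4 * u4"] norm_triangle_ineq4[of "c1 * u1 + c2 * u2" "c3 * u3"]
          norm_triangle_ineq[of "c1 * u1" "c2 * u2"] by linarith
      also have "\<dots> \<le> cmod c1 * C + cmod c2 * C + cmod c3 * C + cmod c4 * C"
        unfolding norm_mult by (intro add_mono mult_left_mono that norm_ge_zero)
      finally show ?thesis by (simp add: algebra_simps)
    qed
    have "cmod (x1 k) \<le> (cmod (m11 - \<sigma>) + cmod m12 + cmod (m11 - \<rho>) + cmod m12) * ?C" unfolding x1_def by (rule tri[OF c])
    moreover have "cmod (x2 k) \<le> (cmod m21 + cmod (m22 - \<sigma>) + cmod m21 + cmod (m22 - \<rho>)) * ?C" unfolding x2_def by (rule tri[OF c])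
    ultimately show ?thesis unfolding norm_divide by (intro add_mono power_mono divide_right_mono) auto
  qed
  ultimately show ?thesis by blast
qed

text \<open>The components of (M - \<sigma>) y obey the forward contraction, those of (M - \<rho>) y
  the backward one, and their difference is (\<rho> - \<sigma>) y. Both boundary terms of the window
  therefore occur on the right.\<close>

lemma rec_apriori:
  "\<exists>K>0. \<forall>e1 e2 y1 y2 N. rec e1 e2 y1 y2 \<longrightarrow>
    (\<Sum>k\<in>{- int N..<int N}. (cmod (y1 k))\<^sup>2 + (cmod (y2 k))\<^sup>2)
    \<le> K * ((cmod (y1 (- int N)))\<^sup>2 + (cmod (y2 (- int N)))\<^sup>2 + (cmod (y1 (int N)))\<^sup>2 + (cmod (y2 (int N)))\<^sup>2
       + (\<Sum>k\<in>{- int N..<int N}. (cmod (e1 k))\<^sup>2 + (cmod (e2 k))\<^sup>2))"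
proof -
  let ?r = "cmod \<rho>"
  define L where "L = (cmod (m11 - \<sigma>))\<^sup>2 + (cmod m12)\<^sup>2 + (cmod m21)\<^sup>2 + (cmod (m22 - \<sigma>))\<^sup>2 + (cmod (m11 - \<rho>))\<^sup>2 + (cmod (m22 - \<rho>))\<^sup>2"
  have L0: "L \<ge> 0" by (simp add: L_def)
  define K0 where "K0 = L / (1 - ?r)\<^sup>2"
  have r1: "1 - ?r > 0" "1 - ?r \<le> 1" using r by auto
  have K00: "K0 \<ge> 0" using L0 by (simp add: K0_def)
  define d where "d = \<rho> - \<sigma>"
  have d: "cmod d > 0" using d_nz by (simp add: d_def)
  define K where "K = 8 * K0 / (cmod d)\<^sup>2 + 1"
  have K: "K > 0" using K00 by (simp add: K_def add_nonneg_pos)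
  show ?thesis
  proof (intro exI[of _ K] conjI allI impI K)
    fix e1 e2 y1 y2 N assume rc: "rec e1 e2 y1 y2"
    then have R: "y1 (k + 1) = m11 * y1 k + m12 * y2 k + e1 k" "y2 (k + 1) = m21 * y1 k + m22 * y2 k + e2 k" for k
      by (auto simp: rec_def)
    let ?S = "\<lambda>g. \<Sum>k\<in>{- int N..<int N}. g k :: real"
    define X where "X = (cmod (y1 (- int N)))\<^sup>2 + (cmod (y2 (- int N)))\<^sup>2 + (cmod (y1 (int N)))\<^sup>2 + (cmod (y2 (int N)))\<^sup>2
       + ?S (\<lambda>k. (cmod (e1 k))\<^sup>2 + (cmod (e2 k))\<^sup>2)"
    have Xb: "(cmod (y1 (- int N)))\<^sup>2 + (cmod (y2 (- int N)))\<^sup>2 + ?S (\<lambda>k. (cmod (e1 k))\<^sup>2 + (cmod (e2 k))\<^sup>2) \<le> X"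
       "(cmod (y1 (int N)))\<^sup>2 + (cmod (y2 (int N)))\<^sup>2 + ?S (\<lambda>k. (cmod (e1 k))\<^sup>2 + (cmod (e2 k))\<^sup>2) \<le> X"
      unfolding X_def by auto
    have gen: "?S (\<lambda>k. (cmod (c1 * y1 k + c2 * y2 k))\<^sup>2) \<le> K0 * X"
      if c: "(cmod c1)\<^sup>2 + (cmod c2)\<^sup>2 \<le> L"
        and ap: "(1 - ?r) * ?S (\<lambda>k. (cmod (c1 * y1 k + c2 * y2 k))\<^sup>2) \<le> (cmod (c1 * y1 j + c2 * y2 j))\<^sup>2 + ?S (\<lambda>k. (cmod (c1 * e1 k + c2 * e2 k))\<^sup>2) / (1 - ?r)"
        and j: "(cmod (y1 j))\<^sup>2 + (cmod (y2 j))\<^sup>2 + ?S (\<lambda>k. (cmod (e1 k))\<^sup>2 + (cmod (e2 k))\<^sup>2) \<le> X" for c1 c2 j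
    proof -
      have 1: "(cmod (c1 * x + c2 * y))\<^sup>2 \<le> L * ((cmod x)\<^sup>2 + (cmod y)\<^sup>2)" for x y
        using lin_sq_le[of c1 x c2 y] mult_right_mono[OF c, of "(cmod x)\<^sup>2 + (cmod y)\<^sup>2"] by simp
      let ?y = "(cmod (c1 * y1 j + c2 * y2 j))\<^sup>2" and ?e = "?S (\<lambda>k. (cmod (c1 * e1 k + c2 * e2 k))\<^sup>2)"
      have "?e \<le> ?S (\<lambda>k. L * ((cmod (e1 k))\<^sup>2 + (cmod (e2 k))\<^sup>2))" by (intro sum_mono 1)
      then have 2: "?e \<le> L * ?S (\<lambda>k. (cmod (e1 k))\<^sup>2 + (cmod (e2 k))\<^sup>2)" by (simp only: sum_distrib_left)
      have "?y + ?e / (1 - ?r) \<le> ?y / (1 - ?r) + ?e / (1 - ?r)"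
        using r1 mult_left_mono[of "1 - ?r" 1 "?y"] by (simp add: pos_le_divide_eq)
      also have "\<dots> = (?y + ?e) / (1 - ?r)" by (simp add: add_divide_distrib)
      also have "\<dots> \<le> (L * X) / (1 - ?r)"
      proof (intro divide_right_mono)
        have "?y + ?e \<le> L * ((cmod (y1 j))\<^sup>2 + (cmod (y2 j))\<^sup>2 + ?S (\<lambda>k. (cmod (e1 k))\<^sup>2 + (cmod (e2 k))\<^sup>2))"
          using add_mono[OF 1[of "y1 j" "y2 j"] 2] by (simp only: distrib_left)
        also have "\<dots> \<le> L * X" by (rule mult_left_mono[OF j L0])
        finally show "?y + ?e \<le> L * X" .
      qed (use r1 in simp)
      finally have "(1 - ?r) * ?S (\<lambda>k. (cmod (c1 * y1 k + c2 * y2 k))\<^sup>2) \<le> (L * X) / (1 - ?r)" using ap by linarith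
      then have "?S (\<lambda>k. (cmod (c1 * y1 k + c2 * y2 k))\<^sup>2) \<le> (L * X) / (1 - ?r) / (1 - ?r)" using r1 by (simp add: pos_le_divide_eq mult.commute)
      then show ?thesis by (simp add: K0_def power2_eq_square)
    qed
    have A1: "?S (\<lambda>k. (cmod ((m11 - \<sigma>) * y1 k + m12 * y2 k))\<^sup>2) \<le> K0 * X"
    proof (rule gen[OF _ contract_apriori[OF r] Xb(1)])
      fix k show "(m11 - \<sigma>) * y1 (k + 1) + m12 * y2 (k + 1) = \<rho> * ((m11 - \<sigma>) * y1 k + m12 * y2 k) + ((m11 - \<sigma>) * e1 k + m12 * e2 k)"
        unfolding R using det tr inv by algebra
    qed (simp add: L_def)
    have A2: "?S (\<lambda>k. (cmod (m21 * y1 k + (m22 - \<sigma>) * y2 k))\<^sup>2) \<le> K0 * X"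
    proof (rule gen[OF _ contract_apriori[OF r] Xb(1)])
      fix k show "m21 * y1 (k + 1) + (m22 - \<sigma>) * y2 (k + 1) = \<rho> * (m21 * y1 k + (m22 - \<sigma>) * y2 k) + (m21 * e1 k + (m22 - \<sigma>) * e2 k)"
        unfolding R using det tr inv by algebra
    qed (simp add: L_def)
    have rle: "?r\<^sup>2 * s \<le> s" if "s \<ge> 0" for s
      using mult_right_mono[of "?r\<^sup>2" 1 s] that r power_le_one[of ?r 2] by simp
    have bk: "(1 - ?r) * ?S (\<lambda>k. (cmod (c1 * y1 k + c2 * y2 k))\<^sup>2) \<le> (cmod (c1 * y1 (int N) + c2 * y2 (int N)))\<^sup>2 + ?S (\<lambda>k. (cmod (c1 * e1 k + c2 * e2 k))\<^sup>2) / (1 - ?r)"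
      if "\<And>k. c1 * y1 (k + 1) + c2 * y2 (k + 1) = \<sigma> * (c1 * y1 k + c2 * y2 k) + (c1 * e1 k + c2 * e2 k)" for c1 c2
    proof -
      have "(1 - ?r) * ?S (\<lambda>k. (cmod (c1 * y1 k + c2 * y2 k))\<^sup>2) \<le> (cmod (c1 * y1 (int N) + c2 * y2 (int N)))\<^sup>2 + ?S (\<lambda>k. (cmod (- \<rho> * (c1 * e1 k + c2 * e2 k)))\<^sup>2) / (1 - ?r)"
      proof (rule contract_apriori_back[OF r])
        fix k show "c1 * y1 k + c2 * y2 k = \<rho> * (c1 * y1 (k + 1) + c2 * y2 (k + 1)) + - \<rho> * (c1 * e1 k + c2 * e2 k)"
          unfolding that using inv by algebra
      qed
      also have "?S (\<lambda>k. (cmod (- \<rho> * (c1 * e1 k + c2 * e2 k)))\<^sup>2) / (1 - ?r) \<le> ?S (\<lambda>k. (cmod (c1 * e1 k + c2 * e2 k))\<^sup>2) / (1 - ?r)"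
        using r1 by (intro divide_right_mono sum_mono) (auto simp: norm_mult power_mult_distrib intro: rle)
      finally show ?thesis by simp
    qed
    have B1: "?S (\<lambda>k. (cmod ((m11 - \<rho>) * y1 k + m12 * y2 k))\<^sup>2) \<le> K0 * X"
    proof (rule gen[OF _ bk Xb(2)])
      fix k show "(m11 - \<rho>) * y1 (k + 1) + m12 * y2 (k + 1) = \<sigma> * ((m11 - \<rho>) * y1 k + m12 * y2 k) + ((m11 - \<rho>) * e1 k + m12 * e2 k)"
        unfolding R using det tr inv by algebra
    qed (simp add: L_def)
    have B2: "?S (\<lambda>k. (cmod (m21 * y1 k + (m22 - \<rho>) * y2 k))\<^sup>2) \<le> K0 * X"
    proof (rule gen[OF _ bk Xb(2)])
      fix k show "m21 * y1 (k + 1) + (m22 - \<rho>) * y2 (k + 1) = \<sigma> * (m21 * y1 k + (m22 - \<rho>) * y2 k) + (m21 * e1 k + (m22 - \<rho>) * e2 k)"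
        unfolding R using det tr inv by algebra
    qed (simp add: L_def)
    have "(cmod d)\<^sup>2 * ?S (\<lambda>k. (cmod (y1 k))\<^sup>2 + (cmod (y2 k))\<^sup>2) = ?S (\<lambda>k. (cmod (d * y1 k))\<^sup>2 + (cmod (d * y2 k))\<^sup>2)"
      by (simp add: sum_distrib_left norm_mult power_mult_distrib distrib_left)
    also have "\<dots> \<le> ?S (\<lambda>k. (2 * (cmod ((m11 - \<sigma>) * y1 k + m12 * y2 k))\<^sup>2 + 2 * (cmod ((m11 - \<rho>) * y1 k + m12 * y2 k))\<^sup>2)
        + (2 * (cmod (m21 * y1 k + (m22 - \<sigma>) * y2 k))\<^sup>2 + 2 * (cmod (m21 * y1 k + (m22 - \<rho>) * y2 k))\<^sup>2))"
    proof (intro sum_mono add_mono)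
      fix k
      have e: "d * y1 k = ((m11 - \<sigma>) * y1 k + m12 * y2 k) + - ((m11 - \<rho>) * y1 k + m12 * y2 k)"
        "d * y2 k = (m21 * y1 k + (m22 - \<sigma>) * y2 k) + - (m21 * y1 k + (m22 - \<rho>) * y2 k)" by (simp_all add: d_def algebra_simps)
      show "(cmod (d * y1 k))\<^sup>2 \<le> 2 * (cmod ((m11 - \<sigma>) * y1 k + m12 * y2 k))\<^sup>2 + 2 * (cmod ((m11 - \<rho>) * y1 k + m12 * y2 k))\<^sup>2"
        unfolding e(1) by (rule order_trans[OF cmod_add_sq_le]) (simp only: norm_minus_cancel order_refl)
      show "(cmod (d * y2 k))\<^sup>2 \<le> 2 * (cmod (m21 * y1 k + (m22 - \<sigma>) * y2 k))\<^sup>2 + 2 * (cmod (m21 * y1 k + (m22 - \<rho>) * y2 k))\<^sup>2"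
        unfolding e(2) by (rule order_trans[OF cmod_add_sq_le]) (simp only: norm_minus_cancel order_refl)
    qed
    also have "\<dots> \<le> 8 * K0 * X"
      using A1 A2 B1 B2 unfolding sum.distrib sum_distrib_left[symmetric] by linarith
    finally have "?S (\<lambda>k. (cmod (y1 k))\<^sup>2 + (cmod (y2 k))\<^sup>2) \<le> 8 * K0 * X / (cmod d)\<^sup>2" using d by (simp add: pos_le_divide_eq mult.commute)
    also have "\<dots> \<le> K * X"
    proof -
      have "X \<ge> 0" unfolding X_def by (intro add_nonneg_nonneg sum_nonneg) auto
      then show ?thesis unfolding K_def by (simp add: distrib_right)
    qed
    finally show "?S (\<lambda>k. (cmod (y1 k))\<^sup>2 + (cmod (y2 k))\<^sup>2) \<le> K * ((cmod (y1 (- int N)))\<^sup>2 + (cmod (y2 (- int N)))\<^sup>2 + (cmod (y1 (int N)))\<^sup>2 + (cmod (y2 (int N)))\<^sup>2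
       + ?S (\<lambda>k. (cmod (e1 k))\<^sup>2 + (cmod (e2 k))\<^sup>2))" unfolding X_def .
  qed
qed

end

section \<open>Hyperbolic monodromy and the resolvent set\<close>

context SL begin

lemma L2_norm_le_zero:
  assumes f: "f \<in> L2 w" and z: "L2_norm w f \<le> 0" shows "AE x in lebesgue. f x = 0"
proof -
  have "(LINT x|lebesgue. \<bar>w x\<bar> * (cmod (f x))\<^sup>2) = 0" using L2_norm_sq[of f] z L2_norm_nonneg[of f] by simp
  then have "AE x in lebesgue. \<bar>w x\<bar> * (cmod (f x))\<^sup>2 = 0"
    by (subst (asm) integral_nonneg_eq_0_iff_AE[OF L2_int[OF f]]) auto
  then show ?thesis using w_nz by eventually_elim simp
qed

lemma sol_diff:
  assumes "sol z h f u" "sol z k g v" shows "sol z (\<lambda>x. h x - k x) (\<lambda>x. f x - g x) (\<lambda>x. u x - v x)"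
  unfolding sol_def
proof
  fix j
  have "psol z (\<lambda>x. 1 * sh j h x + (-1) * sh j k x) (\<lambda>x. 1 * sh j f x + (-1) * sh j g x) (\<lambda>x. 1 * sh j u x + (-1) * sh j v x)"
    using assms unfolding sol_def by (intro psol_lin) auto
  then show "psol z (sh j (\<lambda>x. h x - k x)) (sh j (\<lambda>x. f x - g x)) (sh j (\<lambda>x. u x - v x))"
    by (simp add: sh_def[abs_def])
qed

lemma step_error:
  assumes s: "sol z h f u" and h: "h \<in> L2 w"
  shows "(cmod (f (of_int (k + 1) * a) - (m11 z * f (of_int k * a) + m12 z * u (of_int k * a))))\<^sup>2
      + (cmod (u (of_int (k + 1) * a) - (m21 z * f (of_int k * a) + m22 z * u (of_int k * a))))\<^sup>2 \<le> 2 * w1 * (G z)\<^sup>2 * nsq (sh k h)"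
proof -
  have ps: "psol z (sh k h) (sh k f) (sh k u)" using s by (simp add: sol_def)
  let ?E = "sqrt (w1 * nsq (sh k h)) * G z"
  have E2: "?E\<^sup>2 = w1 * (G z)\<^sup>2 * nsq (sh k h)" using w1_nonneg nsq_nonneg[of "sh k h"] by (simp add: power_mult_distrib)
  have "(cmod (f (of_int (k + 1) * a) - (m11 z * f (of_int k * a) + m12 z * u (of_int k * a))))\<^sup>2 \<le> ?E\<^sup>2"
    using period_step(1)[OF ps L2_l2p[OF h]] by (intro power_mono) (auto simp: sh_0 sh_a)
  moreover have "(cmod (u (of_int (k + 1) * a) - (m21 z * f (of_int k * a) + m22 z * u (of_int k * a))))\<^sup>2 \<le> ?E\<^sup>2"
    using period_step(2)[OF ps L2_l2p[OF h]] by (intro power_mono) (auto simp: sh_0 sh_a)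
  ultimately show ?thesis unfolding E2 by simp
qed

lemma nsq_sum_bound:
  "\<exists>K>0. \<forall>h f u. (\<forall>k. psol z (sh k h) (sh k f) (sh k u)) \<and> (\<forall>k. l2p (sh k h)) \<longrightarrow>
    (\<forall>N. (\<Sum>k\<in>{- int N..<int N}. nsq (sh k f)) \<le> K * ((\<Sum>k\<in>{- int N..<int N}. Ysq f u k) + (\<Sum>k\<in>{- int N..<int N}. nsq (sh k h))))"
proof (intro exI conjI allI impI)
  let ?K = "3 * w1 * (G z)\<^sup>2 * (1 + w1) + 1"
  show "?K > 0" using w1_nonneg by (intro add_nonneg_pos mult_nonneg_nonneg) auto
  fix h f u N assume H: "(\<forall>k. psol z (sh k h) (sh k f) (sh k u)) \<and> (\<forall>k. l2p (sh k h))"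
  have "(\<Sum>k\<in>{- int N..<int N}. nsq (sh k f)) \<le> (\<Sum>k\<in>{- int N..<int N}. ?K * (Ysq f u k + nsq (sh k h)))"
  proof (rule sum_mono)
    fix k
    have "nsq (sh k f) \<le> 3 * w1 * (G z)\<^sup>2 * (Ysq f u k + w1 * nsq (sh k h))"
      using nsq_bound[of z "sh k h" "sh k f" "sh k u"] H by (simp add: Ysq_def sh_0)
    also have "\<dots> \<le> 3 * w1 * (G z)\<^sup>2 * ((1 + w1) * (Ysq f u k + nsq (sh k h)))"
      using w1_nonneg nsq_nonneg[of "sh k h"] Ysq_nonneg[of f u k] by (intro mult_left_mono) (auto simp: algebra_simps)
    also have "\<dots> \<le> ?K * (Ysq f u k + nsq (sh k h))"
      using nsq_nonneg[of "sh k h"] Ysq_nonneg[of f u k] by (simp add: algebra_simps)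
    finally show "nsq (sh k f) \<le> ?K * (Ysq f u k + nsq (sh k h))" .
  qed
  then show "(\<Sum>k\<in>{- int N..<int N}. nsq (sh k f)) \<le> ?K * ((\<Sum>k\<in>{- int N..<int N}. Ysq f u k) + (\<Sum>k\<in>{- int N..<int N}. nsq (sh k h)))"
    by (simp only: sum_distrib_left sum.distrib distrib_left)
qed

text \<open>For square integrable f the data decay, so the boundary terms of
  \<open>rec_apriori\<close> disappear in the limit and the forcing of the recursion, which is
  bounded by the norm of h on each period, is all that remains.\<close>

lemma hyperbolic_bound:
  assumes hyp: "hyp2 (m11 z) (m12 z) (m21 z) (m22 z) \<rho> \<sigma>"
  shows "\<exists>C. \<forall>h f u. sol z h f u \<and> f \<in> L2 w \<and> h \<in> L2 w \<longrightarrow> L2_norm w f \<le> C * L2_norm w h"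
proof -
  interpret hyp2 "m11 z" "m12 z" "m21 z" "m22 z" \<rho> \<sigma> by (rule hyp)
  obtain K where K: "K > 0" "\<And>e1 e2 y1 y2 N. rec e1 e2 y1 y2 \<Longrightarrow>
    (\<Sum>k\<in>{- int N..<int N}. (cmod (y1 k))\<^sup>2 + (cmod (y2 k))\<^sup>2)
    \<le> K * ((cmod (y1 (- int N)))\<^sup>2 + (cmod (y2 (- int N)))\<^sup>2 + (cmod (y1 (int N)))\<^sup>2 + (cmod (y2 (int N)))\<^sup>2
       + (\<Sum>k\<in>{- int N..<int N}. (cmod (e1 k))\<^sup>2 + (cmod (e2 k))\<^sup>2))"
    using rec_apriori by blast
  obtain K' where K': "K' > 0" "\<And>h f u N. (\<forall>k. psol z (sh k h) (sh k f) (sh k u)) \<Longrightarrow> (\<forall>k. l2p (sh k h)) \<Longrightarrow>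
    (\<Sum>k\<in>{- int N..<int N}. nsq (sh k f)) \<le> K' * ((\<Sum>k\<in>{- int N..<int N}. Ysq f u k) + (\<Sum>k\<in>{- int N..<int N}. nsq (sh k h)))"
    using nsq_sum_bound[of z] by blast
  define c where "c = 2 * w1 * (G z)\<^sup>2"
  define C where "C = K' * (K * c + 1)"
  have "L2_norm w f \<le> sqrt C * L2_norm w h" if s: "sol z h f u" and f: "f \<in> L2 w" and h: "h \<in> L2 w" for h f u
  proof -
    let ?S = "\<lambda>g N. \<Sum>k\<in>{- int N..<int N}. g k :: real"
    define y1 y2 where "y1 = (\<lambda>k::int. f (of_int k * a))" and "y2 = (\<lambda>k::int. u (of_int k * a))"
    define e1 e2 where "e1 = (\<lambda>k. y1 (k + 1) - (m11 z * y1 k + m12 z * y2 k))" and "e2 = (\<lambda>k. y2 (k + 1) - (m21 z * y1 k + m22 z * y2 k))"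
    have rc: "rec e1 e2 y1 y2" by (simp add: rec_def e1_def e2_def)
    have Y: "Ysq f u k = (cmod (y1 k))\<^sup>2 + (cmod (y2 k))\<^sup>2" for k by (simp add: Ysq_def y1_def y2_def)
    have e: "(cmod (e1 k))\<^sup>2 + (cmod (e2 k))\<^sup>2 \<le> c * nsq (sh k h)" for k
      using step_error[OF s h, of k] by (simp add: e1_def e2_def y1_def y2_def c_def)
    have "?S (\<lambda>k. nsq (sh k f)) N \<le> K' * (K * (Ysq f u (- int N) + Ysq f u (int N) + c * ?S (\<lambda>k. nsq (sh k h)) N) + ?S (\<lambda>k. nsq (sh k h)) N)" for N
    proof -
      have "?S (\<lambda>k. (cmod (e1 k))\<^sup>2 + (cmod (e2 k))\<^sup>2) N \<le> ?S (\<lambda>k. c * nsq (sh k h)) N" by (intro sum_mono e)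
      then have E: "?S (\<lambda>k. (cmod (e1 k))\<^sup>2 + (cmod (e2 k))\<^sup>2) N \<le> c * ?S (\<lambda>k. nsq (sh k h)) N" by (simp only: sum_distrib_left)
      have "?S (Ysq f u) N \<le> K * (Ysq f u (- int N) + Ysq f u (int N) + ?S (\<lambda>k. (cmod (e1 k))\<^sup>2 + (cmod (e2 k))\<^sup>2) N)"
        using K(2)[OF rc, of N] unfolding Y by (simp add: add.assoc)
      also have "\<dots> \<le> K * (Ysq f u (- int N) + Ysq f u (int N) + c * ?S (\<lambda>k. nsq (sh k h)) N)"
        using K(1) E by (intro mult_left_mono add_left_mono) auto
      finally have YS: "?S (Ysq f u) N \<le> \<dots>" .
      have "?S (\<lambda>k. nsq (sh k f)) N \<le> K' * (?S (Ysq f u) N + ?S (\<lambda>k. nsq (sh k h)) N)"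
        using K'(2)[of h f u N] s L2_l2p[OF h] by (simp add: sol_def)
      also have "\<dots> \<le> K' * (K * (Ysq f u (- int N) + Ysq f u (int N) + c * ?S (\<lambda>k. nsq (sh k h)) N) + ?S (\<lambda>k. nsq (sh k h)) N)"
        using K'(1) YS by (intro mult_left_mono add_right_mono) auto
      finally show ?thesis .
    qed note main = this
    have "(L2_norm w f)\<^sup>2 \<le> K' * (K * (0 + 0 + c * (L2_norm w h)\<^sup>2) + (L2_norm w h)\<^sup>2)"
    proof (rule LIMSEQ_le[OF norm_sum_limit[OF f]])
      show "(\<lambda>N. K' * (K * (Ysq f u (- int N) + Ysq f u (int N) + c * ?S (\<lambda>k. nsq (sh k h)) N) + ?S (\<lambda>k. nsq (sh k h)) N))
        \<longlonglongrightarrow> K' * (K * (0 + 0 + c * (L2_norm w h)\<^sup>2) + (L2_norm w h)\<^sup>2)"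
        by (intro tendsto_add tendsto_mult tendsto_const norm_sum_limit h decay[OF s f h])
    qed (use main in blast)
    also have "\<dots> = C * (L2_norm w h)\<^sup>2" by (simp add: C_def algebra_simps)
    finally have "sqrt ((L2_norm w f)\<^sup>2) \<le> sqrt (C * (L2_norm w h)\<^sup>2)" by (rule real_sqrt_le_mono)
    then show ?thesis using L2_norm_nonneg by (simp add: real_sqrt_mult)
  qed
  then show ?thesis by blast
qed

text \<open>On each period solve with zero data; the end values of these solutions are the forcing
  of the recursion for the data. Adding the homogeneous solutions with the bounded data from
  \<open>rec_exists\<close> makes the pieces match. Bounded boundary terms in
  \<open>rec_apriori\<close> then give square integrability afterwards.\<close>

lemma hyperbolic_exists:
  assumes hyp: "hyp2 (m11 z) (m12 z) (m21 z) (m22 z) \<rho> \<sigma>" and h: "h \<in> L2 w"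
  shows "\<exists>f u. sol z h f u \<and> f \<in> L2 w"
proof -
  interpret hyp2 "m11 z" "m12 z" "m21 z" "m22 z" \<rho> \<sigma> by (rule hyp)
  have lh: "l2p (sh k h)" for k by (rule L2_l2p[OF h])
  have "\<forall>k. \<exists>gv. psol z (sh k h) (fst gv) (snd gv) \<and> fst gv 0 = 0 \<and> snd gv 0 = 0"
  proof
    fix k
    obtain g v where "psol z (sh k h) g v" "g 0 = 0" "v 0 = 0" using psol_exists[of "sh k h" z 0 0] lh[of k] by (auto simp: l2p_def)
    then show "\<exists>gv. psol z (sh k h) (fst gv) (snd gv) \<and> fst gv 0 = 0 \<and> snd gv 0 = 0" by (intro exI[of _ "(g, v)"]) simp
  qed
  then obtain gv where gv: "\<And>k. psol z (sh k h) (fst (gv k)) (snd (gv k))" "\<And>k. fst (gv k) 0 = 0" "\<And>k. snd (gv k) 0 = 0"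
    by metis
  define e1 e2 where "e1 = (\<lambda>k. fst (gv k) a)" and "e2 = (\<lambda>k. snd (gv k) a)"
  have eb: "cmod (e1 k) + cmod (e2 k) \<le> sqrt (w1 * nsq (sh k h)) * G z" for k
    using psol_bound[OF gv(1)[of k] lh, of a] a_pos by (simp add: gv e1_def e2_def)
  have nb: "nsq (sh k h) \<le> (L2_norm w h)\<^sup>2" for k
  proof -
    let ?N = "nat \<bar>k\<bar> + 1"
    have "nsq (sh k h) \<le> (\<Sum>k\<in>{- int ?N..<int ?N}. nsq (sh k h))"
      by (rule member_le_sum[where f="\<lambda>k. nsq (sh k h)"]) (auto simp: nsq_nonneg)
    also have "\<dots> \<le> (L2_norm w h)\<^sup>2" by (rule partial_le_norm[OF h])
    finally show ?thesis .
  qed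
  define B where "B = sqrt (w1 * (L2_norm w h)\<^sup>2) * G z"
  have "sqrt (w1 * nsq (sh k h)) * G z \<le> B" for k
    unfolding B_def using nb[of k] w1_nonneg G_pos[of z] by (intro mult_right_mono real_sqrt_le_mono mult_left_mono) auto
  then have eB: "cmod (e1 k) \<le> B" "cmod (e2 k) \<le> B" for k
    using eb[of k] norm_ge_zero[of "e1 k"] norm_ge_zero[of "e2 k"] by (smt (verit))+
  obtain y1 y2 B' where y: "rec e1 e2 y1 y2" "\<And>k. (cmod (y1 k))\<^sup>2 + (cmod (y2 k))\<^sup>2 \<le> B'"
    using rec_exists[of e1 B e2, OF eB] by blast
  define fk uk where "fk = (\<lambda>k x. (y1 k * C z x + y2 k * S z x) + fst (gv k) x)" and "uk = (\<lambda>k x. (y1 k * C' z x + y2 k * S' z x) + snd (gv k) x)"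
  have ps: "psol z (sh k h) (fk k) (uk k)" for k
    using psol_lin[OF comb_psol[of z "y1 k" "y2 k"] gv(1)[of k], of 1 1] by (simp add: fk_def uk_def)
  have R: "y1 (k + 1) = m11 z * y1 k + m12 z * y2 k + e1 k" "y2 (k + 1) = m21 z * y1 k + m22 z * y2 k + e2 k" for k
    using y(1) by (auto simp: rec_def)
  have m: "fk k a = fk (k + 1) 0" "uk k a = uk (k + 1) 0" for k
    using R[of k] by (simp_all add: fk_def uk_def C_0 S_0 gv m11_def m12_def m21_def m22_def e1_def e2_def mult.commute)
  obtain f u where fu: "sol z h f u" "\<And>k x. x \<in> {0..a} \<Longrightarrow> sh k f x = fk k x \<and> sh k u x = uk k x"
    using glue_sol[OF ps m] by blast
  have fy: "f (of_int k * a) = y1 k" "u (of_int k * a) = y2 k" for k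
    using fu(2)[of 0 k] a_pos by (simp_all add: sh_0 fk_def uk_def C_0 S_0 gv)
  have Y: "Ysq f u k = (cmod (y1 k))\<^sup>2 + (cmod (y2 k))\<^sup>2" for k by (simp add: Ysq_def fy)
  obtain K where K: "K > 0" "\<And>e1 e2 y1 y2 N. rec e1 e2 y1 y2 \<Longrightarrow>
    (\<Sum>k\<in>{- int N..<int N}. (cmod (y1 k))\<^sup>2 + (cmod (y2 k))\<^sup>2)
    \<le> K * ((cmod (y1 (- int N)))\<^sup>2 + (cmod (y2 (- int N)))\<^sup>2 + (cmod (y1 (int N)))\<^sup>2 + (cmod (y2 (int N)))\<^sup>2
       + (\<Sum>k\<in>{- int N..<int N}. (cmod (e1 k))\<^sup>2 + (cmod (e2 k))\<^sup>2))"
    using rec_apriori by blast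
  obtain K' where K': "K' > 0" "\<And>h f u N. (\<forall>k. psol z (sh k h) (sh k f) (sh k u)) \<Longrightarrow> (\<forall>k. l2p (sh k h)) \<Longrightarrow>
    (\<Sum>k\<in>{- int N..<int N}. nsq (sh k f)) \<le> K' * ((\<Sum>k\<in>{- int N..<int N}. Ysq f u k) + (\<Sum>k\<in>{- int N..<int N}. nsq (sh k h)))"
    using nsq_sum_bound[of z] by blast
  define c where "c = 2 * w1 * (G z)\<^sup>2"
  have c0: "c \<ge> 0" unfolding c_def using w1_nonneg by simp
  let ?S = "\<lambda>g N. \<Sum>k\<in>{- int N..<int N}. g k :: real"
  have e: "(cmod (e1 k))\<^sup>2 + (cmod (e2 k))\<^sup>2 \<le> c * nsq (sh k h)" for k
    using step_error[OF fu(1) h, of k] unfolding fy R by (simp add: c_def)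
  have "?S (\<lambda>k. nsq (sh k f)) N \<le> K' * (K * (B' + B' + c * (L2_norm w h)\<^sup>2) + (L2_norm w h)\<^sup>2)" for N
  proof -
    have "?S (\<lambda>k. (cmod (e1 k))\<^sup>2 + (cmod (e2 k))\<^sup>2) N \<le> ?S (\<lambda>k. c * nsq (sh k h)) N" by (intro sum_mono e)
    also have "\<dots> = c * ?S (\<lambda>k. nsq (sh k h)) N" by (simp only: sum_distrib_left)
    also have "\<dots> \<le> c * (L2_norm w h)\<^sup>2" by (intro mult_left_mono partial_le_norm h c0)
    finally have E: "?S (\<lambda>k. (cmod (e1 k))\<^sup>2 + (cmod (e2 k))\<^sup>2) N \<le> c * (L2_norm w h)\<^sup>2" .
    have "?S (Ysq f u) N \<le> K * (((cmod (y1 (- int N)))\<^sup>2 + (cmod (y2 (- int N)))\<^sup>2) + ((cmod (y1 (int N)))\<^sup>2 + (cmod (y2 (int N)))\<^sup>2) + ?S (\<lambda>k. (cmod (e1 k))\<^sup>2 + (cmod (e2 k))\<^sup>2) N)"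
      using K(2)[OF y(1), of N] unfolding Y by (simp add: add.assoc)
    also have "\<dots> \<le> K * (B' + B' + c * (L2_norm w h)\<^sup>2)"
      using K(1) by (intro mult_left_mono add_mono E y(2)) auto
    finally have YS: "?S (Ysq f u) N \<le> \<dots>" .
    have "?S (\<lambda>k. nsq (sh k f)) N \<le> K' * (?S (Ysq f u) N + ?S (\<lambda>k. nsq (sh k h)) N)"
      using K'(2)[of h f u N] fu(1) lh by (simp add: sol_def)
    also have "\<dots> \<le> K' * (K * (B' + B' + c * (L2_norm w h)\<^sup>2) + (L2_norm w h)\<^sup>2)"
      using K'(1) by (intro mult_left_mono add_mono YS partial_le_norm h) auto
    finally show ?thesis .
  qed note main = this
  have lf: "l2p (sh k f)" for k
    using fu(1) unfolding sol_def by (intro l2p_continuous psol_cont(1)) blast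
  have "f \<in> L2 w"
    by (rule L2_from_sums[OF sol_measurable[OF fu(1)] lf main])
  then show ?thesis using fu(1) by blast
qed

text \<open>Uniqueness modulo null functions is the a priori bound applied to the difference of two
  solutions, whose defect is zero.\<close>

lemma hyperbolic_resolvent:
  assumes hyp: "hyp2 (m11 z) (m12 z) (m21 z) (m22 z) \<rho> \<sigma>"
  shows "z \<in> resolvent_set w (maximal_op w p q)"
proof -
  obtain C where C: "\<And>h f u. sol z h f u \<Longrightarrow> f \<in> L2 w \<Longrightarrow> h \<in> L2 w \<Longrightarrow> L2_norm w f \<le> C * L2_norm w h"
    using hyperbolic_bound[OF hyp] by blast
  have rep: "\<exists>f0 u. ae_eq f f0 \<and> sol z h f0 u \<and> f0 \<in> L2 w \<and> L2_norm w f0 = L2_norm w f \<and> h \<in> L2 w \<and> f \<in> L2 w"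
    if "(f, h) \<in> op_shift (maximal_op w p q) z" for f h
  proof -
    from maximal_op_D[OF that] obtain f0 u where 1: "f \<in> L2 w" "h \<in> L2 w" "ae_eq f f0" "sol z h f0 u" by blast
    then show ?thesis using ae_eq_L2[OF 1(3,1) sol_measurable[OF 1(4)]] by blast
  qed
  have bd: "L2_norm w f \<le> C * L2_norm w h" if "(f, h) \<in> op_shift (maximal_op w p q) z" for f h
    using rep[OF that] C by metis
  have uniq: "ae_eq f' f" if m1: "(f, h) \<in> op_shift (maximal_op w p q) z" and m2: "(f', h) \<in> op_shift (maximal_op w p q) z" for f f' h
  proof -
    obtain f0 u where 1: "ae_eq f f0" "sol z h f0 u" "f0 \<in> L2 w" using rep[OF m1] by blast
    obtain f1 v where 2: "ae_eq f' f1" "sol z h f1 v" "f1 \<in> L2 w" using rep[OF m2] by blast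
    have L0: "(\<lambda>x. 0) \<in> L2 w" by (simp add: L2_def)
    have s: "sol z (\<lambda>x. 0) (\<lambda>x. f1 x - f0 x) (\<lambda>x. v x - u x)" using sol_diff[OF 2(2) 1(2)] by simp
    have L: "(\<lambda>x. f1 x - f0 x) \<in> L2 w" using L2_lin[OF 2(3) 1(3), of 1 "-1"] by simp
    have "(L2_norm w (\<lambda>x. 0))\<^sup>2 = 0" unfolding L2_norm_sq by simp
    then have "L2_norm w (\<lambda>x. f1 x - f0 x) \<le> 0" using C[OF s L L0] by simp
    from L2_norm_le_zero[OF L this] show ?thesis using 1(1) 2(1) unfolding ae_eq_def by eventually_elim simp
  qed
  show ?thesis unfolding resolvent_set_def
  proof (intro CollectI conjI ballI)
    fix h assume h: "h \<in> L2 w"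
    obtain f u where "sol z h f u" "f \<in> L2 w" using hyperbolic_exists[OF hyp h] by blast
    then have "(f, h) \<in> op_shift (maximal_op w p q) z" using sol_maximal_op h by blast
    then show "\<exists>f. (f, h) \<in> op_shift (maximal_op w p q) z \<and> (\<forall>f'. (f', h) \<in> op_shift (maximal_op w p q) z \<longrightarrow> ae_eq f' f)"
      using uniq by blast
  next
    show "\<exists>C. \<forall>(f, h)\<in>op_shift (maximal_op w p q) z. L2_norm w f \<le> C * L2_norm w h" using bd by blast
  qed
qed

text \<open>The multipliers are the roots of x^2 - D x + 1, with product 1. Either one of them lies
  inside the unit circle, or both lie on it; in the latter case they are complex conjugates and D is
  their sum.\<close>

lemma multiplier_dichotomy:
  obtains (hyp) \<rho> \<sigma> where "hyp2 (m11 z) (m12 z) (m21 z) (m22 z) \<rho> \<sigma>"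
  | (unit) \<rho> where "cmod \<rho> = 1" "D z = \<rho> + cnj \<rho>"
proof -
  define s where "s = csqrt ((D z)\<^sup>2 - 4)"
  have s2: "s * s = D z * D z - 4" using power2_csqrt[of "(D z)\<^sup>2 - 4"] by (simp add: s_def power2_eq_square)
  define \<rho> \<sigma> where "\<rho> = (D z + s) / 2" and "\<sigma> = (D z - s) / 2"
  have sum: "\<rho> + \<sigma> = D z" by (simp add: \<rho>_def \<sigma>_def field_simps)
  have prod: "\<rho> * \<sigma> = 1"
  proof -
    have "4 * (\<rho> * \<sigma>) = D z * D z - s * s" by (simp add: \<rho>_def \<sigma>_def field_simps)
    then show ?thesis unfolding s2 by simp
  qed
  have np: "cmod \<rho> * cmod \<sigma> = 1" using prod by (metis norm_mult norm_one)
  consider "cmod \<rho> < 1" | "cmod \<sigma> < 1" | "cmod \<rho> = 1"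
  proof -
    have "\<not> (cmod \<rho> > 1 \<and> cmod \<sigma> \<ge> 1)" using np mult_less_le_imp_less[of 1 "cmod \<rho>" 1 "cmod \<sigma>"] by auto
    then show thesis using that by linarith
  qed
  then show thesis
  proof cases
    case 1 show ?thesis by (rule hyp[of \<rho> \<sigma>], unfold_locales) (use 1 det_M sum prod in \<open>auto simp: D_def\<close>)
  next
    case 2 show ?thesis by (rule hyp[of \<sigma> \<rho>], unfold_locales) (use 2 det_M sum prod in \<open>auto simp: D_def mult.commute add.commute\<close>)
  next
    case 3
    have "\<rho> * cnj \<rho> = 1" using complex_norm_square[of \<rho>] 3 by simp
    then have "\<sigma> = cnj \<rho>" using prod by (metis mult.assoc mult.commute mult_1_right)
    then show ?thesis using unit[OF 3] sum by simp
  qed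
qed

text \<open>By Cayley-Hamilton an off-diagonal entry, completed by the difference of \<rho> and a
  diagonal entry, is an eigenvector for \<rho>. If both off-diagonal entries vanish, a unit vector
  is one.\<close>

lemma floquet_vector:
  assumes \<rho>: "cmod \<rho> = 1" and D: "D z = \<rho> + cnj \<rho>"
  obtains \<alpha> \<beta> where "\<alpha> \<noteq> 0 \<or> \<beta> \<noteq> 0" "m11 z * \<alpha> + m12 z * \<beta> = \<rho> * \<alpha>" "m21 z * \<alpha> + m22 z * \<beta> = \<rho> * \<beta>"
proof -
  have r1: "\<rho> * cnj \<rho> = 1" using complex_norm_square[of \<rho>] \<rho> by simp
  have ch: "(m11 z - \<rho>) * (m22 z - \<rho>) = m12 z * m21 z"
    using det_M[of z] D r1 unfolding D_def by algebra
  consider "m12 z \<noteq> 0" | "m21 z \<noteq> 0" | "m12 z = 0" "m21 z = 0" by blast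
  then show thesis
  proof cases
    case 1
    show thesis by (rule that[of "m12 z" "\<rho> - m11 z"]) (use 1 ch in \<open>auto simp: algebra_simps\<close>)
  next
    case 2
    show thesis by (rule that[of "\<rho> - m22 z" "m21 z"]) (use 2 ch in \<open>auto simp: algebra_simps\<close>)
  next
    case 3
    then consider "m11 z = \<rho>" | "m22 z = \<rho>" using ch by auto
    then show thesis
    proof cases
      case 1 show thesis by (rule that[of 1 0]) (use 1 3 in auto)
    next
      case 2 show thesis by (rule that[of 0 1]) (use 2 3 in auto)
    qed
  qed
qed

end

subsection \<open>Approximate eigenfunctions\<close>

lemma geometric_int_sum:
  fixes x :: real
  shows "(\<Sum>k\<in>{- int N..<int N}. x ^ nat \<bar>k\<bar>) * (1 - x) = 1 + x - x ^ N - x ^ Suc N"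
proof (induction N)
  case (Suc N)
  have e: "nat \<bar>- int (Suc N)\<bar> = Suc N" "nat \<bar>int N\<bar> = N" by auto
  have "(\<Sum>k\<in>{- int (Suc N)..<int (Suc N)}. x ^ nat \<bar>k\<bar>) * (1 - x)
     = (\<Sum>k\<in>{- int N..<int N}. x ^ nat \<bar>k\<bar>) * (1 - x) + (x ^ Suc N + x ^ N) * (1 - x)"
    unfolding sum_shift_Suc e by (simp add: algebra_simps)
  then show ?case unfolding Suc.IH by (simp add: algebra_simps)
qed simp

text \<open>For negative k the power grows by the factor 1/t when k increases by one, and this
  half-line dictates the constant 1/t - 1.\<close>

lemma decay_step:
  fixes t :: real
  assumes t: "0 < t" "t < 1"
  shows "\<bar>t ^ nat \<bar>k + 1\<bar> - t ^ nat \<bar>k\<bar>\<bar> \<le> (1 / t - 1) * t ^ nat \<bar>k\<bar>"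
proof (cases "k \<ge> 0")
  case True
  then have "nat \<bar>k + 1\<bar> = Suc (nat \<bar>k\<bar>)" by auto
  then have "\<bar>t ^ nat \<bar>k + 1\<bar> - t ^ nat \<bar>k\<bar>\<bar> = (1 - t) * t ^ nat \<bar>k\<bar>"
    using t by (simp add: abs_if algebra_simps)
  also have "\<dots> \<le> (1 / t - 1) * t ^ nat \<bar>k\<bar>"
  proof (rule mult_right_mono)
    have "0 \<le> (1 - t)\<^sup>2" by simp
    then have "(2 - t) * t \<le> 1" by (simp add: power2_eq_square algebra_simps)
    then have "2 - t \<le> 1 / t" using t by (simp add: pos_le_divide_eq)
    then show "1 - t \<le> 1 / t - 1" by simp
  qed (use t in simp)
  finally show ?thesis .
next
  case False
  then have "nat \<bar>k\<bar> = Suc (nat \<bar>k + 1\<bar>)" by auto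
  then show ?thesis using t by (simp add: abs_if algebra_simps)
qed

context SL begin

lemma psol_cong_AE:
  assumes s: "psol z h f u" and ae: "AE x in lebesgue. x \<in> {0<..<a} \<longrightarrow> h' x = h x"
  shows "psol z h' f u"
proof -
  have "prim_on 0 a (\<lambda>x. P z x * f x - W x * h x) u" using s by (simp add: psol_def)
  then have "prim_on 0 a (\<lambda>x. P z x * f x - W x * h' x) u"
    by (rule prim_on_spike) (use ae in eventually_elim, auto)
  then show ?thesis using s by (simp add: psol_def)
qed

lemma L2_norm_scale:
  "L2_norm w (\<lambda>x. c * f x) = cmod c * L2_norm w f"
proof -
  have "(L2_norm w (\<lambda>x. c * f x))\<^sup>2 = (cmod c * L2_norm w f)\<^sup>2"
    unfolding L2_norm_sq power_mult_distrib
    by (simp add: norm_mult power_mult_distrib mult.left_commute flip: integral_mult_right_zero)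
  then show ?thesis using L2_norm_nonneg by (simp add: power2_eq_iff_nonneg)
qed

lemma sol_scale: "sol z h f u \<Longrightarrow> sol z (\<lambda>x. c * h x) (\<lambda>x. c * f x) (\<lambda>x. c * u x)"
  unfolding sol_def
proof
  fix j assume s: "\<forall>k. psol z (sh k h) (sh k f) (sh k u)"
  have "psol z (\<lambda>x. c * sh j h x + 0 * sh j h x) (\<lambda>x. c * sh j f x + 0 * sh j f x) (\<lambda>x. c * sh j u x + 0 * sh j u x)"
    using s by (intro psol_lin) auto
  then show "psol z (sh j (\<lambda>x. c * h x)) (sh j (\<lambda>x. c * f x)) (sh j (\<lambda>x. c * u x))"
    by (simp add: sh_def[abs_def])
qed

lemma nsq_scale: "nsq (\<lambda>x. c * h x) = (cmod c)\<^sup>2 * nsq h"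
proof -
  have "nsq (\<lambda>x. c * h x) = integral {0..a} (\<lambda>x. (cmod c)\<^sup>2 * (\<bar>w x\<bar> * (cmod (h x))\<^sup>2))"
    unfolding nsq_def by (simp add: norm_mult power_mult_distrib mult.left_commute)
  then show ?thesis by (simp add: nsq_def)
qed

lemma l2p_scale:
  assumes "l2p h" shows "l2p (\<lambda>x. c * h x)"
proof -
  have 1: "(\<lambda>x. (cmod c)\<^sup>2 * (\<bar>w x\<bar> * (cmod (h x))\<^sup>2)) absolutely_integrable_on {0..a}"
    using assms by (intro set_integrable_mult_right) (auto simp: l2p_def)
  have 2: "(\<lambda>x. c * (W x * h x)) absolutely_integrable_on {0..a}"
    using assms by (intro set_integrable_mult_right) (auto simp: l2p_def)
  have e: "(cmod c)\<^sup>2 * (\<bar>w x\<bar> * (cmod (h x))\<^sup>2) = \<bar>w x\<bar> * (cmod (c * h x))\<^sup>2" "c * (W x * h x) = W x * (c * h x)" for x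
    by (simp_all add: norm_mult power_mult_distrib mult_ac)
  show ?thesis using 1 2 unfolding e by (simp add: l2p_def)
qed

lemma l2p_cong_end:
  assumes h: "l2p h" and eq: "\<And>x. x \<in> {0..<a} \<Longrightarrow> h' x = h x"
  shows "l2p h'" "nsq h' = nsq h"
proof -
  have n: "negligible {a}" by simp
  have e: "h' x = h x" if "x \<in> {0..a} - {a}" for x using eq that by auto
  show "l2p h'" unfolding l2p_def
  proof
    show "(\<lambda>x. \<bar>w x\<bar> * (cmod (h' x))\<^sup>2) absolutely_integrable_on {0..a}"
      by (rule absolutely_integrable_spike[OF _ n, where f = "\<lambda>x. \<bar>w x\<bar> * (cmod (h x))\<^sup>2"]) (use h e in \<open>auto simp: l2p_def\<close>)
    show "(\<lambda>x. W x * h' x) absolutely_integrable_on {0..a}"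
      by (rule absolutely_integrable_spike[OF _ n, where f = "\<lambda>x. W x * h x"]) (use h e in \<open>auto simp: l2p_def\<close>)
  qed
  show "nsq h' = nsq h" unfolding nsq_def
    by (rule integral_spike[OF n]) (use e in auto)
qed

text \<open>A Floquet solution damped by the factor \<open>t\<^bsup>|k|\<^esup>\<close> on the \<open>k\<close>-th period; the mismatch of size
  \<open>O(1 - t)\<close> at the period ends is absorbed by the right-hand side.\<close>

lemma damped_floquet:
  assumes z: "z \<in> \<real>" and \<rho>: "cmod \<rho> = 1" "D z = \<rho> + cnj \<rho>"
  shows "\<exists>\<kappa>>0. \<forall>t. 0 < t \<and> t < 1 \<longrightarrow> (\<exists>h f u. sol z h f u \<and> f \<in> L2 w \<and> h \<in> L2 w \<and>
     0 < (L2_norm w f)\<^sup>2 + (L2_norm w h)\<^sup>2 \<and>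
     (L2_norm w h)\<^sup>2 \<le> \<kappa> * (1 / t - 1)\<^sup>2 * ((L2_norm w f)\<^sup>2 + (L2_norm w h)\<^sup>2))"
proof -
  obtain \<alpha> \<beta> where v: "\<alpha> \<noteq> 0 \<or> \<beta> \<noteq> 0" "m11 z * \<alpha> + m12 z * \<beta> = \<rho> * \<alpha>" "m21 z * \<alpha> + m22 z * \<beta> = \<rho> * \<beta>"
    by (rule floquet_vector[OF \<rho>])
  define V where "V = (cmod \<alpha>)\<^sup>2 + (cmod \<beta>)\<^sup>2"
  have V: "V > 0" unfolding V_def using v(1) by (auto simp: add_pos_nonneg add_nonneg_pos)
  obtain \<gamma> \<delta> g gu where g: "psol z (\<lambda>x. of_real (sgn (w x)) * (\<gamma> * C z x + \<delta> * S z x)) g gu" "g 0 = 0" "gu 0 = 0" "g a = \<alpha>" "gu a = \<beta>"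
    using control[OF z] by blast
  define \<phi> where "\<phi> = (\<lambda>x. \<gamma> * C z x + \<delta> * S z x)"
  define h0 where "h0 = (\<lambda>x. of_real (sgn (w x)) * \<phi> x)"
  have g1: "psol z h0 g gu" using g(1) by (simp add: h0_def \<phi>_def)
  have \<phi>c: "continuous_on {0..a} \<phi>" unfolding \<phi>_def by (intro continuous_intros C_cont S_cont)
  have h0l: "l2p h0" unfolding l2p_def
  proof
    have "(\<lambda>x. \<bar>w x\<bar> * (cmod (\<phi> x))\<^sup>2) absolutely_integrable_on {0..a}" by (rule weight_sq_int[OF absw_absint \<phi>c])
    moreover have "\<bar>w x\<bar> * (cmod (\<phi> x))\<^sup>2 = \<bar>w x\<bar> * (cmod (h0 x))\<^sup>2" for x
      by (cases "w x = 0") (auto simp: h0_def norm_mult sgn_if)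
    ultimately show "(\<lambda>x. \<bar>w x\<bar> * (cmod (h0 x))\<^sup>2) absolutely_integrable_on {0..a}" by simp
    show "(\<lambda>x. W x * h0 x) absolutely_integrable_on {0..a}" by (rule psol_Wh[OF g1])
  qed
  obtain K where K: "K > 0" "\<And>h f u. psol z h f u \<Longrightarrow> l2p h \<Longrightarrow> (cmod (f 0))\<^sup>2 + (cmod (u 0))\<^sup>2 \<le> K * (nsq f + nsq h)"
    using initial_bound[of z] by blast
  obtain K' where K': "K' > 0" "\<And>h f u N. (\<forall>k. psol z (sh k h) (sh k f) (sh k u)) \<Longrightarrow> (\<forall>k. l2p (sh k h)) \<Longrightarrow>
    (\<Sum>k\<in>{- int N..<int N}. nsq (sh k f)) \<le> K' * ((\<Sum>k\<in>{- int N..<int N}. Ysq f u k) + (\<Sum>k\<in>{- int N..<int N}. nsq (sh k h)))"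
    using nsq_sum_bound[of z] by blast
  define \<kappa> where "\<kappa> = (nsq h0 + 1) * K / V"
  have \<kappa>: "\<kappa> > 0" unfolding \<kappa>_def using K V nsq_nonneg[of h0] by (intro divide_pos_pos mult_pos_pos) auto
  have \<rho>0: "\<rho> \<noteq> 0" using \<rho>(1) by auto
  show ?thesis
  proof (intro exI[of _ \<kappa>] conjI allI impI \<kappa>)
    fix t :: real assume "0 < t \<and> t < 1"
    then have t: "0 < t" "t < 1" by auto
    define b where "b = (1 / t - 1)\<^sup>2"
    define \<tau> where "\<tau> = (\<lambda>k::int. t ^ nat \<bar>k\<bar>)"
    define pk where "pk = (\<lambda>k::int. \<rho> powi k)"
    have pk: "pk (k + 1) = pk k * \<rho>" "cmod (pk k) = 1" for k
      using \<rho>0 \<rho>(1) by (simp_all add: pk_def power_int_add_1 norm_power_int)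
    \<comment> \<open>The damped data at k + 1 differ from M applied to the data at k by
      \<open>c k\<close> times the Floquet vector. Adding \<open>c k\<close> times the controlled
      solution g, which runs from zero data to this vector, makes the periods match.\<close>
    define c where "c = (\<lambda>k. of_real (\<tau> (k + 1) - \<tau> k) * pk (k + 1))"
    have c2: "(cmod (c k))\<^sup>2 \<le> b * (t\<^sup>2) ^ nat \<bar>k\<bar>" for k
    proof -
      have "cmod (c k) = \<bar>\<tau> (k + 1) - \<tau> k\<bar>" by (simp only: c_def norm_mult norm_of_real pk(2) mult_1_right)
      also have "\<dots> \<le> (1 / t - 1) * \<tau> k" unfolding \<tau>_def by (rule decay_step[OF t])
      finally have "(cmod (c k))\<^sup>2 \<le> ((1 / t - 1) * \<tau> k)\<^sup>2" by (intro power_mono) auto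
      then show ?thesis by (simp only: b_def \<tau>_def power_mult_distrib power_mult[symmetric] mult.commute)
    qed
    define y where "y = (\<lambda>k. of_real (\<tau> k) * pk k)"
    define fk uk where "fk = (\<lambda>k x. 1 * ((y k * \<alpha>) * C z x + (y k * \<beta>) * S z x) + c k * g x)"
      and "uk = (\<lambda>k x. 1 * ((y k * \<alpha>) * C' z x + (y k * \<beta>) * S' z x) + c k * gu x)"
    have ps0: "psol z (\<lambda>x. 1 * 0 + c k * h0 x) (fk k) (uk k)" for k
      unfolding fk_def uk_def by (rule psol_lin[OF comb_psol g1])
    \<comment> \<open>The function \<phi> is continuous only on the base period; clamping its
      argument to [0, a] makes it continuous on the line, which gives measurability of h.\<close>
    define \<psi> where "\<psi> = (\<lambda>x. c \<lfloor>x / a\<rfloor> * \<phi> (max 0 (min a (x - of_int \<lfloor>x / a\<rfloor> * a))))"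
    define h where "h = (\<lambda>x. complex_of_real (sgn (w x)) * \<psi> x)"
    \<comment> \<open>The right end point is left out, since there the floor belongs to the next
      period; a single point affects neither the system nor the norm.\<close>
    have she: "sh k h x = c k * h0 x" if x: "x \<in> {0..<a}" for k x
    proof -
      have "(x + of_int k * a) / a = x / a + of_int k" using a_pos by (simp add: field_simps)
      moreover have "0 \<le> x / a" "x / a < 1" using x a_pos by auto
      ultimately have fl: "\<lfloor>(x + of_int k * a) / a\<rfloor> = k" by (simp add: floor_unique)
      have "max 0 (min a x) = x" using x by auto
      then show ?thesis unfolding sh_def h_def \<psi>_def fl h0_def w_sh by simp
    qed
    have ps: "psol z (sh k h) (fk k) (uk k)" for k
      by (rule psol_cong_AE[OF ps0]) (rule AE_I2, simp add: she)
    have lh: "l2p (sh k h)" and nh: "nsq (sh k h) = (cmod (c k))\<^sup>2 * nsq h0" for k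
      using l2p_cong_end[OF l2p_scale[OF h0l, of "c k"] she] by (auto simp: nsq_scale)
    have m: "fk k a = fk (k + 1) 0" "uk k a = uk (k + 1) 0" for k
    proof -
      have "fk k a = y k * (m11 z * \<alpha> + m12 z * \<beta>) + c k * \<alpha>" by (simp add: fk_def g m11_def m12_def algebra_simps)
      also have "\<dots> = y (k + 1) * \<alpha>" unfolding v(2) y_def c_def pk of_real_diff by (simp add: algebra_simps)
      finally show "fk k a = fk (k + 1) 0" by (simp add: fk_def g C_0 S_0)
      have "uk k a = y k * (m21 z * \<alpha> + m22 z * \<beta>) + c k * \<beta>" by (simp add: uk_def g m21_def m22_def algebra_simps)
      also have "\<dots> = y (k + 1) * \<beta>" unfolding v(3) y_def c_def pk of_real_diff by (simp add: algebra_simps)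
      finally show "uk k a = uk (k + 1) 0" by (simp add: uk_def g C_0 S_0)
    qed
    obtain f u where fu: "sol z h f u" "\<And>k x. x \<in> {0..a} \<Longrightarrow> sh k f x = fk k x \<and> sh k u x = uk k x"
      using glue_sol[OF ps m] by blast
    have Y: "Ysq f u k = (t\<^sup>2) ^ nat \<bar>k\<bar> * V" for k
    proof -
      have "f (of_int k * a) = y k * \<alpha>" "u (of_int k * a) = y k * \<beta>"
        using fu(2)[of 0 k] a_pos by (simp_all add: sh_0 fk_def uk_def C_0 S_0 g)
      moreover have "cmod (y k) = \<tau> k" unfolding y_def norm_mult pk(2) using t by (simp add: \<tau>_def norm_power)
      moreover have "(\<tau> k)\<^sup>2 = (t\<^sup>2) ^ nat \<bar>k\<bar>" by (simp only: \<tau>_def power_mult[symmetric] mult.commute)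
      ultimately show ?thesis by (simp add: Ysq_def norm_mult power_mult_distrib V_def distrib_left)
    qed
    let ?S = "\<lambda>g N. \<Sum>k\<in>{- int N..<int N}. g k :: real"
    define s where "s = (\<lambda>N. ?S (\<lambda>k. (t\<^sup>2) ^ nat \<bar>k\<bar>) N)"
    have t2: "t\<^sup>2 < 1" "t\<^sup>2 > 0" using t by (auto simp: power_less_one_iff abs_square_less_1)
    have sb: "s N \<le> 2 / (1 - t\<^sup>2)" for N
    proof -
      have "s N * (1 - t\<^sup>2) = 1 + t\<^sup>2 - (t\<^sup>2) ^ N - (t\<^sup>2) ^ Suc N" unfolding s_def by (rule geometric_int_sum)
      moreover have "(t\<^sup>2) ^ N \<ge> 0" "(t\<^sup>2) ^ Suc N \<ge> 0" by simp_all
      ultimately have "s N * (1 - t\<^sup>2) \<le> 2" using t2 by linarith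
      then show ?thesis using t2 by (simp add: pos_le_divide_eq)
    qed
    have HN: "?S (\<lambda>k. nsq (sh k h)) N \<le> nsq h0 * b * s N" for N
    proof -
      have "?S (\<lambda>k. nsq (sh k h)) N \<le> ?S (\<lambda>k. (nsq h0 * b) * (t\<^sup>2) ^ nat \<bar>k\<bar>) N"
      proof (rule sum_mono)
        fix k show "nsq (sh k h) \<le> nsq h0 * b * (t\<^sup>2) ^ nat \<bar>k\<bar>"
          unfolding nh using mult_right_mono[OF c2[of k] nsq_nonneg[of h0]] by (simp add: mult_ac)
      qed
      then show ?thesis by (simp only: s_def sum_distrib_left)
    qed
    have b0: "b \<ge> 0" by (simp add: b_def)
    have YN: "?S (Ysq f u) N = V * s N" for N unfolding Y s_def by (simp add: sum_distrib_left mult.commute)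
    have hm: "h \<in> borel_measurable lebesgue"
    proof -
      have "continuous_on UNIV (\<lambda>y. \<phi> (max 0 (min a y)))"
        using a_pos by (intro continuous_on_compose2[OF \<phi>c] continuous_intros) auto
      then have "(\<lambda>y. \<phi> (max 0 (min a y))) \<in> borel_measurable borel" by (rule borel_measurable_continuous_onI)
      then have "\<psi> \<in> borel_measurable borel" unfolding \<psi>_def by measurable
      then have "\<psi> \<in> borel_measurable lebesgue" by (simp add: measurable_completion)
      moreover have "(\<lambda>x. complex_of_real (sgn (w x))) \<in> borel_measurable lebesgue" using w_meas by measurable
      ultimately show ?thesis unfolding h_def by (intro borel_measurable_times)
    qed
    have hL: "h \<in> L2 w"
    proof (rule L2_from_sums[OF hm lh])
      fix N
      have "nsq h0 * b * s N \<le> nsq h0 * b * (2 / (1 - t\<^sup>2))" using nsq_nonneg b0 by (intro mult_left_mono sb) auto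
      then show "?S (\<lambda>k. nsq (sh k h)) N \<le> nsq h0 * b * (2 / (1 - t\<^sup>2))" using HN[of N] by linarith
    qed
    have fl: "l2p (sh k f)" for k using fu(1) unfolding sol_def by (intro l2p_continuous psol_cont(1)) blast
    have fL: "f \<in> L2 w"
    proof (rule L2_from_sums[OF sol_measurable[OF fu(1)] fl])
      fix N
      have "?S (\<lambda>k. nsq (sh k f)) N \<le> K' * (V * s N + ?S (\<lambda>k. nsq (sh k h)) N)"
        using K'(2)[of h f u N] fu(1) lh unfolding YN by (simp add: sol_def)
      also have "\<dots> \<le> K' * (V * (2 / (1 - t\<^sup>2)) + (L2_norm w h)\<^sup>2)"
        using K'(1) V by (intro mult_left_mono add_mono sb partial_le_norm hL) auto
      finally show "?S (\<lambda>k. nsq (sh k f)) N \<le> K' * (V * (2 / (1 - t\<^sup>2)) + (L2_norm w h)\<^sup>2)" .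
    qed
    have low: "V * s N \<le> K * (?S (\<lambda>k. nsq (sh k f)) N + ?S (\<lambda>k. nsq (sh k h)) N)" for N
    proof -
      have "?S (Ysq f u) N \<le> ?S (\<lambda>k. K * (nsq (sh k f) + nsq (sh k h))) N"
      proof (rule sum_mono)
        fix k show "Ysq f u k \<le> K * (nsq (sh k f) + nsq (sh k h))"
          using K(2)[of "sh k h" "sh k f" "sh k u"] fu(1) lh[of k] by (simp add: sol_def Ysq_def sh_0)
      qed
      then show ?thesis unfolding YN by (simp only: sum_distrib_left sum.distrib distrib_left)
    qed
    \<comment> \<open>On the window consisting of the periods -1 and 0 the damping weights add up to
      at least 1, so the data do not vanish and neither do f and h together. Positivity is needed
      for the normalisation.\<close>
    have "0 < (L2_norm w f)\<^sup>2 + (L2_norm w h)\<^sup>2"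
    proof -
      have "{- int 1..<int 1} = {-1, 0}" by auto
      then have "s 1 \<ge> 1" unfolding s_def by simp
      then have "V * 1 \<le> V * s 1" using V by (intro mult_left_mono) auto
      then have "V \<le> K * (?S (\<lambda>k. nsq (sh k f)) 1 + ?S (\<lambda>k. nsq (sh k h)) 1)" using low[of 1] by linarith
      also have "\<dots> \<le> K * ((L2_norm w f)\<^sup>2 + (L2_norm w h)\<^sup>2)"
        using K(1) by (intro mult_left_mono add_mono partial_le_norm fL hL) auto
      finally have "0 < K * ((L2_norm w f)\<^sup>2 + (L2_norm w h)\<^sup>2)" using V by linarith
      then show ?thesis using K(1) by (simp add: zero_less_mult_iff)
    qed
    moreover have "(L2_norm w h)\<^sup>2 \<le> \<kappa> * b * ((L2_norm w f)\<^sup>2 + (L2_norm w h)\<^sup>2)"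
    proof (rule LIMSEQ_le[OF norm_sum_limit[OF hL]])
      show "(\<lambda>N. \<kappa> * b * (?S (\<lambda>k. nsq (sh k f)) N + ?S (\<lambda>k. nsq (sh k h)) N)) \<longlonglongrightarrow> \<kappa> * b * ((L2_norm w f)\<^sup>2 + (L2_norm w h)\<^sup>2)"
        by (intro tendsto_mult tendsto_add tendsto_const norm_sum_limit fL hL)
      have "?S (\<lambda>k. nsq (sh k h)) N \<le> \<kappa> * b * (?S (\<lambda>k. nsq (sh k f)) N + ?S (\<lambda>k. nsq (sh k h)) N)" for N
      proof -
        have s0: "s N \<ge> 0" unfolding s_def using t2 by (intro sum_nonneg) simp
        have "?S (\<lambda>k. nsq (sh k h)) N \<le> (nsq h0 + 1) * b * s N"
          using HN[of N] mult_nonneg_nonneg[OF b0 s0] by (simp only: distrib_right mult_1_left)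
        also have "\<dots> = (nsq h0 + 1) * b / V * (V * s N)" using V by simp
        also have "\<dots> \<le> (nsq h0 + 1) * b / V * (K * (?S (\<lambda>k. nsq (sh k f)) N + ?S (\<lambda>k. nsq (sh k h)) N))"
          using low[of N] b0 V nsq_nonneg[of h0] by (intro mult_left_mono) auto
        also have "\<dots> = \<kappa> * b * (?S (\<lambda>k. nsq (sh k f)) N + ?S (\<lambda>k. nsq (sh k h)) N)" by (simp add: \<kappa>_def)
        finally show ?thesis .
      qed
      then show "\<exists>N. \<forall>n\<ge>N. ?S (\<lambda>k. nsq (sh k h)) n \<le> \<kappa> * b * (?S (\<lambda>k. nsq (sh k f)) n + ?S (\<lambda>k. nsq (sh k h)) n)" by blast
    qed
    ultimately show "\<exists>h f u. sol z h f u \<and> f \<in> L2 w \<and> h \<in> L2 w \<and> 0 < (L2_norm w f)\<^sup>2 + (L2_norm w h)\<^sup>2 \<and>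
      (L2_norm w h)\<^sup>2 \<le> \<kappa> * (1 / t - 1)\<^sup>2 * ((L2_norm w f)\<^sup>2 + (L2_norm w h)\<^sup>2)"
      using fu(1) fL hL unfolding b_def by blast
  qed
qed

text \<open>Letting t tend to 1 makes the defect arbitrarily small relative to the solution. The
  bound on h contains the norm of h itself, so it has to be absorbed before normalising f.\<close>

lemma unit_multiplier_ap:
  assumes z: "z \<in> \<real>" and \<rho>: "cmod \<rho> = 1" "D z = \<rho> + cnj \<rho>"
  shows "z \<in> approx_point_spectrum w (maximal_op w p q)"
proof -
  obtain \<kappa> where \<kappa>: "\<kappa> > 0" "\<And>t. 0 < t \<Longrightarrow> t < 1 \<Longrightarrow> \<exists>h f u. sol z h f u \<and> f \<in> L2 w \<and> h \<in> L2 w \<and>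
     0 < (L2_norm w f)\<^sup>2 + (L2_norm w h)\<^sup>2 \<and> (L2_norm w h)\<^sup>2 \<le> \<kappa> * (1 / t - 1)\<^sup>2 * ((L2_norm w f)\<^sup>2 + (L2_norm w h)\<^sup>2)"
    using damped_floquet[OF assms] by blast
  have ex: "\<exists>f h. (f, h) \<in> op_shift (maximal_op w p q) z \<and> L2_norm w f = 1 \<and> L2_norm w h \<le> e" if e: "e > 0" for e
  proof -
    \<comment> \<open>With m \<le> 1/2 the norm of h on the right is absorbed and leaves a squared
      norm of at most 2 m times that of f; 2 m \<le> e^2 makes the normalised defect at most
      e.\<close>
    define m where "m = min (1/2) (e\<^sup>2 / 2)"
    have m: "m > 0" "m \<le> 1/2" "2 * m \<le> e\<^sup>2" using e by (auto simp: m_def min_def)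
    define x where "x = sqrt (m / \<kappa>)"
    have x: "x > 0" "\<kappa> * x\<^sup>2 = m" unfolding x_def using m \<kappa>(1) by auto
    define t where "t = 1 / (1 + x)"
    have t: "0 < t" "t < 1" "1 / t - 1 = x" using x(1) by (auto simp: t_def)
    obtain h f u where H: "sol z h f u" "f \<in> L2 w" "h \<in> L2 w" "0 < (L2_norm w f)\<^sup>2 + (L2_norm w h)\<^sup>2"
      "(L2_norm w h)\<^sup>2 \<le> m * ((L2_norm w f)\<^sup>2 + (L2_norm w h)\<^sup>2)"
      using \<kappa>(2)[OF t(1,2)] unfolding t(3) x(2) by blast
    define F Hn where "F = L2_norm w f" and "Hn = L2_norm w h"
    have FH: "0 \<le> F" "0 \<le> Hn" "0 < F\<^sup>2 + Hn\<^sup>2" "Hn\<^sup>2 \<le> m * (F\<^sup>2 + Hn\<^sup>2)" using H L2_norm_nonneg by (auto simp: F_def Hn_def)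
    have "m * Hn\<^sup>2 \<le> 1/2 * Hn\<^sup>2" using m by (intro mult_right_mono) auto
    then have 1: "Hn\<^sup>2 \<le> 2 * m * F\<^sup>2" using FH(4) by (simp add: distrib_left)
    have F: "F > 0" using 1 FH by (cases "F = 0") auto
    have "2 * m * F\<^sup>2 \<le> e\<^sup>2 * F\<^sup>2" using m by (intro mult_right_mono) auto
    then have "Hn\<^sup>2 \<le> (e * F)\<^sup>2" using 1 by (simp add: power_mult_distrib)
    then have He: "Hn \<le> e * F" by (rule power2_le_imp_le) (use e F in auto)
    define c where "c = complex_of_real (1 / F)"
    have cn: "cmod c = 1 / F" using F by (simp add: c_def norm_divide)
    have "(\<lambda>x. c * f x) \<in> L2 w" "(\<lambda>x. c * h x) \<in> L2 w" using L2_lin[OF H(2,2), of c 0] L2_lin[OF H(3,3), of c 0] by auto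
    then have "((\<lambda>x. c * f x), (\<lambda>x. c * h x)) \<in> op_shift (maximal_op w p q) z" by (intro sol_maximal_op[OF sol_scale[OF H(1)]])
    moreover have "L2_norm w (\<lambda>x. c * f x) = 1" unfolding L2_norm_scale cn using F by (simp add: F_def)
    moreover have "L2_norm w (\<lambda>x. c * h x) \<le> e" unfolding L2_norm_scale cn using He F by (simp add: Hn_def pos_divide_le_eq)
    ultimately show ?thesis by blast
  qed
  have "\<forall>n::nat. \<exists>fh. fh \<in> op_shift (maximal_op w p q) z \<and> L2_norm w (fst fh) = 1 \<and> L2_norm w (snd fh) \<le> 1 / real (Suc n)"
  proof
    fix n :: nat
    obtain f h where "(f, h) \<in> op_shift (maximal_op w p q) z" "L2_norm w f = 1" "L2_norm w h \<le> 1 / real (Suc n)"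
      using ex[of "1 / real (Suc n)"] by auto
    then show "\<exists>fh. fh \<in> op_shift (maximal_op w p q) z \<and> L2_norm w (fst fh) = 1 \<and> L2_norm w (snd fh) \<le> 1 / real (Suc n)"
      by (intro exI[of _ "(f, h)"]) simp
  qed
  then obtain fh where fh: "\<And>n. fh n \<in> op_shift (maximal_op w p q) z" "\<And>n. L2_norm w (fst (fh n)) = 1" "\<And>n. L2_norm w (snd (fh n)) \<le> 1 / real (Suc n)"
    by metis
  have "approx_eigenseq w (maximal_op w p q) z (\<lambda>n. fst (fh n))"
    unfolding approx_eigenseq_def
  proof (intro conjI allI exI[of _ "\<lambda>n. snd (fh n)"])
    show "(\<lambda>n. L2_norm w (snd (fh n))) \<longlonglongrightarrow> 0"
    proof (rule Lim_null_comparison)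
      show "(\<lambda>n. 1 / real (Suc n)) \<longlonglongrightarrow> 0" using LIMSEQ_inverse_real_of_nat by (simp add: inverse_eq_divide)
      show "\<forall>\<^sub>F n in sequentially. norm (L2_norm w (snd (fh n))) \<le> 1 / real (Suc n)"
        using fh(3) L2_norm_nonneg by (intro always_eventually allI) (simp only: real_norm_def abs_of_nonneg)
    qed
  qed (use fh in auto)
  then show ?thesis unfolding approx_point_spectrum_def by blast
qed

end

subsection \<open>Sign types\<close>

text \<open>Hermitian forms without a term in |y|^2. The change of a form under M ignores multiples
  of the invariant form, whose coefficient at |y|^2 is m12; as m12 is nonzero in the elliptic case,
  these forms produce all possible changes.\<close>

definition half_form :: "real \<Rightarrow> real \<Rightarrow> complex \<Rightarrow> complex \<Rightarrow> real" where
  "half_form \<alpha> \<beta> x y = \<alpha> * (cmod x)\<^sup>2 + \<beta> * Re (x * cnj y)"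

lemma half_form_bound: "\<bar>half_form \<alpha> \<beta> x y\<bar> \<le> (\<bar>\<alpha>\<bar> + \<bar>\<beta>\<bar>) * ((cmod x)\<^sup>2 + (cmod y)\<^sup>2)"
proof -
  have "\<bar>Re (x * cnj y)\<bar> \<le> cmod x * cmod y" using abs_Re_le_cmod[of "x * cnj y"] by (simp add: norm_mult)
  also have "\<dots> \<le> (cmod x)\<^sup>2 + (cmod y)\<^sup>2"
    using sum_squares_bound[of "cmod x" "cmod y"] mult_nonneg_nonneg[OF norm_ge_zero norm_ge_zero, of x y] by linarith
  finally have "\<bar>\<beta>\<bar> * \<bar>Re (x * cnj y)\<bar> \<le> \<bar>\<beta>\<bar> * ((cmod x)\<^sup>2 + (cmod y)\<^sup>2)" by (intro mult_left_mono) auto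
  moreover have "\<bar>\<alpha>\<bar> * (cmod x)\<^sup>2 \<le> \<bar>\<alpha>\<bar> * ((cmod x)\<^sup>2 + (cmod y)\<^sup>2)" by (intro mult_left_mono) auto
  moreover have "\<bar>half_form \<alpha> \<beta> x y\<bar> \<le> \<bar>\<alpha>\<bar> * (cmod x)\<^sup>2 + \<bar>\<beta>\<bar> * \<bar>Re (x * cnj y)\<bar>"
    unfolding half_form_def using abs_triangle_ineq[of "\<alpha> * (cmod x)\<^sup>2" "\<beta> * Re (x * cnj y)"] by (simp only: abs_mult abs_power2)
  ultimately show ?thesis by (simp only: distrib_right)
qed

text \<open>The mixed terms are split with weight \<tau>, so that the dependence on x and y can be
  made as small as desired at the price of a large factor on the errors d and e.\<close>

lemma half_form_perturb:
  assumes \<tau>: "0 < \<tau>" "\<tau> \<le> 1"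
  shows "\<bar>half_form \<alpha> \<beta> (x - d) (y - e) - half_form \<alpha> \<beta> x y\<bar>
    \<le> (\<bar>\<alpha>\<bar> + \<bar>\<beta>\<bar>) * (\<tau> * ((cmod x)\<^sup>2 + (cmod y)\<^sup>2) + 2 / \<tau> * ((cmod d)\<^sup>2 + (cmod e)\<^sup>2))"
proof -
  let ?B = "\<tau> * ((cmod x)\<^sup>2 + (cmod y)\<^sup>2) + 2 / \<tau> * ((cmod d)\<^sup>2 + (cmod e)\<^sup>2)"
  have am: "2 * (s * t) \<le> \<tau> * s\<^sup>2 + 1 / \<tau> * t\<^sup>2" for s t :: real
  proof -
    have "2 * (\<tau> * s) * t \<le> (\<tau> * s)\<^sup>2 + t\<^sup>2" by (rule sum_squares_bound)
    then have "1 / \<tau> * (2 * (\<tau> * s) * t) \<le> 1 / \<tau> * ((\<tau> * s)\<^sup>2 + t\<^sup>2)" using \<tau> by (intro mult_left_mono) auto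
    moreover have "1 / \<tau> * (2 * (\<tau> * s) * t) = 2 * (s * t)" "1 / \<tau> * (\<tau> * s)\<^sup>2 = \<tau> * s\<^sup>2" using \<tau> by (simp_all add: power2_eq_square)
    ultimately show ?thesis by (simp only: distrib_left)
  qed
  have t1: "1 / \<tau> \<ge> 1" using \<tau> by simp
  have sq: "t\<^sup>2 \<le> 1 / \<tau> * t\<^sup>2" for t :: real using mult_right_mono[OF t1, of "t\<^sup>2"] by simp
  have tt: "2 / \<tau> * t = 1 / \<tau> * t + 1 / \<tau> * t" for t by (simp add: field_simps)
  have cr: "\<bar>Re (s * cnj t)\<bar> \<le> cmod s * cmod t" for s t using abs_Re_le_cmod[of "s * cnj t"] by (simp add: norm_mult)
  have nn: "0 \<le> \<tau> * (cmod t)\<^sup>2" "0 \<le> 1 / \<tau> * (cmod t)\<^sup>2" for t using \<tau> by auto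
  define A1 A2 where "A1 = (cmod (x - d))\<^sup>2 - (cmod x)\<^sup>2" and "A2 = Re ((x - d) * cnj (y - e)) - Re (x * cnj y)"
  have "A1 = (cmod d)\<^sup>2 - 2 * Re (x * cnj d)" unfolding A1_def cmod_power2 by (simp add: power2_eq_square algebra_simps)
  then have "\<bar>A1\<bar> \<le> (cmod d)\<^sup>2 + 2 * (cmod x * cmod d)" using cr[of x d] zero_le_power2[of "cmod d"] by linarith
  then have A1: "\<bar>A1\<bar> \<le> ?B" unfolding distrib_left tt using am[of "cmod x" "cmod d"] sq[of "cmod d"] nn[of y] nn[of e] by linarith
  have "A2 = Re (d * cnj e) - Re (x * cnj e) - Re (d * cnj y)" unfolding A2_def by (simp add: algebra_simps)
  then have "\<bar>A2\<bar> \<le> cmod d * cmod e + cmod x * cmod e + cmod y * cmod d"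
    using cr[of d e] cr[of x e] cr[of d y] by (simp only: mult.commute[of "cmod y"])
  moreover have "2 * (cmod d * cmod e) \<le> (cmod d)\<^sup>2 + (cmod e)\<^sup>2" using sum_squares_bound[of "cmod d" "cmod e"] by simp
  ultimately have A2: "\<bar>A2\<bar> \<le> ?B" unfolding distrib_left tt
    using am[of "cmod x" "cmod e"] am[of "cmod y" "cmod d"] sq[of "cmod d"] sq[of "cmod e"] nn[of x] nn[of y] nn[of d] nn[of e] by linarith
  have "half_form \<alpha> \<beta> (x - d) (y - e) - half_form \<alpha> \<beta> x y = \<alpha> * A1 + \<beta> * A2"
    unfolding half_form_def A1_def A2_def by (simp only: right_diff_distrib) 
  then have "\<bar>half_form \<alpha> \<beta> (x - d) (y - e) - half_form \<alpha> \<beta> x y\<bar> \<le> \<bar>\<alpha>\<bar> * \<bar>A1\<bar> + \<bar>\<beta>\<bar> * \<bar>A2\<bar>"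
    by (simp only: abs_mult[symmetric] abs_triangle_ineq)
  also have "\<dots> \<le> \<bar>\<alpha>\<bar> * ?B + \<bar>\<beta>\<bar> * ?B" by (intro add_mono mult_left_mono A1 A2) auto
  finally show ?thesis by (simp only: distrib_right)
qed

text \<open>In the application y (k + 1) - e k is M applied to y k. The sum of the changes of the
  form under M therefore telescopes up to the forcing and is small compared with the sum of |y|^2,
  for every form.\<close>

lemma half_form_sum:
  fixes y1 y2 e1 e2 :: "int \<Rightarrow> complex" and \<alpha> \<beta> :: real
  defines "n \<equiv> \<lambda>k. (cmod (y1 k))\<^sup>2 + (cmod (y2 k))\<^sup>2"
  assumes \<tau>: "0 < \<tau>" "\<tau> \<le> 1"
  shows "\<bar>\<Sum>k\<in>{- int N..<int N}. half_form \<alpha> \<beta> (y1 (k + 1) - e1 k) (y2 (k + 1) - e2 k) - half_form \<alpha> \<beta> (y1 k) (y2 k)\<bar>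
    \<le> (\<bar>\<alpha>\<bar> + \<bar>\<beta>\<bar>) * (\<tau> * (\<Sum>k\<in>{- int N..<int N}. n k)
        + 2 / \<tau> * (\<Sum>k\<in>{- int N..<int N}. (cmod (e1 k))\<^sup>2 + (cmod (e2 k))\<^sup>2) + 2 * (n (int N) + n (- int N)))"
proof -
  let ?J = "{- int N..<int N}" and ?L = "\<bar>\<alpha>\<bar> + \<bar>\<beta>\<bar>"
  define X where "X = (\<lambda>k. half_form \<alpha> \<beta> (y1 k) (y2 k))"
  define \<epsilon> where "\<epsilon> = (\<lambda>k. (cmod (e1 k))\<^sup>2 + (cmod (e2 k))\<^sup>2)"
  define d where "d = (\<lambda>k. half_form \<alpha> \<beta> (y1 (k + 1) - e1 k) (y2 (k + 1) - e2 k) - X (k + 1))"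
  have n0: "n k \<ge> 0" for k by (simp add: n_def)
  have d: "\<bar>d k\<bar> \<le> ?L * (\<tau> * n (k + 1) + 2 / \<tau> * \<epsilon> k)" for k
    unfolding d_def X_def n_def \<epsilon>_def by (rule half_form_perturb[OF \<tau>])
  have nt: "(\<Sum>k\<in>?J. n (k + 1)) = (\<Sum>k\<in>?J. n k) + (n (int N) - n (- int N))"
    using sum_telescope_int[of n N] by (simp add: sum_subtractf)
  have "\<bar>\<Sum>k\<in>?J. d k\<bar> \<le> (\<Sum>k\<in>?J. ?L * (\<tau> * n (k + 1) + 2 / \<tau> * \<epsilon> k))"
    using sum_abs[of d ?J] sum_mono[of ?J "\<lambda>k. \<bar>d k\<bar>", OF d] by linarith
  also have "\<dots> = ?L * (\<tau> * ((\<Sum>k\<in>?J. n k) + (n (int N) - n (- int N))) + 2 / \<tau> * (\<Sum>k\<in>?J. \<epsilon> k))"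
    by (simp only: sum_distrib_left[symmetric] sum.distrib nt)
  also have "\<dots> \<le> ?L * (\<tau> * (\<Sum>k\<in>?J. n k) + 2 / \<tau> * (\<Sum>k\<in>?J. \<epsilon> k) + (n (int N) + n (- int N)))"
  proof (intro mult_left_mono)
    have "\<tau> * n (int N) \<le> 1 * n (int N)" "0 \<le> \<tau> * n (- int N)" using \<tau> n0 by (intro mult_right_mono mult_nonneg_nonneg; simp)+
    then show "\<tau> * ((\<Sum>k\<in>?J. n k) + (n (int N) - n (- int N))) + 2 / \<tau> * (\<Sum>k\<in>?J. \<epsilon> k)
      \<le> \<tau> * (\<Sum>k\<in>?J. n k) + 2 / \<tau> * (\<Sum>k\<in>?J. \<epsilon> k) + (n (int N) + n (- int N))"
      using n0[of "- int N"] by (simp only: distrib_left right_diff_distrib)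
  qed simp
  finally have sd: "\<bar>\<Sum>k\<in>?J. d k\<bar> \<le> \<dots>" .
  have Xb: "\<bar>X k\<bar> \<le> ?L * n k" for k unfolding X_def n_def by (rule half_form_bound)
  have "(\<Sum>k\<in>?J. half_form \<alpha> \<beta> (y1 (k + 1) - e1 k) (y2 (k + 1) - e2 k) - X k) = (\<Sum>k\<in>?J. d k) + (\<Sum>k\<in>?J. X (k + 1) - X k)"
    by (simp only: d_def sum.distrib[symmetric]) simp
  also have "\<dots> = (\<Sum>k\<in>?J. d k) + (X (int N) - X (- int N))" by (simp only: sum_telescope_int)
  finally have "\<bar>\<Sum>k\<in>?J. half_form \<alpha> \<beta> (y1 (k + 1) - e1 k) (y2 (k + 1) - e2 k) - X k\<bar>
      \<le> \<bar>\<Sum>k\<in>?J. d k\<bar> + ?L * n (int N) + ?L * n (- int N)"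
    using Xb[of "int N"] Xb[of "- int N"] by linarith
  also have "\<dots> \<le> ?L * (\<tau> * (\<Sum>k\<in>?J. n k) + 2 / \<tau> * (\<Sum>k\<in>?J. \<epsilon> k) + 2 * (n (int N) + n (- int N)))"
    using sd by (simp only: distrib_left mult.left_commute[of _ 2])
  finally show ?thesis unfolding X_def \<epsilon>_def .
qed

text \<open>With these coefficients the determinant condition reduces each change to two terms. If
  both summed changes were zero, the sums of |x|^2, Re(x cnj y) and |y|^2 would be fixed up to one
  common factor.\<close>

lemma half_form_invariance:
  fixes a11 a12 a21 a22 :: real
  assumes det: "a11 * a22 - a12 * a21 = 1"
  shows "half_form a22 (- a12) (of_real a11 * x + of_real a12 * y) (of_real a21 * x + of_real a22 * y) - half_form a22 (- a12) x y
      = 2 * a12 * Re (x * cnj y) + (a11 - a22) * (cmod x)\<^sup>2"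
    "half_form (- a21) a11 (of_real a11 * x + of_real a12 * y) (of_real a21 * x + of_real a22 * y) - half_form (- a21) a11 x y
      = a12 * (cmod y)\<^sup>2 + a21 * (cmod x)\<^sup>2"
proof -
  have 1: "a22 * (a11 * s + a12 * t)\<^sup>2 - a12 * ((a11 * s + a12 * t) * (a21 * s + a22 * t)) - (a22 * s\<^sup>2 - a12 * (s * t))
    = 2 * a12 * (s * t) + (a11 - a22) * s\<^sup>2" for s t
    using det by algebra
  have 2: "a11 * ((a11 * s + a12 * t) * (a21 * s + a22 * t)) - a21 * (a11 * s + a12 * t)\<^sup>2 - (a11 * (s * t) - a21 * s\<^sup>2)
    = a12 * t\<^sup>2 + a21 * s\<^sup>2" for s t
    using det by algebra
  show "half_form a22 (- a12) (of_real a11 * x + of_real a12 * y) (of_real a21 * x + of_real a22 * y) - half_form a22 (- a12) x y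
      = 2 * a12 * Re (x * cnj y) + (a11 - a22) * (cmod x)\<^sup>2"
    using 1[of "Re x" "Re y"] 1[of "Im x" "Im y"] unfolding half_form_def cmod_power2 by (simp add: distrib_left right_diff_distrib)
  show "half_form (- a21) a11 (of_real a11 * x + of_real a12 * y) (of_real a21 * x + of_real a22 * y) - half_form (- a21) a11 x y
      = a12 * (cmod y)\<^sup>2 + a21 * (cmod x)\<^sup>2"
    using 2[of "Re x" "Re y"] 2[of "Im x" "Im y"] unfolding half_form_def cmod_power2 by (simp add: distrib_left right_diff_distrib)
qed

text \<open>A trace of modulus below 2 gives a11 a22 < 1, because 4 a11 a22 is at most the square of
  the trace; the determinant does the rest.\<close>

lemma elliptic_off_diagonal:
  fixes a11 a12 a21 a22 :: real
  assumes det: "a11 * a22 - a12 * a21 = 1" and tr: "\<bar>a11 + a22\<bar> < 2"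
  shows "a12 * a21 < 0"
proof -
  have "\<bar>a11 + a22\<bar>\<^sup>2 < 2\<^sup>2" using tr by (intro power_strict_mono) auto
  then have "4 * (a11 * a22) < 4" using zero_le_power2[of "a11 - a22"] by (simp add: power2_eq_square algebra_simps)
  then show ?thesis using det by linarith
qed

section \<open>Definite type in the elliptic case\<close>

context SL begin

lemma elliptic_real:
  assumes z: "z \<in> \<real>" and D: "\<bar>Re (D z)\<bar> < 2"
  shows "Re (m11 z) * Re (m22 z) - Re (m12 z) * Re (m21 z) = 1" "Re (m12 z) * Re (m21 z) < 0"
proof -
  have "Re (m11 z * m22 z - m12 z * m21 z) = 1" using det_M by simp
  then show 1: "Re (m11 z) * Re (m22 z) - Re (m12 z) * Re (m21 z) = 1"
    using M_real[OF z] by (auto simp: complex_is_Real_iff)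
  show "Re (m12 z) * Re (m21 z) < 0" by (rule elliptic_off_diagonal[OF 1]) (use D in \<open>simp add: D_def\<close>)
qed

text \<open>Up to errors, [f, f] is a fixed quadratic form summed over the data. By
  \<open>half_form_sum\<close> the three moments of the data are almost proportional to a fixed
  vector, on which this form takes the value F0 S11 / m12. Multiplying by m12 F0 leaves F0^2 S11,
  and S11 controls the whole sum of |Y|^2.\<close>

lemma type_estimate:
  assumes z: "z \<in> \<real>" and D: "\<bar>Re (D z)\<bar> < 2" and F0: "F0 z \<noteq> 0"
  shows "\<exists>c>0. \<exists>K. \<forall>h f u. sol z h f u \<and> f \<in> L2 w \<and> h \<in> L2 w \<longrightarrow>
    c * (L2_norm w f)\<^sup>2 - K * (L2_norm w h)\<^sup>2 \<le> Re (m12 z) * F0 z * Re (krein_inner w f f)"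
proof -
  define a11 a12 a21 a22 where a: "a11 = Re (m11 z)" "a12 = Re (m12 z)" "a21 = Re (m21 z)" "a22 = Re (m22 z)"
  have m: "m11 z = of_real a11" "m12 z = of_real a12" "m21 z = of_real a21" "m22 z = of_real a22"
    unfolding a using M_real[OF z] by (simp_all add: of_real_Re)
  have det: "a11 * a22 - a12 * a21 = 1" and off: "a12 * a21 < 0" using elliptic_real[OF z D] by (auto simp: a)
  have a12: "a12 \<noteq> 0" using off by auto
  \<comment> \<open>If the relation \<open>E2\<close> = 0 held exactly, then a12 S22 = - a21 S11,
    and a12^2 times the sum of |Y|^2 would be \<mu> S11. The opposite signs of a12 and a21 make
    \<mu> positive.\<close>
  define \<mu> where "\<mu> = a12\<^sup>2 - a12 * a21"
  have \<mu>: "\<mu> > 0" unfolding \<mu>_def using off zero_le_power2[of a12] by linarith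
  define F where "F = F0 z"
  have F: "F \<noteq> 0" using F0 by (simp add: F_def)
  obtain K1 where K1: "K1 > 0" "\<And>h f u \<theta>. psol z h f u \<Longrightarrow> l2p h \<Longrightarrow> 0 < \<theta> \<Longrightarrow> \<theta> \<le> 1 \<Longrightarrow>
    \<bar>kr f - ((cmod (f 0))\<^sup>2 * b11 z + 2 * Re (f 0 * cnj (u 0)) * b12 z + (cmod (u 0))\<^sup>2 * b22 z)\<bar>
      \<le> \<theta> * ((cmod (f 0))\<^sup>2 + (cmod (u 0))\<^sup>2) + K1 / \<theta> * nsq h"
    using kr_form[OF z] by blast
  obtain K2 where K2: "K2 > 0" "\<And>h f u N. (\<forall>k. psol z (sh k h) (sh k f) (sh k u)) \<Longrightarrow> (\<forall>k. l2p (sh k h)) \<Longrightarrow>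
    (\<Sum>k\<in>{- int N..<int N}. nsq (sh k f)) \<le> K2 * ((\<Sum>k\<in>{- int N..<int N}. Ysq f u k) + (\<Sum>k\<in>{- int N..<int N}. nsq (sh k h)))"
    using nsq_sum_bound[of z] by blast
  define g where "g = 2 * w1 * (G z)\<^sup>2"
  have g0: "g \<ge> 0" unfolding g_def using w1_nonneg by simp
  define L where "L = \<bar>a11\<bar> + \<bar>a12\<bar> + \<bar>a21\<bar> + \<bar>a22\<bar>"
  \<comment> \<open>Collects the factors with which the three errors enter: the replacement of
    [f, f] by the form on the data, and the deviations \<open>E1\<close> and \<open>E2\<close> from
    the moment relations.\<close>
  define B where "B = \<mu> * \<bar>a12 * F\<bar> + \<bar>\<mu> * F * b12 z\<bar> * L + (\<bar>\<mu> * F * b22 z\<bar> + F\<^sup>2 * \<bar>a12\<bar>) * L"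
  have L0: "L \<ge> 0" by (simp add: L_def)
  have B0: "B > 0" unfolding B_def using \<mu> a12 F L0 by (intro add_pos_nonneg mult_pos_pos mult_nonneg_nonneg) auto
  define c0 where "c0 = F\<^sup>2 * a12\<^sup>2"
  have c0: "c0 > 0" unfolding c0_def using F a12 by simp
  \<comment> \<open>Makes the part of the errors that is proportional to the sum of |Y|^2 at most
    half of the main term c0 S, so that it can be absorbed.\<close>
  define \<tau> where "\<tau> = min 1 (c0 / (2 * B))"
  have \<tau>: "0 < \<tau>" "\<tau> \<le> 1" "B * \<tau> \<le> c0 / 2"
  proof -
    show "0 < \<tau>" "\<tau> \<le> 1" unfolding \<tau>_def using c0 B0 by auto
    have "B * \<tau> \<le> B * (c0 / (2 * B))" unfolding \<tau>_def using B0 by (intro mult_left_mono) auto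
    then show "B * \<tau> \<le> c0 / 2" using B0 by simp
  qed
  define K3 where "K3 = B * (2 / \<tau> * g + K1 / \<tau>)"
  have main: "c0 / (2 * K2) * F1 - (K3 + c0 / 2) * H - B * (2 * bd) \<le> \<mu> * (a12 * F * T)"
    if s: "sol z h f u" and fh: "f \<in> L2 w" "h \<in> L2 w"
      and d: "F1 = (\<Sum>k\<in>{- int N..<int N}. nsq (sh k f))" "H = (\<Sum>k\<in>{- int N..<int N}. nsq (sh k h))"
        "T = (\<Sum>k\<in>{- int N..<int N}. kr (sh k f))" "bd = Ysq f u (int N) + Ysq f u (- int N)" for h f u N F1 H T bd
  proof -
    let ?J = "{- int N..<int N}"
    define y1 y2 where "y1 = (\<lambda>k::int. f (of_int k * a))" and "y2 = (\<lambda>k::int. u (of_int k * a))"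
    define e1 e2 where "e1 = (\<lambda>k. y1 (k + 1) - (of_real a11 * y1 k + of_real a12 * y2 k))"
      and "e2 = (\<lambda>k. y2 (k + 1) - (of_real a21 * y1 k + of_real a22 * y2 k))"
    have Yy: "Ysq f u k = (cmod (y1 k))\<^sup>2 + (cmod (y2 k))\<^sup>2" for k by (simp add: Ysq_def y1_def y2_def)
    define S11 S12 S22 S EE where "S11 = (\<Sum>k\<in>?J. (cmod (y1 k))\<^sup>2)" "S12 = (\<Sum>k\<in>?J. Re (y1 k * cnj (y2 k)))"
      "S22 = (\<Sum>k\<in>?J. (cmod (y2 k))\<^sup>2)" "S = (\<Sum>k\<in>?J. (cmod (y1 k))\<^sup>2 + (cmod (y2 k))\<^sup>2)" 
      "EE = (\<Sum>k\<in>?J. (cmod (e1 k))\<^sup>2 + (cmod (e2 k))\<^sup>2)"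
    note Sd = this
    have SS: "S = S11 + S22" by (simp only: Sd sum.distrib)
    have H0: "H \<ge> 0" unfolding d by (intro sum_nonneg nsq_nonneg)
    have bd0: "bd \<ge> 0" unfolding d by (intro add_nonneg_nonneg Ysq_nonneg)
    have E: "EE \<le> g * H"
    proof -
      have "EE \<le> (\<Sum>k\<in>?J. g * nsq (sh k h))" unfolding Sd
        by (rule sum_mono) (use step_error[OF s fh(2)] in \<open>simp add: e1_def e2_def y1_def y2_def g_def m\<close>)
      then show ?thesis by (simp only: d sum_distrib_left)
    qed
    define U where "U = \<tau> * S + 2 / \<tau> * EE + 2 * bd"
    define V where "V = \<tau> * S + (2 / \<tau> * g + K1 / \<tau>) * H + 2 * bd"
    have V1: "U \<le> V" 
    proof -
      have "2 / \<tau> * EE \<le> 2 / \<tau> * (g * H)" using E \<tau> by (intro mult_left_mono) auto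
      moreover have "0 \<le> K1 / \<tau> * H" using K1(1) \<tau> H0 by simp
      ultimately show ?thesis unfolding U_def V_def distrib_right mult.assoc by linarith
    qed
    have S0: "S \<ge> 0" unfolding Sd by (intro sum_nonneg) auto
    have U0: "U \<ge> 0" unfolding U_def using S0 bd0 \<tau> by (intro add_nonneg_nonneg mult_nonneg_nonneg) (auto simp: Sd intro!: sum_nonneg)
    have my: "y1 (k + 1) - e1 k = of_real a11 * y1 k + of_real a12 * y2 k" "y2 (k + 1) - e2 k = of_real a21 * y1 k + of_real a22 * y2 k" for k
      by (simp_all add: e1_def e2_def)
    define E1 E2 where "E1 = 2 * a12 * S12 + (a11 - a22) * S11" and "E2 = a12 * S22 + a21 * S11"
    have "\<bar>E1\<bar> \<le> (\<bar>a22\<bar> + \<bar>- a12\<bar>) * U"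
      using half_form_sum[OF \<tau>(1,2), where N = N and \<alpha> = a22 and \<beta> = "- a12" and ?y1.0 = y1 and ?y2.0 = y2 and ?e1.0 = e1 and ?e2.0 = e2] unfolding my half_form_invariance[OF det]
      by (simp only: E1_def U_def Sd d Yy sum.distrib sum_distrib_left[symmetric])
    also have "\<dots> \<le> L * V" using U0 V1 L0 by (intro mult_mono) (auto simp: L_def)
    finally have E1: "\<bar>E1\<bar> \<le> L * V" .
    have "\<bar>E2\<bar> \<le> (\<bar>- a21\<bar> + \<bar>a11\<bar>) * U"
      using half_form_sum[OF \<tau>(1,2), where N = N and \<alpha> = "- a21" and \<beta> = a11 and ?y1.0 = y1 and ?y2.0 = y2 and ?e1.0 = e1 and ?e2.0 = e2] unfolding my half_form_invariance[OF det]
      by (simp only: E2_def U_def Sd d Yy sum.distrib sum_distrib_left[symmetric])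
    also have "\<dots> \<le> L * V" using U0 V1 L0 by (intro mult_mono) (auto simp: L_def)
    finally have E2: "\<bar>E2\<bar> \<le> L * V" .
    define Q where "Q = b11 z * S11 + 2 * b12 z * S12 + b22 z * S22"
    have TQ: "\<bar>T - Q\<bar> \<le> V"
    proof -
      let ?q = "\<lambda>k. (cmod (y1 k))\<^sup>2 * b11 z + 2 * Re (y1 k * cnj (y2 k)) * b12 z + (cmod (y2 k))\<^sup>2 * b22 z"
      have "Q = (\<Sum>k\<in>?J. ?q k)" unfolding Q_def Sd sum_distrib_left sum.distrib[symmetric]
        by (intro sum.cong) (auto simp: mult_ac)
      then have "T - Q = (\<Sum>k\<in>?J. kr (sh k f) - ?q k)" unfolding d by (simp only: sum_subtractf)
      then have "\<bar>T - Q\<bar> \<le> (\<Sum>k\<in>?J. \<bar>kr (sh k f) - ?q k\<bar>)" by (simp only: sum_abs)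
      also have "\<dots> \<le> (\<Sum>k\<in>?J. \<tau> * ((cmod (y1 k))\<^sup>2 + (cmod (y2 k))\<^sup>2) + K1 / \<tau> * nsq (sh k h))"
      proof (rule sum_mono)
        fix k
        show "\<bar>kr (sh k f) - ?q k\<bar> \<le> \<tau> * ((cmod (y1 k))\<^sup>2 + (cmod (y2 k))\<^sup>2) + K1 / \<tau> * nsq (sh k h)"
          using K1(2)[of "sh k h" "sh k f" "sh k u", OF _ L2_l2p[OF fh(2)] \<tau>(1,2)] s by (simp add: sol_def sh_0 y1_def y2_def)
      qed
      also have "\<dots> = \<tau> * S + K1 / \<tau> * H" by (simp only: Sd d sum.distrib sum_distrib_left[symmetric])
      also have "\<dots> \<le> V"
      proof -
        have "0 \<le> (2 / \<tau> * g) * H" using g0 \<tau> H0 by simp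
        then show ?thesis unfolding V_def distrib_right using bd0 by linarith
      qed
      finally show ?thesis .
    qed
    have V0: "V \<ge> 0" using U0 V1 by linarith
    \<comment> \<open>Eliminating S12 and S22 by the moment relations leaves the coefficient
      \<open>F0 z\<close> at S11; this is how the derivative of the discriminant enters the
      sign.\<close>
    have id1: "a12 * Q = F * S11 + b12 z * E1 + b22 z * E2"
      unfolding Q_def F_def F0_def E1_def E2_def a[symmetric] by (simp add: algebra_simps)
    have id2: "a12\<^sup>2 * S = \<mu> * S11 + a12 * E2" unfolding \<mu>_def SS E2_def by (simp add: power2_eq_square algebra_simps)
    have "\<mu> * (a12 * F * T) = \<mu> * (a12 * F) * (T - Q) + \<mu> * F * (a12 * Q)" by (simp add: algebra_simps)
    also have "\<mu> * F * (a12 * Q) = F\<^sup>2 * (\<mu> * S11) + \<mu> * F * b12 z * E1 + \<mu> * F * b22 z * E2" unfolding id1 by (simp add: power2_eq_square algebra_simps)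
    also have "F\<^sup>2 * (\<mu> * S11) = c0 * S - F\<^sup>2 * a12 * E2"
    proof -
      have "\<mu> * S11 = a12\<^sup>2 * S - a12 * E2" using id2 by simp
      then show ?thesis unfolding c0_def by (simp only: right_diff_distrib mult_ac)
    qed
    finally have eq: "\<mu> * (a12 * F * T) = \<mu> * (a12 * F) * (T - Q) + (c0 * S - F\<^sup>2 * a12 * E2 + \<mu> * F * b12 z * E1 + \<mu> * F * b22 z * E2)" .
    have ab: "- (\<bar>s\<bar> * r) \<le> s * t" "s * t \<le> \<bar>s\<bar> * r" if "\<bar>t\<bar> \<le> r" for s t r :: real
    proof -
      have "\<bar>s * t\<bar> \<le> \<bar>s\<bar> * r" unfolding abs_mult using that by (intro mult_left_mono) auto
      then show "- (\<bar>s\<bar> * r) \<le> s * t" "s * t \<le> \<bar>s\<bar> * r" by linarith+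
    qed
    have B_V: "B * V = \<bar>\<mu> * (a12 * F)\<bar> * V + \<bar>\<mu> * F * b12 z\<bar> * (L * V) + \<bar>\<mu> * F * b22 z\<bar> * (L * V) + \<bar>F\<^sup>2 * a12\<bar> * (L * V)"
      unfolding B_def using \<mu> by (simp add: abs_mult algebra_simps)
    have "c0 * S - B * V \<le> \<mu> * (a12 * F * T)"
      unfolding eq B_V
      using ab(1)[OF TQ, of "\<mu> * (a12 * F)"] ab(1)[OF E1, of "\<mu> * F * b12 z"] ab(1)[OF E2, of "\<mu> * F * b22 z"] ab(2)[OF E2, of "F\<^sup>2 * a12"] by linarith
    moreover have "B * V \<le> c0 / 2 * S + K3 * H + B * (2 * bd)"
    proof -
      have "B * V = (B * \<tau>) * S + K3 * H + B * (2 * bd)" unfolding V_def K3_def by (simp add: distrib_left mult.assoc)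
      moreover have "(B * \<tau>) * S \<le> c0 / 2 * S" using \<tau>(3) S0 by (rule mult_right_mono)
      ultimately show ?thesis by linarith
    qed
    moreover have "c0 / (2 * K2) * F1 \<le> c0 / 2 * S + c0 / 2 * H"
    proof -
      have "F1 \<le> K2 * (S + H)"
        using K2(2)[of h f u N] s L2_l2p[OF fh(2)] unfolding d Sd Yy sol_def by blast
      then have "c0 / (2 * K2) * F1 \<le> c0 / (2 * K2) * (K2 * (S + H))" using c0 K2(1) by (intro mult_left_mono) auto
      also have "\<dots> = c0 / 2 * S + c0 / 2 * H" using K2(1) by (simp add: field_simps)
      finally show ?thesis .
    qed
    ultimately show ?thesis unfolding distrib_right by linarith
  qed
  define c where "c = c0 / (2 * K2) / \<mu>"
  have c: "c > 0" unfolding c_def using c0 K2(1) \<mu> by simp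
  show ?thesis
  proof (rule exI[of _ c], rule conjI[OF c], rule exI[of _ "(K3 + c0 / 2) / \<mu>"], intro allI impI)
    fix h f u assume "sol z h f u \<and> f \<in> L2 w \<and> h \<in> L2 w"
    then have s: "sol z h f u" and f: "f \<in> L2 w" and h: "h \<in> L2 w" by auto
    have "c0 / (2 * K2) * (L2_norm w f)\<^sup>2 - (K3 + c0 / 2) * (L2_norm w h)\<^sup>2 - B * (2 * (0 + 0)) \<le> \<mu> * (a12 * F * Re (krein_inner w f f))"
    proof (rule LIMSEQ_le)
      show "(\<lambda>N. c0 / (2 * K2) * (\<Sum>k\<in>{- int N..<int N}. nsq (sh k f)) - (K3 + c0 / 2) * (\<Sum>k\<in>{- int N..<int N}. nsq (sh k h))
          - B * (2 * (Ysq f u (int N) + Ysq f u (- int N)))) \<longlonglongrightarrow>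
        c0 / (2 * K2) * (L2_norm w f)\<^sup>2 - (K3 + c0 / 2) * (L2_norm w h)\<^sup>2 - B * (2 * (0 + 0))"
        by (intro tendsto_diff tendsto_mult tendsto_add tendsto_const norm_sum_limit[OF f] norm_sum_limit[OF h] decay[OF s f h])
      show "(\<lambda>N. \<mu> * (a12 * F * (\<Sum>k\<in>{- int N..<int N}. kr (sh k f)))) \<longlonglongrightarrow> \<mu> * (a12 * F * Re (krein_inner w f f))"
        by (intro tendsto_mult tendsto_const krein_sum_limit[OF f])
      show "\<exists>N. \<forall>n\<ge>N. c0 / (2 * K2) * (\<Sum>k\<in>{- int n..<int n}. nsq (sh k f)) - (K3 + c0 / 2) * (\<Sum>k\<in>{- int n..<int n}. nsq (sh k h))
          - B * (2 * (Ysq f u (int n) + Ysq f u (- int n))) \<le> \<mu> * (a12 * F * (\<Sum>k\<in>{- int n..<int n}. kr (sh k f)))"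
        using main[OF s f h refl refl refl refl] by blast
    qed
    then have "(c0 / (2 * K2) * (L2_norm w f)\<^sup>2 - (K3 + c0 / 2) * (L2_norm w h)\<^sup>2) / \<mu> \<le> a12 * F * Re (krein_inner w f f)"
      using \<mu> by (simp add: pos_divide_le_eq mult.commute)
    then show "c * (L2_norm w f)\<^sup>2 - (K3 + c0 / 2) / \<mu> * (L2_norm w h)\<^sup>2 \<le> Re (m12 z) * F0 z * Re (krein_inner w f f)"
      unfolding c_def a(2)[symmetric] F_def[symmetric] by (simp add: diff_divide_distrib)
  qed
qed

end

lemma nonvanishing_same_sign:
  fixes g :: "real \<Rightarrow> real"
  assumes g: "continuous_on {s<..<t} g" and nz: "\<And>x. x \<in> {s<..<t} \<Longrightarrow> g x \<noteq> 0"
    and x: "x \<in> {s<..<t}" and y: "y \<in> {s<..<t}" and pos: "g x > 0"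
  shows "g y > 0"
proof (rule ccontr)
  assume "\<not> g y > 0"
  have "connected (g ` {s<..<t})" by (intro connected_continuous_image g) simp
  then have "0 \<in> g ` {s<..<t}"
    by (rule connectedD_interval[of _ "g y" "g x"]) (use x y pos \<open>\<not> g y > 0\<close> in auto)
  then show False using nz by auto
qed

text \<open>Stated for arbitrary predicates A, B, C on sets, so that the ordering of the exceptional
  points is kept apart from the spectral statements.\<close>

lemma sorted_partition:
  fixes E :: "real set"
  assumes E: "finite E" "E \<noteq> {}" and left: "A {..<Min E}" and right: "B {Max E<..}"
    and gap: "\<And>s t. s \<in> E \<Longrightarrow> t \<in> E \<Longrightarrow> s < t \<Longrightarrow> {s<..<t} \<inter> E = {} \<Longrightarrow> C {s<..<t}"
  shows "\<exists>(n::nat) \<mu>. n \<ge> 1 \<and> (\<forall>j\<in>{2..n}. \<mu> (j - 1) < \<mu> j) \<and> A {..<\<mu> 1} \<and> (\<forall>j\<in>{2..n}. C {\<mu> (j - 1)<..<\<mu> j}) \<and> B {\<mu> n<..}"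
proof -
  define xs where "xs = sorted_list_of_set E"
  have xs: "set xs = E" "sorted xs" "distinct xs" "length xs = card E" using E by (auto simp: xs_def)
  have n: "card E \<ge> 1" using E by (simp add: Suc_leI card_gt_0_iff)
  have mono: "xs ! i < xs ! j" if "i < j" "j < card E" for i j
    using that xs sorted_wrt_nth_less[OF strict_sorted_list_of_set[of E], of i j] by (simp add: xs_def)
  have m1: "xs ! 0 = Min E"
  proof (rule sym, rule Min_eqI)
    show "xs ! 0 \<in> E" using xs n by (metis nth_mem less_le_trans zero_less_one)
    show "xs ! 0 \<le> y" if "y \<in> E" for y
      using that xs sorted_nth_mono[of xs 0] by (metis in_set_conv_nth le0)
  qed (rule E)
  have m2: "xs ! (card E - 1) = Max E"
  proof (rule sym, rule Max_eqI)
    show "xs ! (card E - 1) \<in> E" using xs n by (metis nth_mem diff_less less_le_trans zero_less_one)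
    fix y assume "y \<in> E"
    then obtain i where "i < card E" "y = xs ! i" using xs by (metis in_set_conv_nth)
    then show "y \<le> xs ! (card E - 1)" using xs sorted_nth_mono[of xs i "card E - 1"] by auto
  qed (rule E)
  have g: "C {xs ! (j - 2)<..<xs ! (j - 1)}" "xs ! (j - 2) < xs ! (j - 1)" if j: "j \<in> {2..card E}" for j
  proof -
    show l: "xs ! (j - 2) < xs ! (j - 1)" using j by (intro mono) auto
    have len: "j - 2 < length xs" "j - 1 < length xs" using j unfolding xs(4) by auto
    have mem: "xs ! (j - 2) \<in> E" "xs ! (j - 1) \<in> E" using nth_mem[OF len(1)] nth_mem[OF len(2)] unfolding xs(1) .
    have "y \<notin> {xs ! (j - 2)<..<xs ! (j - 1)}" if "y \<in> E" for y
    proof -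
      obtain i where i: "i < card E" "y = xs ! i" using xs \<open>y \<in> E\<close> by (metis in_set_conv_nth)
      consider "i \<le> j - 2" | "j - 1 \<le> i" by linarith
      then show ?thesis
      proof cases
        case 1 then have "y \<le> xs ! (j - 2)" unfolding i(2) using len by (intro sorted_nth_mono xs)
        then show ?thesis by simp
      next
        case 2 then have "xs ! (j - 1) \<le> y" unfolding i(2) using i(1) xs(4) by (intro sorted_nth_mono xs) auto
        then show ?thesis by simp
      qed
    qed
    then show "C {xs ! (j - 2)<..<xs ! (j - 1)}" by (intro gap mem l) blast
  qed
  \<comment> \<open>The claim numbers the points from 1 while the list counts from 0, so the j-th
    gap lies between the entries j - 2 and j - 1.\<close>
  show ?thesis
  proof (intro exI[of _ "card E"] exI[of _ "\<lambda>j. xs ! (j - 1)"] conjI n ballI)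
    fix j assume j: "j \<in> {2..card E}"
    have "j - 1 - 1 = j - 2" by simp
    then show "xs ! (j - 1 - 1) < xs ! (j - 1)" "C {xs ! (j - 1 - 1)<..<xs ! (j - 1)}" using g[OF j] by auto
  qed (use left right m1 m2 in auto)
qed

section \<open>Spectrum, sign types and the finite exceptional set\<close>

context SL begin

lemma large_unit_multiplier_real:
  assumes z: "cmod z \<ge> Lam" and \<rho>: "cmod \<rho> = 1" "D z = \<rho> + cnj \<rho>"
  shows "z \<in> \<real>"
proof -
  obtain \<alpha> \<beta> where v: "\<alpha> \<noteq> 0 \<or> \<beta> \<noteq> 0" "m11 z * \<alpha> + m12 z * \<beta> = \<rho> * \<alpha>" "m21 z * \<alpha> + m22 z * \<beta> = \<rho> * \<beta>"
    by (rule floquet_vector[OF \<rho>])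
  show ?thesis
    by (rule large_floquet[OF z comb_psol[of z \<alpha> \<beta>], of \<rho>])
      (use v \<rho> in \<open>simp_all add: C_0 S_0 m11_def m12_def m21_def m22_def mult.commute\<close>)
qed

lemma spectrum_unit_multiplier:
  assumes "z \<in> spectrum w (maximal_op w p q)"
  obtains \<rho> where "cmod \<rho> = 1" "D z = \<rho> + cnj \<rho>"
  using assms hyperbolic_resolvent unfolding spectrum_def
  by (rule_tac multiplier_dichotomy[of z]) auto

lemma spectrum_discriminant:
  assumes "z \<in> spectrum w (maximal_op w p q)"
  shows "\<bar>Re (D z)\<bar> \<le> 2" "D z = of_real (Re (D z))"
proof -
  obtain \<rho> where \<rho>: "cmod \<rho> = 1" "D z = \<rho> + cnj \<rho>" using assms by (rule spectrum_unit_multiplier)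
  show "\<bar>Re (D z)\<bar> \<le> 2" using abs_Re_le_cmod[of \<rho>] \<rho> by simp
  show "D z = of_real (Re (D z))" using \<rho> by (simp add: complex_eq_iff)
qed

text \<open>Along a normalised approximate eigensequence the defect terms tend to zero, so s [f, f]
  is eventually at least c/2 and the sign of s decides. The mixed term with K' accommodates the
  estimate for large parameters.\<close>

lemma sign_type_from_estimate:
  fixes s c K K' :: real
  assumes z: "z \<in> approx_point_spectrum w (maximal_op w p q)" and c: "c > 0"
    and est: "\<And>h f u. sol z h f u \<Longrightarrow> f \<in> L2 w \<Longrightarrow> h \<in> L2 w \<Longrightarrow>
      c * (L2_norm w f)\<^sup>2 - K * (L2_norm w h)\<^sup>2 - K' * (L2_norm w h * L2_norm w f) \<le> s * Re (krein_inner w f f)"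
  shows "s > 0 \<Longrightarrow> z \<in> spectrum_pos w (maximal_op w p q)"
    and "s < 0 \<Longrightarrow> z \<in> spectrum_neg w (maximal_op w p q)"
proof -
  have ev: "\<forall>\<^sub>F n in sequentially. c / 2 \<le> s * Re (krein_inner w (f n) (f n))"
    if f: "approx_eigenseq w (maximal_op w p q) z f" for f
  proof -
    obtain h where n1: "\<And>n. L2_norm w (f n) = 1" and fh: "\<And>n. (f n, h n) \<in> op_shift (maximal_op w p q) z"
      and h0: "(\<lambda>n. L2_norm w (h n)) \<longlonglongrightarrow> 0"
      using f unfolding approx_eigenseq_def by blast
    have le: "c - K * (L2_norm w (h n))\<^sup>2 - K' * L2_norm w (h n) \<le> s * Re (krein_inner w (f n) (f n))" for n
    proof -
      obtain f0 u where d: "f n \<in> L2 w" "h n \<in> L2 w" "ae_eq (f n) f0" "sol z (h n) f0 u"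
        using maximal_op_D[OF fh[of n]] by blast
      note e = ae_eq_L2[OF d(3,1) sol_measurable[OF d(4)]]
      show ?thesis using est[OF d(4) e(1) d(2)] unfolding e(2,3) n1 by simp
    qed
    have "(\<lambda>n. c - K * (L2_norm w (h n))\<^sup>2 - K' * L2_norm w (h n)) \<longlonglongrightarrow> c - K * 0\<^sup>2 - K' * 0"
      by (intro tendsto_intros h0)
    then have "\<forall>\<^sub>F n in sequentially. c / 2 < c - K * (L2_norm w (h n))\<^sup>2 - K' * L2_norm w (h n)"
      by (rule order_tendstoD) (use c in simp)
    then show ?thesis
    proof eventually_elim
      case (elim n) show ?case using elim le[of n] by linarith
    qed
  qed
  show "z \<in> spectrum_pos w (maximal_op w p q)" if s: "s > 0"
  proof -
    have "liminf (\<lambda>n. ereal (Re (krein_inner w (f n) (f n)))) > 0" if f: "approx_eigenseq w (maximal_op w p q) z f" for f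
    proof -
      have "\<forall>\<^sub>F n in sequentially. ereal (c / 2 / s) \<le> ereal (Re (krein_inner w (f n) (f n)))"
        using ev[OF f] by eventually_elim (use s in \<open>simp add: pos_divide_le_eq mult.commute\<close>)
      then have "ereal (c / 2 / s) \<le> liminf (\<lambda>n. ereal (Re (krein_inner w (f n) (f n))))" by (rule Liminf_bounded)
      moreover have "0 < ereal (c / 2 / s)" using c s by simp
      ultimately show ?thesis by (rule less_le_trans[rotated])
    qed
    then show ?thesis using z unfolding spectrum_pos_def by blast
  qed
  show "z \<in> spectrum_neg w (maximal_op w p q)" if s: "s < 0"
  proof -
    have "limsup (\<lambda>n. ereal (Re (krein_inner w (f n) (f n)))) < 0" if f: "approx_eigenseq w (maximal_op w p q) z f" for f
    proof -
      have "\<forall>\<^sub>F n in sequentially. ereal (Re (krein_inner w (f n) (f n))) \<le> ereal (c / 2 / s)"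
        using ev[OF f] by eventually_elim (use s in \<open>simp add: neg_le_divide_eq mult.commute\<close>)
      then have "limsup (\<lambda>n. ereal (Re (krein_inner w (f n) (f n)))) \<le> ereal (c / 2 / s)" by (rule Limsup_bounded)
      moreover have "ereal (c / 2 / s) < 0" using c s by (simp add: divide_pos_neg)
      ultimately show ?thesis by (rule le_less_trans)
    qed
    then show ?thesis using z unfolding spectrum_neg_def by blast
  qed
qed

text \<open>Membership in a sign type includes membership in the approximate point spectrum; here
  the damped Floquet solutions provide it at every real spectral point.\<close>

lemma real_spectrum_ap:
  assumes "of_real x \<in> spectrum w (maximal_op w p q)"
  shows "of_real x \<in> approx_point_spectrum w (maximal_op w p q)"
proof -
  obtain \<rho> where "cmod \<rho> = 1" "D (of_real x) = \<rho> + cnj \<rho>" using assms by (rule spectrum_unit_multiplier)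
  then show ?thesis by (intro unit_multiplier_ap) auto
qed

text \<open>In \<open>large_real\<close> the factor in front of [f, f] is x itself, so the type
  follows the sign of x.\<close>

lemma large_sign_type:
  assumes "of_real x \<in> spectrum w (maximal_op w p q)"
  shows "x \<ge> Lam \<Longrightarrow> of_real x \<in> spectrum_pos w (maximal_op w p q)"
    and "x \<le> - Lam \<Longrightarrow> of_real x \<in> spectrum_neg w (maximal_op w p q)"
proof -
  have e: "3 * (L2_norm w f)\<^sup>2 - 1 * (L2_norm w h)\<^sup>2 - 1 * (L2_norm w h * L2_norm w f) \<le> x * Re (krein_inner w f f)"
    if "\<bar>x\<bar> \<ge> Lam" "sol (of_real x) h f u" "f \<in> L2 w" "h \<in> L2 w" for h f u
    using large_real[OF that] by simp
  note st = sign_type_from_estimate[OF real_spectrum_ap[OF assms], of 3 1 1 x]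
  show "of_real x \<in> spectrum_pos w (maximal_op w p q)" if "x \<ge> Lam"
    by (rule st(1)) (use that Lam_pos e in auto)
  show "of_real x \<in> spectrum_neg w (maximal_op w p q)" if "x \<le> - Lam"
    by (rule st(2)) (use that Lam_pos e in auto)
qed

lemma m12_continuous: "isCont m12 y"
proof -
  obtain K where K: "K \<ge> 0" "\<And>z x. cmod (z - y) \<le> 1 \<Longrightarrow> x \<in> {0..a} \<Longrightarrow> cmod (S z x - S y x) \<le> K * cmod (z - y)"
    using param_lip[where f = S and u = S', OF S_psol S_0, of y] by blast
  have "((\<lambda>z. m12 z - m12 y) \<longlongrightarrow> 0) (at y)"
  proof (rule Lim_null_comparison)
    show "((\<lambda>z. K * cmod (z - y)) \<longlongrightarrow> 0) (at y)" by (rule tendsto_eq_intros refl | simp)+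
    have "eventually (\<lambda>z. dist z y < 1) (at y)" unfolding eventually_at by (intro exI[of _ 1]) auto
    then show "\<forall>\<^sub>F z in at y. norm (m12 z - m12 y) \<le> K * cmod (z - y)"
      by eventually_elim (use K(2)[of _ a] a_pos in \<open>auto simp: m12_def dist_norm\<close>)
  qed
  then show ?thesis by (simp add: isCont_def LIM_zero_iff)
qed

text \<open>If the gap contains a spectral point at all, then |D| < 2 there, and hence throughout,
  since D^2 - 4 has no zero. Then m12 and D' are nonzero on the gap, and by continuity their
  product, which fixes the type, keeps its sign.\<close>

lemma definite_gap:
  assumes D4: "\<And>x. x \<in> {s<..<t} \<Longrightarrow> (D (of_real x))\<^sup>2 \<noteq> 4" and D': "\<And>x. x \<in> {s<..<t} \<Longrightarrow> deriv D (of_real x) \<noteq> 0"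
  shows "definite_type w (maximal_op w p q) {s<..<t}"
proof (cases "\<exists>x\<in>{s<..<t}. of_real x \<in> spectrum w (maximal_op w p q)")
  case False
  then show ?thesis unfolding definite_type_def positive_type_def by blast
next
  case True
  then obtain x0 where x0: "x0 \<in> {s<..<t}" "of_real x0 \<in> spectrum w (maximal_op w p q)" by blast
  have Dr: "D (of_real x) = of_real (Re (D (of_real x)))" for x
    using M_real[of "of_real x"] by (simp add: D_def of_real_Re)
  define \<phi> where "\<phi> = (\<lambda>x::real. 4 - (Re (D (of_real x)))\<^sup>2)"
  have \<phi>nz: "\<phi> x \<noteq> 0" if "x \<in> {s<..<t}" for x
  proof
    assume "\<phi> x = 0"
    then have "(complex_of_real (Re (D (of_real x))))\<^sup>2 = of_real 4" unfolding \<phi>_def of_real_power[symmetric] by simp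
    then show False using D4[OF that] Dr[of x] by simp
  qed
  have Dc: "continuous_on UNIV D" by (rule holomorphic_on_imp_continuous_on[OF D_holomorphic])
  have \<phi>c: "continuous_on {s<..<t} \<phi>" unfolding \<phi>_def
    by (intro continuous_intros continuous_on_compose2[OF Dc]) auto
  have "\<bar>Re (D (of_real x0))\<bar> \<le> 2" by (rule spectrum_discriminant(1)[OF x0(2)])
  then have "\<phi> x0 \<ge> 0" unfolding \<phi>_def using abs_le_square_iff[of "Re (D (of_real x0))" 2] by simp
  then have "\<phi> x0 > 0" using \<phi>nz[OF x0(1)] by simp
  then have ell: "\<bar>Re (D (of_real x))\<bar> < 2" if "x \<in> {s<..<t}" for x
    using nonvanishing_same_sign[OF \<phi>c \<phi>nz x0(1) that] abs_square_less_1[of "Re (D (of_real x)) / 2"]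
    unfolding \<phi>_def by (simp add: power_divide)
  define g where "g = (\<lambda>x::real. Re (m12 (of_real x)) * F0 (of_real x))"
  have F0: "F0 (of_real x) = - Re (deriv D (of_real x))" for x by (simp add: deriv_D_real)
  have F0nz: "F0 (of_real x) \<noteq> 0" if "x \<in> {s<..<t}" for x using D'[OF that] by (simp add: deriv_D_real)
  have gnz: "g x \<noteq> 0" if "x \<in> {s<..<t}" for x
    using elliptic_real(2)[OF _ ell[OF that]] F0nz[OF that] by (auto simp: g_def)
  have mc: "continuous_on UNIV m12" using m12_continuous by (simp add: continuous_on_eq_continuous_at)
  have D'c: "continuous_on UNIV (deriv D)" by (intro holomorphic_on_imp_continuous_on holomorphic_deriv D_holomorphic open_UNIV)
  have gc: "continuous_on {s<..<t} g" unfolding g_def F0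
    by (intro continuous_intros continuous_on_compose2[OF mc] continuous_on_compose2[OF D'c]) auto
  have st: "g x > 0 \<Longrightarrow> of_real x \<in> spectrum_pos w (maximal_op w p q)" "g x < 0 \<Longrightarrow> of_real x \<in> spectrum_neg w (maximal_op w p q)"
    if x: "x \<in> {s<..<t}" "of_real x \<in> spectrum w (maximal_op w p q)" for x
  proof -
    obtain c K where cK: "c > 0" "\<And>h f u. sol (of_real x) h f u \<Longrightarrow> f \<in> L2 w \<Longrightarrow> h \<in> L2 w \<Longrightarrow>
      c * (L2_norm w f)\<^sup>2 - K * (L2_norm w h)\<^sup>2 \<le> g x * Re (krein_inner w f f)"
      using type_estimate[OF _ ell[OF x(1)] F0nz[OF x(1)]] unfolding g_def by (metis Reals_of_real)
    show "g x > 0 \<Longrightarrow> of_real x \<in> spectrum_pos w (maximal_op w p q)" "g x < 0 \<Longrightarrow> of_real x \<in> spectrum_neg w (maximal_op w p q)"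
      using sign_type_from_estimate[OF real_spectrum_ap[OF x(2)] cK(1), of K 0 "g x"] cK(2) by auto
  qed
  show ?thesis
  proof (cases "g x0 > 0")
    case True
    have "g x > 0" if "x \<in> {s<..<t}" for x by (rule nonvanishing_same_sign[OF gc gnz x0(1) that True])
    then show ?thesis unfolding definite_type_def positive_type_def using st(1) by auto
  next
    case False
    have "- g x > 0" if "x \<in> {s<..<t}" for x
      by (rule nonvanishing_same_sign[of s t "\<lambda>x. - g x", OF continuous_on_minus[OF gc] _ x0(1) that]) (use gnz False x0 in \<open>auto simp: less_le\<close>)
    then show ?thesis unfolding definite_type_def negative_type_def using st(2) by auto
  qed
qed

text \<open>A spectral point would share its discriminant, hence its unit multiplier, with the
  non-real point \<i> \<open>Lam\<close>, at which a unit multiplier is impossible because it is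
  large.\<close>

lemma constant_discriminant:
  assumes "D constant_on UNIV" shows "z \<notin> spectrum w (maximal_op w p q)"
proof
  assume "z \<in> spectrum w (maximal_op w p q)"
  then obtain \<rho> where \<rho>: "cmod \<rho> = 1" "D z = \<rho> + cnj \<rho>" by (rule spectrum_unit_multiplier)
  have "D (\<i> * of_real Lam) = D z" using assms unfolding constant_on_def by auto
  then have "\<i> * of_real Lam \<in> \<real>"
    using \<rho> Lam_pos by (intro large_unit_multiplier_real[of _ \<rho>]) (auto simp: norm_mult)
  then show False using Lam_pos by (simp add: complex_is_Real_iff)
qed

lemma finite_exceptional:
  assumes nc: "\<not> D constant_on UNIV"
  shows "finite {z \<in> cball 0 Lam. (D z)\<^sup>2 = 4 \<or> deriv D z = 0}"
proof -
  have fin: "finite {z \<in> cball 0 Lam. f z = 0}" if "f holomorphic_on UNIV" "\<not> f constant_on UNIV" for f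
    by (rule holomorphic_compact_finite_zeros[of f UNIV]) (use that in auto)
  have 1: "finite {z \<in> cball 0 Lam. D z - c = 0}" for c
  proof (rule fin)
    show "(\<lambda>z. D z - c) holomorphic_on UNIV" by (intro holomorphic_intros D_holomorphic)
    show "\<not> (\<lambda>z. D z - c) constant_on UNIV" using nc unfolding constant_on_def by (metis UNIV_I diff_add_cancel)
  qed
  \<comment> \<open>Finiteness of zeros in a disc needs a non-constant function. If D' is constant,
    its value is nonzero because D is not constant, and there are no zeros.\<close>
  have 2: "finite {z \<in> cball 0 Lam. deriv D z = 0}"
  proof (cases "deriv D constant_on UNIV")
    case False
    then show ?thesis by (intro fin holomorphic_deriv D_holomorphic open_UNIV)
  next
    case True
    then obtain b where b: "\<And>z. deriv D z = b" unfolding constant_on_def by auto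
    have "b \<noteq> 0"
    proof
      assume "b = 0"
      then have "(D has_field_derivative 0) (at z within UNIV)" for z using D_deriv[of z] deriv_D[of z] b[of z] by simp
      then obtain c where "\<And>z. D z = c"
        using has_field_derivative_zero_constant[of UNIV D] by auto
      then show False using nc by (auto simp: constant_on_def)
    qed
    then show ?thesis using b by simp
  qed
  have "(D z)\<^sup>2 = 4 \<longleftrightarrow> D z - 2 = 0 \<or> D z - (- 2) = 0" for z
    using power2_eq_iff[of "D z" 2] by (auto simp: eq_neg_iff_add_eq_0)
  then have "{z \<in> cball 0 Lam. (D z)\<^sup>2 = 4 \<or> deriv D z = 0} = 
    {z \<in> cball 0 Lam. D z - 2 = 0} \<union> {z \<in> cball 0 Lam. D z - (- 2) = 0} \<union> {z \<in> cball 0 Lam. deriv D z = 0}" by auto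
  then show ?thesis using 1[of 2] 1[of "- 2"] 2 by simp
qed

lemma sign_type_partition:
  "\<exists>(n::nat) (\<mu>::nat \<Rightarrow> real). n \<ge> 1 \<and>
       (\<forall>j\<in>{2..n}. \<mu> (j - 1) < \<mu> j) \<and>
       negative_type w (maximal_op w p q) {..<\<mu> 1} \<and>
       (\<forall>j\<in>{2..n}. definite_type w (maximal_op w p q) {\<mu> (j - 1)<..<\<mu> j}) \<and>
       positive_type w (maximal_op w p q) {\<mu> n<..}"
proof -
  \<comment> \<open>For constant D the derivative vanishes everywhere, so the exceptional set has to
    be cut off by hand; all gaps are then free of spectrum.\<close>
  define Z where "Z = (if D constant_on UNIV then {} else {x::real. \<bar>x\<bar> \<le> Lam \<and> ((D (of_real x))\<^sup>2 = 4 \<or> deriv D (of_real x) = 0)})"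
  have Zf: "finite Z"
  proof (cases "D constant_on UNIV")
    case False
    have "inj complex_of_real" by (simp add: inj_of_real)
    from finite_vimageI[OF finite_exceptional[OF False] this] show ?thesis
      by (rule rev_finite_subset) (auto simp: Z_def)
  qed (simp add: Z_def)
  have Zb: "\<bar>x\<bar> \<le> Lam" if "x \<in> Z" for x using that by (auto simp: Z_def split: if_splits)
  \<comment> \<open>The points at distance \<open>Lam\<close> from 0 confine all gaps to the disc in
    which zeros are finite, leave exactly the large parameters outside, and keep the set
    nonempty.\<close>
  define E where "E = {- Lam, Lam} \<union> Z"
  have E: "finite E" "E \<noteq> {}" using Zf by (auto simp: E_def)
  have b: "\<bar>x\<bar> \<le> Lam" if "x \<in> E" for x using that Zb Lam_pos by (auto simp: E_def)
  have mM: "Min E = - Lam" "Max E = Lam"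
  proof -
    have m: "Lam \<in> E" "- Lam \<in> E" by (auto simp: E_def)
    have "- Lam \<le> x" "x \<le> Lam" if "x \<in> E" for x using b[OF that] by auto
    then show "Min E = - Lam" "Max E = Lam" by (auto intro: Min_eqI[OF E(1) _ m(2)] Max_eqI[OF E(1) _ m(1)])
  qed
  show ?thesis
  proof (rule sorted_partition[OF E])
    show "negative_type w (maximal_op w p q) {..<Min E}" "positive_type w (maximal_op w p q) {Max E<..}"
      unfolding mM negative_type_def positive_type_def using large_sign_type by auto
    fix s t assume st: "s \<in> E" "t \<in> E" "s < t" "{s<..<t} \<inter> E = {}"
    show "definite_type w (maximal_op w p q) {s<..<t}"
    proof (cases "D constant_on UNIV")
      case True
      then show ?thesis using constant_discriminant unfolding definite_type_def positive_type_def by blast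
    next
      case False
      have n: "(D (of_real x))\<^sup>2 \<noteq> 4 \<and> deriv D (of_real x) \<noteq> 0" if x: "x \<in> {s<..<t}" for x
      proof -
        have "\<bar>x\<bar> \<le> Lam" using b[OF st(1)] b[OF st(2)] x by auto
        moreover have "x \<notin> Z" using st(4) x by (auto simp: E_def)
        ultimately show ?thesis using False by (auto simp: Z_def)
      qed
      show ?thesis by (rule definite_gap) (use n in blast)+
    qed
  qed
qed

lemma nonreal_spectrum_bounded: "bounded (spectrum w (maximal_op w p q) - \<real>)"
proof (rule bounded_subset[OF bounded_cball[of 0 Lam]])
  show "spectrum w (maximal_op w p q) - \<real> \<subseteq> cball 0 Lam"
  proof
    fix z assume z: "z \<in> spectrum w (maximal_op w p q) - \<real>"
    then obtain \<rho> where "cmod \<rho> = 1" "D z = \<rho> + cnj \<rho>" using spectrum_unit_multiplier by blast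
    then show "z \<in> cball 0 Lam" using large_unit_multiplier_real[of z \<rho>] z by force
  qed
qed

end

theorem theorem3p1:
  fixes a :: real and w p q :: "real \<Rightarrow> real"
  assumes "a > 0"
    and "w \<in> borel_measurable lebesgue"
    and "p \<in> borel_measurable lebesgue"
    and "q \<in> borel_measurable lebesgue"
    and "\<And>x. w (x + a) = w x"
    and "\<And>x. p (x + a) = p x"
    and "\<And>x. q (x + a) = q x"
    and "set_integrable lebesgue {0<..<a} w"
    and "set_integrable lebesgue {0<..<a} q"
    and "set_integrable lebesgue {0<..<a} (\<lambda>x. 1 / p x)"
    and "AE x in lebesgue. w x \<noteq> 0"
    and "AE x in lebesgue. p x > 0"
  shows "bounded (spectrum w (maximal_op w p q) - \<real>) \<and>
    (\<exists>(n::nat) (\<mu>::nat \<Rightarrow> real). n \<ge> 1 \<and>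
       (\<forall>j\<in>{2..n}. \<mu> (j - 1) < \<mu> j) \<and>
       negative_type w (maximal_op w p q) {..<\<mu> 1} \<and>
       (\<forall>j\<in>{2..n}. definite_type w (maximal_op w p q) {\<mu> (j - 1)<..<\<mu> j}) \<and>
       positive_type w (maximal_op w p q) {\<mu> n<..})"
proof -
  interpret SL a w p q by unfold_locales (fact assms)+
  show ?thesis using nonreal_spectrum_bounded sign_type_partition by blast
qed

end
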